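(* Let $m\in\mathbb N$, let $Q,B$ be real $m\times m$ matrices with $Q=Q^\star\ge 0$, and suppose that $Q(t)=\int_0^t e^{sB}Qe^{sB^\star}\,ds$ is positive definite for every $t>0$. Let $\{\mathcal T(t)\}_{t\ge0}$ be the family of linear operators on $\mathscr S(\mathbb R^m)$ given by $\mathcal T(0)\varphi=\varphi$ and, for $t>0$, $$\mathcal T(t)\varphi(x)=(4\pi)^{-\frac m2}\,\frac{e^{-\frac{i\pi m}{4}}}{\sqrt{\det Q(t)}}\int_{\mathbb R^m}e^{\,i\,\frac{\langle Q(t)^{-1}(y-e^{tB}x),\,y-e^{tB}x\rangle}{4}}\varphi(y)\,dy .$$ (i) If for some $t>0$ and some $1\le p,q\le\infty$ one has $\mathcal T(t):L^p(\mathbb R^m)\to L^q(\mathbb R^m)$ continuously, then $1\le p\le 2$ and $q=p'$. (ii) Given $1\le p\le2$ and $t>0$, the operator $\mathcal T(t)$ can be uniquely extended to a bounded linear operator $\mathcal T(t):L^p(\mathbb R^m)\to L^{p'}(\mathbb R^m)$ such that for every $\varphi\in L^p(\mathbb R^m)$ $$\|\mathcal T(t)\varphi\|_{L^{p'}(\mathbb R^m)}\le(4\pi)^{-\frac m2+\frac m{p'}}\left(\frac{p^{1/p}}{{p'}^{1/p'}}\right)^{\frac m2}\frac{e^{-\frac{\operatorname{tr}B}{p'}t}}{(\det Q(t))^{\frac12-\frac1{p'}}}\,\|\varphi\|_{L^p(\mathbb R^m)} .$$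
   Context: $\mathscr S(\mathbb R^m)$ is the Schwartz space of complex-valued functions on $\mathbb R^m$; $^\star$ denotes transpose; $\langle\cdot,\cdot\rangle$ is the (bilinear) Euclidean product; $i^2=-1$. For $1\le p\le\infty$, $p'$ is the conjugate exponent, $\frac1p+\frac1{p'}=1$; when $p=1$ one has $p'=\infty$, $1/p'=0$ and ${p'}^{1/p'}=1$ by convention. Since $\mathcal T(t)$ is defined on $\mathscr S(\mathbb R^m)$, "$\mathcal T(t):L^p(\mathbb R^m)\to L^q(\mathbb R^m)$ continuously" means that there is a constant $C<\infty$ with $\|\mathcal T(t)\varphi\|_{L^q(\mathbb R^m)}\le C\|\varphi\|_{L^p(\mathbb R^m)}$ for all $\varphi\in\mathscr S(\mathbb R^m)$. *)

theory Defs
  imports "HOL-Analysis.Analysis" "HOL-Probability.Essential_Supremum"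
begin

section \<open>Matrices\<close>

text \<open>The product \<open>*\<close> on \<^typ>\<open>real^'m^'m\<close> is componentwise, so the library's \<^const>\<open>power\<close>
  and \<^const>\<open>exp\<close> are not the matrix operations.\<close>

definition mat_exp :: "real^'m^'m \<Rightarrow> real^'m^'m" where
  "mat_exp A = (\<Sum>k. (1 / fact k) *\<^sub>R (((**) A ^^ k) (mat 1)))"

definition pos_semidef :: "real^'m^'m \<Rightarrow> bool" where
  "pos_semidef A \<longleftrightarrow> (\<forall>x. 0 \<le> (A *v x) \<bullet> x)"

definition pos_def :: "real^'m^'m \<Rightarrow> bool" where
  "pos_def A \<longleftrightarrow> (\<forall>x. x \<noteq> 0 \<longrightarrow> 0 < (A *v x) \<bullet> x)"

definition Qt :: "real^'m^'m \<Rightarrow> real^'m^'m \<Rightarrow> real \<Rightarrow> real^'m^'m" where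
  "Qt Q B t = integral {0..t}
     (\<lambda>s. mat_exp (s *\<^sub>R B) ** Q ** mat_exp (s *\<^sub>R transpose B))"

section \<open>Schwartz functions\<close>

definition partial_deriv :: "'m \<Rightarrow> (real^'m \<Rightarrow> complex) \<Rightarrow> real^'m \<Rightarrow> complex" where
  "partial_deriv j f x = vector_derivative (\<lambda>s. f (x + s *\<^sub>R axis j 1)) (at 0)"

definition iter_partial :: "'m list \<Rightarrow> (real^'m \<Rightarrow> complex) \<Rightarrow> real^'m \<Rightarrow> complex" where
  "iter_partial js f = foldr partial_deriv js f"

text \<open>The lists \<open>js\<close> run over all iterated partial derivatives.  Requiring each of them
  (including the empty one, \<open>f\<close> itself) to be Frechet differentiable everywhere
  is the same as \<open>f\<close> being of class \<open>C\<^sup>\<infinity>\<close>, and guarantees that every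
  \<^const>\<open>vector_derivative\<close> above is a genuine derivative.\<close>

definition schwartz :: "(real^'m \<Rightarrow> complex) set" where
  "schwartz = {f. \<forall>js.
     (\<forall>x. iter_partial js f differentiable (at x)) \<and>
     (\<forall>k::nat. bounded (range (\<lambda>x. norm x ^ k *\<^sub>R iter_partial js f x)))}"

section \<open>Lebesgue spaces\<close>

text \<open>Exponents live in \<^typ>\<open>ennreal\<close>, where \<open>inverse \<infinity> = 0\<close>.\<close>

definition conj_exponents :: "ennreal \<Rightarrow> ennreal \<Rightarrow> bool" where
  "conj_exponents p p' \<longleftrightarrow> 1 \<le> p \<and> 1 \<le> p' \<and> inverse p + inverse p' = 1"

text \<open>Elements of \<open>L\<^sup>p\<close> are represented by measurable functions; equality in
  \<open>L\<^sup>p\<close> is equality almost everywhere.\<close>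

definition Lp_norm :: "ennreal \<Rightarrow> (real^'m \<Rightarrow> complex) \<Rightarrow> ennreal" where
  "Lp_norm p f =
     (if p = \<infinity> then esssup lebesgue (\<lambda>x. ennreal (cmod (f x)))
      else let I = (\<integral>\<^sup>+x. ennreal (cmod (f x) powr enn2real p) \<partial>lebesgue)
           in if I = \<infinity> then \<infinity> else ennreal (enn2real I powr (1 / enn2real p)))"

definition Lp :: "ennreal \<Rightarrow> (real^'m \<Rightarrow> complex) set" where
  "Lp p = {f. f \<in> borel_measurable lebesgue \<and> Lp_norm p f < \<infinity>}"

definition ae_eq :: "(real^'m \<Rightarrow> complex) \<Rightarrow> (real^'m \<Rightarrow> complex) \<Rightarrow> bool" where
  "ae_eq f g \<longleftrightarrow> (AE x in lebesgue. f x = g x)"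

text \<open>The second conjunct says that \<open>S\<close> is well defined on classes modulo
  almost-everywhere equality.\<close>

definition bounded_linear_Lp ::
  "ennreal \<Rightarrow> ennreal \<Rightarrow> ((real^'m \<Rightarrow> complex) \<Rightarrow> real^'m \<Rightarrow> complex) \<Rightarrow> bool" where
  "bounded_linear_Lp p q S \<longleftrightarrow>
     (\<forall>f\<in>Lp p. S f \<in> Lp q) \<and>
     (\<forall>f\<in>Lp p. \<forall>g\<in>Lp p. ae_eq f g \<longrightarrow> ae_eq (S f) (S g)) \<and>
     (\<forall>a b. \<forall>f\<in>Lp p. \<forall>g\<in>Lp p.
        ae_eq (S (\<lambda>x. a * f x + b * g x)) (\<lambda>x. a * S f x + b * S g x)) \<and>
     (\<exists>C<\<infinity>. \<forall>f\<in>Lp p. Lp_norm q (S f) \<le> C * Lp_norm p f)"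

definition Lp_continuous_on_schwartz ::
  "ennreal \<Rightarrow> ennreal \<Rightarrow> ((real^'m \<Rightarrow> complex) \<Rightarrow> real^'m \<Rightarrow> complex) \<Rightarrow> bool" where
  "Lp_continuous_on_schwartz p q S \<longleftrightarrow>
     (\<exists>C<\<infinity>. \<forall>\<phi>\<in>schwartz. Lp_norm q (S \<phi>) \<le> C * Lp_norm p \<phi>)"

definition bounded_extension ::
  "ennreal \<Rightarrow> ennreal \<Rightarrow> ((real^'m \<Rightarrow> complex) \<Rightarrow> real^'m \<Rightarrow> complex) \<Rightarrow>
   ((real^'m \<Rightarrow> complex) \<Rightarrow> real^'m \<Rightarrow> complex) \<Rightarrow> bool" where
  "bounded_extension p q T S \<longleftrightarrow>
     bounded_linear_Lp p q S \<and> (\<forall>\<phi>\<in>schwartz. ae_eq (S \<phi>) (T \<phi>))"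

section \<open>The operators and the constant\<close>

definition T_op ::
  "real^'m^'m \<Rightarrow> real^'m^'m \<Rightarrow> real \<Rightarrow> (real^'m \<Rightarrow> complex) \<Rightarrow> real^'m \<Rightarrow> complex" where
  "T_op Q B t \<phi> = (if t = 0 then \<phi> else (\<lambda>x.
     complex_of_real ((4 * pi) powr (- (real CARD('m) / 2)))
     * (exp (- (\<i> * complex_of_real pi * of_nat CARD('m) / 4))
        / complex_of_real (sqrt (det (Qt Q B t))))
     * (LINT y|lebesgue.
          exp (\<i> * complex_of_real
             ((matrix_inv (Qt Q B t) *v (y - mat_exp (t *\<^sub>R B) *v x))
                \<bullet> (y - mat_exp (t *\<^sub>R B) *v x)) / 4) * \<phi> y)))"

text \<open>\<open>p\<^bsup>1/p\<^esup>\<close>, with the convention that it is \<open>1\<close> for \<open>p = \<infinity>\<close>.\<close>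

definition self_root :: "ennreal \<Rightarrow> real" where
  "self_root p = (if p = \<infinity> then 1 else enn2real p powr (1 / enn2real p))"

text \<open>Here \<open>r\<close> is \<open>1/p'\<close>, which is \<open>0\<close> for \<open>p' = \<infinity>\<close>.\<close>

definition T_const ::
  "real^'m^'m \<Rightarrow> real^'m^'m \<Rightarrow> real \<Rightarrow> ennreal \<Rightarrow> ennreal \<Rightarrow> real" where
  "T_const Q B t p p' = (let m = real CARD('m); r = enn2real (inverse p') in
     (4 * pi) powr (- (m / 2) + m * r)
     * (self_root p / self_root p') powr (m / 2)
     * (exp (- (trace B * r * t)) / det (Qt Q B t) powr (1 / 2 - r)))"

end

theory Submission
  imports Defs "HOL-Complex_Analysis.Complex_Analysis" "HOL-Probability.Probability" "HOL-Real_Asymp.Real_Asymp"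
begin

text \<open>
  Expanding the quadratic form in the kernel splits \<open>\<T>(t)\<close> into three factors: multiplication by
  the unimodular function \<open>e\<^bsup>i\<langle>Ry,y\<rangle>/4\<^esup>\<close> with \<open>R = Q(t)\<^sup>-\<^sup>1\<close> (a chirp), a Fourier transform evaluated at a linear
  image of \<open>x\<close>, and multiplication by another unimodular function
  (\<open>T_op_fourier\<close>).  Hence \<open>L\<^sup>p\<close> bounds for \<open>\<T>(t)\<close> are \<open>L\<^sup>p\<close> bounds for the Fourier transform after a linear
  change of variables.  The Jacobian contributes \<open>det e\<^bsup>tB\<^esup> = e\<^bsup>t tr B\<^esup>\<close> and \<open>det Q(t)\<close>, and the remaining factor
  \<open>(p\<^bsup>1/p\<^esup> / p'\<^bsup>1/p'\<^esup>)\<^bsup>m/2\<^esup>\<close> in (ii) is the constant of the sharp Hausdorff--Young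
  inequality of Babenko and Beckner (\<open>sharp_hausdorff_young\<close>).

  That inequality is derived along Beckner's route.  With \<open>\<omega> = i \<surd>(p - 1)\<close>, the map
  \<open>a + \<epsilon>b \<mapsto> a + \<omega>\<epsilon>b\<close>, \<open>\<epsilon> = \<plusminus>1\<close>, is a contraction from
  \<open>L\<^sup>p\<close> to \<open>L\<^bsup>p'\<^esup>\<close> of the two-point space (\<open>two_point_hypercontractivity\<close>).  By Minkowski's inequality,
  contractions of this kind tensorize, so the same holds on every discrete cube
  (\<open>cube_hypercontractivity\<close>).  Sums of \<open>n\<close> signs divided by \<open>\<surd>n\<close> tend to a Gaussian variable; for
  the moments of trigonometric polynomials this is an explicit
  limit of powers of cosines together with Weierstrass' theorem (\<open>walk_mean_powr_limit\<close>).  The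
  limit is a bilinear inequality for trigonometric polynomials in \<open>L\<^sup>p\<close> of Gaussian measure
  (\<open>gaussian_bilinear_inequality\<close>), and absorbing the weight \<open>exp (-|x|\<^sup>2/2p)\<close> into the functions
  turns its kernel into the Fourier kernel (\<open>gauss_times_bilinear\<close>).  Products of trigonometric
  polynomials with a fixed Gaussian are dense
  enough to reach all bounded functions of bounded support (\<open>dominated_density\<close>), and duality turns the
  bilinear bound into a norm bound.

  For (ii) with \<open>p > 1\<close>, the extension is defined on \<open>L\<^sup>p\<close> as the limit of \<open>\<T>(t)\<close> applied to truncations; the limit
  exists because \<open>L\<^bsup>p'\<^esup>\<close> is complete, and for integrable functions it agrees with the
  integral by dominated convergence.  Uniqueness follows from density of
  Schwartz functions.  For \<open>p = 1\<close> the integral formula itself is the extension.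

  For (i), let \<open>Re z > 0\<close>.  The function \<open>exp (-z|y|\<^sup>2)\<close>, multiplied by the
  conjugate chirp, is sent by \<open>\<T>(t)\<close> to a function of modulus
  \<open>c |z|\<^bsup>-m/2\<^esup> exp (- (Re z / 4|z|\<^sup>2) |Mx|\<^sup>2)\<close>.  Comparing norms for real \<open>z\<close>
  of all sizes forces \<open>1/p + 1/q = 1\<close>.  Keeping \<open>Re z = 1\<close> and letting \<open>|z|\<close> grow leaves the input norm fixed, while the
  output norm is a multiple of \<open>|z|\<^bsup>m(1/q - 1/2)\<^esup>\<close>; so \<open>q \<ge> 2\<close>.
\<close>

section \<open>The two-point inequality\<close>

lemma powr_convex_combination:
  fixes x y u v r :: real
  assumes "1 \<le> r" "0 \<le> x" "0 \<le> y" "0 \<le> u" "0 \<le> v" "u + v = 1"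
  shows "(u * x + v * y) powr r \<le> u * x powr r + v * y powr r"
proof -
  have aux: "(w * z) powr r \<le> w * z powr r" if "0 \<le> w" "w \<le> 1" "0 \<le> z" for w z :: real
  proof -
    have "w powr r \<le> w"
      using powr_mono'[of 1 r w] that assms(1) by simp
    then show ?thesis
      using that by (simp add: powr_mult mult_right_mono)
  qed
  consider "x = 0" | "y = 0" | "0 < x" "0 < y" using assms by linarith
  then show ?thesis
  proof cases
    case 3
    have c: "convex_on {0<..} (\<lambda>x::real. x powr r)" using powr_convex assms(1) by auto
    have uv: "u = 1 - v" "v \<le> 1" using assms by auto
    show ?thesis
      using convex_onD[OF c, of v x y] 3 assms uv(2) unfolding uv(1) by simp
  qed (use aux[of v y] aux[of u x] assms in auto)
qed

text \<open>Normalizing both summands to have norm \<open>1\<close> turns \<open>a + b\<close>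
  into a convex combination, so the triangle inequality is the convexity of
  \<open>x\<^sup>r\<close>.\<close>

lemma weighted_minkowski:
  fixes a b w :: "'i \<Rightarrow> real" and r :: real
  assumes fin: "finite I" and r: "1 \<le> r"
    and nn: "\<And>i. i \<in> I \<Longrightarrow> 0 \<le> a i" "\<And>i. i \<in> I \<Longrightarrow> 0 \<le> b i" "\<And>i. i \<in> I \<Longrightarrow> 0 \<le> w i"
  shows "(\<Sum>i\<in>I. w i * (a i + b i) powr r) powr (1/r)
     \<le> (\<Sum>i\<in>I. w i * a i powr r) powr (1/r) + (\<Sum>i\<in>I. w i * b i powr r) powr (1/r)"
proof -
  define sa where "sa = (\<Sum>i\<in>I. w i * a i powr r)"
  define sb where "sb = (\<Sum>i\<in>I. w i * b i powr r)"
  define s where "s = (\<Sum>i\<in>I. w i * (a i + b i) powr r)"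
  have nn': "0 \<le> sa" "0 \<le> sb" unfolding sa_def sb_def using nn by (auto intro!: sum_nonneg)
  have z: "(\<Sum>i\<in>I. w i * (c i + d i) powr r) = (\<Sum>i\<in>I. w i * d i powr r)"
    if "(\<Sum>i\<in>I. w i * c i powr r) = 0" "\<And>i. i \<in> I \<Longrightarrow> 0 \<le> c i" for c d
  proof (rule sum.cong[OF refl])
    fix i assume i: "i \<in> I"
    have "\<forall>i\<in>I. w i * c i powr r = 0"
      using that(1) by (subst (asm) sum_nonneg_eq_0_iff) (use fin nn in auto)
    then show "w i * (c i + d i) powr r = w i * d i powr r" using i by auto
  qed
  consider "sa = 0" | "sb = 0" | "0 < sa" "0 < sb" using nn' by linarith
  then have "s powr (1/r) \<le> sa powr (1/r) + sb powr (1/r)"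
  proof cases
    case 1 then show ?thesis using z[of a b] nn r by (simp add: sa_def sb_def s_def)
  next
    case 2 then show ?thesis using z[of b a] nn r by (simp add: sa_def sb_def s_def add.commute)
  next
    case 3
    define \<alpha> where "\<alpha> = sa powr (1/r)"
    define \<beta> where "\<beta> = sb powr (1/r)"
    have p: "0 < \<alpha>" "0 < \<beta>" using 3 by (auto simp: \<alpha>_def \<beta>_def)
    have ar: "\<alpha> powr r = sa" "\<beta> powr r = sb"
      using 3 r by (auto simp: \<alpha>_def \<beta>_def powr_powr)
    have "s / (\<alpha> + \<beta>) powr r = (\<Sum>i\<in>I. w i * ((a i + b i) / (\<alpha>+\<beta>)) powr r)"
      using p nn by (simp add: s_def sum_divide_distrib powr_divide)
    also have "\<dots> \<le> (\<Sum>i\<in>I. w i * (\<alpha>/(\<alpha>+\<beta>) * (a i / \<alpha>) powr r + \<beta>/(\<alpha>+\<beta>) * (b i / \<beta>) powr r))"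
    proof (intro sum_mono mult_left_mono)
      fix i assume i: "i \<in> I"
      have "(a i + b i) / (\<alpha>+\<beta>) = \<alpha>/(\<alpha>+\<beta>) * (a i / \<alpha>) + \<beta>/(\<alpha>+\<beta>) * (b i / \<beta>)"
        using p by (simp add: add_divide_distrib)
      then show "((a i + b i) / (\<alpha>+\<beta>)) powr r
          \<le> \<alpha>/(\<alpha>+\<beta>) * (a i / \<alpha>) powr r + \<beta>/(\<alpha>+\<beta>) * (b i / \<beta>) powr r"
        using p i nn r by (simp only:) (rule powr_convex_combination; simp flip: add_divide_distrib)
    qed (use nn in auto)
    also have "\<dots> = \<alpha>/(\<alpha>+\<beta>) * (sa / \<alpha> powr r) + \<beta>/(\<alpha>+\<beta>) * (sb / \<beta> powr r)"
      using nn p by (simp add: sa_def sb_def sum.distrib distrib_left sum_distrib_left powr_divide sum_divide_distrib mult_ac)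
    also have "\<dots> = 1" using ar 3 p by (simp flip: add_divide_distrib)
    finally have "s \<le> (\<alpha>+\<beta>) powr r" using p by (simp add: divide_le_eq)
    then have "s powr (1/r) \<le> ((\<alpha>+\<beta>) powr r) powr (1/r)"
      using r nn by (intro powr_mono2) (auto simp: s_def intro!: sum_nonneg)
    then show ?thesis using p r by (simp add: powr_powr \<alpha>_def \<beta>_def)
  qed
  then show ?thesis by (simp add: s_def sa_def sb_def)
qed

lemma powr_square_half: "(x\<^sup>2) powr (r/2) = \<bar>x\<bar> powr r" for x r :: real
proof (cases "x = 0")
  case False
  then have "x\<^sup>2 = \<bar>x\<bar> powr 2" by (simp add: powr_numeral)
  then show ?thesis by (simp only: powr_powr) simp
qed simp

lemma conjugate_exponents_real:
  fixes p q :: real assumes "1 < p" "1/p + 1/q = 1"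
  shows "1 < q" "q = p / (p - 1)" "(p - 1) * (q - 1) = 1" "(q - 1) * p = q" "p * q = p + q"
proof -
  have "q \<noteq> 0" using assms by auto
  then show pq: "p * q = p + q" using assms by (simp add: field_simps)
  then have *: "q * (p - 1) = p" by (simp add: algebra_simps)
  then show q: "q = p / (p - 1)" using assms by (simp add: field_simps)
  show "1 < q" unfolding q using assms by (simp add: field_simps)
  show "(p - 1) * (q - 1) = 1" "(q - 1) * p = q" using pq by (auto simp: algebra_simps)
qed

text \<open>Young's inequality applied termwise after normalizing both factors.\<close>

lemma weighted_holder:
  fixes a b w :: "'i \<Rightarrow> real" and p q :: real
  assumes fin: "finite I" and p: "1 < p" and pq: "1/p + 1/q = 1"
    and nn: "\<And>i. i \<in> I \<Longrightarrow> 0 \<le> a i" "\<And>i. i \<in> I \<Longrightarrow> 0 \<le> b i" "\<And>i. i \<in> I \<Longrightarrow> 0 \<le> w i"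
  shows "(\<Sum>i\<in>I. w i * (a i * b i))
     \<le> (\<Sum>i\<in>I. w i * a i powr q) powr (1/q) * (\<Sum>i\<in>I. w i * b i powr p) powr (1/p)"
proof -
  have q: "q > 1" by (rule conjugate_exponents_real(1)[OF p pq])
  define sa where "sa = (\<Sum>i\<in>I. w i * a i powr q)"
  define sb where "sb = (\<Sum>i\<in>I. w i * b i powr p)"
  have nn': "0 \<le> sa" "0 \<le> sb" unfolding sa_def sb_def using nn by (auto intro!: sum_nonneg)
  have z: "\<forall>i\<in>I. w i = 0 \<or> c i = 0" if "(\<Sum>i\<in>I. w i * c i powr s) = 0" for c and s :: real
    using that by (subst (asm) sum_nonneg_eq_0_iff) (use fin nn in auto)
  consider "sa = 0" | "sb = 0" | "0 < sa" "0 < sb" using nn' by linarith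
  then show ?thesis
  proof cases
    case 1
    then have "(\<Sum>i\<in>I. w i * (a i * b i)) = 0" using z[of a q] by (intro sum.neutral) (auto simp: sa_def)
    then show ?thesis by simp
  next
    case 2
    then have "(\<Sum>i\<in>I. w i * (a i * b i)) = 0" using z[of b p] by (intro sum.neutral) (auto simp: sb_def)
    then show ?thesis by simp
  next
    case 3
    define \<alpha> where "\<alpha> = sa powr (1/q)"
    define \<beta> where "\<beta> = sb powr (1/p)"
    have pos: "0 < \<alpha>" "0 < \<beta>" using 3 by (auto simp: \<alpha>_def \<beta>_def)
    have ar: "\<alpha> powr q = sa" "\<beta> powr p = sb"
      using 3 p q by (auto simp: \<alpha>_def \<beta>_def powr_powr)
    have "(\<Sum>i\<in>I. w i * (a i * b i)) = \<alpha> * \<beta> * (\<Sum>i\<in>I. w i * ((a i / \<alpha>) * (b i / \<beta>)))"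
      using pos by (simp add: sum_distrib_left)
    also have "\<dots> \<le> \<alpha> * \<beta> * (\<Sum>i\<in>I. w i * ((a i / \<alpha>) powr q / q + (b i / \<beta>) powr p / p))"
      using nn p q pq pos
      by (intro mult_left_mono sum_mono Youngs_inequality) (auto simp: add.commute)
    also have "(\<Sum>i\<in>I. w i * ((a i / \<alpha>) powr q / q + (b i / \<beta>) powr p / p))
        = (sa / \<alpha> powr q) / q + (sb / \<beta> powr p) / p"
      using nn pos by (simp add: sa_def sb_def sum.distrib distrib_left powr_divide sum_divide_distrib)
    also have "\<dots> = 1" using ar 3 pq by simp
    finally show ?thesis by (simp add: \<alpha>_def \<beta>_def sa_def sb_def)
  qed
qed

text \<open>The two sides agree to first order at \<open>0\<close>. The second derivative of the
  right side is \<open>p (p - 1)\<close> times the mean of \<open>(1 +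
  x)\<^bsup>p-2\<^esup>\<close> and \<open>(1 - x)\<^bsup>p-2\<^esup>\<close>, which is at least
  \<open>1\<close> by the inequality of arithmetic and geometric means, since \<open>(1 + x) (1
  - x) \<le> 1\<close> and \<open>p \<le> 2\<close>.\<close>

lemma two_point_binomial:
  fixes p x :: real
  assumes p: "1 < p" "p \<le> 2" and x: "0 \<le> x" "x \<le> 1"
  shows "1 + p * (p - 1) / 2 * x\<^sup>2 \<le> ((1 + x) powr p + (1 - x) powr p) / 2"
proof -
  define k where "k = (\<lambda>x::real. ((1 + x) powr (p-1) - (1 - x) powr (p-1)) / 2 - (p - 1) * x)"
  define h where "h = (\<lambda>x::real. ((1 + x) powr p + (1 - x) powr p) / 2 - p * (p - 1) / 2 * x\<^sup>2)"
  have k: "0 \<le> k y" if y: "0 \<le> y" "y < 1" for y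
  proof -
    have "k 0 \<le> k y"
    proof (rule DERIV_nonneg_imp_nondecreasing[OF y(1)])
      fix z assume z: "0 \<le> z" "z \<le> y"
      have d: "(k has_real_derivative (p-1) * (((1 + z) powr (p-2) + (1 - z) powr (p-2)) / 2 - 1)) (at z)"
        unfolding k_def using z y by (auto intro!: derivative_eq_intros simp: field_simps)
      have "1 \<le> ((1 + z) powr ((p-2)/2)) * ((1 - z) powr ((p-2)/2))"
      proof -
        have "((1 + z) powr ((p-2)/2)) * ((1 - z) powr ((p-2)/2)) = ((1 + z) * (1 - z)) powr ((p-2)/2)"
          using z y by (simp add: powr_mult)
        moreover have "1 powr ((p-2)/2) \<le> ((1 + z) * (1 - z)) powr ((p-2)/2)"
          using z y p mult_strict_mono[of z 1 z 1] by (intro powr_mono2') (auto simp: algebra_simps)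
        ultimately show ?thesis by simp
      qed
      moreover have "0 \<le> ((1 + z) powr ((p-2)/2) - (1 - z) powr ((p-2)/2))\<^sup>2" by simp
      moreover have "((1 + z) powr ((p-2)/2))\<^sup>2 = (1+z) powr (p-2)" "((1 - z) powr ((p-2)/2))\<^sup>2 = (1-z) powr (p-2)"
        using z y by (auto simp: power2_eq_square simp flip: powr_add)
      ultimately have "1 \<le> ((1 + z) powr (p-2) + (1 - z) powr (p-2)) / 2"
        by (simp add: power2_diff)
      then show "\<exists>d. (k has_real_derivative d) (at z) \<and> 0 \<le> d"
        using d p by (intro exI[of _ "(p-1) * (((1 + z) powr (p-2) + (1 - z) powr (p-2)) / 2 - 1)"]) auto
    qed
    then show ?thesis by (simp add: k_def)
  qed
  have "h 0 \<le> h x"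
  proof (rule DERIV_nonneg_imp_increasing_open[OF x(1)])
    fix z assume z: "0 < z" "z < x"
    have d: "(h has_real_derivative p * k z) (at z)"
      unfolding h_def k_def using z x by (auto intro!: derivative_eq_intros simp: field_simps)
    then show "\<exists>d. (h has_real_derivative d) (at z) \<and> 0 \<le> d"
      using k[of z] z x p by (intro exI[of _ "p * k z"]) auto
  next
    show "continuous_on {0..x} h"
      unfolding h_def using x p by (intro continuous_intros continuous_on_powr') auto
  qed
  then show ?thesis by (simp add: h_def diff_divide_distrib add_divide_distrib)
qed

text \<open>The real two-point inequality between \<open>L\<^sup>p\<close> and
  \<open>L\<^sup>2\<close>. For \<open>|x| \<le> 1\<close> the quadratic lower bound of
  \<open>two_point_binomial\<close> also dominates the left side, by Bernoulli's inequality for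
  the exponent \<open>p/2 \<le> 1\<close>. The case \<open>|x| > 1\<close> reduces to
  \<open>1/x\<close>, because \<open>1 + (p - 1) x\<^sup>2 \<le> x\<^sup>2 (1 + (p - 1) /
  x\<^sup>2)\<close>.\<close>

lemma two_point_real_p_2:
  fixes p x :: real
  assumes p: "1 < p" "p \<le> 2"
  shows "(1 + (p - 1) * x\<^sup>2) powr (p/2) \<le> (\<bar>1 + x\<bar> powr p + \<bar>1 - x\<bar> powr p) / 2"
proof -
  \<comment> \<open>Bernoulli's inequality, as Young's inequality with weights
    \<open>p/2\<close> and \<open>1 - p/2\<close>\<close>
  have bern: "(1 + (p - 1) * y\<^sup>2) powr (p/2) \<le> 1 + p * (p - 1) / 2 * y\<^sup>2" for y :: real
  proof -
    have "(1 + (p - 1) * y\<^sup>2) powr (p/2) * 1 powr (1 - p/2) \<le> p/2 * (1 + (p - 1) * y\<^sup>2) + (1 - p/2) * 1"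
      using p by (intro Youngs_inequality_0) (auto intro!: add_pos_nonneg)
    also have "\<dots> = 1 + p * (p - 1) / 2 * y\<^sup>2" by (simp add: field_simps)
    finally show ?thesis by simp
  qed
  have small: "(1 + (p - 1) * y\<^sup>2) powr (p/2) \<le> (\<bar>1 + y\<bar> powr p + \<bar>1 - y\<bar> powr p) / 2"
    if "\<bar>y\<bar> \<le> 1" for y :: real
  proof (cases "0 \<le> y")
    case True
    then show ?thesis using that bern[of y] two_point_binomial[OF p, of y] by simp
  next
    case False
    then show ?thesis using that bern[of "-y"] two_point_binomial[OF p, of "-y"] by (simp add: add.commute)
  qed
  show ?thesis
  proof (cases "\<bar>x\<bar> \<le> 1")
    case True then show ?thesis by (rule small)
  next
    case False
    define y where "y = 1/x"
    have x0: "x \<noteq> 0" and y: "\<bar>y\<bar> \<le> 1" using False by (auto simp: y_def field_simps)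
    have x1: "1 \<le> x\<^sup>2" using False by (metis abs_le_square_iff abs_one linear one_power2)
    have "(p - 2) * x\<^sup>2 \<le> (p-2) * 1" using p x1 by (intro mult_left_mono_neg) auto
    then have "1 + (p - 1) * x\<^sup>2 \<le> x\<^sup>2 + (p - 1)" by (simp add: algebra_simps)
    also have "\<dots> = x\<^sup>2 * (1 + (p - 1) * y\<^sup>2)"
      using x0 by (simp add: y_def distrib_left power_divide)
    finally have "1 + (p - 1) * x\<^sup>2 \<le> x\<^sup>2 * (1 + (p - 1) * y\<^sup>2)" .
    then have "(1 + (p - 1) * x\<^sup>2) powr (p/2) \<le> (x\<^sup>2 * (1 + (p - 1) * y\<^sup>2)) powr (p/2)"
      using p by (intro powr_mono2) (auto intro!: add_nonneg_nonneg)
    also have "\<dots> = (x\<^sup>2) powr (p/2) * (1 + (p - 1) * y\<^sup>2) powr (p/2)"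
      using p by (intro powr_mult)
    also have "(x\<^sup>2) powr (p/2) = \<bar>x\<bar> powr p"
      by (rule powr_square_half)
    also have "\<bar>x\<bar> powr p * (1 + (p - 1) * y\<^sup>2) powr (p/2) \<le> \<bar>x\<bar> powr p * ((\<bar>1 + y\<bar> powr p + \<bar>1 - y\<bar> powr p) / 2)"
      by (intro mult_left_mono small y) auto
    also have "\<dots> = ((\<bar>x\<bar> * \<bar>1 + y\<bar>) powr p + (\<bar>x\<bar> * \<bar>1 - y\<bar>) powr p) / 2"
      by (simp add: powr_mult distrib_left)
    also have "\<bar>x\<bar> * \<bar>1 + y\<bar> = \<bar>x + 1\<bar>"
      unfolding abs_mult[symmetric] using x0 by (simp add: y_def distrib_left)
    also have "\<bar>x\<bar> * \<bar>1 - y\<bar> = \<bar>x - 1\<bar>"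
      unfolding abs_mult[symmetric] using x0 by (simp add: y_def right_diff_distrib)
    finally show ?thesis by (simp add: add.commute abs_minus_commute)
  qed
qed

lemma two_point_real_p_2_homogeneous:
  fixes p a b :: real
  assumes p: "1 < p" "p \<le> 2"
  shows "(a\<^sup>2 + (p - 1) * b\<^sup>2) powr (p/2) \<le> (\<bar>a + b\<bar> powr p + \<bar>a - b\<bar> powr p) / 2"
proof (cases "a = 0")
  case True
  have "((p-1) * b\<^sup>2) powr (p/2) \<le> (b\<^sup>2) powr (p/2)"
    using p by (intro powr_mono2 mult_left_le_one_le) auto
  also have "\<dots> = \<bar>b\<bar> powr p" by (rule powr_square_half)
  finally show ?thesis using True by simp
next
  case False
  have "(a\<^sup>2 + (p - 1) * b\<^sup>2) = a\<^sup>2 * (1 + (p-1) * (b/a)\<^sup>2)" using False by (simp add: field_simps)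
  then have "(a\<^sup>2 + (p - 1) * b\<^sup>2) powr (p/2) = (a\<^sup>2) powr (p/2) * (1 + (p-1) * (b/a)\<^sup>2) powr (p/2)"
    by (simp add: powr_mult)
  also have "(a\<^sup>2) powr (p/2) = \<bar>a\<bar> powr p"
    by (rule powr_square_half)
  also have "\<bar>a\<bar> powr p * (1 + (p-1) * (b/a)\<^sup>2) powr (p/2)
     \<le> \<bar>a\<bar> powr p * ((\<bar>1 + b/a\<bar> powr p + \<bar>1 - b/a\<bar> powr p) / 2)"
    by (intro mult_left_mono two_point_real_p_2 p) auto
  also have "\<dots> = ((\<bar>a\<bar> * \<bar>1 + b/a\<bar>) powr p + (\<bar>a\<bar> * \<bar>1 - b/a\<bar>) powr p) / 2"
    by (simp add: powr_mult distrib_left)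
  also have "\<bar>a\<bar> * \<bar>1 + b/a\<bar> = \<bar>a + b\<bar>"
    unfolding abs_mult[symmetric] using False by (simp add: distrib_left)
  also have "\<bar>a\<bar> * \<bar>1 - b/a\<bar> = \<bar>a - b\<bar>"
    unfolding abs_mult[symmetric] using False by (simp add: right_diff_distrib)
  finally show ?thesis .
qed

text \<open>The dual of \<open>two_point_real_p_2_homogeneous\<close>: the
  \<open>L\<^sup>q\<close> norm of \<open>1 + \<epsilon>s\<close> is attained by pairing with
  \<open>sgn (1 + \<epsilon>s) |1 + \<epsilon>s|\<^bsup>q-1\<^esup> = A + \<epsilon>B\<close>,
  and the pairing \<open>A + sB\<close> is estimated by the Cauchy--Schwarz inequality with
  weights \<open>1\<close> and \<open>p - 1 = 1 / (q - 1)\<close>.\<close>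

lemma two_point_real_2_q:
  fixes p q s :: real
  assumes p: "1 < p" "p \<le> 2" and pq: "1/p + 1/q = 1"
  shows "((\<bar>1 + s\<bar> powr q + \<bar>1 - s\<bar> powr q) / 2) powr (2/q) \<le> 1 + (q - 1) * s\<^sup>2"
proof -
  note c = conjugate_exponents_real[OF p(1) pq]
  define N where "N = (\<bar>1 + s\<bar> powr q + \<bar>1 - s\<bar> powr q) / 2"
  define g1 where "g1 = sgn (1+s) * \<bar>1+s\<bar> powr (q-1)"
  define g2 where "g2 = sgn (1-s) * \<bar>1-s\<bar> powr (q-1)"
  define A where "A = (g1 + g2)/2"
  define B where "B = (g1 - g2)/2"
  have N0: "0 < N"
  proof -
    have "1 + s \<noteq> 0 \<or> 1 - s \<noteq> 0" by auto
    then consider "0 < \<bar>1 + s\<bar> powr q" | "0 < \<bar>1 - s\<bar> powr q" by force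
    then show ?thesis unfolding N_def by cases (simp_all add: add_pos_nonneg add_nonneg_pos)
  qed
  have e: "t * (sgn t * \<bar>t\<bar> powr (q-1)) = \<bar>t\<bar> powr q" for t :: real
  proof (cases "t = 0")
    case False
    have "t * (sgn t * \<bar>t\<bar> powr (q-1)) = \<bar>t\<bar> * \<bar>t\<bar> powr (q-1)"
      by (metis abs_sgn mult.assoc)
    also have "\<dots> = \<bar>t\<bar> powr q" using False by (simp add: powr_mult_base)
    finally show ?thesis .
  qed simp
  have e2: "\<bar>sgn t * \<bar>t\<bar> powr (q-1)\<bar> powr p = \<bar>t\<bar> powr q" for t :: real
  proof (cases "t = 0")
    case False
    then show ?thesis using c by (simp add: abs_mult abs_sgn_eq powr_powr)
  qed simp
  have N1: "N = A + s * B"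
    using e[of "1+s"] e[of "1-s"] by (simp add: N_def A_def B_def g1_def g2_def field_simps)
  have "A\<^sup>2 + (p-1) * B\<^sup>2 \<le> N powr (2/p)"
  proof -
    have "(A\<^sup>2 + (p - 1) * B\<^sup>2) powr (p/2) \<le> (\<bar>A + B\<bar> powr p + \<bar>A - B\<bar> powr p) / 2"
      by (rule two_point_real_p_2_homogeneous[OF p])
    also have "A + B = g1" by (simp add: A_def B_def field_simps)
    also have "A - B = g2" by (simp add: A_def B_def field_simps)
    also have "(\<bar>g1\<bar> powr p + \<bar>g2\<bar> powr p) / 2 = N"
      unfolding g1_def g2_def e2 N_def by simp
    finally have "((A\<^sup>2 + (p - 1) * B\<^sup>2) powr (p/2)) powr (2/p) \<le> N powr (2/p)"
      using p by (intro powr_mono2) auto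
    moreover have "0 \<le> A\<^sup>2 + (p - 1) * B\<^sup>2" using p by auto
    ultimately show ?thesis using p by (simp add: powr_powr)
  qed
  moreover have "N\<^sup>2 \<le> (1 + (q-1) * s\<^sup>2) * (A\<^sup>2 + (p-1) * B\<^sup>2)"
  proof -
    have "(1 + (q-1) * s\<^sup>2) * (A\<^sup>2 + (p-1) * B\<^sup>2) - N\<^sup>2
       = (p-1) * B\<^sup>2 + (q-1) * s\<^sup>2 * A\<^sup>2 - 2 * A * s * B + ((p-1)*(q-1) - 1) * s\<^sup>2 * B\<^sup>2"
      unfolding N1 by algebra
    also have "\<dots> = (p-1) * B\<^sup>2 + (q-1) * s\<^sup>2 * A\<^sup>2 - 2 * ((p-1)*(q-1)) * (A * s * B)"
      using c(3) by simp
    also have "\<dots> = (p-1) * (B - (q-1) * s * A)\<^sup>2 + (q-1) * s\<^sup>2 * A\<^sup>2 * (1 - (p-1) * (q-1))"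
      by algebra
    also have "\<dots> \<ge> 0" using c(3) p by simp
    finally show ?thesis by simp
  qed
  ultimately have "N\<^sup>2 \<le> (1 + (q-1) * s\<^sup>2) * N powr (2/p)"
    using c(1) by (meson add_nonneg_nonneg diff_ge_0_iff_ge less_imp_le mult_left_mono mult_nonneg_nonneg order_trans zero_le_one zero_le_power2)
  moreover have "N\<^sup>2 = N powr (2/q) * N powr (2/p)"
  proof -
    have "2/q + 2/p = 2" using pq by (simp add: add.commute field_simps)
    then show ?thesis using N0 by (simp flip: powr_add)
  qed
  ultimately have "N powr (2/q) \<le> 1 + (q-1) * s\<^sup>2" using N0 by simp
  then show ?thesis by (simp add: N_def)
qed

text \<open>Both sides are separated by \<open>1 + y\<^sup>2 + (p - 1) x\<^sup>2\<close> for
  \<open>z = x + iy\<close>. Because \<open>\<omega>\<close> is imaginary, the squared moduli on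
  the left are \<open>(1 \<minusplus> s)\<^sup>2 + (p - 1) x\<^sup>2\<close> with \<open>s =
  \<surd>(p - 1) y\<close>, those on the right are \<open>(1 \<plusminus> x)\<^sup>2 +
  y\<^sup>2\<close>. Minkowski's inequality, with exponent \<open>q/2 \<ge> 1\<close> on the
  left and \<open>2/p \<ge> 1\<close> on the right, splits off the summand that does not depend
  on the sign and leaves the two real inequalities.\<close>

lemma two_point_normalized:
  fixes p q :: real and z :: complex
  assumes p: "1 < p" "p \<le> 2" and pq: "1/p + 1/q = 1"
  defines "\<omega> \<equiv> \<i> * complex_of_real (sqrt (p - 1))"
  shows "((cmod (1 + \<omega> * z) powr q + cmod (1 - \<omega> * z) powr q) / 2) powr (1/q)
    \<le> ((cmod (1 + z) powr p + cmod (1 - z) powr p) / 2) powr (1/p)"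
proof -
  note c = conjugate_exponents_real[OF p(1) pq]
  define x where "x = Re z" define y where "y = Im z"
  define s where "s = sqrt (p-1) * y"
  define L where "L = (cmod (1 + \<omega> * z) powr q + cmod (1 - \<omega> * z) powr q) / 2"
  define R where "R = (cmod (1 + z) powr p + cmod (1 - z) powr p) / 2"
  have q2: "2 \<le> q" unfolding c(2) using p by (simp add: field_simps)
  have m: "cmod w powr r = ((Re w)\<^sup>2 + (Im w)\<^sup>2) powr (r/2)" for w r
    using powr_square_half[of "cmod w" r] by (simp add: cmod_power2)
  have w1: "cmod (1 + \<omega> * z) powr q = ((1 - s)\<^sup>2 + (p-1) * x\<^sup>2) powr (q/2)"
    and w2: "cmod (1 - \<omega> * z) powr q = ((1 + s)\<^sup>2 + (p-1) * x\<^sup>2) powr (q/2)"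
    unfolding m using p by (auto simp: \<omega>_def s_def x_def y_def power_mult_distrib)
  have LU: "L powr (2/q) \<le> 1 + y\<^sup>2 + (p-1) * x\<^sup>2"
  proof -
    \<comment> \<open>the mean over the two signs, as a sum with weights \<open>1/2\<close>\<close>
    have "(\<Sum>i\<in>{1,-1::real}. 1/2 * ((1 + i * s)\<^sup>2 + (p-1) * x\<^sup>2) powr (q/2)) powr (1/(q/2))
      \<le> (\<Sum>i\<in>{1,-1::real}. 1/2 * ((1 + i * s)\<^sup>2) powr (q/2)) powr (1/(q/2))
       + (\<Sum>i\<in>{1,-1::real}. 1/2 * ((p-1) * x\<^sup>2) powr (q/2)) powr (1/(q/2))"
      using q2 p by (intro weighted_minkowski) auto
    moreover have "(((p-1) * x\<^sup>2) powr (q/2)) powr (1/(q/2)) = (p-1) * x\<^sup>2"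
      using p q2 by (simp add: powr_powr)
    moreover have "((\<bar>1 + s\<bar> powr q + \<bar>1 - s\<bar> powr q) / 2) powr (2/q) \<le> 1 + (q - 1) * s\<^sup>2"
      by (rule two_point_real_2_q[OF p pq])
    moreover have "(q - 1) * s\<^sup>2 = y\<^sup>2"
      using c(3) p by (simp add: s_def power_mult_distrib mult.commute)
    ultimately show ?thesis
      by (simp add: L_def w1 w2 powr_square_half add_divide_distrib add.commute)
  qed
  have RL: "1 + y\<^sup>2 + (p-1) * x\<^sup>2 \<le> R powr (2/p)"
  proof -
    define X where "X = (\<lambda>e::real. \<bar>1 + e * x\<bar> powr p)"
    define Y where "Y = \<bar>y\<bar> powr p"
    have pw: "(\<bar>t\<bar> powr p) powr (2/p) = t\<^sup>2" for t :: real
      using p by (cases "t = 0") (simp_all add: powr_powr)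
    \<comment> \<open>triangle inequality in \<open>\<ell>\<^bsup>2/p\<^esup>\<close> of two
      points for \<open>(|1 + x|\<^sup>p, |y|\<^sup>p)\<close> and \<open>(|1 - x|\<^sup>p,
      |y|\<^sup>p)\<close>\<close>
    have "(\<Sum>b\<in>(UNIV::bool set). 1 * ((if b then X 1 else Y) + (if b then X (-1) else Y)) powr (2/p)) powr (1/(2/p))
       \<le> (\<Sum>b\<in>(UNIV::bool set). 1 * (if b then X 1 else Y) powr (2/p)) powr (1/(2/p))
        + (\<Sum>b\<in>(UNIV::bool set). 1 * (if b then X (-1) else Y) powr (2/p)) powr (1/(2/p))"
      using p by (intro weighted_minkowski) (auto simp: X_def Y_def)
    then have "((X 1 + X (-1)) powr (2/p) + (2 * Y) powr (2/p)) powr (p/2)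
      \<le> ((1+x)\<^sup>2 + y\<^sup>2) powr (p/2) + ((1-x)\<^sup>2 + y\<^sup>2) powr (p/2)"
      by (simp add: UNIV_bool X_def Y_def pw add.commute)
    also have "\<dots> = 2 * R" unfolding R_def m by (simp add: x_def y_def)
    finally have "(((X 1 + X (-1)) powr (2/p) + (2 * Y) powr (2/p)) powr (p/2)) powr (2/p) \<le> (2 * R) powr (2/p)"
      using p by (intro powr_mono2) auto
    then have "(X 1 + X (-1)) powr (2/p) + (2 * Y) powr (2/p) \<le> (2 * R) powr (2/p)"
      using p by (simp add: powr_powr add_nonneg_nonneg)
    then have "((X 1 + X (-1)) powr (2/p) + (2 * Y) powr (2/p)) / 2 powr (2/p) \<le> R powr (2/p)"
      by (subst (asm) powr_mult) (simp add: divide_le_eq mult.commute)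
    then have "((X 1 + X (-1)) / 2) powr (2/p) + Y powr (2/p) \<le> R powr (2/p)"
      by (subst powr_divide) (simp_all add: X_def powr_mult add_divide_distrib[of "_ powr (2/p)"] Y_def)
    moreover have "Y powr (2/p) = y\<^sup>2" by (simp add: Y_def pw)
    moreover have "1 + (p - 1) * x\<^sup>2 \<le> ((X 1 + X (-1)) / 2) powr (2/p)"
    proof -
      have "((1 + (p - 1) * x\<^sup>2) powr (p/2)) powr (2/p) \<le> ((X 1 + X (-1)) / 2) powr (2/p)"
        using two_point_real_p_2[OF p, of x] p by (intro powr_mono2) (auto simp: X_def)
      moreover have "0 \<le> 1 + (p - 1) * x\<^sup>2" using p by auto
      ultimately show ?thesis using p by (simp add: powr_powr)
    qed
    ultimately show ?thesis by simp
  qed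
  have "(L powr (2/q)) powr (1/2) \<le> (R powr (2/p)) powr (1/2)"
    using LU RL by (intro powr_mono2) auto
  then show ?thesis by (simp add: powr_powr L_def R_def)
qed

text \<open>Beckner's two-point inequality. For \<open>a \<noteq> 0\<close> it is
  \<open>two_point_normalized\<close> at \<open>z = b/a\<close>, by homogeneity; for \<open>a =
  0\<close> it says \<open>|\<omega>| \<le> 1\<close>.\<close>

lemma two_point_hypercontractivity:
  fixes p q :: real and a b :: complex
  assumes p: "1 < p" "p \<le> 2" and pq: "1/p + 1/q = 1"
  defines "\<omega> \<equiv> \<i> * complex_of_real (sqrt (p - 1))"
  shows "((cmod (a + \<omega> * b) powr q + cmod (a - \<omega> * b) powr q) / 2) powr (1/q)
    \<le> ((cmod (a + b) powr p + cmod (a - b) powr p) / 2) powr (1/p)"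
proof (cases "a = 0")
  case True
  note c = conjugate_exponents_real[OF p(1) pq]
  have "cmod (\<omega> * b) \<le> cmod b"
    using p by (simp add: \<omega>_def norm_mult mult_left_le_one_le)
  then show ?thesis using True p c by (simp add: powr_powr)
next
  case False
  note c = conjugate_exponents_real[OF p(1) pq]
  have h: "((cmod (a + v * b) powr r + cmod (a - v * b) powr r) / 2) powr (1/r)
     = cmod a * ((cmod (1 + v * (b/a)) powr r + cmod (1 - v * (b/a)) powr r) / 2) powr (1/r)"
    if "r > 1" for v r
  proof -
    have "a + v * b = a * (1 + v * (b/a))" "a - v * b = a * (1 - v * (b/a))"
      using False by (simp_all add: field_simps)
    then have "(cmod (a + v * b) powr r + cmod (a - v * b) powr r) / 2
      = cmod a powr r * ((cmod (1 + v * (b/a)) powr r + cmod (1 - v * (b/a)) powr r) / 2)"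
      by (simp only: norm_mult powr_mult norm_ge_zero) (simp add: field_simps)
    then show ?thesis using that False by (simp only: powr_mult) (simp add: powr_powr)
  qed
  show ?thesis
    using mult_left_mono[OF two_point_normalized[OF p pq, of "b/a"], of "cmod a"]
      h[OF c(1), of \<omega>] h[OF p(1), of 1] by (simp add: \<omega>_def)
qed

section \<open>Hypercontractivity on the discrete cube\<close>

lemma cis_sum: "finite A \<Longrightarrow> cis (sum t A) = (\<Prod>i\<in>A. cis (t i))"
  by (induction A rule: finite_induct) (auto simp: cis_mult[symmetric])

text \<open>A point of the cube \<open>{-1, 1}\<^sup>I\<close> is encoded as the set \<open>A
  \<subseteq> I\<close> of coordinates equal to \<open>1\<close>.\<close>

definition cube_mean :: "'i set \<Rightarrow> ('i set \<Rightarrow> 'b::real_vector) \<Rightarrow> 'b" where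
  "cube_mean I h = (1 / 2 ^ card I) *\<^sub>R (\<Sum>A\<in>Pow I. h A)"

text \<open>In the coordinates \<open>\<epsilon>\<^sub>i, \<delta>\<^sub>i =
  \<plusminus>1\<close> of \<open>A\<close> and \<open>B\<close> the kernel is
  \<open>\<Prod>\<^sub>i (1 + \<omega> \<epsilon>\<^sub>i \<delta>\<^sub>i)\<close>: this is the
  operator multiplying the Walsh character of \<open>S \<subseteq> I\<close> by
  \<open>\<omega>\<^bsup>|S|\<^esup>\<close>.\<close>

definition cube_op :: "complex \<Rightarrow> 'i set \<Rightarrow> ('i set \<Rightarrow> complex) \<Rightarrow> 'i set \<Rightarrow> complex" where
  "cube_op \<omega> I f B =
     cube_mean I (\<lambda>A. (\<Prod>i\<in>I. if (i \<in> A) = (i \<in> B) then 1 + \<omega> else 1 - \<omega>) * f A)"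

lemma cube_mean_empty [simp]: "cube_mean {} h = h {}"
  by (simp add: cube_mean_def)

lemma sum_Pow_insert:
  assumes "finite J" "i \<notin> J"
  shows "(\<Sum>A\<in>Pow (insert i J). h A) = (\<Sum>A\<in>Pow J. h A) + (\<Sum>A\<in>Pow J. h (insert i A))"
proof -
  have "inj_on (insert i) (Pow J)" using assms(2) by (auto simp: inj_on_def)
  then show ?thesis
    unfolding Pow_insert using assms
    by (subst sum.union_disjoint) (auto simp: sum.reindex)
qed

lemma cube_mean_insert:
  fixes h :: "'i set \<Rightarrow> 'b::real_vector"
  assumes "finite J" "i \<notin> J"
  shows "cube_mean (insert i J) h = cube_mean J (\<lambda>A. (1/2) *\<^sub>R (h A + h (insert i A)))"
  using assms
  by (simp add: cube_mean_def sum_Pow_insert sum.distrib scaleR_right.sum[symmetric] scaleR_add_right mult.commute)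

lemma cube_mean_cong: "(\<And>A. A \<subseteq> I \<Longrightarrow> f A = g A) \<Longrightarrow> cube_mean I f = cube_mean I g"
  by (simp add: cube_mean_def)

lemma cube_mean_add: "cube_mean I (\<lambda>A. f A + g A) = cube_mean I f + cube_mean I g"
  by (simp add: cube_mean_def sum.distrib scaleR_add_right)

lemma cube_mean_scaleR: "cube_mean I (\<lambda>A. c *\<^sub>R f A) = c *\<^sub>R cube_mean I f"
  by (simp add: cube_mean_def scaleR_right.sum[symmetric])

lemma cube_mean_mult_left:
  fixes c :: "'b::real_algebra_1" shows "cube_mean I (\<lambda>A. c * f A) = c * cube_mean I f"
  by (simp add: cube_mean_def sum_distrib_left)

lemma cube_mean_sum: "cube_mean I (\<lambda>A. \<Sum>j\<in>J. f j A) = (\<Sum>j\<in>J. cube_mean I (f j))"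
  unfolding cube_mean_def by (subst sum.swap) (simp add: scaleR_right.sum)

lemma cube_mean_mono:
  fixes f g :: "'i set \<Rightarrow> real"
  shows "(\<And>A. A \<subseteq> I \<Longrightarrow> f A \<le> g A) \<Longrightarrow> cube_mean I f \<le> cube_mean I g"
  by (auto simp: cube_mean_def intro!: divide_right_mono sum_mono)

lemma cube_mean_nonneg:
  fixes f :: "'i set \<Rightarrow> real"
  shows "(\<And>A. A \<subseteq> I \<Longrightarrow> 0 \<le> f A) \<Longrightarrow> 0 \<le> cube_mean I f"
  by (auto simp: cube_mean_def intro!: divide_nonneg_nonneg sum_nonneg)

lemma cube_mean_minkowski:
  fixes u v :: "'i set \<Rightarrow> real"
  assumes "finite I" "1 \<le> r" "\<And>A. A \<subseteq> I \<Longrightarrow> 0 \<le> u A" "\<And>A. A \<subseteq> I \<Longrightarrow> 0 \<le> v A"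
  shows "cube_mean I (\<lambda>A. (u A + v A) powr r) powr (1/r)
    \<le> cube_mean I (\<lambda>A. u A powr r) powr (1/r) + cube_mean I (\<lambda>A. v A powr r) powr (1/r)"
  using weighted_minkowski[of "Pow I" r u v "\<lambda>_. 1 / 2 ^ card I"] assms
  by (simp add: cube_mean_def sum_divide_distrib)

lemma cube_mean_holder:
  fixes u v :: "'i set \<Rightarrow> real"
  assumes "finite I" "1 < p" "1/p + 1/q = 1" "\<And>A. 0 \<le> u A" "\<And>A. 0 \<le> v A"
  shows "cube_mean I (\<lambda>A. u A * v A)
    \<le> cube_mean I (\<lambda>A. u A powr q) powr (1/q) * cube_mean I (\<lambda>A. v A powr p) powr (1/p)"
  using weighted_holder[of "Pow I" p q u v "\<lambda>_. 1 / 2 ^ card I"] assms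
  by (simp add: cube_mean_def sum_divide_distrib)

text \<open>Independence of the coordinates.\<close>

lemma cube_mean_prod:
  fixes x y :: "'i \<Rightarrow> complex"
  assumes "finite I"
  shows "cube_mean I (\<lambda>A. \<Prod>i\<in>I. if i \<in> A then x i else y i) = (\<Prod>i\<in>I. (x i + y i) / 2)"
  using assms
proof (induction I)
  case (insert i J)
  have "cube_mean (insert i J) (\<lambda>A. \<Prod>j\<in>insert i J. if j \<in> A then x j else y j)
    = cube_mean J (\<lambda>A. ((x i + y i) / 2) * (\<Prod>j\<in>J. if j \<in> A then x j else y j))"
    unfolding cube_mean_insert[OF insert.hyps]
  proof (rule cube_mean_cong)
    fix A assume "A \<subseteq> J"
    then have A: "i \<notin> A" using insert.hyps by auto
    have "(\<Prod>j\<in>J. if j \<in> insert i A then x j else y j) = (\<Prod>j\<in>J. if j \<in> A then x j else y j)"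
      using insert.hyps by (intro prod.cong) auto
    then show "(1/2) *\<^sub>R ((\<Prod>j\<in>insert i J. if j \<in> A then x j else y j) +
            (\<Prod>j\<in>insert i J. if j \<in> insert i A then x j else y j)) =
          ((x i + y i) / 2) * (\<Prod>j\<in>J. if j \<in> A then x j else y j)"
      using A insert.hyps by (simp add: scaleR_conv_of_real field_simps)
  qed
  also have "\<dots> = (x i + y i) / 2 * cube_mean J (\<lambda>A. \<Prod>j\<in>J. if j \<in> A then x j else y j)"
    by (rule cube_mean_mult_left)
  finally show ?case unfolding insert.IH using insert.hyps by simp
qed simp

text \<open>In a new coordinate the operator acts as \<open>a + \<epsilon>b \<mapsto> a +
  \<omega>\<epsilon>b\<close>, where \<open>a\<close> and \<open>b\<close> are half the sum and
  half the difference of the images \<open>F0\<close>, \<open>F1\<close> of the two slices.\<close>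

lemma cube_op_insert:
  fixes \<omega> :: complex and f :: "'i set \<Rightarrow> complex"
  assumes J: "finite J" "i \<notin> J" and B: "B \<subseteq> J"
  defines "F0 \<equiv> cube_op \<omega> J f B" and "F1 \<equiv> cube_op \<omega> J (\<lambda>A. f (insert i A)) B"
  shows "cube_op \<omega> (insert i J) f B = (F0 + F1) / 2 + \<omega> * ((F0 - F1) / 2)"
    and "cube_op \<omega> (insert i J) f (insert i B) = (F0 + F1) / 2 - \<omega> * ((F0 - F1) / 2)"
proof -
  let ?k = "\<lambda>A B. \<Prod>j\<in>J. if (j \<in> A) = (j \<in> B) then 1 + \<omega> else 1 - \<omega>"
  have k: "?k (insert i A) B' = ?k A B'" "?k A (insert i B') = ?k A B'" for A B'
    using J by (auto intro!: prod.cong)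
  have k': "(\<Prod>j\<in>J. if (j = i \<or> j \<in> A) = (j \<in> B') then 1 + \<omega> else 1 - \<omega>) = ?k A B'"
    "(\<Prod>j\<in>J. if (j \<in> A) = (j = i \<or> j \<in> B') then 1 + \<omega> else 1 - \<omega>) = ?k A B'"
    "(\<Prod>j\<in>J. if (j = i \<or> j \<in> A) = (j = i \<or> j \<in> B') then 1 + \<omega> else 1 - \<omega>) = ?k A B'" for A B'
    using J by (auto intro!: prod.cong)
  have iB: "i \<notin> B" using J B by auto
  have "cube_op \<omega> (insert i J) f B =
      cube_mean J (\<lambda>A. (1 + \<omega>)/2 * (?k A B * f A) + (1 - \<omega>)/2 * (?k A B * f (insert i A)))"
    unfolding cube_op_def cube_mean_insert[OF J]
  proof (rule cube_mean_cong)
    fix A assume "A \<subseteq> J"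
    then have A: "i \<notin> A" using J by auto
    show "(1/2) *\<^sub>R ((\<Prod>i\<in>insert i J. if (i \<in> A) = (i \<in> B) then 1 + \<omega> else 1 - \<omega>) * f A +
        (\<Prod>ia\<in>insert i J. if (ia \<in> insert i A) = (ia \<in> B) then 1 + \<omega> else 1 - \<omega>) * f (insert i A))
      = (1 + \<omega>)/2 * (?k A B * f A) + (1 - \<omega>)/2 * (?k A B * f (insert i A))"
      using A iB J by (simp add: k k' scaleR_conv_of_real field_simps)
  qed
  then have "cube_op \<omega> (insert i J) f B = (1+\<omega>)/2 * F0 + (1-\<omega>)/2 * F1"
    by (simp only: cube_mean_add cube_mean_mult_left F0_def F1_def cube_op_def)
  then show "cube_op \<omega> (insert i J) f B = (F0 + F1) / 2 + \<omega> * ((F0 - F1) / 2)"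
    by (simp add: field_simps)
  have "cube_op \<omega> (insert i J) f (insert i B) =
      cube_mean J (\<lambda>A. (1 - \<omega>)/2 * (?k A B * f A) + (1 + \<omega>)/2 * (?k A B * f (insert i A)))"
    unfolding cube_op_def cube_mean_insert[OF J]
  proof (rule cube_mean_cong)
    fix A assume "A \<subseteq> J"
    then have A: "i \<notin> A" using J by auto
    show "(1/2) *\<^sub>R ((\<Prod>ia\<in>insert i J. if (ia \<in> A) = (ia \<in> insert i B) then 1 + \<omega> else 1 - \<omega>) * f A +
        (\<Prod>ia\<in>insert i J. if (ia \<in> insert i A) = (ia \<in> insert i B) then 1 + \<omega> else 1 - \<omega>) * f (insert i A))
      = (1 - \<omega>)/2 * (?k A B * f A) + (1 + \<omega>)/2 * (?k A B * f (insert i A))"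
      using A iB J by (simp add: k k' scaleR_conv_of_real field_simps)
  qed
  then have "cube_op \<omega> (insert i J) f (insert i B) = (1-\<omega>)/2 * F0 + (1+\<omega>)/2 * F1"
    by (simp only: cube_mean_add cube_mean_mult_left F0_def F1_def cube_op_def)
  then show "cube_op \<omega> (insert i J) f (insert i B) = (F0 + F1) / 2 - \<omega> * ((F0 - F1) / 2)"
    by (simp add: field_simps)
qed

text \<open>Induction on the number of coordinates. The two-point inequality in the new
  coordinate produces an \<open>\<ell>\<^sup>p\<close> norm inside an \<open>L\<^sup>q\<close>
  norm; Minkowski's inequality with exponent \<open>q/p \<ge> 1\<close> interchanges the two,
  and the induction hypothesis applies to each slice.\<close>

theorem cube_hypercontractivity:
  fixes p q :: real and f :: "'i set \<Rightarrow> complex"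
  assumes p: "1 < p" "p \<le> 2" and pq: "1/p + 1/q = 1" and "finite I"
  defines "\<omega> \<equiv> \<i> * complex_of_real (sqrt (p - 1))"
  shows "cube_mean I (\<lambda>B. cmod (cube_op \<omega> I f B) powr q) powr (1/q)
    \<le> cube_mean I (\<lambda>A. cmod (f A) powr p) powr (1/p)"
  using \<open>finite I\<close>
proof (induction I arbitrary: f)
  case empty
  then show ?case using p conjugate_exponents_real(1)[OF p(1) pq] by (simp add: cube_op_def powr_powr)
next
  case (insert i J)
  note c = conjugate_exponents_real[OF p(1) pq]
  have pq': "p \<le> q"
  proof -
    have "p * (p - 1) \<le> p * 1" by (rule mult_left_mono) (use p in auto)
    then show ?thesis unfolding c(2) using p(1) by (subst pos_le_divide_eq) auto
  qed
  define F0 where "F0 = cube_op \<omega> J f"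
  define F1 where "F1 = cube_op \<omega> J (\<lambda>A. f (insert i A))"
  have nn: "0 \<le> cube_mean J (\<lambda>A. cmod (h A) powr s)" for h :: "'i set \<Rightarrow> complex" and s
    by (rule cube_mean_nonneg) simp
  define r where "r = q / p"
  have r: "1 \<le> r" using pq' p by (simp add: r_def)
  have step: "cube_mean (insert i J) (\<lambda>B. cmod (cube_op \<omega> (insert i J) f B) powr q)
    \<le> cube_mean J (\<lambda>B. (1/2 * cmod (F0 B) powr p + 1/2 * cmod (F1 B) powr p) powr r)"
    unfolding cube_mean_insert[OF insert.hyps]
  proof (rule cube_mean_mono)
    fix B assume B: "B \<subseteq> J"
    let ?a = "(F0 B + F1 B) / 2" and ?b = "(F0 B - F1 B) / 2"
    have ab: "?a + ?b = F0 B" "?a - ?b = F1 B" by (auto simp: field_simps)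
    let ?L = "(cmod (?a + \<omega> * ?b) powr q + cmod (?a - \<omega> * ?b) powr q) / 2"
    have "?L powr (1/q) \<le> ((cmod (F0 B) powr p + cmod (F1 B) powr p) / 2) powr (1/p)"
      using two_point_hypercontractivity[OF p pq, of ?a ?b] unfolding \<omega>_def ab .
    then have "(?L powr (1/q)) powr q \<le> (((cmod (F0 B) powr p + cmod (F1 B) powr p) / 2) powr (1/p)) powr q"
      using c(1) by (intro powr_mono2) auto
    then have "?L \<le> ((cmod (F0 B) powr p + cmod (F1 B) powr p) / 2) powr r"
      using c(1) p by (simp add: powr_powr r_def)
    then show "(1/2) *\<^sub>R (cmod (cube_op \<omega> (insert i J) f B) powr q
          + cmod (cube_op \<omega> (insert i J) f (insert i B)) powr q)
        \<le> (1/2 * cmod (F0 B) powr p + 1/2 * cmod (F1 B) powr p) powr r"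
      unfolding cube_op_insert[OF insert.hyps B] by (simp add: F0_def F1_def add_divide_distrib)
  qed
  have half: "cube_mean J (\<lambda>B. (1/2 * cmod (F B) powr p) powr r) powr (1/r)
     \<le> 1/2 * cube_mean J (\<lambda>A. cmod (h A) powr p)"
    if F: "F = cube_op \<omega> J h" for F h
  proof -
    have e: "(1/2 * cmod (F B) powr p) powr r = (1/2) powr r *\<^sub>R (cmod (F B) powr q)" for B
      using p by (subst powr_mult) (simp_all add: powr_powr r_def)
    have "cube_mean J (\<lambda>B. (1/2 * cmod (F B) powr p) powr r) powr (1/r)
      = 1/2 * (cube_mean J (\<lambda>B. cmod (F B) powr q)) powr (1/r)"
      unfolding e cube_mean_scaleR using r nn by (simp add: powr_mult powr_powr)
    also have "(cube_mean J (\<lambda>B. cmod (F B) powr q)) powr (1/r)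
      = (cube_mean J (\<lambda>B. cmod (F B) powr q) powr (1/q)) powr p"
      using c(1) p by (simp add: powr_powr r_def)
    also have "\<dots> \<le> (cube_mean J (\<lambda>A. cmod (h A) powr p) powr (1/p)) powr p"
      unfolding F using p by (intro powr_mono2 insert.IH) auto
    also have "\<dots> = cube_mean J (\<lambda>A. cmod (h A) powr p)"
      using p nn by (simp add: powr_powr)
    finally show ?thesis by simp
  qed
  have "cube_mean (insert i J) (\<lambda>B. cmod (cube_op \<omega> (insert i J) f B) powr q) powr (1/r)
    \<le> cube_mean J (\<lambda>B. (1/2 * cmod (F0 B) powr p + 1/2 * cmod (F1 B) powr p) powr r) powr (1/r)"
    using r by (intro powr_mono2 step) (auto intro!: cube_mean_nonneg)
  also have "\<dots> \<le> cube_mean J (\<lambda>B. (1/2 * cmod (F0 B) powr p) powr r) powr (1/r)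
      + cube_mean J (\<lambda>B. (1/2 * cmod (F1 B) powr p) powr r) powr (1/r)"
    using r insert.hyps by (intro cube_mean_minkowski) auto
  also have "\<dots> \<le> 1/2 * cube_mean J (\<lambda>A. cmod (f A) powr p)
      + 1/2 * cube_mean J (\<lambda>A. cmod (f (insert i A)) powr p)"
    by (intro add_mono half) (auto simp: F0_def F1_def)
  also have "\<dots> = cube_mean (insert i J) (\<lambda>A. cmod (f A) powr p)"
    unfolding cube_mean_insert[OF insert.hyps] cube_mean_scaleR cube_mean_add by simp
  finally have "(cube_mean (insert i J) (\<lambda>B. cmod (cube_op \<omega> (insert i J) f B) powr q) powr (1/r)) powr (1/p)
     \<le> cube_mean (insert i J) (\<lambda>A. cmod (f A) powr p) powr (1/p)"
    using p by (intro powr_mono2) auto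
  then show ?case using p by (simp add: powr_powr r_def)
qed

definition cube_sign :: "'i set \<Rightarrow> 'i \<Rightarrow> real" where
  "cube_sign A i = (if i \<in> A then 1 else -1)"

text \<open>Hypercontractivity paired with a second function by Hoelder's inequality, for sums
  of exponentials \<open>e\<^bsup>i\<langle>\<theta>,\<epsilon>\<rangle>\<^esup>\<close>. On
  these the operator acts coordinatewise, turning \<open>cos \<theta>\<^sub>i +
  i\<epsilon>\<^sub>i sin \<theta>\<^sub>i\<close> into \<open>cos \<theta>\<^sub>i +
  i\<omega>\<epsilon>\<^sub>i sin \<theta>\<^sub>i\<close>, so that the pairing is an explicit
  product.\<close>

theorem cube_bilinear_inequality:
  fixes p :: real and J :: "'j set" and K :: "'k set" and c :: "'j \<Rightarrow> complex" and d :: "'k \<Rightarrow> complex"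
    and I :: "'i set" and \<theta> :: "'j \<Rightarrow> 'i \<Rightarrow> real" and \<eta> :: "'k \<Rightarrow> 'i \<Rightarrow> real"
  assumes p: "1 < p" "p \<le> 2" and I: "finite I"
  defines "s \<equiv> sqrt (p - 1)"
  defines "f \<equiv> (\<lambda>A. \<Sum>j\<in>J. c j * cis (\<Sum>i\<in>I. \<theta> j i * cube_sign A i))"
  defines "g \<equiv> (\<lambda>A. \<Sum>k\<in>K. d k * cis (\<Sum>i\<in>I. \<eta> k i * cube_sign A i))"
  shows "cmod (\<Sum>j\<in>J. \<Sum>k\<in>K. c j * d k *
      (\<Prod>i\<in>I. Complex (cos (\<theta> j i) * cos (\<eta> k i)) (- s * (sin (\<theta> j i) * sin (\<eta> k i)))))
    \<le> cube_mean I (\<lambda>A. cmod (f A) powr p) powr (1/p) * cube_mean I (\<lambda>A. cmod (g A) powr p) powr (1/p)"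
proof -
  define q where "q = p / (p - 1)"
  have pq: "1/p + 1/q = 1" using p by (simp add: q_def field_simps)
  define \<omega> where "\<omega> = \<i> * complex_of_real (sqrt (p - 1))"
  have sgn: "cis (\<Sum>i\<in>I. t i * cube_sign A i) = (\<Prod>i\<in>I. if i \<in> A then cis (t i) else cis (- t i))" for t A
    unfolding cis_sum[OF I] by (intro prod.cong) (auto simp: cube_sign_def)
  have op1: "cube_op \<omega> I (\<lambda>A. cis (\<Sum>i\<in>I. t i * cube_sign A i)) B
      = (\<Prod>i\<in>I. if i \<in> B then complex_of_real (cos (t i)) + \<omega> * \<i> * complex_of_real (sin (t i)) else complex_of_real (cos (t i)) - \<omega> * \<i> * complex_of_real (sin (t i)))" for t B
  proof -
    have "cube_op \<omega> I (\<lambda>A. cis (\<Sum>i\<in>I. t i * cube_sign A i)) B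
     = cube_mean I (\<lambda>A. \<Prod>i\<in>I. if i \<in> A then (if i \<in> B then 1 + \<omega> else 1 - \<omega>) * cis (t i)
            else (if i \<in> B then 1 - \<omega> else 1 + \<omega>) * cis (- t i))"
      unfolding cube_op_def sgn
      by (intro cube_mean_cong, subst prod.distrib[symmetric]) (auto intro!: prod.cong)
    also have "\<dots> = (\<Prod>i\<in>I. ((if i \<in> B then 1 + \<omega> else 1 - \<omega>) * cis (t i)
            + (if i \<in> B then 1 - \<omega> else 1 + \<omega>) * cis (- t i)) / 2)"
      by (rule cube_mean_prod[OF I])
    also have "\<dots> = (\<Prod>i\<in>I. if i \<in> B then complex_of_real (cos (t i)) + \<omega> * \<i> * complex_of_real (sin (t i)) else complex_of_real (cos (t i)) - \<omega> * \<i> * complex_of_real (sin (t i)))"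
    proof (intro prod.cong refl)
      fix i
      have e: "cis (t i) = complex_of_real (cos (t i)) + \<i> * complex_of_real (sin (t i))" "cis (- t i) = complex_of_real (cos (t i)) - \<i> * complex_of_real (sin (t i))"
        by (auto simp: complex_eq_iff)
      show "((if i \<in> B then 1 + \<omega> else 1 - \<omega>) * cis (t i)
            + (if i \<in> B then 1 - \<omega> else 1 + \<omega>) * cis (- t i)) / 2
          = (if i \<in> B then complex_of_real (cos (t i)) + \<omega> * \<i> * complex_of_real (sin (t i)) else complex_of_real (cos (t i)) - \<omega> * \<i> * complex_of_real (sin (t i)))"
        unfolding e by (auto simp: field_simps)
    qed
    finally show ?thesis .
  qed
  have op: "cube_mean I (\<lambda>B. cube_op \<omega> I (\<lambda>A. cis (\<Sum>i\<in>I. t i * cube_sign A i)) B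
        * cis (\<Sum>i\<in>I. u i * cube_sign B i))
      = (\<Prod>i\<in>I. Complex (cos (t i) * cos (u i)) (- s * (sin (t i) * sin (u i))))" for t u
  proof -
    have "cube_mean I (\<lambda>B. cube_op \<omega> I (\<lambda>A. cis (\<Sum>i\<in>I. t i * cube_sign A i)) B
        * cis (\<Sum>i\<in>I. u i * cube_sign B i))
      = cube_mean I (\<lambda>B. \<Prod>i\<in>I. if i \<in> B then (complex_of_real (cos (t i)) + \<omega> * \<i> * complex_of_real (sin (t i))) * cis (u i)
           else (complex_of_real (cos (t i)) - \<omega> * \<i> * complex_of_real (sin (t i))) * cis (- u i))"
      unfolding op1 unfolding sgn
      by (intro cube_mean_cong, subst prod.distrib[symmetric]) (auto intro!: prod.cong)
    also have "\<dots> = (\<Prod>i\<in>I. ((complex_of_real (cos (t i)) + \<omega> * \<i> * complex_of_real (sin (t i))) * cis (u i)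
           + (complex_of_real (cos (t i)) - \<omega> * \<i> * complex_of_real (sin (t i))) * cis (- u i)) / 2)"
      by (rule cube_mean_prod[OF I])
    also have "\<dots> = (\<Prod>i\<in>I. Complex (cos (t i) * cos (u i)) (- s * (sin (t i) * sin (u i))))"
      by (intro prod.cong refl) (auto simp: complex_eq_iff \<omega>_def s_def algebra_simps)
    finally show ?thesis .
  qed
  have "cube_op \<omega> I f B = (\<Sum>j\<in>J. c j * cube_op \<omega> I (\<lambda>A. cis (\<Sum>i\<in>I. \<theta> j i * cube_sign A i)) B)" for B
    unfolding cube_op_def f_def
    by (simp add: sum_distrib_left cube_mean_sum mult.left_commute flip: cube_mean_mult_left)
  then have "cube_mean I (\<lambda>B. cube_op \<omega> I f B * g B) = (\<Sum>j\<in>J. \<Sum>k\<in>K. c j * d k *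
      cube_mean I (\<lambda>B. cube_op \<omega> I (\<lambda>A. cis (\<Sum>i\<in>I. \<theta> j i * cube_sign A i)) B
        * cis (\<Sum>i\<in>I. \<eta> k i * cube_sign B i)))"
    unfolding g_def cube_mean_mult_left[symmetric] cube_mean_sum[symmetric]
    by (intro cube_mean_cong) (simp add: sum_product mult_ac, rule sum.swap)
  then have "cmod (\<Sum>j\<in>J. \<Sum>k\<in>K. c j * d k *
      (\<Prod>i\<in>I. Complex (cos (\<theta> j i) * cos (\<eta> k i)) (- s * (sin (\<theta> j i) * sin (\<eta> k i)))))
    = cmod (cube_mean I (\<lambda>B. cube_op \<omega> I f B * g B))" by (simp add: op)
  also have "\<dots> \<le> cube_mean I (\<lambda>B. cmod (cube_op \<omega> I f B) * cmod (g B))"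
    unfolding cube_mean_def by (auto simp: norm_mult[symmetric] intro!: divide_right_mono norm_sum)
  also have "\<dots> \<le> cube_mean I (\<lambda>B. cmod (cube_op \<omega> I f B) powr q) powr (1/q)
      * cube_mean I (\<lambda>B. cmod (g B) powr p) powr (1/p)"
    by (rule cube_mean_holder[OF I p(1) pq]) auto
  also have "\<dots> \<le> cube_mean I (\<lambda>A. cmod (f A) powr p) powr (1/p)
      * cube_mean I (\<lambda>B. cmod (g B) powr p) powr (1/p)"
    unfolding \<omega>_def by (intro mult_right_mono cube_hypercontractivity p pq I) auto
  finally show ?thesis .
qed

section \<open>Fourier integrals of Gaussians\<close>

lemma norm_square_Basis: "(norm x)\<^sup>2 = (\<Sum>e\<in>Basis. (x \<bullet> e)\<^sup>2)" for x :: "'a::euclidean_space"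
  by (subst norm_eq_sqrt_inner, subst euclidean_inner) (simp add: power2_eq_square sum_nonneg)

lemma cis_inner_measurable [measurable]:
  "(\<lambda>x::'a::euclidean_space. cis (b \<bullet> x)) \<in> borel_measurable borel"
  by (intro borel_measurable_continuous_onI continuous_intros)

lemma sum_le_sums:
  fixes f :: "nat \<Rightarrow> real"
  assumes "f sums s" "\<And>k. 0 \<le> f k"
  shows "(\<Sum>k<n. f k) \<le> s"
  using sum_le_suminf[of f "{..<n}"] assms by (auto simp: sums_iff)

lemma gaussian_fourier_1d:
  fixes a b :: real
  assumes a: "0 < a"
  shows "integrable lborel (\<lambda>x::real. exp (- a * x\<^sup>2) *\<^sub>R cis (b * x))"
    and "(\<integral>x. exp (- a * x\<^sup>2) *\<^sub>R cis (b * x) \<partial>lborel) = complex_of_real (sqrt (pi / a) * exp (- b\<^sup>2 / (4 * a)))"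
proof -
  let ?f = "\<lambda>x::real. exp (- a * x\<^sup>2) *\<^sub>R cis (b * x)"
  \<comment> \<open>rescaling to the standard normal density\<close>
  define c where "c = 1 / sqrt (2 * a)"
  have c0: "c > 0" "c\<^sup>2 = 1 / (2 * a)" using a by (auto simp: c_def power_divide)
  have resc: "?f (0 + c * x) = sqrt (2*pi) *\<^sub>R (std_normal_density x *\<^sub>R iexp (b * c * x))" for x
  proof -
    have "- a * (c * x)\<^sup>2 = - x\<^sup>2 / 2" using a by (simp add: power_mult_distrib c0)
    then show ?thesis by (simp add: std_normal_density_def cis_conv_exp mult_ac)
  qed
  have int: "integrable lborel (\<lambda>x. std_normal_density x *\<^sub>R iexp (t * x))" for t :: real
    by (rule Bochner_Integration.integrable_bound[OF integrable_std_normal_moment[of 0]]) auto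
  have "integrable lborel (\<lambda>x. ?f (0 + c * x))"
    unfolding resc by (intro integrable_scaleR_right int)
  then show "integrable lborel ?f"
    using lborel_integrable_real_affine_iff[of c ?f 0] c0 by simp
  have ch: "(\<integral>x. std_normal_density x *\<^sub>R iexp (t * x) \<partial>lborel) = complex_of_real (exp (- t\<^sup>2 / 2))" for t
  proof -
    have "char std_normal_distribution t = (\<integral>x. std_normal_density x *\<^sub>R iexp (t * x) \<partial>lborel)"
      unfolding char_def by (subst integral_density) auto
    then show ?thesis by (simp add: char_std_normal_distribution)
  qed
  have "(\<integral>x. ?f x \<partial>lborel) = \<bar>c\<bar> *\<^sub>R (\<integral>x. ?f (0 + c * x) \<partial>lborel)"
    by (rule lborel_integral_real_affine) (use c0 in auto)
  also have "\<dots> = (c * sqrt (2*pi)) *\<^sub>R complex_of_real (exp (- (b * c)\<^sup>2 / 2))"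
    unfolding resc integral_scaleR_right ch using c0 by simp
  also have "- (b * c)\<^sup>2 / 2 = - b\<^sup>2 / (4 * a)" by (simp add: power_mult_distrib c0)
  also have "c * sqrt (2*pi) = sqrt (pi / a)" using a by (simp add: c_def real_sqrt_mult real_sqrt_divide)
  finally show "(\<integral>x. ?f x \<partial>lborel) = complex_of_real (sqrt (pi / a) * exp (- b\<^sup>2 / (4 * a)))"
    by (simp add: scaleR_conv_of_real)
qed

lemma gaussian_fourier_real:
  fixes a :: real and b :: "'a::euclidean_space"
  assumes a: "0 < a"
  shows "integrable lborel (\<lambda>x::'a. exp (- a * (norm x)\<^sup>2) *\<^sub>R cis (b \<bullet> x))"
    and "(\<integral>x. exp (- a * (norm x)\<^sup>2) *\<^sub>R cis (b \<bullet> x) \<partial>lborel)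
      = complex_of_real (sqrt (pi / a) ^ DIM('a) * exp (- (norm b)\<^sup>2 / (4 * a)))"
proof -
  let ?f = "\<lambda>x::'a. exp (- a * (norm x)\<^sup>2) *\<^sub>R cis (b \<bullet> x)"
  let ?g = "\<lambda>(e::'a) (t::real). exp (- a * t\<^sup>2) *\<^sub>R cis ((b \<bullet> e) * t)"
  have f: "?f (\<Sum>e\<in>Basis. y e *\<^sub>R e) = (\<Prod>e\<in>Basis. ?g e (y e))" for y :: "'a \<Rightarrow> real"
  proof -
    let ?x = "\<Sum>e\<in>Basis. y e *\<^sub>R e :: 'a"
    have i: "?x \<bullet> e = y e" if "e \<in> Basis" for e
      using that by simp
    have "(norm ?x)\<^sup>2 = (\<Sum>e\<in>Basis. (y e)\<^sup>2)"
      by (subst norm_eq_sqrt_inner, subst euclidean_inner) (simp add: power2_eq_square i sum_nonneg)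
    moreover have "b \<bullet> ?x = (\<Sum>e\<in>Basis. (b \<bullet> e) * y e)"
      by (simp add: inner_sum_right mult.commute)
    ultimately have "?f ?x = complex_of_real (\<Prod>e\<in>Basis. exp (- a * (y e)\<^sup>2)) * (\<Prod>e\<in>Basis. cis ((b \<bullet> e) * y e))"
      by (simp add: cis_sum exp_sum[symmetric] sum_distrib_left sum_negf scaleR_conv_of_real)
    then show ?thesis by (simp add: prod.distrib scaleR_conv_of_real)
  qed
  interpret product_sigma_finite "\<lambda>_::'a. lborel :: real measure" ..
  have prodint: "integrable (\<Pi>\<^sub>M e\<in>Basis. lborel) (\<lambda>y::'a\<Rightarrow>real. \<Prod>e\<in>Basis. ?g e (y e))"
    by (intro product_integrable_prod gaussian_fourier_1d(1) a) auto
  show "integrable lborel ?f"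
    by (subst lborel_eq, subst integrable_distr_eq) (use prodint in \<open>auto simp only: f\<close>, measurable)
  have "(\<integral>x. ?f x \<partial>lborel) = (\<integral>y. ?f (\<Sum>e\<in>Basis. y e *\<^sub>R e) \<partial>(\<Pi>\<^sub>M e\<in>Basis. lborel))"
    by (subst lborel_eq, subst integral_distr) (auto, measurable)
  also have "\<dots> = (\<Prod>e\<in>Basis. \<integral>t. ?g e t \<partial>lborel)"
    unfolding f by (intro product_integral_prod gaussian_fourier_1d(1) a) auto
  also have "\<dots> = complex_of_real (\<Prod>e\<in>(Basis::'a set). sqrt (pi / a) * exp (- (b \<bullet> e)\<^sup>2 / (4 * a)))"
    unfolding gaussian_fourier_1d(2)[OF a] by simp
  also have "(\<Prod>e\<in>(Basis::'a set). sqrt (pi / a) * exp (- (b \<bullet> e)\<^sup>2 / (4 * a)))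
     = sqrt (pi / a) ^ DIM('a) * exp (- (norm b)\<^sup>2 / (4 * a))"
  proof -
    show ?thesis
      unfolding norm_square_Basis by (simp add: prod.distrib exp_sum[symmetric] sum_negf sum_divide_distrib)
  qed
  finally show "(\<integral>x. ?f x \<partial>lborel)
      = complex_of_real (sqrt (pi / a) ^ DIM('a) * exp (- (norm b)\<^sup>2 / (4 * a)))" .
qed

lemma gaussian_integrable:
  fixes a :: real assumes "0 < a"
  shows "integrable lborel (\<lambda>x::'a::euclidean_space. exp (- a * (norm x)\<^sup>2))"
  using integrable_norm[OF gaussian_fourier_real(1)[OF assms, of 0]] by simp

text \<open>Both sides are holomorphic in the width \<open>z\<close> and agree for real
  \<open>z\<close>. Holomorphy of the integral near \<open>z\<close> comes from expanding
  \<open>exp (-z|x|\<^sup>2)\<close> in powers of \<open>z - r\<close> about a large real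
  \<open>r\<close> and integrating termwise: for \<open>|z - r| < r\<close> the absolute values
  of the terms sum to an integrable Gaussian.\<close>

lemma gaussian_fourier:
  fixes z :: complex and b :: "'a::euclidean_space"
  assumes z: "0 < Re z"
  shows "integrable lborel (\<lambda>x::'a. exp (- z * of_real ((norm x)\<^sup>2)) * cis (b \<bullet> x))"
    and "(\<integral>x. exp (- z * of_real ((norm x)\<^sup>2)) * cis (b \<bullet> x) \<partial>lborel)
      = csqrt (pi / z) ^ DIM('a) * exp (- of_real ((norm b)\<^sup>2) / (4 * z))"
proof -
  define h where "h = (\<lambda>w (x::'a). exp (- w * of_real ((norm x)\<^sup>2)) * cis (b \<bullet> x))"
  define F where "F = (\<lambda>w. \<integral>x. h w x \<partial>lborel)"
  define H where "H = (\<lambda>w::complex. csqrt (pi / w) ^ DIM('a) * exp (- of_real ((norm b)\<^sup>2) / (4 * w)))"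
  have hm: "h w \<in> borel_measurable lborel" for w
    unfolding h_def cis_conv_exp by measurable
  have int: "integrable lborel (h w)" if "0 < Re w" for w
    by (rule Bochner_Integration.integrable_bound[OF gaussian_integrable[OF that] hm])
       (auto simp: h_def norm_mult)
  then show "integrable lborel (\<lambda>x::'a. exp (- z * of_real ((norm x)\<^sup>2)) * cis (b \<bullet> x))"
    using z unfolding h_def by blast
  \<comment> \<open>the disc of centre and radius \<open>R\<close> lies in the right half plane,
    and this \<open>R\<close> is large enough for it to contain \<open>z\<close>\<close>
  define R where "R = (cmod z)\<^sup>2 / Re z"
  have z0: "z \<noteq> 0" using z by auto
  then have R0: "R > 0" using z by (simp add: R_def)
  have zR: "z \<in> ball (of_real R) R"
  proof -
    have "(cmod (of_real R - z))\<^sup>2 = R\<^sup>2 - 2 * R * Re z + (cmod z)\<^sup>2"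
      unfolding cmod_power2 by (simp add: power2_eq_square algebra_simps)
    moreover have RR: "R * Re z = (cmod z)\<^sup>2" using z by (simp add: R_def)
    moreover have "R\<^sup>2 - 2 * R * Re z + (cmod z)\<^sup>2 < R\<^sup>2"
      using z0 RR by (simp only: mult.assoc) simp
    ultimately have "(cmod (of_real R - z))\<^sup>2 < R\<^sup>2" by simp
    then have "cmod (of_real R - z) < R"
      by (rule power2_less_imp_less) (use R0 in simp)
    then show ?thesis by (simp add: dist_norm)
  qed
  have Repos: "0 < Re w" if "w \<in> ball (complex_of_real R) R" for w
  proof -
    have "\<bar>R - Re w\<bar> < R"
      using that abs_Re_le_cmod[of "of_real R - w"] by (simp add: dist_norm)
    then show ?thesis by linarith
  qed
  define a where "a = (\<lambda>k. \<integral>x. (- of_real ((norm x)\<^sup>2)) ^ k / fact k * h (of_real R) x \<partial>lborel)"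
  have ser: "(\<lambda>k. a k * (w - of_real R) ^ k) sums F w" if w: "w \<in> ball (complex_of_real R) R" for w
  proof -
    define \<rho> where "\<rho> = cmod (w - of_real R)"
    have \<rho>: "0 \<le> \<rho>" "\<rho> < R" using w by (auto simp: \<rho>_def dist_norm norm_minus_commute)
    define f where "f = (\<lambda>k x. ((- of_real ((norm x)\<^sup>2)) ^ k / fact k * h (of_real R) x) * (w - of_real R) ^ k)"
    define G where "G = (\<lambda>x::'a. exp (- (R - \<rho>) * (norm x)\<^sup>2))"
    have Gint: "integrable lborel G" unfolding G_def using \<rho> by (intro gaussian_integrable) auto
    have nf: "norm (f k x) = (\<rho> * (norm x)\<^sup>2) ^ k / fact k * exp (- R * (norm x)\<^sup>2)" for k x
      by (simp add: f_def h_def norm_mult norm_divide norm_power \<rho>_def power_mult_distrib)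
    have es: "(\<lambda>k. norm (f k x)) sums G x" for x
    proof -
      have "(\<lambda>k. (\<rho> * (norm x)\<^sup>2) ^ k / fact k * exp (- R * (norm x)\<^sup>2)) sums
          (exp (\<rho> * (norm x)\<^sup>2) * exp (- R * (norm x)\<^sup>2))"
        using exp_converges[of "\<rho> * (norm x)\<^sup>2"]
        by (intro sums_mult2) (simp add: divide_inverse mult.commute)
      then show ?thesis unfolding nf by (simp add: G_def exp_add[symmetric] algebra_simps)
    qed
    have fs: "(\<lambda>k. f k x) sums h w x" for x
    proof -
      have "(\<lambda>k. (- of_real ((norm x)\<^sup>2) * (w - of_real R)) ^ k /\<^sub>R fact k * h (of_real R) x) sums
          (exp (- of_real ((norm x)\<^sup>2) * (w - of_real R)) * h (of_real R) x)"
        by (intro sums_mult2 exp_converges)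
      moreover have "exp (- of_real ((norm x)\<^sup>2) * (w - of_real R)) * h (of_real R) x = h w x"
        unfolding h_def mult.assoc[symmetric] exp_add[symmetric] by (simp add: algebra_simps)
      moreover have "(- of_real ((norm x)\<^sup>2) * (w - of_real R)) ^ k /\<^sub>R fact k * h (of_real R) x = f k x" for k
        unfolding f_def power_mult_distrib by (simp add: scaleR_conv_of_real divide_inverse mult_ac)
      ultimately show ?thesis by simp
    qed
    have fm: "f k \<in> borel_measurable lborel" for k
      unfolding f_def using hm by measurable
    have fle: "norm (f k x) \<le> G x" for k x
      using sums_le[OF _ sums_single[of k "\<lambda>k. norm (f k x)"] es[of x]] by auto
    have fint: "integrable lborel (f k)" for k
      by (rule Bochner_Integration.integrable_bound[OF Gint fm])
         (use fle in \<open>auto simp: G_def\<close>)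
    have sm: "summable (\<lambda>k. \<integral>x. norm (f k x) \<partial>lborel)"
    proof (rule summableI_nonneg_bounded)
      fix n
      have "(\<Sum>k<n. \<integral>x. norm (f k x) \<partial>lborel) = (\<integral>x. (\<Sum>k<n. norm (f k x)) \<partial>lborel)"
        using fint by (subst Bochner_Integration.integral_sum) auto
      also have "\<dots> \<le> (\<integral>x. G x \<partial>lborel)"
        using fint Gint es
        by (intro integral_mono Bochner_Integration.integrable_sum integrable_norm)
           (auto intro!: sum_le_sums)
      finally show "(\<Sum>k<n. \<integral>x. norm (f k x) \<partial>lborel) \<le> (\<integral>x. G x \<partial>lborel)" .
    qed simp
    have "(\<lambda>k. \<integral>x. f k x \<partial>lborel) sums (\<integral>x. (\<Sum>k. f k x) \<partial>lborel)"
      using es by (intro sums_integral fint sm) (auto simp: sums_iff)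
    also have "(\<lambda>x. \<Sum>k. f k x) = h w" using fs by (auto simp: sums_iff)
    finally show ?thesis unfolding f_def a_def F_def by simp
  qed
  have holF: "F holomorphic_on ball (of_real R) R"
    by (rule power_series_holomorphic[OF ser])
  have holH: "H holomorphic_on ball (of_real R) R"
  proof -
    have "complex_of_real pi / w \<notin> \<real>\<^sub>\<le>\<^sub>0" if "w \<in> ball (complex_of_real R) R" for w
    proof -
      have "0 < Re (complex_of_real pi / w)" using Repos[OF that]
        by (auto simp: Re_divide complex_neq_0 intro!: divide_pos_pos add_pos_nonneg)
      then show ?thesis by (auto elim!: nonpos_Reals_cases)
    qed
    moreover have "w \<noteq> 0" if "w \<in> ball (complex_of_real R) R" for w
      using Repos[OF that] by auto
    ultimately show ?thesis unfolding H_def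
      by (intro holomorphic_intros) auto
  qed
  have eqreal: "F w - H w = 0" if "w \<in> of_real ` {0<..}" for w
  proof -
    from that obtain t where t: "t > 0" "w = of_real t" by auto
    have "h w = (\<lambda>x. exp (- t * (norm x)\<^sup>2) *\<^sub>R cis (b \<bullet> x))"
      by (auto simp: h_def t scaleR_conv_of_real fun_eq_iff exp_of_real[symmetric])
    then have "F w = complex_of_real (sqrt (pi / t) ^ DIM('a) * exp (- (norm b)\<^sup>2 / (4 * t)))"
      unfolding F_def using gaussian_fourier_real(2)[OF t(1), of b] by simp
    also have "\<dots> = H w"
      using t by (simp add: H_def exp_of_real[symmetric] flip: of_real_divide of_real_sqrt) simp
    finally show ?thesis by simp
  qed
  have "F z - H z = 0"
  proof (rule analytic_continuation[of "\<lambda>w. F w - H w" "ball (of_real R) R" "of_real ` {0<..} \<inter> ball (of_real R) R" "of_real R" z])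
    show "complex_of_real R islimpt of_real ` {0<..} \<inter> ball (complex_of_real R) R"
      unfolding islimpt_approachable
    proof (intro allI impI)
      fix e :: real assume e: "e > 0"
      define d where "d = min e R / 2"
      have d: "0 < d" "d < e" "d < R" using e R0 by (auto simp: d_def)
      show "\<exists>x'\<in>of_real ` {0<..} \<inter> ball (complex_of_real R) R. x' \<noteq> of_real R \<and> dist x' (of_real R) < e"
        using d R0 by (intro bexI[of _ "of_real (R + d)"]) (auto simp: dist_norm intro!: image_eqI[of _ complex_of_real "R + d"] simp flip: of_real_diff)
    qed
  qed (use holF holH eqreal R0 zR in \<open>auto intro!: holomorphic_intros\<close>)
  then show "(\<integral>x. exp (- z * of_real ((norm x)\<^sup>2)) * cis (b \<bullet> x) \<partial>lborel)
      = csqrt (pi / z) ^ DIM('a) * exp (- of_real ((norm b)\<^sup>2) / (4 * z))"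
    by (simp add: F_def H_def h_def)
qed

section \<open>From the cube to Gaussian measure\<close>

inductive trig_poly :: "('a::euclidean_space \<Rightarrow> complex) \<Rightarrow> bool" where
  trig_poly_cis: "trig_poly (\<lambda>x. c * cis (\<theta> \<bullet> x))"
| trig_poly_add: "trig_poly f \<Longrightarrow> trig_poly g \<Longrightarrow> trig_poly (\<lambda>x. f x + g x)"

lemma trig_poly_const: "trig_poly (\<lambda>x. c)"
  using trig_poly_cis[of c 0] by simp

lemma trig_poly_mult:
  assumes "trig_poly f" "trig_poly g" shows "trig_poly (\<lambda>x. f x * g x)"
  using assms
proof (induction arbitrary: g)
  case (trig_poly_cis c \<theta>)
  from trig_poly_cis show ?case
  proof (induction)
    case (trig_poly_cis c' \<theta>')
    have "(\<lambda>x. c * cis (\<theta> \<bullet> x) * (c' * cis (\<theta>' \<bullet> x))) = (\<lambda>x. (c * c') * cis ((\<theta> + \<theta>') \<bullet> x))"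
      by (auto simp: fun_eq_iff inner_add_left cis_mult[symmetric])
    then show ?case by (simp only: trig_poly.trig_poly_cis)
  qed (simp add: distrib_left trig_poly.trig_poly_add)
qed (simp add: distrib_right trig_poly.trig_poly_add)

lemma trig_poly_cnj: "trig_poly f \<Longrightarrow> trig_poly (\<lambda>x. cnj (f x))"
proof (induction rule: trig_poly.induct)
  case (trig_poly_cis c \<theta>)
  have "(\<lambda>x. cnj (c * cis (\<theta> \<bullet> x))) = (\<lambda>x. cnj c * cis ((- \<theta>) \<bullet> x))"
    by (auto simp: fun_eq_iff cis_cnj)
  then show ?case by (simp only: trig_poly.trig_poly_cis)
qed (simp add: trig_poly.trig_poly_add)

lemma trig_poly_sum: "finite J \<Longrightarrow> (\<And>j. j \<in> J \<Longrightarrow> trig_poly (f j)) \<Longrightarrow> trig_poly (\<lambda>x. \<Sum>j\<in>J. f j x)"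
  by (induction J rule: finite_induct) (auto intro: trig_poly_const trig_poly_add)

lemma trig_poly_power: "trig_poly f \<Longrightarrow> trig_poly (\<lambda>x. f x ^ k)"
  by (induction k) (auto intro: trig_poly_const trig_poly_mult)

lemma trig_poly_bounded:
  assumes "trig_poly f" obtains M where "\<And>x. cmod (f x) \<le> M" "0 \<le> M"
proof -
  have "\<exists>M\<ge>0. \<forall>x. cmod (f x) \<le> M" using assms
  proof (induction rule: trig_poly.induct)
    case (trig_poly_cis c \<theta>) then show ?case by (intro exI[of _ "cmod c"]) (auto simp: norm_mult)
  next
    case (trig_poly_add f g)
    then obtain M N where "0 \<le> M" "0 \<le> N" "\<And>x. cmod (f x) \<le> M" "\<And>x. cmod (g x) \<le> N" by blast
    then show ?case by (intro exI[of _ "M + N"]) (auto intro: norm_triangle_le add_mono)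
  qed
  then show ?thesis using that by blast
qed

lemma trig_poly_continuous: "trig_poly f \<Longrightarrow> continuous_on UNIV f"
  by (induction rule: trig_poly.induct) (auto intro!: continuous_intros)

lemma trig_poly_measurable: "trig_poly f \<Longrightarrow> f \<in> borel_measurable borel"
  by (intro borel_measurable_continuous_onI trig_poly_continuous)

lemma trig_poly_repr:
  assumes "trig_poly f"
  obtains n c \<theta> where "f = (\<lambda>x. \<Sum>j<(n::nat). c j * cis (\<theta> j \<bullet> x))"
proof -
  have "\<exists>n c \<theta>. f = (\<lambda>x. \<Sum>j<(n::nat). c j * cis (\<theta> j \<bullet> x))" using assms
  proof (induction rule: trig_poly.induct)
    case (trig_poly_cis c \<theta>)
    show ?case by (rule exI[of _ 1], rule exI[of _ "\<lambda>_. c"], rule exI[of _ "\<lambda>_. \<theta>"]) simp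
  next
    case (trig_poly_add f g)
    then obtain n c \<theta> m d \<eta> where f: "f = (\<lambda>x. \<Sum>j<(n::nat). c j * cis (\<theta> j \<bullet> x))"
      and g: "g = (\<lambda>x. \<Sum>j<(m::nat). d j * cis (\<eta> j \<bullet> x))" by blast
    show ?case
    proof (rule exI[of _ "n + m"], rule exI[of _ "\<lambda>j. if j < n then c j else d (j - n)"],
        rule exI[of _ "\<lambda>j. if j < n then \<theta> j else \<eta> (j - n)"], rule ext)
      fix x
      have "(\<Sum>j<n + m. (if j < n then c j else d (j - n)) * cis ((if j < n then \<theta> j else \<eta> (j - n)) \<bullet> x))
        = (\<Sum>j<n. c j * cis (\<theta> j \<bullet> x)) + (\<Sum>j=n..<n+m. d (j-n) * cis (\<eta> (j-n) \<bullet> x))"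
        by (subst lessThan_atLeast0, subst sum.atLeastLessThan_concat[of 0 n "n+m", symmetric])
           (auto simp: lessThan_atLeast0)
      also have "(\<Sum>j=n..<n+m. d (j-n) * cis (\<eta> (j-n) \<bullet> x)) = (\<Sum>j<m. d j * cis (\<eta> j \<bullet> x))"
        by (subst sum.atLeastLessThan_shift_0) (simp add: lessThan_atLeast0)
      finally show "f x + g x = (\<Sum>j<n + m. (if j < n then c j else d (j - n)) * cis ((if j < n then \<theta> j else \<eta> (j - n)) \<bullet> x))"
        by (simp add: f g)
    qed
  qed
  then show ?thesis using that by blast
qed

definition gauss_mean :: "('a::euclidean_space \<Rightarrow> 'b::{banach, second_countable_topology}) \<Rightarrow> 'b" where
  "gauss_mean f = (1 / sqrt (2 * pi) ^ DIM('a)) *\<^sub>R (\<integral>x. exp (- (norm x)\<^sup>2 / 2) *\<^sub>R f x \<partial>lborel)"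

text \<open>The normalized sum of \<open>n\<close> independent sign vectors, where the sign of
  coordinate \<open>e\<close> in step \<open>i\<close> is indexed by the pair \<open>(e,
  i)\<close>.\<close>

definition random_walk :: "nat \<Rightarrow> ('a \<times> nat) set \<Rightarrow> 'a::euclidean_space" where
  "random_walk n A = (\<Sum>e\<in>Basis. (\<Sum>i<n. cube_sign A (e, i) / sqrt n) *\<^sub>R e)"

definition walk_mean :: "nat \<Rightarrow> ('a::euclidean_space \<Rightarrow> 'b::real_vector) \<Rightarrow> 'b" where
  "walk_mean n f = cube_mean (Basis \<times> {..<n}) (\<lambda>A. f (random_walk n A))"

lemma inner_random_walk:
  "\<theta> \<bullet> random_walk n A = (\<Sum>i\<in>Basis \<times> {..<n}. (\<theta> \<bullet> fst i / sqrt n) * cube_sign A i)"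
  by (simp add: random_walk_def inner_sum_right sum_distrib_left sum.cartesian_product' mult_ac
      sum_distrib_right split_def)

lemma gauss_mean_cis: "gauss_mean (\<lambda>x::'a::euclidean_space. cis (\<theta> \<bullet> x)) = exp (- (norm \<theta>)\<^sup>2 / 2)"
  using gaussian_fourier_real(2)[of "1/2" \<theta>]
  by (simp add: gauss_mean_def mult.commute scaleR_conv_of_real)

lemma prod_Basis_times:
  fixes f :: "'a::euclidean_space \<Rightarrow> 'b::comm_monoid_mult"
  shows "(\<Prod>i\<in>Basis \<times> {..<n::nat}. f (fst i)) = (\<Prod>e\<in>Basis. f e ^ n)"
  by (simp add: prod.cartesian_product' split_def)

lemma walk_mean_cis:
  fixes \<theta> :: "'a::euclidean_space"
  shows "walk_mean n (\<lambda>x. cis (\<theta> \<bullet> x)) = of_real (\<Prod>e\<in>Basis. cos (\<theta> \<bullet> e / sqrt n) ^ n)"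
proof -
  let ?I = "(Basis :: 'a set) \<times> {..<n}"
  let ?t = "\<lambda>i::'a \<times> nat. \<theta> \<bullet> fst i / sqrt n"
  have "walk_mean n (\<lambda>x. cis (\<theta> \<bullet> x)) = cube_mean ?I (\<lambda>A. \<Prod>i\<in>?I. if i \<in> A then cis (?t i) else cis (- ?t i))"
    unfolding walk_mean_def inner_random_walk
    by (subst cis_sum) (auto simp: cube_sign_def intro!: cube_mean_cong prod.cong)
  also have "\<dots> = (\<Prod>i\<in>?I. of_real (cos (\<theta> \<bullet> fst i / sqrt n)))"
    by (subst cube_mean_prod, simp, intro prod.cong refl) (simp add: complex_eq_iff)
  also have "\<dots> = (\<Prod>e\<in>Basis. of_real (cos (\<theta> \<bullet> e / sqrt n)) ^ n)"
    by (rule prod_Basis_times)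
  finally show ?thesis by simp
qed

text \<open>In the closed unit disc the \<open>n\<close>-th powers of two numbers differ by at
  most \<open>n\<close> times their distance, so \<open>z\<^sub>n\<close> may be replaced by
  \<open>e\<^bsup>w/n\<^esup>\<close>.\<close>

lemma power_tendsto_exp:
  fixes z :: "nat \<Rightarrow> complex"
  assumes z: "\<And>n. cmod (z n) \<le> 1" and w: "Re w \<le> 0" and lim: "(\<lambda>n. of_nat n * (z n - 1)) \<longlonglongrightarrow> w"
  shows "(\<lambda>n. z n ^ n) \<longlonglongrightarrow> exp w"
proof -
  have e: "((\<lambda>h. (exp (w * h) - 1) / h) \<longlongrightarrow> w) (at 0)"
  proof -
    have "((\<lambda>h. exp (w * h)) has_field_derivative w) (at 0)"
      by (auto intro!: derivative_eq_intros)
    then show ?thesis by (simp add: has_field_derivative_iff)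
  qed
  have "filterlim (\<lambda>n. 1 / of_nat n :: complex) (at 0) sequentially"
    unfolding filterlim_at by (auto intro!: lim_1_over_n eventually_sequentiallyI[of 1])
  from filterlim_compose[OF e this]
  have "(\<lambda>n. of_nat n * (exp (w / of_nat n) - 1)) \<longlonglongrightarrow> w" by (simp add: mult.commute)
  from tendsto_diff[OF lim this]
  have "(\<lambda>n. of_nat n * (z n - exp (w / of_nat n))) \<longlonglongrightarrow> 0"
    by (simp add: algebra_simps)
  then have l0: "(\<lambda>n. cmod (of_nat n * (z n - exp (w / of_nat n)))) \<longlonglongrightarrow> 0"
    using tendsto_norm_zero by blast
  have "(\<lambda>n. z n ^ n - exp w) \<longlonglongrightarrow> 0"
  proof (rule Lim_null_comparison[OF eventually_sequentiallyI[of 1] l0])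
    fix n :: nat assume n: "1 \<le> n"
    have "exp (w / of_nat n) ^ n = exp w" using n by (simp add: exp_of_nat_mult[symmetric])
    moreover have "norm (z n ^ n - exp (w / of_nat n) ^ n) \<le> real n * norm (z n - exp (w / of_nat n))"
      using w by (intro norm_power_diff z) (auto simp: Re_divide_of_nat divide_nonpos_nonneg)
    ultimately show "norm (z n ^ n - exp w) \<le> cmod (of_nat n * (z n - exp (w / of_nat n)))"
      by (simp add: norm_mult)
  qed
  then show ?thesis by (simp add: LIM_zero_iff)
qed

lemma cos_cos_limit:
  fixes t u :: real
  shows "(\<lambda>n. real n * (cos (t / sqrt n) * cos (u / sqrt n) - 1)) \<longlonglongrightarrow> - (u * u / 2) - t * t / 2"
proof -
  have one: "(\<lambda>n. real n * (cos (v / sqrt n) - 1)) \<longlonglongrightarrow> - (v * v / 2)" for v :: real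
  proof (cases "v = 0")
    case False then show ?thesis by real_asymp
  qed simp
  consider "t = 0" | "u = 0" | "t \<noteq> 0" "u \<noteq> 0" by blast
  then show ?thesis
  proof cases
    case 3 then show ?thesis by real_asymp
  qed (use one[of t] one[of u] in auto)
qed

lemma sin_sin_limit:
  fixes t u :: real
  shows "(\<lambda>n. real n * (sin (t / sqrt n) * sin (u / sqrt n))) \<longlonglongrightarrow> t * u"
  by real_asymp

text \<open>The contribution of one direction to the pairing in
  \<open>cube_bilinear_inequality\<close>, over \<open>n\<close> steps.\<close>

lemma two_point_power_limit:
  fixes t u s :: real
  assumes s: "0 \<le> s" "s \<le> 1"
  shows "(\<lambda>n. Complex (cos (t / sqrt n) * cos (u / sqrt n)) (- s * (sin (t / sqrt n) * sin (u / sqrt n))) ^ n)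
    \<longlonglongrightarrow> exp (- of_real (t\<^sup>2 + u\<^sup>2) / 2 - \<i> * of_real (s * t * u))"
proof (rule power_tendsto_exp)
  fix n :: nat
  define a b where "a = t / sqrt n" and "b = u / sqrt n"
  have "(cmod (Complex (cos a * cos b) (- s * (sin a * sin b))))\<^sup>2
    = (cos a)\<^sup>2 * (cos b)\<^sup>2 + s\<^sup>2 * ((sin a)\<^sup>2 * (sin b)\<^sup>2)"
    by (simp add: cmod_power2 power_mult_distrib)
  also have "\<dots> \<le> (cos a)\<^sup>2 * (cos b)\<^sup>2 + 1 * ((sin a)\<^sup>2 * (sin b)\<^sup>2)"
    using s by (intro add_left_mono mult_right_mono) (auto simp: power_le_one)
  also have "\<dots> \<le> (cos a)\<^sup>2 * 1 + (sin a)\<^sup>2 * 1"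
    unfolding mult_1 by (intro add_mono mult_left_mono) (auto simp: abs_square_le_1)
  also have "\<dots> = 1\<^sup>2" by simp
  finally show "cmod (Complex (cos (t / sqrt n) * cos (u / sqrt n)) (- s * (sin (t / sqrt n) * sin (u / sqrt n)))) \<le> 1"
    unfolding a_def b_def by (rule power2_le_imp_le) simp
next
  have e: "of_nat n * (Complex x y - 1) = Complex (real n * (x - 1)) (real n * y)" for x y n
    by (simp add: complex_eq_iff)
  have "(\<lambda>n. - s * (real n * (sin (t / sqrt n) * sin (u / sqrt n)))) \<longlonglongrightarrow> - s * (t * u)"
    by (intro tendsto_mult_left sin_sin_limit)
  then have "(\<lambda>n. Complex (real n * (cos (t / sqrt n) * cos (u / sqrt n) - 1))
       (real n * (- s * (sin (t / sqrt n) * sin (u / sqrt n)))))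
     \<longlonglongrightarrow> Complex (- (u * u / 2) - t * t / 2) (- s * (t * u))"
    by (intro tendsto_Complex cos_cos_limit) (simp add: mult_ac)
  moreover have "Complex (- (u * u / 2) - t * t / 2) (- s * (t * u)) = - of_real (t\<^sup>2 + u\<^sup>2) / 2 - \<i> * of_real (s * t * u)"
    by (simp add: complex_eq_iff power2_eq_square field_simps)
  ultimately show "(\<lambda>n. of_nat n * (Complex (cos (t / sqrt n) * cos (u / sqrt n)) (- s * (sin (t / sqrt n) * sin (u / sqrt n))) - 1))
    \<longlonglongrightarrow> - of_real (t\<^sup>2 + u\<^sup>2) / 2 - \<i> * of_real (s * t * u)"
    unfolding e by simp
qed simp

lemma gauss_weight_integrable: "integrable lborel (\<lambda>x::'a::euclidean_space. exp (- (norm x)\<^sup>2 / 2))"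
  using gaussian_integrable[of "1/2"] by simp

lemma gauss_bounded_integrable:
  fixes f :: "'a::euclidean_space \<Rightarrow> 'b::{banach, second_countable_topology}"
  assumes "f \<in> borel_measurable borel" "\<And>x. norm (f x) \<le> M"
  shows "integrable lborel (\<lambda>x. exp (- (norm x)\<^sup>2 / 2) *\<^sub>R f x)"
proof (rule Bochner_Integration.integrable_bound[OF integrable_mult_left[OF gauss_weight_integrable, of M]])
  show "AE x in lborel. norm (exp (- (norm x)\<^sup>2 / 2) *\<^sub>R f x) \<le> norm (exp (- (norm x)\<^sup>2 / 2) * M)"
    using order_trans[OF assms(2) abs_ge_self] by (auto simp: abs_mult intro!: mult_left_mono)
qed (use assms in measurable)

lemma gauss_mean_mult: "gauss_mean (\<lambda>x. c * f x) = c * gauss_mean f" for c :: complex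
  by (simp add: gauss_mean_def mult_scaleR_right[symmetric] del: mult_scaleR_right)

lemma walk_mean_trig_limit:
  fixes f :: "'a::euclidean_space \<Rightarrow> complex"
  assumes "trig_poly f" shows "(\<lambda>n. walk_mean n f) \<longlonglongrightarrow> gauss_mean f"
  using assms
proof (induction rule: trig_poly.induct)
  case (trig_poly_cis c \<theta>)
  have l: "(\<lambda>n. cos (t / sqrt n) ^ n) \<longlonglongrightarrow> exp (- t\<^sup>2 / 2)" for t :: real
  proof -
    \<comment> \<open>the case \<open>s = u = 0\<close> of \<open>two_point_power_limit\<close>\<close>
    have "(\<lambda>n. Re (Complex (cos (t / sqrt n) * cos (0 / sqrt n)) (- 0 * (sin (t / sqrt n) * sin (0 / sqrt n))) ^ n))
        \<longlonglongrightarrow> Re (exp (- of_real (t\<^sup>2 + 0\<^sup>2) / 2 - \<i> * of_real (0 * t * 0)))"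
      by (intro tendsto_Re two_point_power_limit) auto
    moreover have "Complex (x * cos (0 / sqrt n)) (- 0 * (y * sin (0 / sqrt n))) = of_real x" for x y n
      by (simp add: complex_eq_iff)
    moreover have "Re (exp (- of_real (t\<^sup>2 + 0\<^sup>2) / 2 - \<i> * of_real (0 * t * 0))) = exp (- t\<^sup>2 / 2)"
      by (simp add: Re_exp)
    ultimately show ?thesis by (simp flip: of_real_power)
  qed
  have "(\<Prod>e\<in>Basis. exp (- (\<theta> \<bullet> e)\<^sup>2 / 2)) = exp (- (norm \<theta>)\<^sup>2 / 2)"
    unfolding norm_square_Basis by (simp add: exp_sum[symmetric] sum_negf sum_divide_distrib)
  moreover have "(\<lambda>n. \<Prod>e\<in>Basis. cos (\<theta> \<bullet> e / sqrt n) ^ n) \<longlonglongrightarrow> (\<Prod>e\<in>Basis. exp (- (\<theta> \<bullet> e)\<^sup>2 / 2))"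
    by (intro tendsto_prod l)
  ultimately have "(\<lambda>n. c * walk_mean n (\<lambda>x. cis (\<theta> \<bullet> x))) \<longlonglongrightarrow> c * of_real (exp (- (norm \<theta>)\<^sup>2 / 2))"
    unfolding walk_mean_cis by (intro tendsto_intros) auto
  moreover have "gauss_mean (\<lambda>x. c * cis (\<theta> \<bullet> x)) = c * gauss_mean (\<lambda>x. cis (\<theta> \<bullet> x))"
    by (rule gauss_mean_mult)
  moreover have "walk_mean n (\<lambda>x. c * cis (\<theta> \<bullet> x)) = c * walk_mean n (\<lambda>x. cis (\<theta> \<bullet> x))" for n
    by (simp add: walk_mean_def cube_mean_mult_left)
  ultimately show ?case by (simp add: gauss_mean_cis)
next
  case (trig_poly_add f g)
  have "integrable lborel (\<lambda>x. exp (- (norm x)\<^sup>2 / 2) *\<^sub>R f x)" if "trig_poly f" for f :: "'a \<Rightarrow> complex"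
    by (rule trig_poly_bounded[OF that]) (rule gauss_bounded_integrable[OF trig_poly_measurable[OF that]])
  then have "gauss_mean (\<lambda>x. f x + g x) = gauss_mean f + gauss_mean g"
    using trig_poly_add.hyps by (simp add: gauss_mean_def scaleR_add_right)
  moreover have "walk_mean n (\<lambda>x. f x + g x) = walk_mean n f + walk_mean n g" for n
    by (simp add: walk_mean_def cube_mean_add)
  ultimately show ?case using trig_poly_add.IH by (simp add: tendsto_add)
qed

lemma gauss_weight_integral:
  "(\<integral>(x::'a::euclidean_space). exp (- (norm x)\<^sup>2 / 2) \<partial>lborel) = sqrt (2 * pi) ^ DIM('a)"
proof -
  have "complex_of_real (\<integral>(x::'a). exp (- (norm x)\<^sup>2 / 2) \<partial>lborel) = complex_of_real (sqrt (2 * pi) ^ DIM('a))"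
    using gaussian_fourier_real(2)[of "1/2" "0::'a"]
    by (simp add: scaleR_conv_of_real mult.commute)
  then show ?thesis by (simp only: of_real_eq_iff)
qed

lemma gauss_mean_dist:
  fixes f g :: "'a::euclidean_space \<Rightarrow> complex"
  assumes m: "f \<in> borel_measurable borel" "g \<in> borel_measurable borel"
    and b: "\<And>x. cmod (f x) \<le> M" "\<And>x. cmod (g x) \<le> N" and d: "\<And>x. cmod (f x - g x) \<le> e"
  shows "cmod (gauss_mean f - gauss_mean g) \<le> e"
proof -
  have "gauss_mean f - gauss_mean g = gauss_mean (\<lambda>x. f x - g x)"
    using gauss_bounded_integrable[OF m(1) b(1)] gauss_bounded_integrable[OF m(2) b(2)]
    by (simp add: gauss_mean_def scaleR_diff_right)
  also have "cmod \<dots> \<le> (1 / sqrt (2 * pi) ^ DIM('a)) * (\<integral>(x::'a). exp (- (norm x)\<^sup>2 / 2) * e \<partial>lborel)"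
    unfolding gauss_mean_def norm_scaleR
  proof (intro mult_mono)
    show "norm (\<integral>x. exp (- (norm x)\<^sup>2 / 2) *\<^sub>R (f x - g x) \<partial>lborel) \<le> (\<integral>(x::'a). exp (- (norm x)\<^sup>2 / 2) * e \<partial>lborel)"
    proof -
      have "norm (\<integral>x. exp (- (norm x)\<^sup>2 / 2) *\<^sub>R (f x - g x) \<partial>lborel)
          \<le> (\<integral>x. norm (exp (- (norm x)\<^sup>2 / 2) *\<^sub>R (f x - g x)) \<partial>lborel)"
        by (rule Bochner_Integration.integral_norm_bound)
      also have "\<dots> \<le> (\<integral>(x::'a). exp (- (norm x)\<^sup>2 / 2) * e \<partial>lborel)"
      proof (rule Bochner_Integration.integral_mono)
        show "integrable lborel (\<lambda>x. norm (exp (- (norm x)\<^sup>2 / 2) *\<^sub>R (f x - g x)))"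
          using m d by (intro integrable_norm gauss_bounded_integrable[of _ e]) auto
        show "integrable lborel (\<lambda>x::'a. exp (- (norm x)\<^sup>2 / 2) * e)"
          by (intro integrable_mult_left gauss_weight_integrable)
      qed (use d in auto)
      finally show ?thesis .
    qed
  qed auto
  also have "\<dots> = e" by (simp add: gauss_weight_integral[simplified])
  finally show ?thesis .
qed

lemma walk_mean_dist:
  fixes f g :: "'a::euclidean_space \<Rightarrow> complex"
  assumes d: "\<And>x. cmod (f x - g x) \<le> e"
  shows "cmod (walk_mean n f - walk_mean n g) \<le> e"
proof -
  let ?I = "(Basis :: 'a set) \<times> {..<n}"
  have "walk_mean n f - walk_mean n g = cube_mean ?I (\<lambda>A. f (random_walk n A) - g (random_walk n A))"
    by (simp add: walk_mean_def cube_mean_def sum_subtractf scaleR_diff_right)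
  also have "cmod \<dots> \<le> cube_mean ?I (\<lambda>A. cmod (f (random_walk n A) - g (random_walk n A)))"
    unfolding cube_mean_def by (auto intro!: divide_right_mono norm_sum)
  also have "\<dots> \<le> cube_mean ?I (\<lambda>A. e)" by (intro cube_mean_mono d)
  also have "\<dots> = e" by (simp add: cube_mean_def card_Pow)
  finally show ?thesis .
qed

text \<open>Weierstrass' theorem on \<open>[0, M\<^sup>2]\<close> approximates
  \<open>u\<^bsup>s/2\<^esup>\<close> uniformly by polynomials in \<open>u\<close>. At \<open>u
  = |f|\<^sup>2 = f \<cdot> cnj f\<close> these are again trigonometric polynomials, for which
  the limit is computed exponential by exponential. Both means change by at most the error of
  the approximation.\<close>

theorem walk_mean_powr_limit:
  fixes f :: "'a::euclidean_space \<Rightarrow> complex"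
  assumes f: "trig_poly f" and s: "0 < s"
  shows "(\<lambda>n. walk_mean n (\<lambda>x. cmod (f x) powr s)) \<longlonglongrightarrow> gauss_mean (\<lambda>x. cmod (f x) powr s)"
proof -
  obtain M where M: "\<And>x. cmod (f x) \<le> M" "0 \<le> M" using trig_poly_bounded[OF f] by blast
  define G where "G = (\<lambda>x. complex_of_real (cmod (f x) powr s))"
  have Gm: "G \<in> borel_measurable borel" unfolding G_def using trig_poly_measurable[OF f] by measurable
  have Gb: "cmod (G x) \<le> M powr s" for x using M s by (auto simp: G_def intro!: powr_mono2)
  have "(\<lambda>n. walk_mean n G) \<longlonglongrightarrow> gauss_mean G"
  proof (rule LIMSEQ_I)
    fix r :: real assume r: "0 < r"
    have "continuous_on {0..M\<^sup>2} (\<lambda>u. u powr (s/2))"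
      using s by (intro continuous_intros continuous_on_powr') auto
    then obtain h where h: "real_polynomial_function h" "\<And>u. u \<in> {0..M\<^sup>2} \<Longrightarrow> \<bar>u powr (s/2) - h u\<bar> < r/3"
      using Stone_Weierstrass_real_polynomial_function[of "{0..M\<^sup>2}" "\<lambda>u. u powr (s/2)" "r/3"] r by auto
    obtain a k where hs: "h = (\<lambda>u. \<Sum>i\<le>k. a i * u ^ i)" using h(1) unfolding real_polynomial_function_iff_sum by blast
    define H where "H = (\<lambda>x. complex_of_real (h ((cmod (f x))\<^sup>2)))"
    have H: "trig_poly H"
    proof -
      have "H = (\<lambda>x. \<Sum>i\<le>k. of_real (a i) * (f x * cnj (f x)) ^ i)"
        unfolding H_def hs complex_norm_square[symmetric] by simp
      then show ?thesis
        by (auto intro!: trig_poly_sum trig_poly_mult trig_poly_power trig_poly_cnj f trig_poly_const)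
    qed
    have GH: "cmod (G x - H x) \<le> r/3" for x
    proof -
      have "(cmod (f x))\<^sup>2 \<in> {0..M\<^sup>2}" using M by (auto intro!: power_mono)
      from h(2)[OF this] show ?thesis
        by (simp add: G_def H_def powr_square_half flip: of_real_diff)
    qed
    obtain N where N: "\<And>x. cmod (H x) \<le> N" using trig_poly_bounded[OF H] by blast
    obtain n0 where n0: "\<And>n. n \<ge> n0 \<Longrightarrow> cmod (walk_mean n H - gauss_mean H) < r/3"
      using LIMSEQ_D[OF walk_mean_trig_limit[OF H], of "r/3"] r by auto
    have "norm (walk_mean n G - gauss_mean G) < r" if "n \<ge> n0" for n
    proof -
      have "norm (walk_mean n G - gauss_mean G) \<le> norm (walk_mean n G - walk_mean n H)
          + norm (walk_mean n H - gauss_mean H) + norm (gauss_mean G - gauss_mean H)"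
        by norm
      also have "\<dots> < r/3 + r/3 + r/3"
        using walk_mean_dist[of G H, OF GH, of n] n0[OF that]
          gauss_mean_dist[OF Gm trig_poly_measurable[OF H] Gb N GH] by linarith
      finally show ?thesis by simp
    qed
    then show "\<exists>no. \<forall>n\<ge>no. norm (walk_mean n G - gauss_mean G) < r" by blast
  qed
  moreover have "walk_mean n G = of_real (walk_mean n (\<lambda>x. cmod (f x) powr s))" for n
    by (simp add: walk_mean_def cube_mean_def G_def scaleR_conv_of_real)
  moreover have "gauss_mean G = of_real (gauss_mean (\<lambda>x. cmod (f x) powr s))"
    by (simp add: gauss_mean_def G_def scaleR_conv_of_real flip: of_real_mult)
  ultimately show ?thesis by (simp add: tendsto_of_real_iff)
qed

text \<open>The limit of \<open>cube_bilinear_inequality\<close> along random walks with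
  \<open>n \<rightarrow> \<infinity>\<close> steps.\<close>

theorem gaussian_bilinear_inequality:
  fixes p :: real and \<theta> :: "'j \<Rightarrow> 'a::euclidean_space" and \<eta> :: "'k \<Rightarrow> 'a"
    and J :: "'j set" and K :: "'k set" and c d
  assumes p: "1 < p" "p \<le> 2" and fin: "finite J" "finite K"
  defines "s \<equiv> sqrt (p - 1)"
  defines "f \<equiv> (\<lambda>x. \<Sum>j\<in>J. c j * cis (\<theta> j \<bullet> x))"
  defines "g \<equiv> (\<lambda>x. \<Sum>k\<in>K. d k * cis (\<eta> k \<bullet> x))"
  shows "cmod (\<Sum>j\<in>J. \<Sum>k\<in>K. c j * d k *
      exp (- of_real ((norm (\<theta> j))\<^sup>2 + (norm (\<eta> k))\<^sup>2) / 2 - \<i> * of_real (s * (\<theta> j \<bullet> \<eta> k))))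
    \<le> gauss_mean (\<lambda>x. cmod (f x) powr p) powr (1/p) * gauss_mean (\<lambda>x. cmod (g x) powr p) powr (1/p)"
proof (rule LIMSEQ_le)
  have s: "0 \<le> s" "s \<le> 1" using p by (auto simp: s_def)
  have fg: "trig_poly f" "trig_poly g"
    unfolding f_def g_def using fin by (auto intro!: trig_poly_sum trig_poly_cis)
  let ?P = "\<lambda>n t u. Complex (cos (t / sqrt (real n)) * cos (u / sqrt (real n))) (- s * (sin (t / sqrt (real n)) * sin (u / sqrt (real n))))"
  let ?L = "\<lambda>n. cmod (\<Sum>j\<in>J. \<Sum>k\<in>K. c j * d k * (\<Prod>e\<in>Basis. ?P n (\<theta> j \<bullet> e) (\<eta> k \<bullet> e) ^ n))"
  let ?R = "\<lambda>n. walk_mean n (\<lambda>x. cmod (f x) powr p) powr (1/p) * walk_mean n (\<lambda>x. cmod (g x) powr p) powr (1/p)"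
  have eq: "(\<Prod>e\<in>Basis. exp (- of_real ((a \<bullet> e)\<^sup>2 + (b \<bullet> e)\<^sup>2) / 2 - \<i> * of_real (s * (a \<bullet> e) * (b \<bullet> e))))
     = exp (- of_real ((norm a)\<^sup>2 + (norm b)\<^sup>2) / 2 - \<i> * complex_of_real (s * (a \<bullet> b)))" for a b :: 'a
    unfolding norm_square_Basis euclidean_inner[of a b]
    by (simp add: exp_sum[symmetric] sum_subtractf sum_negf sum_divide_distrib sum.distrib sum_distrib_left mult.assoc diff_divide_distrib)
  show "?L \<longlonglongrightarrow> cmod (\<Sum>j\<in>J. \<Sum>k\<in>K. c j * d k *
      exp (- of_real ((norm (\<theta> j))\<^sup>2 + (norm (\<eta> k))\<^sup>2) / 2 - \<i> * of_real (s * (\<theta> j \<bullet> \<eta> k))))"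
    unfolding eq[symmetric]
    by (intro tendsto_norm tendsto_sum tendsto_mult tendsto_const tendsto_prod two_point_power_limit s)
  show "?R \<longlonglongrightarrow> gauss_mean (\<lambda>x. cmod (f x) powr p) powr (1/p) * gauss_mean (\<lambda>x. cmod (g x) powr p) powr (1/p)"
  proof (intro tendsto_mult)
    have nn: "0 \<le> walk_mean n (\<lambda>x. cmod (h x) powr p)" for n and h :: "'a \<Rightarrow> complex"
      unfolding walk_mean_def by (rule cube_mean_nonneg) simp
    have "(\<lambda>n. walk_mean n (\<lambda>x. cmod (h x) powr p) powr (1/p)) \<longlonglongrightarrow> gauss_mean (\<lambda>x. cmod (h x) powr p) powr (1/p)"
      if "trig_poly h" for h :: "'a \<Rightarrow> complex"
      using p by (intro tendsto_powr' walk_mean_powr_limit that tendsto_const) (auto intro!: always_eventually nn)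
    then show "(\<lambda>n. walk_mean n (\<lambda>x. cmod (f x) powr p) powr (1/p)) \<longlonglongrightarrow> gauss_mean (\<lambda>x. cmod (f x) powr p) powr (1/p)"
      "(\<lambda>n. walk_mean n (\<lambda>x. cmod (g x) powr p) powr (1/p)) \<longlonglongrightarrow> gauss_mean (\<lambda>x. cmod (g x) powr p) powr (1/p)"
      using fg by auto
  qed
  show "\<exists>N. \<forall>n\<ge>N. ?L n \<le> ?R n"
  proof (intro exI allI impI)
    fix n :: nat
    have "?L n = cmod (\<Sum>j\<in>J. \<Sum>k\<in>K. c j * d k * (\<Prod>i\<in>Basis \<times> {..<n}. ?P n (\<theta> j \<bullet> fst i) (\<eta> k \<bullet> fst i)))"
      unfolding prod_Basis_times[of "\<lambda>e. ?P n (\<theta> _ \<bullet> e) (\<eta> _ \<bullet> e)" n] ..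
    also have "\<dots> \<le> ?R n"
      unfolding walk_mean_def f_def g_def inner_random_walk s_def
      by (rule cube_bilinear_inequality[OF p]) simp
    finally show "?L n \<le> ?R n" .
  qed
qed

section \<open>Approximation by trigonometric polynomials times a Gaussian\<close>

text \<open>Coordinates in which polynomials become trigonometric polynomials. The map takes
  values in the cube \<open>[-1, 1]\<^sup>d\<close> everywhere and is injective on the ball of
  radius \<open>L > 0\<close>.\<close>

definition sine_map :: "real \<Rightarrow> 'a::euclidean_space \<Rightarrow> 'a" where
  "sine_map L x = (\<Sum>e\<in>Basis. sin (pi * (x \<bullet> e) / (2 * L)) *\<^sub>R e)"

definition arcsine_map :: "real \<Rightarrow> 'a::euclidean_space \<Rightarrow> 'a" where
  "arcsine_map L s = (\<Sum>e\<in>Basis. (2 * L / pi * arcsin (s \<bullet> e)) *\<^sub>R e)"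

lemma sine_map_in_cbox: "sine_map L x \<in> cbox (- One) One"
  by (auto simp: mem_box sine_map_def inner_sum_left_Basis)

lemma arcsine_sine_map:
  assumes L: "0 < L" and x: "norm x \<le> L"
  shows "arcsine_map L (sine_map L x) = x"
proof (rule euclidean_eqI)
  fix e :: 'a assume e: "e \<in> Basis"
  have "\<bar>x \<bullet> e\<bar> \<le> L" using Basis_le_norm[OF e, of x] x by linarith
  then have "pi / 2 * (\<bar>x \<bullet> e\<bar> / L) \<le> pi / 2 * 1"
    using L by (intro mult_left_mono) (auto simp: divide_le_eq)
  then have "\<bar>pi * (x \<bullet> e) / (2 * L)\<bar> \<le> pi / 2"
    using L by (simp add: abs_mult)
  then have "arcsin (sin (pi * (x \<bullet> e) / (2 * L))) = pi * (x \<bullet> e) / (2 * L)"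
    by (intro arcsin_sin) linarith+
  then show "arcsine_map L (sine_map L x) \<bullet> e = x \<bullet> e"
    using e L by (simp add: arcsine_map_def sine_map_def)
qed

lemma continuous_on_arcsine_map: "continuous_on (cbox (- One) One) (arcsine_map L)"
  unfolding arcsine_map_def
  by (intro continuous_intros continuous_on_arcsin) (auto simp: mem_box)

lemma trig_poly_polynomial_sine:
  fixes h :: "'a::euclidean_space \<Rightarrow> real"
  assumes "real_polynomial_function h"
  shows "trig_poly (\<lambda>x. of_real (h (sine_map L x)))"
  using assms
proof (induction rule: real_polynomial_function.induct)
  case (linear h)
  then interpret bounded_linear h .
  have "trig_poly (\<lambda>x. complex_of_real (sin (pi * (x \<bullet> e) / (2 * L))))" for e :: 'a
  proof -
    let ?\<theta> = "(pi / (2 * L)) *\<^sub>R e"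
    have "(\<lambda>x. complex_of_real (sin (pi * (x \<bullet> e) / (2 * L)))) =
      (\<lambda>x. (- \<i> / 2) * cis (?\<theta> \<bullet> x) + (\<i> / 2) * cis ((- ?\<theta>) \<bullet> x))"
      by (auto simp: fun_eq_iff complex_eq_iff inner_commute)
    then show ?thesis by (simp only: trig_poly_add trig_poly_cis)
  qed
  then have "trig_poly (\<lambda>x. \<Sum>e\<in>(Basis::'a set). complex_of_real (sin (pi * (x \<bullet> e) / (2 * L))) * of_real (h e))"
    by (intro trig_poly_sum trig_poly_mult trig_poly_const) auto
  then show ?case by (simp add: sine_map_def sum scaleR)
qed (auto intro: trig_poly_const trig_poly_add trig_poly_mult)

text \<open>Stone--Weierstrass in the coordinates of \<open>sine_map\<close>. Since these
  coordinates never leave the cube, the approximant is bounded on the whole space although it is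
  close to \<open>h\<close> only on a ball.\<close>

lemma trig_poly_approximation:
  fixes h :: "'a::euclidean_space \<Rightarrow> complex"
  assumes h: "continuous_on UNIV h" "\<And>x. cmod (h x) \<le> M" and L: "0 < L" and e: "0 < e"
  obtains P where "trig_poly P" "\<And>x. norm x \<le> L \<Longrightarrow> cmod (P x - h x) < e" "\<And>x. cmod (P x) \<le> M + e"
proof -
  let ?F = "\<lambda>s. h (arcsine_map L s)"
  have "continuous_on (cbox (- One) One) ?F"
    by (rule continuous_on_compose2[OF h(1) continuous_on_arcsine_map]) auto
  then obtain g where g: "polynomial_function g" "\<And>s. s \<in> cbox (- One) One \<Longrightarrow> cmod (?F s - g s) < e"
    using Stone_Weierstrass_polynomial_function[of "cbox (- One) One" ?F e] e by auto
  have "real_polynomial_function (\<lambda>s. Re (g s))" "real_polynomial_function (\<lambda>s. Im (g s))"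
    using g(1) bounded_linear_Re bounded_linear_Im unfolding polynomial_function_def o_def by blast+
  then have "trig_poly (\<lambda>x. of_real (Re (g (sine_map L x))) + \<i> * of_real (Im (g (sine_map L x))))"
    by (intro trig_poly_add trig_poly_mult trig_poly_const trig_poly_polynomial_sine)
  then have P: "trig_poly (\<lambda>x. g (sine_map L x))" by (simp add: complex_eq[symmetric])
  show ?thesis
  proof (rule that[OF P])
    fix x :: 'a
    have d: "cmod (?F (sine_map L x) - g (sine_map L x)) < e" by (intro g(2) sine_map_in_cbox)
    then show "cmod (g (sine_map L x) - h x) < e" if "norm x \<le> L"
      using arcsine_sine_map[OF L that] by (simp add: norm_minus_commute)
    have "cmod (g (sine_map L x)) \<le> cmod (?F (sine_map L x)) + cmod (?F (sine_map L x) - g (sine_map L x))"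
      by (metis norm_triangle_sub norm_minus_commute add.commute)
    then show "cmod (g (sine_map L x)) \<le> M + e"
      using d h(2)[of "arcsine_map L (sine_map L x)"] by linarith
  qed
qed

definition gauss_times :: "real \<Rightarrow> ('a::euclidean_space \<Rightarrow> complex) \<Rightarrow> 'a \<Rightarrow> complex" where
  "gauss_times \<alpha> f x = exp (- \<alpha> * (norm x)\<^sup>2) *\<^sub>R f x"

lemma gauss_times_continuous: "continuous_on UNIV f \<Longrightarrow> continuous_on UNIV (gauss_times \<alpha> f)"
  unfolding gauss_times_def by (intro continuous_intros) auto

lemma continuous_imp_lebesgue_measurable:
  "continuous_on UNIV f \<Longrightarrow> f \<in> borel_measurable lebesgue" for f :: "'a::euclidean_space \<Rightarrow> 'b::topological_space"
  by (simp add: borel_measurable_continuous_onI measurable_completion)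

text \<open>An induction principle: a property that holds for trigonometric polynomials times a
  fixed Gaussian and survives limits dominated by a multiple of this Gaussian holds for all
  bounded measurable functions of bounded support. For continuous \<open>g\<close> of bounded
  support one approximates \<open>exp (\<alpha>|x|\<^sup>2) g\<close> by trigonometric
  polynomials; a measurable function is an almost everywhere limit of continuous ones, which are
  clipped in value and cut off in space to keep them dominated.\<close>

theorem dominated_density:
  fixes P :: "('a::euclidean_space \<Rightarrow> complex) \<Rightarrow> bool" and f :: "'a \<Rightarrow> complex"
  assumes \<alpha>: "0 < \<alpha>"
    and trig: "\<And>g. trig_poly g \<Longrightarrow> P (gauss_times \<alpha> g)"
    and lim: "\<And>g gn C. (\<And>n::nat. gn n \<in> borel_measurable lebesgue) \<Longrightarrow> (\<And>n. P (gn n)) \<Longrightarrow>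
        g \<in> borel_measurable lebesgue \<Longrightarrow> (\<And>n x. cmod (gn n x) \<le> C * exp (- \<alpha> * (norm x)\<^sup>2)) \<Longrightarrow>
        (AE x in lebesgue. (\<lambda>n. gn n x) \<longlonglongrightarrow> g x) \<Longrightarrow> P g"
    and f: "f \<in> borel_measurable lebesgue" "\<And>x. cmod (f x) \<le> M" "\<And>x. R < norm x \<Longrightarrow> f x = 0"
  shows "P f"
proof -
  have dom: "cmod (g x) \<le> N * exp (\<alpha> * r\<^sup>2) * exp (- \<alpha> * (norm x)\<^sup>2)"
    if "\<And>x. cmod (g x) \<le> N" "\<And>x. r < norm x \<Longrightarrow> g x = 0" for g :: "'a \<Rightarrow> complex" and N r x
  proof (cases "norm x \<le> r")
    case True
    then have "(norm x)\<^sup>2 \<le> r\<^sup>2" by (intro power_mono) auto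
    then have "1 \<le> exp (\<alpha> * r\<^sup>2) * exp (- \<alpha> * (norm x)\<^sup>2)"
      using \<alpha> by (simp add: exp_add[symmetric])
    moreover have "0 \<le> N" using that(1)[of x] norm_ge_zero order_trans by blast
    ultimately have "N * 1 \<le> N * (exp (\<alpha> * r\<^sup>2) * exp (- \<alpha> * (norm x)\<^sup>2))" by (rule mult_left_mono)
    with that(1)[of x] show ?thesis by simp
  next
    case False
    moreover have "0 \<le> N" using that(1)[of x] norm_ge_zero order_trans by blast
    ultimately show ?thesis using that(2)[of x] by simp
  qed
  have cont: "P g" if g: "continuous_on UNIV g" "\<And>x. cmod (g x) \<le> N" "\<And>x. r < norm x \<Longrightarrow> g x = 0"
    for g :: "'a \<Rightarrow> complex" and N r
  proof -
    define h where "h = gauss_times (- \<alpha>) g"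
    have hc: "continuous_on UNIV h" unfolding h_def by (intro gauss_times_continuous g)
    have hb: "cmod (h x) \<le> N * exp (\<alpha> * r\<^sup>2)" for x
    proof -
      have "cmod (h x) = exp (\<alpha> * (norm x)\<^sup>2) * cmod (g x)" by (simp add: h_def gauss_times_def)
      also have "\<dots> \<le> exp (\<alpha> * (norm x)\<^sup>2) * (N * exp (\<alpha> * r\<^sup>2) * exp (- \<alpha> * (norm x)\<^sup>2))"
        by (intro mult_left_mono dom g) auto
      also have "\<dots> = N * exp (\<alpha> * r\<^sup>2)" by (simp add: exp_minus)
      finally show ?thesis .
    qed
    define Q where "Q = N * exp (\<alpha> * r\<^sup>2)"
    have "\<exists>p. trig_poly p \<and> (\<forall>x. norm x \<le> real (Suc n) \<longrightarrow> cmod (p x - h x) < 1 / real (Suc n))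
        \<and> (\<forall>x. cmod (p x) \<le> Q + 1 / real (Suc n))" for n
      by (rule trig_poly_approximation[OF hc hb, of "real (Suc n)" "1 / real (Suc n)"]) (auto simp: Q_def)
    then obtain p where p: "\<And>n. trig_poly (p n)"
      "\<And>n x. norm x \<le> real (Suc n) \<Longrightarrow> cmod (p n x - h x) < 1 / real (Suc n)"
      "\<And>n x. cmod (p n x) \<le> Q + 1 / real (Suc n)" by metis
    have pb: "cmod (p n x) \<le> Q + 1" for n x
    proof -
      have "1 / real (Suc n) \<le> 1" by simp
      then show ?thesis using p(3)[of n x] by linarith
    qed
    have plim: "(\<lambda>n. p n x) \<longlonglongrightarrow> h x" for x
    proof (rule LIM_zero_cancel, rule Lim_null_comparison)
      obtain n0 :: nat where n0: "norm x \<le> real n0" using real_arch_simple by blast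
      show "\<forall>\<^sub>F n in sequentially. cmod (p n x - h x) \<le> 1 / real (Suc n)"
        using n0 by (intro eventually_sequentiallyI[of n0] less_imp_le p(2)) linarith
      show "(\<lambda>n. 1 / real (Suc n)) \<longlonglongrightarrow> 0" using LIMSEQ_inverse_real_of_nat by (simp add: inverse_eq_divide)
    qed
    have gh: "g x = exp (- \<alpha> * (norm x)\<^sup>2) *\<^sub>R h x" for x
      by (simp add: h_def gauss_times_def exp_minus)
    show ?thesis
    proof (rule lim[of "\<lambda>n. gauss_times \<alpha> (p n)" g "Q + 1"])
      show "gauss_times \<alpha> (p n) \<in> borel_measurable lebesgue" for n
        by (intro continuous_imp_lebesgue_measurable gauss_times_continuous trig_poly_continuous p)
      show "g \<in> borel_measurable lebesgue" by (intro continuous_imp_lebesgue_measurable g)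
      show "cmod (gauss_times \<alpha> (p n) x) \<le> (Q + 1) * exp (- \<alpha> * (norm x)\<^sup>2)" for n x
        using mult_right_mono[OF pb[of n x], of "exp (- \<alpha> * (norm x)\<^sup>2)"] by (simp add: gauss_times_def mult.commute)
      show "AE x in lebesgue. (\<lambda>n. gauss_times \<alpha> (p n) x) \<longlonglongrightarrow> g x"
        unfolding gh gauss_times_def by (intro AE_I2 tendsto_intros plim)
    qed (intro trig p)
  qed
  define B where "B = max M 1"
  have B: "1 \<le> B" "\<And>x. cmod (f x) \<le> B" using f(2) by (auto simp: B_def le_max_iff_disj)
  have "f measurable_on UNIV"
    using f(1) measurable_on_iff_borel_measurable[of UNIV f] by simp
  then obtain N g where N: "negligible N" and g: "\<And>n. continuous_on UNIV (g n)"
    and gl: "\<And>x. x \<notin> N \<Longrightarrow> (\<lambda>n::nat. g n x) \<longlonglongrightarrow> f x"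
    unfolding measurable_on_def by auto
  \<comment> \<open>retraction of the plane onto the disc of radius \<open>B\<close>\<close>
  define clip where "clip = (\<lambda>z::complex. (B / max B (cmod z)) *\<^sub>R z)"
  \<comment> \<open>equal to \<open>1\<close> on the ball of radius \<open>R\<close> and to
    \<open>0\<close> outside the ball of radius \<open>R + 1\<close>\<close>
  define cut where "cut = (\<lambda>x::'a. max 0 (min 1 (R + 1 - norm x)))"
  have mx: "max B (cmod z) \<noteq> 0" "0 < max B (cmod z)" for z using B(1) by (auto simp: max_def)
  have clip_cont: "continuous_on UNIV clip"
    unfolding clip_def using mx by (intro continuous_intros) auto
  have clip_le: "cmod (clip z) \<le> B" for z
  proof -
    have "B * cmod z \<le> B * max B (cmod z)" using B(1) by (intro mult_left_mono) auto
    then have "B * cmod z / max B (cmod z) \<le> B" using mx(2)[of z] by (simp add: pos_divide_le_eq)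
    then show ?thesis using B(1) mx(2)[of z] by (simp add: clip_def)
  qed
  have clip_id: "clip z = z" if "cmod z \<le> B" for z
    using that B(1) by (simp add: clip_def max_absorb1)
  have cut: "0 \<le> cut x" "cut x \<le> 1" "norm x \<le> R \<Longrightarrow> cut x = 1" "R + 1 < norm x \<Longrightarrow> cut x = 0" for x
    by (auto simp: cut_def)
  have cut_cont: "continuous_on UNIV cut" unfolding cut_def by (intro continuous_intros)
  define k where "k = (\<lambda>n x. cut x *\<^sub>R clip (g n x))"
  have k: "continuous_on UNIV (k n)" "cmod (k n x) \<le> B" "R + 1 < norm x \<Longrightarrow> k n x = 0" for n x
  proof -
    show "continuous_on UNIV (k n)" unfolding k_def
      by (intro continuous_intros cut_cont continuous_on_compose2[OF clip_cont g]) auto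
    have "cut x * cmod (clip (g n x)) \<le> 1 * B" using cut clip_le B(1) by (intro mult_mono) auto
    then show "cmod (k n x) \<le> B" using cut(1)[of x] by (simp add: k_def)
  qed (simp add: k_def cut)
  show ?thesis
  proof (rule lim[of k f "B * exp (\<alpha> * (R+1)\<^sup>2)"])
    show "k n \<in> borel_measurable lebesgue" for n by (intro continuous_imp_lebesgue_measurable k)
    show "P (k n)" for n by (rule cont[OF k])
    show "cmod (k n x) \<le> B * exp (\<alpha> * (R+1)\<^sup>2) * exp (- \<alpha> * (norm x)\<^sup>2)" for n x by (rule dom[OF k(2,3)])
    show "AE x in lebesgue. (\<lambda>n. k n x) \<longlonglongrightarrow> f x"
    proof (rule AE_I')
      show "N \<in> null_sets lebesgue" using N by (simp add: negligible_iff_null_sets)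
      show "{x \<in> space lebesgue. \<not> (\<lambda>n. k n x) \<longlonglongrightarrow> f x} \<subseteq> N"
      proof (rule subsetI, rule ccontr)
        fix x assume x: "x \<in> {x \<in> space lebesgue. \<not> (\<lambda>n. k n x) \<longlonglongrightarrow> f x}" "x \<notin> N"
        have "isCont clip (f x)" using clip_cont by (simp add: continuous_on_eq_continuous_at)
        then have "(\<lambda>n. clip (g n x)) \<longlonglongrightarrow> clip (f x)"
          using gl[OF x(2)] by (rule isCont_tendsto_compose)
        then have "(\<lambda>n. k n x) \<longlonglongrightarrow> cut x *\<^sub>R f x"
          unfolding k_def clip_id[OF B(2)] by (intro tendsto_intros)
        moreover have "cut x *\<^sub>R f x = f x" using cut(3)[of x] f(3)[of x] by (cases "norm x \<le> R") auto
        ultimately show False using x(1) by simp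
      qed
    qed
  qed (rule f(1))
qed

section \<open>A bilinear inequality for the Fourier kernel\<close>

lemma integral_linear_combination:
  fixes h :: "'j \<Rightarrow> 'a \<Rightarrow> complex"
  assumes "\<And>j. j \<in> J \<Longrightarrow> integrable M (h j)"
  shows "(\<integral>x. (\<Sum>j\<in>J. a j * h j x) \<partial>M) = (\<Sum>j\<in>J. a j * (\<integral>x. h j x \<partial>M))"
  using assms by (subst Bochner_Integration.integral_sum) (auto intro: integrable_mult_right)

lemma lborel_integral_translate:
  fixes f :: "'a::euclidean_space \<Rightarrow> 'b::{banach, second_countable_topology}"
  assumes [measurable]: "f \<in> borel_measurable borel"
  shows "(\<integral>x. f (x + c) \<partial>lborel) = (\<integral>x. f x \<partial>lborel)"
proof -
  have "(\<integral>x. f x \<partial>lborel) = (\<integral>x. f x \<partial>(distr lborel borel ((+) c)))"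
    by (subst lborel_distr_plus) rule
  also have "\<dots> = (\<integral>x. f (c + x) \<partial>lborel)" by (rule integral_distr) auto
  finally show ?thesis by (simp add: add.commute)
qed

lemma gaussian_fourier_shifted:
  fixes v \<eta> :: "'a::euclidean_space"
  shows "integrable lborel (\<lambda>y. exp (- (norm (y + v))\<^sup>2 / 2) *\<^sub>R cis (\<eta> \<bullet> y))"
    and "(\<integral>y. exp (- (norm (y + v))\<^sup>2 / 2) *\<^sub>R cis (\<eta> \<bullet> y) \<partial>lborel)
      = cis (- (\<eta> \<bullet> v)) * of_real (sqrt (2 * pi) ^ DIM('a) * exp (- (norm \<eta>)\<^sup>2 / 2))"
proof -
  define g where "g = (\<lambda>y::'a. exp (- (norm y)\<^sup>2 / 2) *\<^sub>R cis (\<eta> \<bullet> (y - v)))"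
  have gm: "g \<in> borel_measurable borel" unfolding g_def inner_diff_right
    by (intro borel_measurable_continuous_onI continuous_intros) auto
  have g: "g y = cis (- (\<eta> \<bullet> v)) * (exp (- (1/2) * (norm y)\<^sup>2) *\<^sub>R cis (\<eta> \<bullet> y))" for y
    by (simp add: g_def inner_diff_right cis_mult add.commute mult_scaleR_right)
  have gi: "integrable lborel g"
    unfolding g by (intro integrable_mult_right gaussian_fourier_real(1)) simp
  have e: "(\<lambda>y. exp (- (norm (y + v))\<^sup>2 / 2) *\<^sub>R cis (\<eta> \<bullet> y)) = (\<lambda>y. g (y + v))"
    by (simp add: g_def)
  have "integrable (distr lborel borel ((+) v)) g" using gi by (simp add: lborel_distr_plus)
  then show "integrable lborel (\<lambda>y. exp (- (norm (y + v))\<^sup>2 / 2) *\<^sub>R cis (\<eta> \<bullet> y))"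
    unfolding e using gm by (subst (asm) integrable_distr_eq) (auto simp: add.commute)
  show "(\<integral>y. exp (- (norm (y + v))\<^sup>2 / 2) *\<^sub>R cis (\<eta> \<bullet> y) \<partial>lborel)
      = cis (- (\<eta> \<bullet> v)) * of_real (sqrt (2 * pi) ^ DIM('a) * exp (- (norm \<eta>)\<^sup>2 / 2))"
    unfolding e lborel_integral_translate[OF gm] unfolding g
    by (subst integral_mult_right_zero, subst gaussian_fourier_real(2)) (simp_all add: mult.commute)
qed

lemma gauss_times_fourier:
  fixes f :: "'a::euclidean_space \<Rightarrow> complex"
  assumes p: "0 < p" and f: "f = (\<lambda>x. \<Sum>j\<in>J. c j * cis (\<theta> j \<bullet> x))"
  shows "(\<integral>x. cis (\<kappa> * (x \<bullet> y)) * gauss_times (1 / (2 * p)) f x \<partial>lborel)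
     = (\<Sum>j\<in>J. c j * of_real (sqrt (2 * pi * p) ^ DIM('a) * exp (- p * (norm (\<theta> j + \<kappa> *\<^sub>R y))\<^sup>2 / 2)))"
proof -
  let ?a = "1 / (2 * p)"
  have a: "0 < ?a" using p by simp
  have "(\<lambda>x. cis (\<kappa> * (x \<bullet> y)) * gauss_times ?a f x) =
     (\<lambda>x. \<Sum>j\<in>J. c j * (exp (- ?a * (norm x)\<^sup>2) *\<^sub>R cis ((\<theta> j + \<kappa> *\<^sub>R y) \<bullet> x)))"
  proof
    fix x
    have "cis ((\<theta> j + \<kappa> *\<^sub>R y) \<bullet> x) = cis (\<theta> j \<bullet> x) * cis (\<kappa> * (x \<bullet> y))" for j
      by (simp add: inner_add_left cis_mult) (simp add: inner_commute)
    then show "cis (\<kappa> * (x \<bullet> y)) * gauss_times ?a f x =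
        (\<Sum>j\<in>J. c j * (exp (- ?a * (norm x)\<^sup>2) *\<^sub>R cis ((\<theta> j + \<kappa> *\<^sub>R y) \<bullet> x)))"
      unfolding gauss_times_def f by (simp add: scaleR_sum_right sum_distrib_left mult_ac)
  qed
  then have "(\<integral>x. cis (\<kappa> * (x \<bullet> y)) * gauss_times ?a f x \<partial>lborel)
    = (\<Sum>j\<in>J. c j * (\<integral>x. exp (- ?a * (norm x)\<^sup>2) *\<^sub>R cis ((\<theta> j + \<kappa> *\<^sub>R y) \<bullet> x) \<partial>lborel))"
    by (simp only:) (rule integral_linear_combination, rule gaussian_fourier_real(1)[OF a])
  also have "\<dots> = (\<Sum>j\<in>J. c j * of_real (sqrt (2 * pi * p) ^ DIM('a) * exp (- p * (norm (\<theta> j + \<kappa> *\<^sub>R y))\<^sup>2 / 2)))"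
    unfolding gaussian_fourier_real(2)[OF a] using p by (simp add: mult_ac)
  finally show ?thesis .
qed

text \<open>Two ways to write the exponent of one Gaussian. Left: the weight attached to the
  second function times the Fourier transform, at frequency \<open>\<kappa>y\<close> with
  \<open>\<kappa> = \<surd>(p - 1) / p\<close>, of the first. Right: a Gaussian centred at
  \<open>-\<surd>(p - 1) \<theta>\<close> whose integral against
  \<open>e\<^bsup>i\<langle>\<eta>,y\<rangle>\<^esup>\<close> is a constant multiple of the
  kernel of \<open>gaussian_bilinear_inequality\<close>. This identity singles out the value of
  \<open>\<kappa>\<close>.\<close>

lemma complete_square:
  fixes y \<theta> :: "'a::euclidean_space" and p :: real
  assumes p: "1 < p"
  shows "- (1 / (2 * p)) * (norm y)\<^sup>2 + - p * (norm (\<theta> + (sqrt (p - 1) / p) *\<^sub>R y))\<^sup>2 / 2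
     = - (norm (y + sqrt (p - 1) *\<^sub>R \<theta>))\<^sup>2 / 2 + - (norm \<theta>)\<^sup>2 / 2"
proof -
  define s where "s = sqrt (p - 1)"
  have s2: "s * s = p - 1" using p by (simp add: s_def)
  have n: "(norm (\<theta> + (s/p) *\<^sub>R y))\<^sup>2 = \<theta> \<bullet> \<theta> + 2 * (s/p) * (\<theta> \<bullet> y) + (s/p) * (s/p) * (y \<bullet> y)"
    "(norm (y + s *\<^sub>R \<theta>))\<^sup>2 = y \<bullet> y + 2 * s * (\<theta> \<bullet> y) + s * s * (\<theta> \<bullet> \<theta>)"
    unfolding power2_norm_eq_inner by (simp_all add: inner_add_left inner_add_right inner_commute algebra_simps)
  have q: "(s/p) * (s/p) = (p - 1) / (p * p)" using s2 by simp
  show ?thesis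
    using p unfolding s_def[symmetric] n s2 q unfolding power2_norm_eq_inner by (simp add: field_simps)
qed

text \<open>The numerator is the product of the integrals of \<open>exp
  (-|x|\<^sup>2/2p)\<close> and \<open>exp (-|x|\<^sup>2/2)\<close>; the denominator converts
  two \<open>L\<^sup>p\<close> norms for the Gaussian probability measure into Lebesgue norms.\<close>

definition hausdorff_young_const :: "real \<Rightarrow> nat \<Rightarrow> real" where
  "hausdorff_young_const p d = (sqrt (2 * pi * p) ^ d * sqrt (2 * pi) ^ d) / ((sqrt (2 * pi) ^ d) powr (1/p) * (sqrt (2 * pi) ^ d) powr (1/p))"

text \<open>Multiplication by \<open>exp (-|x|\<^sup>2/2p)\<close> carries
  \<open>L\<^sup>p\<close> of Gaussian measure to \<open>L\<^sup>p\<close> of Lebesgue measure,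
  up to a constant. Under it the bilinear form of \<open>gaussian_bilinear_inequality\<close>
  becomes, by \<open>complete_square\<close>, the one with the Fourier kernel.\<close>

theorem gauss_times_bilinear:
  fixes f g :: "'a::euclidean_space \<Rightarrow> complex"
  assumes p: "1 < p" "p \<le> 2" and fg: "trig_poly f" "trig_poly g"
  defines "u \<equiv> gauss_times (1 / (2 * p)) f" and "v \<equiv> gauss_times (1 / (2 * p)) g"
  shows "cmod (\<integral>y. v y * (\<integral>x. cis (sqrt (p - 1) / p * (x \<bullet> y)) * u x \<partial>lborel) \<partial>lborel)
    \<le> hausdorff_young_const p DIM('a) * (\<integral>x. cmod (u x) powr p \<partial>lborel) powr (1/p) * (\<integral>x. cmod (v x) powr p \<partial>lborel) powr (1/p)"
proof -
  let ?\<kappa> = "sqrt (p - 1) / p" and ?s = "sqrt (p - 1)"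
  have p0: "0 < p" using p by simp
  obtain J c \<theta> where f: "f = (\<lambda>x. \<Sum>j<(J::nat). c j * cis (\<theta> j \<bullet> x))" using trig_poly_repr[OF fg(1)] by blast
  obtain K d \<eta> where g: "g = (\<lambda>x. \<Sum>k<(K::nat). d k * cis (\<eta> k \<bullet> x))" using trig_poly_repr[OF fg(2)] by blast
  define W where "W = sqrt (2 * pi * p) ^ DIM('a)"
  define V where "V = sqrt (2 * pi) ^ DIM('a)"
  have WV: "0 < W" "0 < V" using p by (auto simp: W_def V_def)
  have gm: "gauss_mean (\<lambda>x. cmod (h x) powr p) = (1/V) * (\<integral>x. cmod (gauss_times (1 / (2 * p)) h x) powr p \<partial>lborel)" for h :: "'a \<Rightarrow> complex"
  proof -
    have "cmod (gauss_times (1 / (2 * p)) h x) powr p = exp (- (norm x)\<^sup>2 / 2) * cmod (h x) powr p" for x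
      using p by (simp add: gauss_times_def powr_mult exp_powr_real)
    then show ?thesis by (simp add: gauss_mean_def V_def)
  qed
  have "v y * (\<integral>x. cis (?\<kappa> * (x \<bullet> y)) * u x \<partial>lborel) =
     (\<Sum>j<J. \<Sum>k<K. (c j * d k * of_real (W * exp (- (norm (\<theta> j))\<^sup>2 / 2))) *
        (exp (- (norm (y + ?s *\<^sub>R \<theta> j))\<^sup>2 / 2) *\<^sub>R cis (\<eta> k \<bullet> y)))" (is "_ = ?S y") for y
  proof -
    have "v y * (\<integral>x. cis (?\<kappa> * (x \<bullet> y)) * u x \<partial>lborel) =
      (\<Sum>j<J. \<Sum>k<K. (exp (- (1 / (2 * p)) * (norm y)\<^sup>2) *\<^sub>R (d k * cis (\<eta> k \<bullet> y)))
        * (c j * of_real (W * exp (- p * (norm (\<theta> j + ?\<kappa> *\<^sub>R y))\<^sup>2 / 2))))"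
    proof -
      have "v y = (\<Sum>k<K. exp (- (1 / (2 * p)) * (norm y)\<^sup>2) *\<^sub>R (d k * cis (\<eta> k \<bullet> y)))"
        by (simp add: v_def gauss_times_def g scaleR_sum_right)
      then show ?thesis
        unfolding u_def gauss_times_fourier[OF p0 f] W_def by (subst sum.swap) (simp add: sum_product)
    qed
    also have "\<dots> = ?S y"
    proof (intro sum.cong refl)
      fix j k
      have "exp (- (1 / (2 * p)) * (norm y)\<^sup>2) * exp (- p * (norm (\<theta> j + ?\<kappa> *\<^sub>R y))\<^sup>2 / 2)
        = exp (- (norm (\<theta> j))\<^sup>2 / 2) * exp (- (norm (y + ?s *\<^sub>R \<theta> j))\<^sup>2 / 2)"
        unfolding exp_add[symmetric] complete_square[OF p(1)] by (simp add: add.commute)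
      then have "complex_of_real (exp (- (1 / (2 * p)) * (norm y)\<^sup>2)) * of_real (exp (- p * (norm (\<theta> j + ?\<kappa> *\<^sub>R y))\<^sup>2 / 2))
        = of_real (exp (- (norm (\<theta> j))\<^sup>2 / 2)) * of_real (exp (- (norm (y + ?s *\<^sub>R \<theta> j))\<^sup>2 / 2))"
        by (simp only: of_real_mult[symmetric])
      then show "(exp (- (1 / (2 * p)) * (norm y)\<^sup>2) *\<^sub>R (d k * cis (\<eta> k \<bullet> y)))
        * (c j * of_real (W * exp (- p * (norm (\<theta> j + ?\<kappa> *\<^sub>R y))\<^sup>2 / 2)))
        = (c j * d k * of_real (W * exp (- (norm (\<theta> j))\<^sup>2 / 2))) *
        (exp (- (norm (y + ?s *\<^sub>R \<theta> j))\<^sup>2 / 2) *\<^sub>R cis (\<eta> k \<bullet> y))"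
        unfolding scaleR_conv_of_real of_real_mult by algebra
    qed
    finally show ?thesis .
  qed
  then have "(\<integral>y. v y * (\<integral>x. cis (?\<kappa> * (x \<bullet> y)) * u x \<partial>lborel) \<partial>lborel) =
     (\<Sum>j<J. \<Sum>k<K. (c j * d k * of_real (W * exp (- (norm (\<theta> j))\<^sup>2 / 2))) *
        (\<integral>y. exp (- (norm (y + ?s *\<^sub>R \<theta> j))\<^sup>2 / 2) *\<^sub>R cis (\<eta> k \<bullet> y) \<partial>lborel))"
    by (simp only: sum.cartesian_product split_def)
       (rule integral_linear_combination, rule gaussian_fourier_shifted(1))
  also have "\<dots> = of_real (W * V) * (\<Sum>j<J. \<Sum>k<K. c j * d k *
      exp (- of_real ((norm (\<theta> j))\<^sup>2 + (norm (\<eta> k))\<^sup>2) / 2 - \<i> * of_real (?s * (\<theta> j \<bullet> \<eta> k))))"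
    unfolding sum_distrib_left
  proof (intro sum.cong refl)
    fix j k
    have "exp (- of_real ((norm (\<theta> j))\<^sup>2 + (norm (\<eta> k))\<^sup>2) / 2 - \<i> * of_real (?s * (\<theta> j \<bullet> \<eta> k)))
      = complex_of_real (exp (- (norm (\<theta> j))\<^sup>2 / 2)) * of_real (exp (- (norm (\<eta> k))\<^sup>2 / 2)) * cis (- (\<eta> k \<bullet> (?s *\<^sub>R \<theta> j)))"
      by (simp add: cis_conv_exp exp_of_real[symmetric] exp_add[symmetric] inner_commute diff_divide_distrib)
    then show "(c j * d k * of_real (W * exp (- (norm (\<theta> j))\<^sup>2 / 2))) *
        (\<integral>y. exp (- (norm (y + ?s *\<^sub>R \<theta> j))\<^sup>2 / 2) *\<^sub>R cis (\<eta> k \<bullet> y) \<partial>lborel)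
      = of_real (W * V) * (c j * d k * exp (- of_real ((norm (\<theta> j))\<^sup>2 + (norm (\<eta> k))\<^sup>2) / 2 - \<i> * of_real (?s * (\<theta> j \<bullet> \<eta> k))))"
      unfolding gaussian_fourier_shifted(2) V_def[symmetric] by (simp only: of_real_mult mult_ac)
  qed
  finally have "cmod (\<integral>y. v y * (\<integral>x. cis (?\<kappa> * (x \<bullet> y)) * u x \<partial>lborel) \<partial>lborel)
    = W * V * cmod (\<Sum>j<J. \<Sum>k<K. c j * d k *
      exp (- of_real ((norm (\<theta> j))\<^sup>2 + (norm (\<eta> k))\<^sup>2) / 2 - \<i> * of_real (?s * (\<theta> j \<bullet> \<eta> k))))"
    using WV by (simp only: norm_mult norm_of_real) simp
  also have "\<dots> \<le> W * V * (gauss_mean (\<lambda>x. cmod (f x) powr p) powr (1/p) * gauss_mean (\<lambda>x. cmod (g x) powr p) powr (1/p))"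
    unfolding f g using WV by (intro mult_left_mono gaussian_bilinear_inequality p) auto
  also have "\<dots> = W * V * (((1/V) * (\<integral>x. cmod (gauss_times (1 / (2 * p)) f x) powr p \<partial>lborel)) powr (1/p)
      * ((1/V) * (\<integral>x. cmod (gauss_times (1 / (2 * p)) g x) powr p \<partial>lborel)) powr (1/p))"
    unfolding gm ..
  also have "W * V * (((1/V) * (\<integral>x. cmod (gauss_times (1 / (2 * p)) f x) powr p \<partial>lborel)) powr (1/p)
      * ((1/V) * (\<integral>x. cmod (gauss_times (1 / (2 * p)) g x) powr p \<partial>lborel)) powr (1/p))
    = hausdorff_young_const p DIM('a) * (\<integral>x. cmod (u x) powr p \<partial>lborel) powr (1/p) * (\<integral>x. cmod (v x) powr p \<partial>lborel) powr (1/p)"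
    using WV by (simp add: hausdorff_young_const_def powr_mult powr_divide u_def v_def V_def W_def)
  finally show ?thesis .
qed

section \<open>The sharp Hausdorff--Young inequality\<close>

definition fourier :: "real \<Rightarrow> ('a::euclidean_space \<Rightarrow> complex) \<Rightarrow> 'a \<Rightarrow> complex" where
  "fourier \<kappa> u y = (\<integral>x. cis (\<kappa> * (x \<bullet> y)) * u x \<partial>lebesgue)"

lemma cis_kernel_measurable: "(\<lambda>x::'a::euclidean_space. cis (\<kappa> * (x \<bullet> y))) \<in> borel_measurable lebesgue"
  by (intro continuous_imp_lebesgue_measurable continuous_intros)

lemma fourier_integrable:
  assumes "integrable lebesgue u"
  shows "integrable lebesgue (\<lambda>x. cis (\<kappa> * (x \<bullet> y)) * u x)"
  by (rule Bochner_Integration.integrable_bound[OF assms])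
     (use assms in \<open>auto simp: norm_mult intro!: borel_measurable_times cis_kernel_measurable\<close>)

lemma fourier_bound:
  fixes u :: "'a::euclidean_space \<Rightarrow> complex"
  shows "cmod (fourier \<kappa> u y) \<le> (\<integral>x. cmod (u x) \<partial>lebesgue)"
  unfolding fourier_def by (rule order_trans[OF Bochner_Integration.integral_norm_bound]) (simp add: norm_mult)

lemma fourier_continuous:
  fixes u :: "'a::euclidean_space \<Rightarrow> complex"
  assumes u: "integrable lebesgue u"
  shows "continuous_on UNIV (fourier \<kappa> u)"
  unfolding continuous_on_sequentially
proof (intro allI ballI impI)
  fix y and a :: "nat \<Rightarrow> 'a"
  assume a: "(\<forall>n. a n \<in> UNIV) \<and> a \<longlonglongrightarrow> y"
  show "(fourier \<kappa> u \<circ> a) \<longlonglongrightarrow> fourier \<kappa> u y"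
    unfolding fourier_def o_def
  proof (rule integral_dominated_convergence[where w="\<lambda>x. cmod (u x)"])
    have "isCont cis t" for t
      using continuous_on_cis[of UNIV "\<lambda>t. t"] by (simp add: continuous_on_eq_continuous_at)
    then show "AE x in lebesgue. (\<lambda>n. cis (\<kappa> * (x \<bullet> a n)) * u x) \<longlonglongrightarrow> cis (\<kappa> * (x \<bullet> y)) * u x"
      using a by (intro AE_I2 tendsto_intros isCont_tendsto_compose[of _ cis]) auto
  qed (use u in \<open>auto simp: norm_mult intro!: borel_measurable_times cis_kernel_measurable\<close>)
qed

lemma fourier_measurable:
  assumes "integrable lebesgue u" shows "fourier \<kappa> u \<in> borel_measurable lebesgue"
  by (intro continuous_imp_lebesgue_measurable fourier_continuous assms)

definition Np :: "real \<Rightarrow> ('a::euclidean_space \<Rightarrow> complex) \<Rightarrow> real" where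
  "Np p u = (\<integral>x. cmod (u x) powr p \<partial>lebesgue) powr (1/p)"

lemma gaussian_integrable_lebesgue:
  assumes "0 < a" shows "integrable lebesgue (\<lambda>x::'a::euclidean_space. exp (- a * (norm x)\<^sup>2))"
proof -
  have i: "integrable lborel (\<lambda>x::'a. exp (- a * (norm x)\<^sup>2))" by (rule gaussian_integrable[OF assms])
  show ?thesis
    using i borel_measurable_integrable[OF i] integrable_completion[of "\<lambda>x::'a. exp (- a * (norm x)\<^sup>2)" lborel] by blast
qed

text \<open>All quantities in the bilinear inequality pass to the limits that occur in
  \<open>dominated_density\<close>.\<close>

lemma dominated_limits:
  fixes g :: "'a::euclidean_space \<Rightarrow> complex"
  assumes \<alpha>: "0 < \<alpha>" and p: "0 < p"
    and m: "\<And>n::nat. gn n \<in> borel_measurable lebesgue" "g \<in> borel_measurable lebesgue"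
    and b: "\<And>n x. cmod (gn n x) \<le> C * exp (- \<alpha> * (norm x)\<^sup>2)"
    and l: "AE x in lebesgue. (\<lambda>n. gn n x) \<longlonglongrightarrow> g x"
  shows "integrable lebesgue (gn n)" "integrable lebesgue g"
    and "h \<in> borel_measurable lebesgue \<Longrightarrow> (\<And>x. cmod (h x) \<le> K) \<Longrightarrow>
       (\<lambda>n. \<integral>x. h x * gn n x \<partial>lebesgue) \<longlonglongrightarrow> (\<integral>x. h x * g x \<partial>lebesgue)"
    and "(\<lambda>n. Np p (gn n)) \<longlonglongrightarrow> Np p g"
    and "(\<integral>x. cmod (gn n x) \<partial>lebesgue) \<le> (\<integral>(x::'a). C * exp (- \<alpha> * (norm x)\<^sup>2) \<partial>lebesgue)"
proof -
  have C: "0 \<le> C"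
    using order_trans[OF norm_ge_zero b[of 0 0]] by simp
  have w: "integrable lebesgue (\<lambda>x::'a. K * (C * exp (- \<alpha> * (norm x)\<^sup>2)))" for K
    by (intro integrable_mult_right gaussian_integrable_lebesgue \<alpha>)
  have w1: "integrable lebesgue (\<lambda>x::'a. C * exp (- \<alpha> * (norm x)\<^sup>2))" using w[of 1] by simp
  show gi: "integrable lebesgue (gn n)" for n
    by (rule Bochner_Integration.integrable_bound[OF w1 m(1)])
       (use b C in \<open>auto simp: abs_mult intro!: AE_I2\<close>)
  show "integrable lebesgue g"
    by (rule integrable_dominated_convergence[OF m(2) m(1) w1 l]) (use b in auto)
  show "(\<lambda>n. \<integral>x. h x * gn n x \<partial>lebesgue) \<longlonglongrightarrow> (\<integral>x. h x * g x \<partial>lebesgue)"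
    if h: "h \<in> borel_measurable lebesgue" "\<And>x. cmod (h x) \<le> K"
  proof (rule integral_dominated_convergence[OF _ _ w[of K]])
    show "AE x in lebesgue. (\<lambda>n. h x * gn n x) \<longlonglongrightarrow> h x * g x"
      using l by eventually_elim (intro tendsto_intros)
    show "AE x in lebesgue. cmod (h x * gn n x) \<le> K * (C * exp (- \<alpha> * (norm x)\<^sup>2))" for n
      using b h(2) order_trans[OF norm_ge_zero h(2)] by (auto simp: norm_mult intro!: mult_mono)
  qed (use h m in auto)
  have wp: "integrable lebesgue (\<lambda>x::'a. C powr p * exp (- (p * \<alpha>) * (norm x)\<^sup>2))"
    using \<alpha> p by (intro integrable_mult_right gaussian_integrable_lebesgue) auto
  have lp: "(\<lambda>n. \<integral>x. cmod (gn n x) powr p \<partial>lebesgue) \<longlonglongrightarrow> (\<integral>x. cmod (g x) powr p \<partial>lebesgue)"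
  proof (rule integral_dominated_convergence[OF _ _ wp])
    show "AE x in lebesgue. (\<lambda>n. cmod (gn n x) powr p) \<longlonglongrightarrow> cmod (g x) powr p"
      using l by eventually_elim (use p in \<open>auto intro!: tendsto_powr' tendsto_norm tendsto_const\<close>)
    show "AE x in lebesgue. norm (cmod (gn n x) powr p) \<le> C powr p * exp (- (p * \<alpha>) * (norm x)\<^sup>2)" for n
    proof (rule AE_I2)
      fix x
      have "cmod (gn n x) powr p \<le> (C * exp (- \<alpha> * (norm x)\<^sup>2)) powr p"
        using b p by (intro powr_mono2) auto
      also have "\<dots> = C powr p * exp (- (p * \<alpha>) * (norm x)\<^sup>2)"
        using C by (simp add: powr_mult exp_powr_real mult_ac)
      finally show "norm (cmod (gn n x) powr p) \<le> C powr p * exp (- (p * \<alpha>) * (norm x)\<^sup>2)" by simp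
    qed
  qed (use m in measurable)
  show "(\<lambda>n. Np p (gn n)) \<longlonglongrightarrow> Np p g"
    unfolding Np_def using p by (intro tendsto_powr' lp tendsto_const) (auto intro!: always_eventually)
  show "(\<integral>x. cmod (gn n x) \<partial>lebesgue) \<le> (\<integral>(x::'a). C * exp (- \<alpha> * (norm x)\<^sup>2) \<partial>lebesgue)"
    by (rule Bochner_Integration.integral_mono[OF integrable_norm[OF gi] w1]) (rule b)
qed

lemma gauss_times_integrable:
  assumes "0 < \<alpha>" "trig_poly f" shows "integrable lebesgue (gauss_times \<alpha> f)"
proof -
  obtain M where M: "\<And>x. cmod (f x) \<le> M" using trig_poly_bounded[OF assms(2)] by blast
  show ?thesis
  proof (rule Bochner_Integration.integrable_bound[OF integrable_mult_right[OF gaussian_integrable_lebesgue[OF assms(1)], of M]])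
    show "gauss_times \<alpha> f \<in> borel_measurable lebesgue"
      by (intro continuous_imp_lebesgue_measurable gauss_times_continuous trig_poly_continuous assms)
    show "AE x in lebesgue. norm (gauss_times \<alpha> f x) \<le> norm (M * exp (- \<alpha> * (norm x)\<^sup>2))"
      using order_trans[OF M abs_ge_self] by (auto simp: gauss_times_def abs_mult mult.commute intro!: mult_left_mono)
  qed
qed

lemma gauss_times_bilinear_lebesgue:
  fixes f g :: "'a::euclidean_space \<Rightarrow> complex"
  assumes p: "1 < p" "p \<le> 2" and fg: "trig_poly f" "trig_poly g"
  defines "u \<equiv> gauss_times (1 / (2 * p)) f" and "v \<equiv> gauss_times (1 / (2 * p)) g"
  shows "cmod (\<integral>y. fourier (sqrt (p - 1) / p) u y * v y \<partial>lebesgue) \<le> hausdorff_young_const p DIM('a) * Np p u * Np p v"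
proof -
  have c: "continuous_on UNIV u" "continuous_on UNIV v"
    unfolding u_def v_def by (intro gauss_times_continuous trig_poly_continuous fg)+
  then have [measurable]: "u \<in> borel_measurable borel" "v \<in> borel_measurable borel"
    by (auto intro: borel_measurable_continuous_onI)
  have ui: "integrable lebesgue u" unfolding u_def using p by (intro gauss_times_integrable fg) auto
  have F: "fourier \<kappa> u y = (\<integral>x. cis (\<kappa> * (x \<bullet> y)) * u x \<partial>lborel)" for \<kappa> y
    unfolding fourier_def
    by (rule integral_completion) (auto intro!: borel_measurable_continuous_onI continuous_intros c)
  have Fm: "fourier \<kappa> u \<in> borel_measurable borel" for \<kappa>
    by (intro borel_measurable_continuous_onI fourier_continuous ui)
  have "(\<integral>y. fourier \<kappa> u y * v y \<partial>lebesgue) = (\<integral>y. v y * (\<integral>x. cis (\<kappa> * (x \<bullet> y)) * u x \<partial>lborel) \<partial>lborel)" for \<kappa>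
    unfolding F[symmetric] by (subst integral_completion) (use Fm in \<open>auto simp: mult.commute\<close>)
  moreover have "Np p h = (\<integral>x. cmod (h x) powr p \<partial>lborel) powr (1/p)" if "h \<in> borel_measurable borel" for h :: "'a \<Rightarrow> complex"
    unfolding Np_def by (subst integral_completion) (use that in auto)
  ultimately show ?thesis
    using gauss_times_bilinear[OF p fg] by (simp add: u_def[symmetric] v_def[symmetric])
qed

definition bounded_supported :: "('a::euclidean_space \<Rightarrow> complex) \<Rightarrow> bool" where
  "bounded_supported f \<longleftrightarrow> f \<in> borel_measurable lebesgue \<and> (\<exists>M. \<forall>x. cmod (f x) \<le> M) \<and> (\<exists>R. \<forall>x. R < norm x \<longrightarrow> f x = 0)"

lemma hausdorff_young_const_nonneg: "1 < p \<Longrightarrow> 0 \<le> hausdorff_young_const p d"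
  by (simp add: hausdorff_young_const_def)

text \<open>\<open>dominated_density\<close> is applied to \<open>u\<close> first, keeping the
  second argument a trigonometric polynomial times the Gaussian, and then to \<open>v\<close>.\<close>

theorem bounded_supported_bilinear:
  fixes u v :: "'a::euclidean_space \<Rightarrow> complex"
  assumes p: "1 < p" "p \<le> 2" and u: "bounded_supported u" and v: "bounded_supported v"
  shows "integrable lebesgue u"
    "cmod (\<integral>y. fourier (sqrt (p - 1) / p) u y * v y \<partial>lebesgue) \<le> hausdorff_young_const p DIM('a) * Np p u * Np p v"
proof -
  let ?\<kappa> = "sqrt (p - 1) / p" and ?\<alpha> = "1 / (2 * p)" and ?H = "hausdorff_young_const p DIM('a)"
  have \<alpha>: "0 < ?\<alpha>" and p0: "0 < p" using p by auto
  have step1: "integrable lebesgue u \<and> (\<forall>g. trig_poly g \<longrightarrow>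
      cmod (\<integral>y. fourier ?\<kappa> u y * gauss_times ?\<alpha> g y \<partial>lebesgue) \<le> ?H * Np p u * Np p (gauss_times ?\<alpha> g))"
  proof -
    from u obtain M R where uu: "u \<in> borel_measurable lebesgue" "\<And>x. cmod (u x) \<le> M" "\<And>x. R < norm x \<Longrightarrow> u x = 0"
      unfolding bounded_supported_def by blast
    show ?thesis
    proof (rule dominated_density[OF \<alpha> _ _ uu, where P="\<lambda>u. integrable lebesgue u \<and> (\<forall>g. trig_poly g \<longrightarrow>
      cmod (\<integral>y. fourier ?\<kappa> u y * gauss_times ?\<alpha> g y \<partial>lebesgue) \<le> ?H * Np p u * Np p (gauss_times ?\<alpha> g))"])
      fix f :: "'a \<Rightarrow> complex" assume f: "trig_poly f"
      show "integrable lebesgue (gauss_times ?\<alpha> f) \<and> (\<forall>g. trig_poly g \<longrightarrow>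
        cmod (\<integral>y. fourier ?\<kappa> (gauss_times ?\<alpha> f) y * gauss_times ?\<alpha> g y \<partial>lebesgue) \<le> ?H * Np p (gauss_times ?\<alpha> f) * Np p (gauss_times ?\<alpha> g))"
        using gauss_times_bilinear_lebesgue[OF p f] gauss_times_integrable[OF \<alpha> f] by blast
    next
      fix w :: "'a \<Rightarrow> complex" and wn C
      assume m: "\<And>n::nat. wn n \<in> borel_measurable lebesgue" and P: "\<And>n. integrable lebesgue (wn n) \<and> (\<forall>g. trig_poly g \<longrightarrow>
          cmod (\<integral>y. fourier ?\<kappa> (wn n) y * gauss_times ?\<alpha> g y \<partial>lebesgue) \<le> ?H * Np p (wn n) * Np p (gauss_times ?\<alpha> g))"
        and wm: "w \<in> borel_measurable lebesgue" and b: "\<And>n x. cmod (wn n x) \<le> C * exp (- ?\<alpha> * (norm x)\<^sup>2)"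
        and l: "AE x in lebesgue. (\<lambda>n. wn n x) \<longlonglongrightarrow> w x"
      note D = dominated_limits[OF \<alpha> p0 m wm b l]
      have Fl: "(\<lambda>n. fourier ?\<kappa> (wn n) y) \<longlonglongrightarrow> fourier ?\<kappa> w y" for y
        unfolding fourier_def by (rule D(3)[OF cis_kernel_measurable, of _ _ 1]) simp
      show "integrable lebesgue w \<and> (\<forall>g. trig_poly g \<longrightarrow>
          cmod (\<integral>y. fourier ?\<kappa> w y * gauss_times ?\<alpha> g y \<partial>lebesgue) \<le> ?H * Np p w * Np p (gauss_times ?\<alpha> g))"
      proof (intro conjI allI impI D(2))
        fix g :: "'a \<Rightarrow> complex" assume g: "trig_poly g"
        let ?g = "gauss_times ?\<alpha> g"
        have gi: "integrable lebesgue ?g" by (rule gauss_times_integrable[OF \<alpha> g])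
        define B where "B = (\<integral>(x::'a). C * exp (- ?\<alpha> * (norm x)\<^sup>2) \<partial>lebesgue)"
        have "(\<lambda>n. \<integral>y. fourier ?\<kappa> (wn n) y * ?g y \<partial>lebesgue) \<longlonglongrightarrow> (\<integral>y. fourier ?\<kappa> w y * ?g y \<partial>lebesgue)"
        proof (rule integral_dominated_convergence[where w="\<lambda>y. B * cmod (?g y)"])
          show "AE y in lebesgue. (\<lambda>n. fourier ?\<kappa> (wn n) y * ?g y) \<longlonglongrightarrow> fourier ?\<kappa> w y * ?g y"
            by (intro AE_I2 tendsto_intros Fl)
          show "AE y in lebesgue. cmod (fourier ?\<kappa> (wn n) y * ?g y) \<le> B * cmod (?g y)" for n
            unfolding norm_mult B_def
            by (intro AE_I2 mult_right_mono order_trans[OF fourier_bound D(5)]) auto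
        qed (use gi D(1,2) in \<open>auto intro!: borel_measurable_times fourier_measurable\<close>)
        then have "(\<lambda>n. cmod (\<integral>y. fourier ?\<kappa> (wn n) y * ?g y \<partial>lebesgue)) \<longlonglongrightarrow> cmod (\<integral>y. fourier ?\<kappa> w y * ?g y \<partial>lebesgue)"
          by (rule tendsto_norm)
        moreover have "(\<lambda>n. ?H * Np p (wn n) * Np p ?g) \<longlonglongrightarrow> ?H * Np p w * Np p ?g"
          by (intro tendsto_intros D(4))
        ultimately show "cmod (\<integral>y. fourier ?\<kappa> w y * ?g y \<partial>lebesgue) \<le> ?H * Np p w * Np p ?g"
          by (rule LIMSEQ_le) (use P g in blast)
      qed
    qed
  qed
  then show ui: "integrable lebesgue u" by blast
  from v obtain M R where vv: "v \<in> borel_measurable lebesgue" "\<And>x. cmod (v x) \<le> M" "\<And>x. R < norm x \<Longrightarrow> v x = 0"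
    unfolding bounded_supported_def by blast
  show "cmod (\<integral>y. fourier ?\<kappa> u y * v y \<partial>lebesgue) \<le> ?H * Np p u * Np p v"
  proof (rule dominated_density[OF \<alpha> _ _ vv, where P="\<lambda>v. cmod (\<integral>y. fourier ?\<kappa> u y * v y \<partial>lebesgue) \<le> ?H * Np p u * Np p v"])
    fix g :: "'a \<Rightarrow> complex" assume "trig_poly g"
    then show "cmod (\<integral>y. fourier ?\<kappa> u y * gauss_times ?\<alpha> g y \<partial>lebesgue) \<le> ?H * Np p u * Np p (gauss_times ?\<alpha> g)"
      using step1 by blast
  next
    fix w :: "'a \<Rightarrow> complex" and wn C
    assume m: "\<And>n::nat. wn n \<in> borel_measurable lebesgue"
      and P: "\<And>n. cmod (\<integral>y. fourier ?\<kappa> u y * wn n y \<partial>lebesgue) \<le> ?H * Np p u * Np p (wn n)"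
      and wm: "w \<in> borel_measurable lebesgue" and b: "\<And>n x. cmod (wn n x) \<le> C * exp (- ?\<alpha> * (norm x)\<^sup>2)"
      and l: "AE x in lebesgue. (\<lambda>n. wn n x) \<longlonglongrightarrow> w x"
    note D = dominated_limits[OF \<alpha> p0 m wm b l]
    have "(\<lambda>n. cmod (\<integral>y. fourier ?\<kappa> u y * wn n y \<partial>lebesgue)) \<longlonglongrightarrow> cmod (\<integral>y. fourier ?\<kappa> u y * w y \<partial>lebesgue)"
      by (intro tendsto_norm D(3)[OF fourier_measurable[OF ui] fourier_bound])
    moreover have "(\<lambda>n. ?H * Np p u * Np p (wn n)) \<longlonglongrightarrow> ?H * Np p u * Np p w"
      by (intro tendsto_intros D(4))
    ultimately show "cmod (\<integral>y. fourier ?\<kappa> u y * w y \<partial>lebesgue) \<le> ?H * Np p u * Np p w"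
      by (rule LIMSEQ_le) (use P in blast)
  qed
qed

text \<open>Duality: the bilinear bound is tested with \<open>v = |F|\<^bsup>q-2\<^esup> cnj
  F\<close> on a ball, which is bounded because \<open>F\<close>, the transform of an integrable
  function, is; then the ball exhausts the space.\<close>

theorem sharp_hausdorff_young:
  fixes u :: "'a::euclidean_space \<Rightarrow> complex"
  assumes p: "1 < p" "p \<le> 2" and pq: "1/p + 1/q = 1" and u: "bounded_supported u"
  shows "(\<integral>\<^sup>+y. ennreal (cmod (fourier (sqrt (p - 1) / p) u y) powr q) \<partial>lebesgue)
    \<le> ennreal ((hausdorff_young_const p DIM('a) * Np p u) powr q)"
proof -
  note c = conjugate_exponents_real[OF p(1) pq]
  let ?F = "fourier (sqrt (p - 1) / p) u"
  have ui: "integrable lebesgue u" by (rule bounded_supported_bilinear(1)[OF p u u])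
  have Fm[measurable]: "?F \<in> borel_measurable lebesgue" by (rule fourier_measurable[OF ui])
  define K where "K = (\<integral>x. cmod (u x) \<partial>lebesgue)"
  have K: "cmod (?F y) \<le> K" for y unfolding K_def by (rule fourier_bound)
  define A where "A = hausdorff_young_const p DIM('a) * Np p u"
  have A: "0 \<le> A" using hausdorff_young_const_nonneg[OF p(1)] by (simp add: A_def Np_def)
  have Fp: "(\<lambda>y. cmod (?F y) powr r) \<in> borel_measurable lebesgue" for r
    by (intro powr_real_measurable borel_measurable_norm Fm) auto
  have ind: "(\<lambda>y::'a. indicator (cball 0 (real n)) y :: real) \<in> borel_measurable lebesgue" for n
    by (intro borel_measurable_indicator) auto
  define h where "h = (\<lambda>n y. indicator (cball 0 (real n)) y * cmod (?F y) powr q :: real)"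
  have hm: "h n \<in> borel_measurable lebesgue" for n unfolding h_def by (intro borel_measurable_times Fp ind)
  have hi: "integrable lebesgue (h n)" for n
  proof (rule Bochner_Integration.integrable_bound)
    show "integrable lebesgue (\<lambda>y::'a. K powr q * indicator (cball 0 (real n)) y)"
      by (intro integrable_mult_right integrable_real_indicator) (use emeasure_lborel_cball_finite[of "0::'a" "real n"] in \<open>auto simp: top_unique less_top\<close>)
    show "AE y in lebesgue. norm (h n y) \<le> norm (K powr q * indicator (cball 0 (real n)) y)"
      using K c(1) by (intro AE_I2) (auto simp: h_def abs_mult indicator_def intro!: powr_mono2)
  qed (rule hm)
  have In: "(\<integral>y. h n y \<partial>lebesgue) \<le> A powr q" for n
  proof -
    define I where "I = (\<integral>y. h n y \<partial>lebesgue)"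
    have I0: "0 \<le> I" unfolding I_def by (intro Bochner_Integration.integral_nonneg) (simp add: h_def)
    define v where "v = (\<lambda>y. of_real (indicator (cball 0 (real n)) y * cmod (?F y) powr (q - 2)) * cnj (?F y))"
    have vc: "cmod (v y) = indicator (cball 0 (real n)) y * cmod (?F y) powr (q - 1)" for y
    proof (cases "?F y = 0")
      case False
      then have "cmod (?F y) powr (q - 2) * cmod (?F y) = cmod (?F y) powr (q - 1)"
        using powr_mult_base[of "cmod (?F y)" "q - 2"] by (simp add: mult.commute add.commute)
      then show ?thesis by (simp add: v_def norm_mult abs_mult mult.assoc)
    qed (use c in \<open>simp add: v_def\<close>)
    have Fv: "?F y * v y = of_real (h n y)" for y
    proof (cases "?F y = 0")
      case False
      have "?F y * v y = of_real (indicator (cball 0 (real n)) y * cmod (?F y) powr (q - 2)) * (?F y * cnj (?F y))"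
        by (simp add: v_def mult_ac)
      also have "\<dots> = of_real (indicator (cball 0 (real n)) y * (cmod (?F y) powr (q - 2) * (cmod (?F y))\<^sup>2))"
        unfolding complex_norm_square[symmetric] of_real_mult[symmetric] by (simp only: mult.assoc)
      also have "cmod (?F y) powr (q - 2) * (cmod (?F y))\<^sup>2 = cmod (?F y) powr q"
        using False powr_add[of "cmod (?F y)" "q - 2" 2] by (simp add: powr_numeral)
      finally show ?thesis by (simp add: h_def)
    qed (use c in \<open>simp add: v_def h_def\<close>)
    have "bounded_supported v"
      unfolding bounded_supported_def
    proof (intro conjI exI allI impI)
      have rv: "(\<lambda>y::'a. indicator (cball 0 (real n)) y * cmod (?F y) powr (q - 2)) \<in> borel_measurable lebesgue"
        by (intro borel_measurable_times Fp ind)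
      show "v \<in> borel_measurable lebesgue" unfolding v_def
        by (intro borel_measurable_times measurable_compose[OF rv borel_measurable_continuous_onI]
            measurable_compose[OF Fm borel_measurable_continuous_onI] continuous_intros)
      show "cmod (v y) \<le> K powr (q - 1)" for y
        using K[of y] c(1) by (auto simp: vc indicator_def intro!: powr_mono2)
      show "v y = 0" if "real n < norm y" for y using that by (simp add: v_def)
    qed
    from bounded_supported_bilinear(2)[OF p u this]
    have "cmod (\<integral>y. of_real (h n y) \<partial>lebesgue) \<le> A * Np p v"
      unfolding Fv A_def .
    also have "Np p v = I powr (1/p)"
    proof -
      have "cmod (v y) powr p = h n y" for y
        using c(4) p by (auto simp: vc h_def powr_mult powr_powr indicator_def)
      then show ?thesis by (simp add: Np_def I_def)
    qed
    \<comment> \<open>the ball makes \<open>I\<close> finite, so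
      \<open>I\<^bsup>1/p\<^esup>\<close> may be cancelled\<close>
    finally have le: "I \<le> A * I powr (1/p)" using I0 by (simp add: I_def[symmetric])
    show ?thesis
    proof (cases "I = 0")
      case False
      then have I: "0 < I" using I0 by simp
      have "I = I powr (1/q) * I powr (1/p)" using I pq by (simp add: powr_add[symmetric] add.commute)
      with le have "I powr (1/q) * I powr (1/p) \<le> A * I powr (1/p)" by simp
      then have "I powr (1/q) \<le> A" using I by simp
      then have "(I powr (1/q)) powr q \<le> A powr q" using c(1) by (intro powr_mono2) auto
      then show ?thesis using I c(1) by (simp add: powr_powr I_def)
    qed (simp add: I_def)
  qed
  have "(\<integral>\<^sup>+y. ennreal (cmod (?F y) powr q) \<partial>lebesgue) = (\<integral>\<^sup>+y. (SUP n. ennreal (h n y)) \<partial>lebesgue)"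
  proof (rule nn_integral_cong)
    fix y :: 'a
    obtain n0 :: nat where n0: "norm y \<le> real n0" using real_arch_simple by blast
    show "ennreal (cmod (?F y) powr q) = (SUP n. ennreal (h n y))"
    proof (rule antisym)
      show "ennreal (cmod (?F y) powr q) \<le> (SUP n. ennreal (h n y))"
        using n0 by (intro SUP_upper2[of n0]) (auto simp: h_def)
    qed (auto intro!: SUP_least ennreal_leI simp: h_def indicator_def)
  qed
  also have "\<dots> = (SUP n. \<integral>\<^sup>+y. ennreal (h n y) \<partial>lebesgue)"
    using hm by (intro nn_integral_monotone_convergence_SUP)
       (auto simp: incseq_def le_fun_def h_def indicator_def intro!: ennreal_leI)
  also have "\<dots> \<le> ennreal (A powr q)"
  proof (rule SUP_least)
    fix n
    have "(\<integral>\<^sup>+y. ennreal (h n y) \<partial>lebesgue) = ennreal (\<integral>y. h n y \<partial>lebesgue)"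
      by (intro nn_integral_eq_integral hi) (simp add: h_def)
    then show "(\<integral>\<^sup>+y. ennreal (h n y) \<partial>lebesgue) \<le> ennreal (A powr q)"
      using In[of n] by (simp add: ennreal_leI)
  qed
  finally show ?thesis by (simp add: A_def)
qed

section \<open>Linear change of variables\<close>

text \<open>Lebesgue measure is determined by its values on boxes.\<close>

lemma lborel_invariantI:
  fixes T :: "real^'n \<Rightarrow> real^'n"
  assumes T: "linear T" "inj T"
    and im: "\<And>a b. measure lebesgue (T ` cbox a b) = measure lebesgue (cbox a b)"
  shows "distr lborel borel T = lborel"
proof -
  have bT: "bij T" using T linear_inj_imp_surj by (auto simp: bij_def)
  define S where "S = inv T"
  have S: "linear S" unfolding S_def using T linear_injective_isomorphism
    by (metis bT bij_is_surj inj_linear_imp_inv_linear)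
  have TS: "T (S x) = x" "S (T x) = x" for x
    unfolding S_def using bT by (simp_all add: bij_is_surj surj_f_inv_f bij_is_inj)
  have Tc: "continuous_on UNIV T" using T by (simp add: linear_continuous_on linear_linear)
  then have [measurable]: "T \<in> borel_measurable borel" by (rule borel_measurable_continuous_onI)
  have pre: "T -` A = S ` A" for A using TS by (auto simp: image_iff) metis
  show ?thesis
  proof (rule lborel_eqI[symmetric])
    fix l u :: "real^'n" assume lu: "\<And>b. b \<in> Basis \<Longrightarrow> l \<bullet> b \<le> u \<bullet> b"
    have op: "open (T -` box l u)" by (rule open_vimage[OF open_box Tc])
    have bd: "bounded (T -` box l u)" unfolding pre
      using S by (simp add: bounded_linear_image linear_linear)
    have lm: "T -` box l u \<in> lmeasurable" by (rule lmeasurable_open[OF bd op])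
    have "measure lebesgue (T ` (T -` box l u)) = 1 * measure lebesgue (T -` box l u)"
      using measure_linear_sufficient[OF T(1) lm, of 1] im by simp
    moreover have "T ` (T -` box l u) = box l u" using bT by (simp add: bij_is_surj)
    ultimately have "measure lebesgue (T -` box l u) = measure lebesgue (box l u)" by simp
    then have "emeasure lebesgue (T -` box l u) = emeasure lebesgue (box l u)"
      using lm by (simp add: emeasure_eq_measure2)
    then show "emeasure (distr lborel borel T) (box l u) = (\<Prod>b\<in>Basis. (u - l) \<bullet> b)"
      using op lu by (simp add: emeasure_distr)
  qed simp
qed

lemma lborel_swap_coordinates:
  fixes m n :: "'n::finite"
  shows "distr lborel borel (\<lambda>x::real^'n. \<chi> i. x $ Transposition.transpose m n i) = lborel" (is "distr _ _ ?T = _")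
proof (rule lborel_invariantI)
  let ?\<tau> = "Transposition.transpose m n"
  show "linear ?T" by (auto simp: linear_iff vec_eq_iff)
  have inv: "?T (?T x) = x" for x by (simp add: vec_eq_iff)
  then show "inj ?T" by (rule inj_on_inverseI)
  fix a b :: "real^'n"
  have img: "?T ` cbox a b = cbox (?T a) (?T b)"
  proof (intro equalityI subsetI)
    fix y assume "y \<in> cbox (?T a) (?T b)"
    then have "?T y \<in> cbox a b"
      unfolding mem_box_cart by (metis transpose_involutory vec_lambda_beta)
    then show "y \<in> ?T ` cbox a b" by (metis inv imageI)
  qed (auto simp: mem_box_cart)
  show "measure lebesgue (?T ` cbox a b) = measure lebesgue (cbox a b)"
  proof (cases "cbox a b = {}")
    case False
    then have ne: "cbox (?T a) (?T b) \<noteq> {}" using img by auto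
    have "(\<Prod>i\<in>UNIV. b $ ?\<tau> i - a $ ?\<tau> i) = (\<Prod>i\<in>UNIV. b $ i - a $ i)"
      by (rule prod.reindex_bij_betw[of ?\<tau> UNIV UNIV "\<lambda>i. b $ i - a $ i"]) simp
    then show ?thesis
      unfolding img using content_cbox_cart[OF ne] content_cbox_cart[OF False] by simp
  qed simp
qed

lemma lborel_shear:
  fixes m n :: "'n::finite"
  assumes mn: "m \<noteq> n"
  shows "distr lborel borel (\<lambda>x::real^'n. \<chi> i. if i = m then x $ m + x $ n else x $ i) = lborel" (is "distr _ _ ?T = _")
proof (rule lborel_invariantI)
  show lin: "linear ?T" by (auto simp: linear_iff vec_eq_iff algebra_simps)
  show "inj ?T"
  proof (rule injI)
    fix x y :: "real^'n" assume "?T x = ?T y"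
    then have e: "(if i = m then x $ m + x $ n else x $ i) = (if i = m then y $ m + y $ n else y $ i)" for i
      by (simp add: vec_eq_iff)
    have "x $ n = y $ n" using e[of n] mn by simp
    then show "x = y" using e by (auto simp: vec_eq_iff split: if_splits) (metis add_right_cancel)
  qed
  fix a b :: "real^'n"
  \<comment> \<open>translating by \<open>c\<close> makes the \<open>n\<close>-th coordinate of
    the box nonnegative\<close>
  define c :: "real^'n" where "c = (\<chi> i. \<bar>a $ n\<bar>)"
  show "measure lebesgue (?T ` cbox a b) = measure lebesgue (cbox a b)"
  proof (cases "cbox a b = {}")
    case False
    have box: "cbox (c + a) (c + b) = (+) c ` cbox a b" by (rule cbox_translation)
    have "?T ` cbox (c + a) (c + b) = (+) (?T c) ` (?T ` cbox a b)"
      unfolding box image_image using linear_add[OF lin] by simp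
    then have "measure lebesgue (?T ` cbox a b) = measure lebesgue (?T ` cbox (c + a) (c + b))"
      by (simp only: measure_translation)
    also have "\<dots> = measure lebesgue (cbox (c + a) (c + b))"
    proof (rule measure_shear_interval[OF mn])
      show "cbox (c + a) (c + b) \<noteq> {}" using False unfolding box by simp
    qed (simp add: c_def)
    also have "\<dots> = measure lebesgue (cbox a b)" unfolding box by (rule measure_translation)
    finally show ?thesis .
  qed simp
qed

text \<open>The formula is multiplicative in \<open>A\<close>, so it is enough to treat diagonal
  matrices, transpositions of coordinates and shears.\<close>

theorem nn_integral_linear_image:
  fixes A :: "real^'n^'n" and f :: "real^'n \<Rightarrow> ennreal"
  assumes "det A \<noteq> 0" "f \<in> borel_measurable borel"
  shows "ennreal \<bar>det A\<bar> * (\<integral>\<^sup>+x. f (A *v x) \<partial>lborel) = (\<integral>\<^sup>+x. f x \<partial>lborel)"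
proof -
  have mv: "(\<lambda>x. B *v x) \<in> borel_measurable borel" for B :: "real^'n^'n"
    by (intro borel_measurable_continuous_onI continuous_intros)
  have inv: "(\<integral>\<^sup>+x. f (T x) \<partial>lborel) = (\<integral>\<^sup>+x. f x \<partial>lborel)"
    if "distr lborel borel T = lborel" "T \<in> borel_measurable borel" "f \<in> borel_measurable borel"
    for T :: "real^'n \<Rightarrow> real^'n" and f :: "real^'n \<Rightarrow> ennreal"
    using nn_integral_distr[of T lborel borel f] that by simp
  have "det A \<noteq> 0 \<longrightarrow> (\<forall>f \<in> borel_measurable borel.
     ennreal \<bar>det A\<bar> * (\<integral>\<^sup>+x. f (A *v x) \<partial>lborel) = (\<integral>\<^sup>+x. f x \<partial>lborel))"
  proof (induction A rule: induct_matrix_elementary_alt)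
    case (1 A B)
    show ?case
    proof (intro impI ballI)
      fix f :: "real^'n \<Rightarrow> ennreal" assume f[measurable]: "f \<in> borel_measurable borel" and "det (A ** B) \<noteq> 0"
      then have d: "det A \<noteq> 0" "det B \<noteq> 0" by (auto simp: det_mul)
      have fA: "(\<lambda>x. f (A *v x)) \<in> borel_measurable borel" by (rule measurable_compose[OF mv f])
      have "ennreal \<bar>det (A ** B)\<bar> * (\<integral>\<^sup>+x. f ((A ** B) *v x) \<partial>lborel)
        = ennreal \<bar>det A\<bar> * (ennreal \<bar>det B\<bar> * (\<integral>\<^sup>+x. f (A *v (B *v x)) \<partial>lborel))"
        by (simp add: det_mul abs_mult ennreal_mult mult.assoc matrix_vector_mul_assoc)
      also have "\<dots> = ennreal \<bar>det A\<bar> * (\<integral>\<^sup>+x. f (A *v x) \<partial>lborel)"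
        using 1(2)[rule_format, OF d(2) fA] by simp
      also have "\<dots> = (\<integral>\<^sup>+x. f x \<partial>lborel)" by (rule 1(1)[rule_format, OF d(1) f])
      finally show "ennreal \<bar>det (A ** B)\<bar> * (\<integral>\<^sup>+x. f ((A ** B) *v x) \<partial>lborel) = (\<integral>\<^sup>+x. f x \<partial>lborel)" .
    qed
  next
    case (2 A i)
    then show ?case using det_zero_row(2)[of i A] by simp
  next
    case (3 A)
    show ?case
    proof (intro impI ballI)
      fix f :: "real^'n \<Rightarrow> ennreal" assume f[measurable]: "f \<in> borel_measurable borel" and d: "det A \<noteq> 0"
      have dA: "det A = (\<Prod>i\<in>UNIV. A $ i $ i)" using 3 by (intro det_diagonal) auto
      define c where "c = (\<lambda>e::real^'n. \<Sum>i\<in>UNIV. A $ i $ i * e $ i)"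
      have c: "c (axis i 1) = A $ i $ i" for i by (simp add: c_def axis_def if_distrib cong: if_cong)
      have c0: "c e \<noteq> 0" if "e \<in> Basis" for e
        using that d unfolding dA by (auto simp: Basis_vec_def c)
      have sumB: "(\<Sum>e\<in>Basis. h e) = (\<Sum>i\<in>UNIV. h (axis i 1))" for h :: "real^'n \<Rightarrow> real^'n"
        unfolding Basis_vec_def by (simp add: sum.reindex axis_eq_axis inj_on_def UNION_singleton_eq_range)
      have "A *v x = 0 + (\<Sum>j\<in>Basis. (c j * (x \<bullet> j)) *\<^sub>R j)" for x
      proof -
        have "(A *v x) $ i = (\<Sum>j\<in>UNIV. (A $ j $ j * x $ j) *\<^sub>R axis j 1) $ i" for i
        proof -
          have "(A *v x) $ i = (\<Sum>j\<in>UNIV. A $ i $ j * x $ j)"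
            by (simp add: matrix_vector_mult_def)
          also have "\<dots> = (\<Sum>j\<in>UNIV. if j = i then A $ i $ i * x $ i else 0)"
            using 3 by (intro sum.cong refl) auto
          also have "\<dots> = (\<Sum>j\<in>UNIV. (A $ j $ j * x $ j) *\<^sub>R axis j 1) $ i"
            by (simp add: axis_def if_distrib cong: if_cong)
          finally show ?thesis .
        qed
        then show ?thesis unfolding sumB by (simp add: vec_eq_iff c inner_axis)
      qed
      then have T: "(\<lambda>x. A *v x) = (\<lambda>x. 0 + (\<Sum>j\<in>Basis. (c j * (x \<bullet> j)) *\<^sub>R j))" by auto
      have pr: "(\<Prod>e\<in>Basis. \<bar>c e\<bar>) = \<bar>det A\<bar>"
        unfolding Basis_vec_def dA
        by (simp add: prod.reindex axis_eq_axis inj_on_def UNION_singleton_eq_range c abs_prod)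
      have L: "lborel = density (distr lborel borel (\<lambda>x. A *v x)) (\<lambda>x. ennreal \<bar>det A\<bar>)"
        using lborel_affine_euclidean[of c 0, OF c0] unfolding T pr .
      have "(\<integral>\<^sup>+x. f x \<partial>lborel) = (\<integral>\<^sup>+x. f x \<partial>density (distr lborel borel (\<lambda>x. A *v x)) (\<lambda>x. ennreal \<bar>det A\<bar>))"
        by (rule arg_cong[OF L, of "\<lambda>M. nn_integral M f"])
      also have "\<dots> = ennreal \<bar>det A\<bar> * (\<integral>\<^sup>+x. f (A *v x) \<partial>lborel)"
        using mv by (subst nn_integral_density) (auto simp: nn_integral_cmult nn_integral_distr)
      finally show "ennreal \<bar>det A\<bar> * (\<integral>\<^sup>+x. f (A *v x) \<partial>lborel) = (\<integral>\<^sup>+x. f x \<partial>lborel)" ..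
    qed
  next
    case (4 m n)
    let ?A = "(\<chi> i j. mat 1 $ i $ Transposition.transpose m n j) :: real^'n^'n"
    have A: "?A *v x = (\<chi> i. x $ Transposition.transpose m n i)" for x :: "real^'n"
    proof -
      have e: "(i = Transposition.transpose m n j) = (Transposition.transpose m n i = j)" for i j
        by (metis transpose_involutory)
      have "(\<Sum>j\<in>UNIV. (if i = Transposition.transpose m n j then 1 else 0) * x $ j)
          = (\<Sum>j\<in>UNIV. if Transposition.transpose m n i = j then x $ j else 0)" for i
        by (intro sum.cong refl) (auto simp: e)
      then show ?thesis by (simp add: vec_eq_iff matrix_vector_mult_def mat_def)
    qed
    have "\<bar>det ?A\<bar> = 1"
      by (subst det_permute_columns) (auto simp: permutes_swap_id abs_mult sign_def)
    then show ?case using inv[OF lborel_swap_coordinates] mv[of ?A] by (simp add: A)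
  next
    case (5 m n)
    let ?A = "(\<chi> i j. of_bool (i = m \<and> j = n \<or> i = j)) :: real^'n^'n"
    have A: "?A *v x = (\<chi> i. if i = m then x $ m + x $ n else x $ i)" for x :: "real^'n"
    proof -
      have "(\<Sum>j\<in>UNIV. of_bool (i = m \<and> j = n \<or> i = j) * x $ j) =
         (\<Sum>j\<in>UNIV. (if j = i then x $ j else 0) + (if i = m \<and> j = n then x $ j else 0))" for i
        using 5 by (intro sum.cong) auto
      then show ?thesis
        by (auto simp: vec_eq_iff matrix_vector_mult_def sum.distrib)
    qed
    have "?A = (\<chi> k. if k = m then row m (mat 1) + 1 *s row n (mat 1) else row k (mat 1))"
      using 5 by (auto simp: vec_eq_iff row_def mat_def)
    then have "det ?A = det (mat 1 :: real^'n^'n)"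
      using det_row_operation[OF 5, of "mat 1 :: real^'n^'n" 1] by (simp only:)
    then have d: "\<bar>det ?A\<bar> = 1" by simp
    have e: "(\<lambda>x. ?A *v x) = (\<lambda>x. \<chi> i. if i = m then x $ m + x $ n else x $ i)" by (rule ext) (rule A)
    show ?case
    proof (intro impI ballI)
      fix f :: "real^'n \<Rightarrow> ennreal" assume f: "f \<in> borel_measurable borel"
      have "(\<integral>\<^sup>+x. f (?A *v x) \<partial>lborel) = (\<integral>\<^sup>+x. f x \<partial>lborel)"
        unfolding A by (rule inv[OF lborel_shear[OF 5] mv[of ?A, unfolded e] f])
      then show "ennreal \<bar>det ?A\<bar> * (\<integral>\<^sup>+x. f (?A *v x) \<partial>lborel) = (\<integral>\<^sup>+x. f x \<partial>lborel)"
        by (simp only: d ennreal_1 mult_1)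
    qed
  qed
  from this[rule_format, OF assms] show ?thesis .
qed

section \<open>Matrix exponentials and positive definite matrices\<close>

definition mat_pow :: "real^'m^'m \<Rightarrow> nat \<Rightarrow> real^'m^'m" where
  "mat_pow A k = ((**) A ^^ k) (mat 1)"

lemma mat_pow_0 [simp]: "mat_pow A 0 = mat 1"
  and mat_pow_Suc: "mat_pow A (Suc k) = A ** mat_pow A k"
  by (simp_all add: mat_pow_def)

lemma mat_pow_commute: "mat_pow A k ** A = A ** mat_pow A k"
  by (induction k) (simp_all add: mat_pow_Suc matrix_mul_assoc[symmetric])

lemma mat_pow_scaleR: "mat_pow (t *\<^sub>R A) k = t ^ k *\<^sub>R mat_pow A k" for A :: "real^'m^'m"
  proof (induction k)
  case (Suc k)
  have "(t *\<^sub>R A) ** (c *\<^sub>R C) = (t * c) *\<^sub>R (A ** C)" for c and C :: "real^'m^'m"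
    by (simp add: vec_eq_iff matrix_matrix_mult_def sum_distrib_left mult_ac)
  then show ?case by (simp add: mat_pow_Suc Suc.IH)
qed simp

lemma transpose_mat_pow: "transpose (mat_pow A k) = mat_pow (transpose A) k"
  by (induction k) (simp_all add: mat_pow_Suc matrix_transpose_mul mat_pow_commute)

lemma mat_pow_bound:
  fixes A :: "real^'m^'m"
  shows "\<bar>mat_pow A k $ i $ j\<bar> \<le> (\<Sum>i\<in>UNIV. \<Sum>j\<in>UNIV. \<bar>A $ i $ j\<bar>) ^ k"
proof (induction k arbitrary: i j)
  case 0 then show ?case by (simp add: mat_def)
next
  case (Suc k)
  let ?N = "\<Sum>i\<in>UNIV. \<Sum>j\<in>UNIV. \<bar>A $ i $ j\<bar>"
  have "\<bar>mat_pow A (Suc k) $ i $ j\<bar> = \<bar>\<Sum>l\<in>UNIV. A $ i $ l * mat_pow A k $ l $ j\<bar>"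
    by (simp add: mat_pow_Suc matrix_matrix_mult_def)
  also have "\<dots> \<le> (\<Sum>l\<in>UNIV. \<bar>A $ i $ l\<bar> * ?N ^ k)"
    by (rule order_trans[OF sum_abs sum_mono]) (simp add: abs_mult mult_left_mono Suc.IH)
  also have "\<dots> = (\<Sum>l\<in>UNIV. \<bar>A $ i $ l\<bar>) * ?N ^ k" by (simp add: sum_distrib_right)
  also have "\<dots> \<le> ?N * ?N ^ k"
    by (intro mult_right_mono member_le_sum[of i UNIV "\<lambda>i. \<Sum>l\<in>UNIV. \<bar>A $ i $ l\<bar>"] sum_nonneg zero_le_power) auto
  finally show ?case by simp
qed

lemma mat_exp_entry_summable:
  fixes A :: "real^'m^'m" and t :: real
  shows "summable (\<lambda>k. mat_pow A k $ i $ j / fact k * t ^ k)"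
proof (rule summable_comparison_test')
  let ?N = "\<Sum>i\<in>UNIV. \<Sum>j\<in>UNIV. \<bar>A $ i $ j\<bar>"
  show "summable (\<lambda>k. inverse (fact k) * (?N * \<bar>t\<bar>) ^ k)" by (rule summable_exp)
  fix k :: nat
  have "norm (mat_pow A k $ i $ j / fact k * t ^ k) = inverse (fact k) * (\<bar>mat_pow A k $ i $ j\<bar> * \<bar>t\<bar> ^ k)"
    by (simp add: abs_mult power_abs divide_inverse)
  also have "\<dots> \<le> inverse (fact k) * (?N ^ k * \<bar>t\<bar> ^ k)"
    by (intro mult_left_mono mult_right_mono mat_pow_bound) auto
  finally show "norm (mat_pow A k $ i $ j / fact k * t ^ k) \<le> inverse (fact k) * (?N * \<bar>t\<bar>) ^ k"
    by (simp add: power_mult_distrib)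
qed

lemma mat_exp_nth:
  fixes A :: "real^'m^'m"
  shows "mat_exp (t *\<^sub>R A) $ i $ j = (\<Sum>k. mat_pow A k $ i $ j / fact k * t ^ k)"
proof -
  let ?X = "\<chi> i j. (\<Sum>k. mat_pow A k $ i $ j / fact k * t ^ k)"
  have "(\<lambda>k. (1 / fact k) *\<^sub>R mat_pow (t *\<^sub>R A) k) sums ?X"
    unfolding sums_def
  proof (rule vec_tendstoI, rule vec_tendstoI)
    fix i j
    have "(\<Sum>k<n. (1 / fact k) *\<^sub>R mat_pow (t *\<^sub>R A) k) $ i $ j = (\<Sum>k<n. mat_pow A k $ i $ j / fact k * t ^ k)" for n
      by (simp add: mat_pow_scaleR mult_ac)
    then show "(\<lambda>n. (\<Sum>k<n. (1 / fact k) *\<^sub>R mat_pow (t *\<^sub>R A) k) $ i $ j) \<longlonglongrightarrow> ?X $ i $ j"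
      using summable_LIMSEQ[OF mat_exp_entry_summable[of A i j t]] by simp
  qed
  then have "mat_exp (t *\<^sub>R A) = ?X"
    unfolding mat_exp_def mat_pow_def[symmetric] by (rule sums_unique[symmetric])
  then show ?thesis by simp
qed

lemma transpose_mat_exp: "transpose (mat_exp (t *\<^sub>R A)) = mat_exp (t *\<^sub>R transpose A)" for A :: "real^'m^'m"
proof -
  have "transpose M $ i $ j = M $ j $ i" for M :: "real^'m^'m" and i j by (simp add: transpose_def)
  then show ?thesis by (simp add: vec_eq_iff mat_exp_nth transpose_mat_pow[symmetric])
qed

lemma mat_exp_entry_deriv:
  fixes A :: "real^'m^'m"
  shows "((\<lambda>t. mat_exp (t *\<^sub>R A) $ i $ j) has_field_derivative (\<Sum>l\<in>UNIV. A $ i $ l * mat_exp (t *\<^sub>R A) $ l $ j)) (at t)"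
proof -
  let ?c = "\<lambda>k. mat_pow A k $ i $ j / fact k"
  have d: "diffs ?c k * t ^ k = (\<Sum>l\<in>UNIV. A $ i $ l * (mat_pow A k $ l $ j / fact k * t ^ k))" for k
  proof -
    have "diffs ?c k = mat_pow A (Suc k) $ i $ j / fact k"
      by (simp add: diffs_def field_simps del: of_nat_Suc)
    then show ?thesis
      by (simp add: mat_pow_Suc matrix_matrix_mult_def sum_divide_distrib sum_distrib_right mult.assoc)
  qed
  have "((\<lambda>t. \<Sum>k. ?c k * t ^ k) has_field_derivative (\<Sum>k. diffs ?c k * t ^ k)) (at t)"
    by (rule termdiffs_strong_converges_everywhere) (rule mat_exp_entry_summable)
  also have "(\<Sum>k. diffs ?c k * t ^ k) = (\<Sum>l\<in>UNIV. A $ i $ l * mat_exp (t *\<^sub>R A) $ l $ j)"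
    unfolding d mat_exp_nth
    by (subst suminf_sum[OF summable_mult[OF mat_exp_entry_summable]])
       (intro sum.cong refl suminf_mult mat_exp_entry_summable)
  finally show ?thesis unfolding mat_exp_nth .
qed

lemma has_field_derivative_prod_remove:
  fixes f :: "'i \<Rightarrow> real \<Rightarrow> real"
  assumes "finite S" "\<And>i. i \<in> S \<Longrightarrow> (f i has_field_derivative f' i) (at t)"
  shows "((\<lambda>t. \<Prod>i\<in>S. f i t) has_field_derivative (\<Sum>i\<in>S. f' i * (\<Prod>j\<in>S - {i}. f j t))) (at t)"
  using assms
proof (induction S rule: finite_induct)
  case (insert k S)
  have "((\<lambda>t. f k t * (\<Prod>i\<in>S. f i t)) has_field_derivative
     f' k * (\<Prod>i\<in>S. f i t) + (\<Sum>i\<in>S. f' i * (\<Prod>j\<in>S - {i}. f j t)) * f k t) (at t)"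
    using insert by (intro DERIV_mult) auto
  moreover have "(\<Sum>i\<in>S. f' i * (\<Prod>j\<in>insert k S - {i}. f j t)) = (\<Sum>i\<in>S. f' i * (\<Prod>j\<in>S - {i}. f j t)) * f k t"
    unfolding sum_distrib_right
  proof (rule sum.cong[OF refl])
    fix i assume "i \<in> S"
    then have "insert k S - {i} = insert k (S - {i})" using insert by auto
    then show "f' i * (\<Prod>j\<in>insert k S - {i}. f j t) = f' i * (\<Prod>j\<in>S - {i}. f j t) * f k t"
      using insert by (simp add: mult_ac)
  qed
  ultimately show ?case using insert.hyps by simp
qed simp

text \<open>The Leibniz rule, one row at a time.\<close>

lemma det_has_field_derivative:
  fixes X :: "real \<Rightarrow> real^'m^'m"
  assumes "\<And>i j. ((\<lambda>t. X t $ i $ j) has_field_derivative X' $ i $ j) (at t)"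
  shows "((\<lambda>t. det (X t)) has_field_derivative (\<Sum>i\<in>UNIV. det (\<chi> r. if r = i then X' $ i else X t $ r))) (at t)"
proof -
  let ?P = "{p. p permutes (UNIV :: 'm set)}"
  have "((\<lambda>t. det (X t)) has_field_derivative
     (\<Sum>p\<in>?P. of_int (sign p) * (\<Sum>i\<in>UNIV. X' $ i $ p i * (\<Prod>j\<in>UNIV - {i}. X t $ j $ p j)))) (at t)"
    unfolding det_def by (intro DERIV_sum DERIV_cmult has_field_derivative_prod_remove assms) auto
  also have "(\<Sum>p\<in>?P. of_int (sign p) * (\<Sum>i\<in>UNIV. X' $ i $ p i * (\<Prod>j\<in>UNIV - {i}. X t $ j $ p j)))
    = (\<Sum>i\<in>UNIV. \<Sum>p\<in>?P. of_int (sign p) * (X' $ i $ p i * (\<Prod>j\<in>UNIV - {i}. X t $ j $ p j)))"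
    unfolding sum_distrib_left by (rule sum.swap)
  also have "\<dots> = (\<Sum>i\<in>UNIV. det (\<chi> r. if r = i then X' $ i else X t $ r))"
    unfolding det_def
  proof (intro sum.cong refl arg_cong2[where f="(*)"])
    fix i :: 'm and p
    show "X' $ i $ p i * (\<Prod>j\<in>UNIV - {i}. X t $ j $ p j) = (\<Prod>r\<in>UNIV. (\<chi> r. if r = i then X' $ i else X t $ r) $ r $ p r)"
      by (subst prod.remove[of UNIV i]) (auto intro!: prod.cong)
  qed
  finally show ?thesis .
qed

text \<open>Jacobi's formula. In \<open>X' = B X\<close> the \<open>i\<close>-th row is a
  combination of the rows of \<open>X\<close>, so replacing the \<open>i\<close>-th row of
  \<open>X\<close> by it multiplies the determinant by \<open>B\<^sub>i\<^sub>i\<close>. Thus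
  \<open>det X\<close> solves \<open>d' = (tr B) d\<close>.\<close>

theorem det_mat_exp:
  fixes B :: "real^'m^'m"
  shows "det (mat_exp (t *\<^sub>R B)) = exp (t * trace B)"
proof -
  let ?X = "\<lambda>t. mat_exp (t *\<^sub>R B)"
  have D: "((\<lambda>t. det (?X t)) has_field_derivative trace B * det (?X t)) (at t)" for t
  proof -
    let ?X' = "B ** ?X t"
    have "((\<lambda>t. det (?X t)) has_field_derivative (\<Sum>i\<in>UNIV. det (\<chi> r. if r = i then ?X' $ i else ?X t $ r))) (at t)"
      by (rule det_has_field_derivative) (use mat_exp_entry_deriv in \<open>simp add: matrix_matrix_mult_def\<close>)
    also have "(\<Sum>i\<in>UNIV. det (\<chi> r. if r = i then ?X' $ i else ?X t $ r)) = (\<Sum>i\<in>UNIV. B $ i $ i * det (?X t))"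
    proof (rule sum.cong[OF refl])
      fix i :: 'm
      have "?X' $ i = (\<Sum>l\<in>UNIV. B $ i $ l *s row l (?X t))"
        by (simp add: vec_eq_iff matrix_matrix_mult_def row_def)
      then have "(\<chi> r. if r = i then ?X' $ i else ?X t $ r)
        = (\<chi> r. if r = i then \<Sum>l\<in>UNIV. B $ i $ l *s row l (?X t) else row r (?X t))"
        by (simp add: vec_eq_iff row_def)
      then show "det (\<chi> r. if r = i then ?X' $ i else ?X t $ r) = B $ i $ i * det (?X t)"
        using cramer_lemma_transpose[of i "B $ i" "?X t"] by simp
    qed
    also have "\<dots> = trace B * det (?X t)" by (simp add: trace_def sum_distrib_right)
    finally show ?thesis .
  qed
  have "((\<lambda>t. det (?X t) * exp (- (t * trace B))) has_field_derivative 0) (at t)" for t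
    by (rule derivative_eq_intros D refl | simp)+
  then have "det (?X t) * exp (- (t * trace B)) = det (?X 0) * exp (- (0 * trace B))"
    by (intro DERIV_isconst_all[of "\<lambda>t. det (?X t) * exp (- (t * trace B))"] allI)
  moreover have "?X 0 = mat 1"
    unfolding vec_eq_iff mat_exp_nth
  proof (intro allI)
    fix i j
    have "(\<lambda>k. mat_pow B k $ i $ j / fact k * 0 ^ k) sums (mat_pow B 0 $ i $ j / fact 0 * 0 ^ 0)"
      using powser_sums_zero[of "\<lambda>k. mat_pow B k $ i $ j / fact k"] by simp
    then show "(\<Sum>k. mat_pow B k $ i $ j / fact k * 0 ^ k) = mat 1 $ i $ j" by (simp add: sums_iff)
  qed
  ultimately have "det (?X t) * exp (- (t * trace B)) = 1" by simp
  then show ?thesis by (simp add: exp_minus field_simps)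
qed

text \<open>The integrand is symmetric at every time. If it fails to be integrable, the integral
  is \<open>0\<close> by convention and the claim still holds.\<close>

lemma symmetric_Qt:
  fixes Q B :: "real^'m^'m"
  assumes "transpose Q = Q" shows "transpose (Qt Q B t) = Qt Q B t"
proof -
  let ?f = "\<lambda>s. mat_exp (s *\<^sub>R B) ** Q ** mat_exp (s *\<^sub>R transpose B)"
  have l: "bounded_linear (transpose :: real^'m^'m \<Rightarrow> _)"
    by (intro linear_conv_bounded_linear[THEN iffD1] linearI) (auto simp: transpose_def vec_eq_iff)
  have tf: "transpose \<circ> ?f = ?f"
    by (auto simp: fun_eq_iff matrix_transpose_mul transpose_mat_exp assms matrix_mul_assoc)
  show ?thesis
  proof (cases "?f integrable_on {0..t}")
    case True
    then show ?thesis using integral_linear[OF True l] unfolding tf Qt_def by simp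
  next
    case False
    then show ?thesis by (simp add: Qt_def not_integrable_integral transpose_def vec_eq_iff)
  qed
qed

text \<open>No matrix on the segment from the identity to \<open>A\<close> is singular, so the
  determinant keeps its sign along it.\<close>

lemma pos_def_det_pos:
  fixes A :: "real^'m^'m"
  assumes A: "pos_def A" shows "0 < det A"
proof -
  define M where "M = (\<lambda>s::real. (1 - s) *\<^sub>R mat 1 + s *\<^sub>R A)"
  have nz: "det (M s) \<noteq> 0" if s: "0 \<le> s" "s \<le> 1" for s
  proof -
    have "x = 0" if x: "M s *v x = 0" for x
    proof (rule ccontr)
      assume x0: "x \<noteq> 0"
      have "0 = (M s *v x) \<bullet> x" by (simp add: x)
      also have "\<dots> = (1 - s) * (x \<bullet> x) + s * ((A *v x) \<bullet> x)"
        by (simp add: M_def matrix_vector_mult_add_rdistrib inner_add_left scaleR_matrix_vector_assoc[symmetric])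
      also have "\<dots> > 0"
      proof (cases "s = 0")
        case False
        then have "0 < s * ((A *v x) \<bullet> x)" using A x0 s by (simp add: pos_def_def)
        then show ?thesis using s by (intro add_nonneg_pos) auto
      qed (use x0 in simp)
      finally show False by simp
    qed
    then have "invertible (M s)"
      using matrix_left_invertible_ker[of "M s"] invertible_left_inverse by blast
    then show ?thesis by (simp add: invertible_det_nz)
  qed
  have cont: "continuous_on {0..1} (\<lambda>s. det (M s))"
    unfolding det_def M_def by (intro continuous_intros)
  have M1: "M 1 = A" and M0: "det (M 0) = 1" by (auto simp: M_def)
  show ?thesis
  proof (rule ccontr)
    assume "\<not> 0 < det A"
    then have "det (M 1) \<le> 0" "0 \<le> det (M 0)" using M0 M1 by auto
    then obtain s where "0 \<le> s" "s \<le> 1" "det (M s) = 0"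
      using IVT2'[of "\<lambda>s. det (M s)" 1 0 0] cont by auto
    then show False using nz by blast
  qed
qed

lemma symmetric_matrix_inv:
  fixes A :: "real^'m^'m"
  assumes "transpose A = A" "det A \<noteq> 0"
  shows "transpose (matrix_inv A) = matrix_inv A" "det (matrix_inv A) = 1 / det A"
proof -
  have inv: "invertible A" using assms by (simp add: invertible_det_nz)
  have AI: "A ** matrix_inv A = mat 1" "matrix_inv A ** A = mat 1"
    using someI_ex[OF inv[unfolded invertible_def]] unfolding matrix_inv_def by auto
  have "transpose (matrix_inv A) ** A = mat 1"
    using AI(1) matrix_transpose_mul[of A "matrix_inv A"] assms by simp
  then have "transpose (matrix_inv A) ** A ** matrix_inv A = matrix_inv A" by simp
  then show "transpose (matrix_inv A) = matrix_inv A"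
    by (simp add: matrix_mul_assoc[symmetric] AI)
  have "det A * det (matrix_inv A) = 1" using det_mul[of A "matrix_inv A"] AI by simp
  then show "det (matrix_inv A) = 1 / det A" using assms by (simp add: field_simps)
qed

section \<open>Schwartz functions of Gaussian type\<close>

inductive cpoly :: "(real^'m \<Rightarrow> complex) \<Rightarrow> bool" where
  cpoly_const: "cpoly (\<lambda>x. c)"
| cpoly_coord: "cpoly (\<lambda>x. of_real (x $ i))"
| cpoly_add: "cpoly f \<Longrightarrow> cpoly g \<Longrightarrow> cpoly (\<lambda>x. f x + g x)"
| cpoly_mult: "cpoly f \<Longrightarrow> cpoly g \<Longrightarrow> cpoly (\<lambda>x. f x * g x)"

lemma cpoly_sum: "finite I \<Longrightarrow> (\<And>i. i \<in> I \<Longrightarrow> cpoly (f i)) \<Longrightarrow> cpoly (\<lambda>x. \<Sum>i\<in>I. f i x)"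
  by (induction I rule: finite_induct) (auto intro: cpoly.intros)

lemma cpoly_inner: "cpoly (\<lambda>x. of_real (\<theta> \<bullet> x))"
proof -
  have e: "(\<lambda>x. complex_of_real (\<theta> \<bullet> x)) = (\<lambda>x. \<Sum>i\<in>UNIV. of_real (\<theta> $ i) * of_real (x $ i))"
    by (simp add: inner_vec_def)
  show ?thesis unfolding e by (intro cpoly_sum cpoly.intros) auto
qed

lemma cpoly_quadratic: "cpoly (\<lambda>x. of_real ((A *v x) \<bullet> x))" for A :: "real^'m^'m"
proof -
  have e: "(\<lambda>x. complex_of_real ((A *v x) \<bullet> x)) = (\<lambda>x. \<Sum>i\<in>UNIV. (\<Sum>j\<in>UNIV. of_real (A $ i $ j) * of_real (x $ j)) * of_real (x $ i))"
    by (simp add: inner_vec_def matrix_vector_mult_def)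
  show ?thesis unfolding e by (intro cpoly_sum cpoly.intros) auto
qed

lemma cpoly_norm_square: "cpoly (\<lambda>x. of_real ((norm x)\<^sup>2))"
  using cpoly_quadratic[of "mat 1"] by (simp add: power2_norm_eq_inner)

lemma cpoly_differentiable: "cpoly f \<Longrightarrow> f differentiable (at x)"
proof (induction rule: cpoly.induct)
  case (cpoly_coord i)
  have "bounded_linear (\<lambda>x::real^'a. complex_of_real (x $ i))"
    by (intro bounded_linear_compose[OF bounded_linear_of_real] bounded_linear_vec_nth)
  then show ?case using bounded_linear_imp_differentiable by blast
qed (auto intro: differentiable_add differentiable_mult)

lemma partial_derivI:
  "((\<lambda>s. f (x + s *\<^sub>R axis j 1)) has_vector_derivative d) (at 0) \<Longrightarrow> partial_deriv j f x = d"
  unfolding partial_deriv_def by (rule vector_derivative_at)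

lemma differentiable_partial:
  fixes f :: "real^'m \<Rightarrow> complex"
  assumes "f differentiable (at x)"
  shows "((\<lambda>s. f (x + s *\<^sub>R axis j 1)) has_vector_derivative partial_deriv j f x) (at 0)"
proof -
  have "(\<lambda>s. f (x + s *\<^sub>R axis j 1)) differentiable (at 0)"
  proof (rule differentiable_chain_at[of "\<lambda>s. x + s *\<^sub>R axis j 1" 0 f, unfolded o_def])
    show "(\<lambda>s. x + s *\<^sub>R axis j (1::real)) differentiable (at 0)"
      by (auto intro!: derivative_intros)
    show "f differentiable (at (x + 0 *\<^sub>R axis j 1))" using assms by simp
  qed
  then show ?thesis unfolding partial_deriv_def by (simp add: vector_derivative_works)
qed

lemma partial_deriv_add:
  assumes "f differentiable (at x)" "g differentiable (at x)"
  shows "partial_deriv j (\<lambda>x. f x + g x) x = partial_deriv j f x + partial_deriv j g x"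
  by (intro partial_derivI has_vector_derivative_add differentiable_partial assms)

lemma partial_deriv_mult:
  assumes "f differentiable (at x)" "g differentiable (at x)"
  shows "partial_deriv j (\<lambda>x. f x * g x) x = f x * partial_deriv j g x + partial_deriv j f x * g x"
  using has_vector_derivative_mult[OF differentiable_partial[OF assms(1)] differentiable_partial[OF assms(2)]]
  by (intro partial_derivI) simp

lemma partial_deriv_exp:
  assumes "f differentiable (at x)"
  shows "partial_deriv j (\<lambda>x. exp (f x)) x = partial_deriv j f x * exp (f x)"
proof (rule partial_derivI)
  have "(exp has_field_derivative exp (f x)) (at (f (x + 0 *\<^sub>R axis j 1)))" by (auto intro!: derivative_eq_intros)
  from field_vector_diff_chain_at[OF differentiable_partial[OF assms] this]
  show "((\<lambda>s. exp (f (x + s *\<^sub>R axis j 1))) has_vector_derivative partial_deriv j f x * exp (f x)) (at 0)"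
    by (simp add: o_def)
qed

lemma cpoly_partial_deriv: "cpoly f \<Longrightarrow> cpoly (partial_deriv j f)"
proof (induction rule: cpoly.induct)
  case (cpoly_const c)
  have "partial_deriv j (\<lambda>x. c) = (\<lambda>x. 0)" by (intro ext partial_derivI) simp
  then show ?case by (simp add: cpoly.cpoly_const)
next
  case (cpoly_coord i)
  have "partial_deriv j (\<lambda>x. complex_of_real (x $ i)) = (\<lambda>x. of_real (axis j 1 $ i))"
  proof (intro ext partial_derivI)
    fix x :: "real^'a"
    have "((\<lambda>s. (x + s *\<^sub>R axis j 1) $ i) has_vector_derivative axis j 1 $ i) (at 0)"
      by (auto intro!: derivative_eq_intros)
    then show "((\<lambda>s. complex_of_real ((x + s *\<^sub>R axis j 1) $ i)) has_vector_derivative of_real (axis j 1 $ i)) (at 0)"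
      by (rule bounded_linear.has_vector_derivative[OF bounded_linear_of_real])
  qed
  then show ?case by (simp only: cpoly.cpoly_const)
next
  case (cpoly_add f g)
  have "partial_deriv j (\<lambda>x. f x + g x) = (\<lambda>x. partial_deriv j f x + partial_deriv j g x)"
    by (intro ext partial_deriv_add cpoly_differentiable cpoly_add.hyps)
  then show ?case using cpoly_add.IH by (simp add: cpoly.cpoly_add)
next
  case (cpoly_mult f g)
  have "partial_deriv j (\<lambda>x. f x * g x) = (\<lambda>x. f x * partial_deriv j g x + partial_deriv j f x * g x)"
    by (intro ext partial_deriv_mult cpoly_differentiable cpoly_mult.hyps)
  then show ?case using cpoly_mult by (simp add: cpoly.intros)
qed

lemma cpoly_growth:
  fixes f :: "real^'m \<Rightarrow> complex"
  shows "cpoly f \<Longrightarrow> \<exists>C k. 0 \<le> C \<and> (\<forall>x. cmod (f x) \<le> C * (1 + norm x) ^ k)"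
proof (induction rule: cpoly.induct)
  case (cpoly_const c)
  show ?case by (rule exI[of _ "cmod c"], rule exI[of _ 0]) simp
next
  case (cpoly_coord i)
  show ?case
  proof (rule exI[of _ 1], rule exI[of _ 1], intro conjI allI)
    show "cmod (complex_of_real (x $ i)) \<le> 1 * (1 + norm x) ^ 1" for x :: "real^'m"
      using component_le_norm_cart[of x i] by simp
  qed simp
next
  case (cpoly_add f g)
  then obtain C k D l where C: "0 \<le> C" "\<And>x. cmod (f x) \<le> C * (1 + norm x) ^ k"
    and D: "0 \<le> D" "\<And>x. cmod (g x) \<le> D * (1 + norm x) ^ l" by blast
  show ?case
  proof (rule exI[of _ "C + D"], rule exI[of _ "k + l"], intro conjI allI)
    fix x :: "real^'m"
    have "C * (1 + norm x) ^ k \<le> C * (1 + norm x) ^ (k + l)" "D * (1 + norm x) ^ l \<le> D * (1 + norm x) ^ (k + l)"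
      using C(1) D(1) by (auto intro!: mult_left_mono power_increasing)
    then show "cmod (f x + g x) \<le> (C + D) * (1 + norm x) ^ (k + l)"
      using C(2)[of x] D(2)[of x] norm_triangle_ineq[of "f x" "g x"] by (simp add: distrib_right)
  qed (use C D in simp)
next
  case (cpoly_mult f g)
  then obtain C k D l where C: "0 \<le> C" "\<And>x. cmod (f x) \<le> C * (1 + norm x) ^ k"
    and D: "0 \<le> D" "\<And>x. cmod (g x) \<le> D * (1 + norm x) ^ l" by blast
  show ?case
  proof (rule exI[of _ "C * D"], rule exI[of _ "k + l"], intro conjI allI)
    fix x :: "real^'m"
    have "cmod (f x) * cmod (g x) \<le> (C * (1 + norm x) ^ k) * (D * (1 + norm x) ^ l)"
      using C D by (intro mult_mono) auto
    then show "cmod (f x * g x) \<le> C * D * (1 + norm x) ^ (k + l)"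
      by (simp add: norm_mult power_add mult_ac)
  qed (use C D in simp)
qed

lemma power_exp_neg_bounded:
  fixes c :: real assumes "0 < c"
  obtains K where "\<And>r. 0 \<le> r \<Longrightarrow> (1 + r) ^ k * exp (- c * r\<^sup>2) \<le> K"
proof
  fix r :: real assume r: "0 \<le> r"
  have "(1 + r) ^ k / fact k \<le> exp (1 + r)"
    using sum_le_suminf[of "\<lambda>n. (1 + r) ^ n /\<^sub>R fact n" "{k}"] exp_converges[of "1 + r"] r
    by (simp add: sums_iff divide_inverse mult.commute)
  then have "(1 + r) ^ k * exp (- c * r\<^sup>2) \<le> fact k * exp (1 + r) * exp (- c * r\<^sup>2)"
    by (intro mult_right_mono) (auto simp: field_simps)
  also have "\<dots> = fact k * exp (1 + r - c * r\<^sup>2)" by (simp add: exp_add[symmetric] exp_diff exp_minus field_simps)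
  also have "\<dots> \<le> fact k * exp (1 + 1 / (4 * c))"
  proof -
    have "0 \<le> c * (r - 1 / (2 * c))\<^sup>2" using assms by simp
    also have "\<dots> = c * r\<^sup>2 - r + 1 / (4 * c)" using assms by (simp add: power2_diff field_simps power2_eq_square)
    finally show ?thesis by simp
  qed
  finally show "(1 + r) ^ k * exp (- c * r\<^sup>2) \<le> fact k * exp (1 + 1 / (4 * c))" .
qed

text \<open>Sums of polynomials times exponentials of polynomials that decay like a Gaussian.
  This class is closed under partial derivatives, which makes membership in the Schwartz space a
  matter of decay alone.\<close>

inductive gauss_class :: "(real^'m \<Rightarrow> complex) \<Rightarrow> bool" where
  gauss_class_base: "cpoly f \<Longrightarrow> cpoly q \<Longrightarrow> 0 < c \<Longrightarrow> (\<And>x. Re (q x) \<le> C - c * (norm x)\<^sup>2) \<Longrightarrow>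
    gauss_class (\<lambda>x. f x * exp (q x))"
| gauss_class_add: "gauss_class f \<Longrightarrow> gauss_class g \<Longrightarrow> gauss_class (\<lambda>x. f x + g x)"

lemma gauss_class_differentiable: "gauss_class f \<Longrightarrow> f differentiable (at x)"
proof (induction rule: gauss_class.induct)
  case (gauss_class_base f q c C)
  have D: "(exp \<circ> q) differentiable (at x)"
    by (intro differentiable_chain_at cpoly_differentiable gauss_class_base field_differentiable_imp_differentiable field_differentiable_within_exp)
  show ?case
    by (rule differentiable_mult[OF cpoly_differentiable[OF gauss_class_base(1)] D[unfolded o_def]])
qed (auto intro: differentiable_add)

lemma gauss_class_partial_deriv: "gauss_class f \<Longrightarrow> gauss_class (partial_deriv j f)"
proof (induction rule: gauss_class.induct)
  case (gauss_class_base f q c C)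
  have dq: "(\<lambda>x. exp (q x)) differentiable (at x)" for x
  proof -
    have "gauss_class (\<lambda>x. 1 * exp (q x))"
      using gauss_class_base by (intro gauss_class.gauss_class_base[of "\<lambda>x. 1"] cpoly.cpoly_const) auto
    then show ?thesis using gauss_class_differentiable by force
  qed
  have "partial_deriv j (\<lambda>x. f x * exp (q x)) = (\<lambda>x. (f x * partial_deriv j q x + partial_deriv j f x) * exp (q x))"
  proof
    fix x
    show "partial_deriv j (\<lambda>x. f x * exp (q x)) x = (f x * partial_deriv j q x + partial_deriv j f x) * exp (q x)"
      using partial_deriv_mult[OF cpoly_differentiable[OF gauss_class_base(1)] dq]
        partial_deriv_exp[OF cpoly_differentiable[OF gauss_class_base(2)]]
      by (simp add: algebra_simps)
  qed
  moreover have "gauss_class (\<lambda>x. (f x * partial_deriv j q x + partial_deriv j f x) * exp (q x))"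
    using gauss_class_base by (intro gauss_class.gauss_class_base cpoly_add cpoly_mult cpoly_partial_deriv) auto
  ultimately show ?case by simp
next
  case (gauss_class_add f g)
  have "partial_deriv j (\<lambda>x. f x + g x) = (\<lambda>x. partial_deriv j f x + partial_deriv j g x)"
    by (intro ext partial_deriv_add gauss_class_differentiable gauss_class_add.hyps)
  then show ?case using gauss_class_add.IH by (simp add: gauss_class.gauss_class_add)
qed

lemma gauss_class_decay: "gauss_class f \<Longrightarrow> \<exists>K. \<forall>x. norm x ^ k * cmod (f x) \<le> K"
proof (induction rule: gauss_class.induct)
  case (gauss_class_base f q c C)
  obtain D l where D: "0 \<le> D" "\<And>x. cmod (f x) \<le> D * (1 + norm x) ^ l" using cpoly_growth[OF gauss_class_base(1)] by blast
  obtain K where K: "\<And>r. 0 \<le> r \<Longrightarrow> (1 + r) ^ (k + l) * exp (- c * r\<^sup>2) \<le> K"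
    using power_exp_neg_bounded[OF gauss_class_base(3)] by blast
  have "norm x ^ k * cmod (f x * exp (q x)) \<le> D * exp C * K" for x
  proof -
    have "norm x ^ k * cmod (f x * exp (q x)) \<le> (1 + norm x) ^ k * ((D * (1 + norm x) ^ l) * exp (C - c * (norm x)\<^sup>2))"
      unfolding norm_mult norm_exp_eq_Re using D gauss_class_base(4)
      by (intro mult_mono power_mono) auto
    also have "\<dots> = D * exp C * ((1 + norm x) ^ (k + l) * exp (- c * (norm x)\<^sup>2))"
      by (simp add: power_add exp_diff exp_minus field_simps)
    also have "\<dots> \<le> D * exp C * K" using D K by (intro mult_left_mono) auto
    finally show ?thesis .
  qed
  then show ?case by blast
next
  case (gauss_class_add f g)
  then obtain K L where "\<And>x. norm x ^ k * cmod (f x) \<le> K" "\<And>x. norm x ^ k * cmod (g x) \<le> L" by blast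
  then have "norm x ^ k * cmod (f x + g x) \<le> K + L" for x
    using order_trans[OF mult_left_mono[OF norm_triangle_ineq[of "f x" "g x"], of "norm x ^ k"]]
    by (smt (verit, best) distrib_left zero_le_power norm_ge_zero)
  then show ?case by blast
qed

text \<open>Every iterated derivative stays in the class, and all members of the class decay
  rapidly.\<close>

theorem gauss_class_schwartz:
  assumes "gauss_class f" shows "f \<in> schwartz"
proof -
  have *: "gauss_class (iter_partial js f)" for js
    by (induction js) (auto simp: iter_partial_def assms intro: gauss_class_partial_deriv)
  have "bounded (range (\<lambda>x. norm x ^ k *\<^sub>R iter_partial js f x))" for k js
  proof -
    obtain K where "\<And>x. norm x ^ k * cmod (iter_partial js f x) \<le> K" using gauss_class_decay[OF *] by blast
    then show ?thesis unfolding bounded_iff by (intro exI[of _ K]) auto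
  qed
  then show ?thesis unfolding schwartz_def using gauss_class_differentiable[OF *] by blast
qed

lemma gauss_times_schwartz:
  fixes f :: "real^'m \<Rightarrow> complex"
  assumes \<alpha>: "0 < \<alpha>" and f: "trig_poly f" shows "gauss_times \<alpha> f \<in> schwartz"
proof (rule gauss_class_schwartz)
  show "gauss_class (gauss_times \<alpha> f)" using f
  proof (induction rule: trig_poly.induct)
    case (trig_poly_cis c \<theta>)
    have "gauss_class (\<lambda>x. c * exp (of_real (- \<alpha>) * of_real ((norm x)\<^sup>2) + \<i> * of_real (\<theta> \<bullet> x)))"
      using \<alpha> by (intro gauss_class_base[of _ _ \<alpha> 0] cpoly_add cpoly_mult cpoly_const cpoly_norm_square cpoly_inner) auto
    also have "(\<lambda>x. c * exp (of_real (- \<alpha>) * of_real ((norm x)\<^sup>2) + \<i> * of_real (\<theta> \<bullet> x))) = gauss_times \<alpha> (\<lambda>x. c * cis (\<theta> \<bullet> x))"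
      unfolding exp_add cis_conv_exp of_real_mult[symmetric] exp_of_real
      by (simp add: fun_eq_iff gauss_times_def scaleR_conv_of_real mult_ac)
    finally show ?case .
  next
    case (trig_poly_add f g)
    then show ?case by (simp add: gauss_times_def scaleR_add_right gauss_class_add)
  qed
qed

section \<open>The evolution operator as a Fourier transform\<close>

text \<open>The unimodular factor \<open>e\<^bsup>i\<langle>Ry,y\<rangle>/4\<^esup>\<close>,
  used with \<open>R = Q(t)\<^sup>-\<^sup>1\<close>.\<close>

definition chirp :: "real^'m^'m \<Rightarrow> real^'m \<Rightarrow> complex" where
  "chirp R y = cis ((R *v y) \<bullet> y / 4)"

text \<open>The matrix taking \<open>x\<close> to the point at which the Fourier transform with
  kernel \<open>e\<^bsup>i\<kappa>\<langle>x,y\<rangle>\<^esup>\<close> is evaluated.\<close>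

definition freq_map :: "real^'m^'m \<Rightarrow> real^'m^'m \<Rightarrow> real \<Rightarrow> real \<Rightarrow> real^'m^'m" where
  "freq_map Q B t \<kappa> = (- (1 / (2 * \<kappa>))) *\<^sub>R (matrix_inv (Qt Q B t) ** mat_exp (t *\<^sub>R B))"

text \<open>The modulus of the constant in front of the integral.\<close>

definition T_factor :: "real^'m^'m \<Rightarrow> real^'m^'m \<Rightarrow> real \<Rightarrow> real" where
  "T_factor Q B t = (4 * pi) powr (- (real CARD('m) / 2)) / sqrt (det (Qt Q B t))"

lemma det_scaleR: "det (s *\<^sub>R A) = s ^ CARD('m) * det A" for A :: "real^'m^'m"
proof -
  have "det (s *\<^sub>R A) = (\<Sum>p\<in>{p. p permutes UNIV}. s ^ CARD('m) * (of_int (sign p) * (\<Prod>i\<in>UNIV. A $ i $ p i)))"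
    unfolding det_def by (intro sum.cong refl) (simp add: prod.distrib)
  then show ?thesis by (simp add: det_def sum_distrib_left)
qed

lemma matrix_vector_mult_continuous: "continuous_on S (\<lambda>x. A *v x)" for A :: "real^'m^'n"
  by (rule linear_continuous_on[OF matrix_vector_mul_bounded_linear])

lemma chirp_continuous: "continuous_on UNIV (chirp R)"
  unfolding chirp_def by (intro continuous_on_cis continuous_on_divide continuous_on_inner
      matrix_vector_mult_continuous continuous_on_id continuous_on_const) auto

lemma chirp_measurable: "chirp R \<in> borel_measurable lebesgue"
  by (rule continuous_imp_lebesgue_measurable[OF chirp_continuous])

lemma cmod_chirp [simp]: "cmod (chirp R y) = 1"
  by (simp add: chirp_def)

lemma symmetric_inner: "transpose R = R \<Longrightarrow> (R *v x) \<bullet> y = x \<bullet> (R *v y)" for R :: "real^'m^'m"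
proof -
  assume "transpose R = R"
  then have "R *v x = x v* R" using transpose_matrix_vector[of R x] by simp
  then show ?thesis by (simp add: dot_lmul_matrix)
qed

locale schroedinger =
  fixes Q B :: "real^'m^'m" and t :: real
  assumes symm: "transpose Q = Q" and t: "0 < t" and pd: "pos_def (Qt Q B t)"
begin

abbreviation "D \<equiv> det (Qt Q B t)"
abbreviation "R \<equiv> matrix_inv (Qt Q B t)"
abbreviation "E \<equiv> mat_exp (t *\<^sub>R B)"
abbreviation "T \<equiv> T_op Q B t"

lemma D_pos: "0 < D" by (rule pos_def_det_pos[OF pd])

lemma R_sym: "transpose R = R" and det_R: "det R = 1 / D"
  using symmetric_matrix_inv[OF symmetric_Qt[OF symm, of B t]] D_pos by auto

lemma T_factor_pos: "0 < T_factor Q B t"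
  unfolding T_factor_def using D_pos by simp

text \<open>Since \<open>R = Q(t)\<^sup>-\<^sup>1\<close> is symmetric, \<open>\<langle>R (y -
  Ex), y - Ex\<rangle> = \<langle>Ry, y\<rangle> - 2 \<langle>y, REx\<rangle> + \<langle>REx,
  Ex\<rangle>\<close>. The parameter \<open>\<kappa>\<close> only rescales the frequency, so
  that the kernel can be matched with the one in \<open>sharp_hausdorff_young\<close>.\<close>

lemma T_op_fourier:
  assumes \<kappa>: "\<kappa> \<noteq> 0"
  shows "T \<phi> x = (complex_of_real ((4 * pi) powr (- (real CARD('m) / 2)))
     * (exp (- (\<i> * complex_of_real pi * of_nat CARD('m) / 4)) / complex_of_real (sqrt D)))
     * (chirp R (E *v x) * fourier \<kappa> (\<lambda>y. chirp R y * \<phi> y) (freq_map Q B t \<kappa> *v x))"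
proof -
  let ?e = "E *v x"
  have k: "exp (\<i> * complex_of_real ((R *v (y - ?e)) \<bullet> (y - ?e)) / 4) * \<phi> y
     = chirp R ?e * (cis (\<kappa> * (y \<bullet> (freq_map Q B t \<kappa> *v x))) * (chirp R y * \<phi> y))" for y
  proof -
    have M: "\<kappa> * (y \<bullet> (freq_map Q B t \<kappa> *v x)) = - (1/2) * (y \<bullet> (R *v ?e))"
    proof -
      have "freq_map Q B t \<kappa> *v x = (- (1 / (2 * \<kappa>))) *\<^sub>R (R *v ?e)"
        unfolding freq_map_def scaleR_matrix_vector_assoc[symmetric] matrix_vector_mul_assoc[symmetric] ..
      then show ?thesis using \<kappa> by simp
    qed
    have "(R *v (y - ?e)) \<bullet> (y - ?e) = (R *v y) \<bullet> y - 2 * (y \<bullet> (R *v ?e)) + (R *v ?e) \<bullet> ?e"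
      by (simp add: matrix_vector_mult_diff_distrib inner_diff_left inner_diff_right symmetric_inner[OF R_sym, of y]
          inner_commute[of "R *v ?e" y])
    then have "((R *v (y - ?e)) \<bullet> (y - ?e)) / 4 = (R *v ?e) \<bullet> ?e / 4 + (\<kappa> * (y \<bullet> (freq_map Q B t \<kappa> *v x)) + (R *v y) \<bullet> y / 4)"
      unfolding M by (simp add: field_simps)
    then have "cis (((R *v (y - ?e)) \<bullet> (y - ?e)) / 4)
       = chirp R ?e * (cis (\<kappa> * (y \<bullet> (freq_map Q B t \<kappa> *v x))) * chirp R y)"
      unfolding chirp_def cis_mult by (simp only:)
    moreover have "exp (\<i> * complex_of_real ((R *v (y - ?e)) \<bullet> (y - ?e)) / 4) = cis (((R *v (y - ?e)) \<bullet> (y - ?e)) / 4)"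
      by (simp add: cis_conv_exp)
    ultimately show ?thesis by (simp add: mult.assoc)
  qed
  have "T \<phi> x = (complex_of_real ((4 * pi) powr (- (real CARD('m) / 2)))
     * (exp (- (\<i> * complex_of_real pi * of_nat CARD('m) / 4)) / complex_of_real (sqrt D)))
     * (\<integral>y. exp (\<i> * complex_of_real ((R *v (y - ?e)) \<bullet> (y - ?e)) / 4) * \<phi> y \<partial>lebesgue)"
    using t by (simp add: T_op_def)
  then show ?thesis unfolding k fourier_def by simp
qed

lemma cmod_T_op:
  assumes \<kappa>: "\<kappa> \<noteq> 0"
  shows "cmod (T \<phi> x) = T_factor Q B t * cmod (fourier \<kappa> (\<lambda>y. chirp R y * \<phi> y) (freq_map Q B t \<kappa> *v x))"
proof -
  have "exp (- (\<i> * complex_of_real pi * of_nat CARD('m) / 4)) = cis (- (pi * real CARD('m) / 4))"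
    by (simp add: cis_conv_exp mult_ac)
  then show ?thesis
    unfolding T_op_fourier[OF \<kappa>] T_factor_def using D_pos by (simp add: norm_mult norm_divide)
qed

lemma chirp_integrable: "integrable lebesgue (\<lambda>y. chirp R y * \<phi> y) \<longleftrightarrow> integrable lebesgue \<phi>"
proof
  have 1: "integrable lebesgue (\<lambda>y. g y * f y)"
    if "integrable lebesgue f" "g \<in> borel_measurable lebesgue" "\<And>y. cmod (g y) = 1" for f g :: "real^'m \<Rightarrow> complex"
    by (rule Bochner_Integration.integrable_bound[OF that(1)])
       (use that in \<open>auto simp: norm_mult intro!: borel_measurable_times\<close>)
  show "integrable lebesgue (\<lambda>y. chirp R y * \<phi> y)" if "integrable lebesgue \<phi>"
    by (rule 1[OF that chirp_measurable]) simp
  assume i: "integrable lebesgue (\<lambda>y. chirp R y * \<phi> y)"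
  have "(\<lambda>y. cnj (chirp R y)) \<in> borel_measurable lebesgue"
    by (intro continuous_imp_lebesgue_measurable continuous_on_cnj chirp_continuous)
  from 1[OF i this] have "integrable lebesgue (\<lambda>y. (cnj (chirp R y) * chirp R y) * \<phi> y)"
    by (simp add: mult.assoc)
  moreover have "cnj (chirp R y) * chirp R y = 1" for y
    by (simp add: chirp_def cis_cnj cis_mult)
  ultimately show "integrable lebesgue \<phi>" by simp
qed

lemma T_op_continuous:
  assumes "integrable lebesgue \<phi>" shows "continuous_on UNIV (T \<phi>)"
proof -
  have "continuous_on UNIV (\<lambda>x. fourier 1 (\<lambda>y. chirp R y * \<phi> y) (freq_map Q B t 1 *v x))"
    by (rule continuous_on_compose2[OF fourier_continuous[of "\<lambda>y. chirp R y * \<phi> y" 1]])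
       (use assms in \<open>auto simp: chirp_integrable intro!: matrix_vector_mult_continuous\<close>)
  then have "continuous_on UNIV (\<lambda>x. (complex_of_real ((4 * pi) powr (- (real CARD('m) / 2)))
     * (exp (- (\<i> * complex_of_real pi * of_nat CARD('m) / 4)) / complex_of_real (sqrt D)))
     * (chirp R (E *v x) * fourier 1 (\<lambda>y. chirp R y * \<phi> y) (freq_map Q B t 1 *v x)))"
    by (intro continuous_intros continuous_on_compose2[OF chirp_continuous matrix_vector_mult_continuous]) auto
  then show ?thesis by (simp only: T_op_fourier[of 1, symmetric] one_neq_zero not_False_eq_True eta_contract_eq)
qed

lemma T_op_measurable: "integrable lebesgue \<phi> \<Longrightarrow> T \<phi> \<in> borel_measurable lebesgue"
  by (intro continuous_imp_lebesgue_measurable T_op_continuous)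

lemma T_op_linear:
  assumes "integrable lebesgue f" "integrable lebesgue g"
  shows "T (\<lambda>y. a * f y + b * g y) x = a * T f x + b * T g x"
proof -
  have F: "fourier 1 (\<lambda>y. chirp R y * (a * f y + b * g y)) w =
      a * fourier 1 (\<lambda>y. chirp R y * f y) w + b * fourier 1 (\<lambda>y. chirp R y * g y) w" for w
  proof -
    have i: "integrable lebesgue (\<lambda>y. cis (1 * (y \<bullet> w)) * (chirp R y * f y))"
       "integrable lebesgue (\<lambda>y. cis (1 * (y \<bullet> w)) * (chirp R y * g y))"
      using assms by (intro fourier_integrable; simp add: chirp_integrable)+
    have "fourier 1 (\<lambda>y. chirp R y * (a * f y + b * g y)) w =
      (\<integral>y. a * (cis (1 * (y \<bullet> w)) * (chirp R y * f y)) + b * (cis (1 * (y \<bullet> w)) * (chirp R y * g y)) \<partial>lebesgue)"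
      unfolding fourier_def by (intro Bochner_Integration.integral_cong) (auto simp: algebra_simps)
    also have "\<dots> = a * fourier 1 (\<lambda>y. chirp R y * f y) w + b * fourier 1 (\<lambda>y. chirp R y * g y) w"
      unfolding fourier_def using i by simp
    finally show ?thesis .
  qed
  show ?thesis unfolding T_op_fourier[OF one_neq_zero] F by (simp add: algebra_simps)
qed

text \<open>The two images are equal as functions, not only almost everywhere, because every
  value is an integral. If the integrands fail to be measurable, both integrals are
  \<open>0\<close>.\<close>

lemma T_op_cong_AE: "AE y in lebesgue. f y = g y \<Longrightarrow> T f = T g"
proof -
  assume ae: "AE y in lebesgue. f y = g y"
  have "integral\<^sup>L lebesgue (\<lambda>y. c y * f y) = integral\<^sup>L lebesgue (\<lambda>y. c y * g y)"
    if c: "c \<in> borel_measurable lebesgue" "\<And>y. c y \<noteq> 0" for c :: "real^'m \<Rightarrow> complex"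
  proof -
    have "(\<lambda>y. c y * f y) \<in> borel_measurable lebesgue \<longleftrightarrow> (\<lambda>y. c y * g y) \<in> borel_measurable lebesgue"
    proof
      assume m: "(\<lambda>y. c y * f y) \<in> borel_measurable lebesgue"
      show "(\<lambda>y. c y * g y) \<in> borel_measurable lebesgue"
        by (rule borel_measurable_AE[OF m]) (use ae in eventually_elim, simp)
    next
      assume m: "(\<lambda>y. c y * g y) \<in> borel_measurable lebesgue"
      show "(\<lambda>y. c y * f y) \<in> borel_measurable lebesgue"
        by (rule borel_measurable_AE[OF m]) (use ae in eventually_elim, simp)
    qed
    then show ?thesis
    proof (cases "(\<lambda>y. c y * f y) \<in> borel_measurable lebesgue")
      case True
      with \<open>_ \<longleftrightarrow> _\<close> show ?thesis
        by (intro integral_cong_AE) (use ae in \<open>auto elim!: eventually_mono\<close>)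
    next
      case False
      with \<open>_ \<longleftrightarrow> _\<close> show ?thesis
        by (simp add: not_integrable_integral_eq integrable_iff_bounded)
    qed
  qed
  then have "fourier 1 (\<lambda>y. chirp R y * f y) w = fourier 1 (\<lambda>y. chirp R y * g y) w" for w
    unfolding fourier_def mult.assoc[symmetric]
    using borel_measurable_times[OF cis_kernel_measurable[of 1 w] chirp_measurable[of R]] by (auto simp: chirp_def)
  then show ?thesis by (simp add: fun_eq_iff T_op_fourier[OF one_neq_zero])
qed

lemma T_op_bound:
  assumes "integrable lebesgue \<phi>"
  shows "cmod (T \<phi> x) \<le> T_factor Q B t * (\<integral>y. cmod (\<phi> y) \<partial>lebesgue)"
  unfolding cmod_T_op[OF one_neq_zero]
  by (rule mult_left_mono[OF order_trans[OF fourier_bound]]) (use T_factor_pos in \<open>auto simp: norm_mult\<close>)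

lemma abs_det_freq_map:
  assumes "0 < \<kappa>"
  shows "\<bar>det (freq_map Q B t \<kappa>)\<bar> = (1 / (2 * \<kappa>)) ^ CARD('m) * (exp (t * trace B) / D)" "0 < \<bar>det (freq_map Q B t \<kappa>)\<bar>"
proof -
  show 1: "\<bar>det (freq_map Q B t \<kappa>)\<bar> = (1 / (2 * \<kappa>)) ^ CARD('m) * (exp (t * trace B) / D)"
    unfolding freq_map_def det_scaleR det_mul det_R det_mat_exp
    using assms D_pos by (simp add: abs_mult power_abs)
  show "0 < \<bar>det (freq_map Q B t \<kappa>)\<bar>" unfolding 1 using assms D_pos by simp
qed

text \<open>The value of \<open>T_const\<close> for real exponents; see
  \<open>T_const_real\<close>.\<close>

definition sharp_const :: "real \<Rightarrow> real \<Rightarrow> real" where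
  "sharp_const p q = (let m = real CARD('m) in
     (4 * pi) powr (- (m / 2) + m * (1 / q)) * (p powr (1/p) / q powr (1/q)) powr (m / 2)
     * (exp (- (trace B * (1/q) * t)) / D powr (1 / 2 - 1/q)))"

text \<open>The constant of (ii) is the product of the prefactor of the kernel, the Jacobian of
  the frequency map to the power \<open>-1/q\<close>, and the Hausdorff--Young constant. The
  logarithms of both sides are compared.\<close>

lemma constant_identity:
  assumes p: "1 < p" "p \<le> 2" and pq: "1/p + 1/q = 1"
  shows "T_factor Q B t * \<bar>det (freq_map Q B t (sqrt (p - 1) / p))\<bar> powr (- (1/q)) * hausdorff_young_const p CARD('m) = sharp_const p q"
proof -
  note c = conjugate_exponents_real[OF p(1) pq]
  define r where "r = 1/q"
  define m where "m = real CARD('m)"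
  have rp: "1/p = 1 - r" using pq by (simp add: r_def)
  let ?\<kappa> = "sqrt (p - 1) / p"
  have \<kappa>: "0 < ?\<kappa>" using p by simp
  have lnk: "ln ?\<kappa> = ln (p - 1) / 2 - ln p" using p by (simp add: ln_div ln_sqrt)
  have lnq: "ln q = ln p - ln (p - 1)" unfolding c(2) using p by (simp add: ln_div)
  have ln4: "ln (4::real) = 2 * ln 2" using ln_powr[of 2 "2::real"] by (simp add: powr_numeral)
  have lnpow: "ln (x ^ CARD('m)) = m * ln x" if "0 < x" for x :: real
    using that by (simp add: ln_realpow m_def)
  have ln3: "ln (x * y * z) = ln x + ln y + ln z" if "0 < x" "0 < y" "0 < z" for x y z :: real
    using that by (simp add: ln_mult_pos)
  have ln_half_inverse: "ln (1 / (2 * k)) = - (ln 2 + ln k)" if "0 < k" for k :: real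
    using that by (simp add: ln_div ln_mult_pos)
  have l1: "ln (T_factor Q B t) = - (m/2) * (2 * ln 2 + ln pi) - ln D / 2"
    unfolding T_factor_def m_def[symmetric] using D_pos by (simp add: ln_div ln_powr ln_mult ln_sqrt ln4)
  have l2: "ln \<bar>det (freq_map Q B t ?\<kappa>)\<bar> = - m * (ln 2 + ln ?\<kappa>) + t * trace B - ln D"
  proof -
    have "ln \<bar>det (freq_map Q B t ?\<kappa>)\<bar> = ln ((1 / (2 * ?\<kappa>)) ^ CARD('m)) + ln (exp (t * trace B) / D)"
      unfolding abs_det_freq_map[OF \<kappa>] using p D_pos by (intro ln_mult_pos zero_less_power) auto
    also have "ln ((1 / (2 * ?\<kappa>)) ^ CARD('m)) = m * ln (1 / (2 * ?\<kappa>))" using p by (intro lnpow) auto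
    also have "ln (1 / (2 * ?\<kappa>)) = - (ln 2 + ln ?\<kappa>)" by (rule ln_half_inverse[OF \<kappa>])
    finally show ?thesis using D_pos p by (simp add: ln_div algebra_simps)
  qed
  have l3: "ln (hausdorff_young_const p CARD('m)) = m/2 * (ln 2 + ln pi + ln p) + m/2 * (ln 2 + ln pi) - 2 * (1/p) * (m/2 * (ln 2 + ln pi))"
  proof -
    define b where "b = m/2 * (ln 2 + ln pi)"
    have s1: "ln (sqrt (2 * pi) ^ CARD('m)) = b"
      by (subst lnpow) (simp_all add: ln_sqrt ln_mult_pos b_def)
    have s2: "ln (sqrt (2 * pi * p) ^ CARD('m)) = m/2 * (ln 2 + ln pi + ln p)"
      using p by (subst lnpow) (simp_all add: ln_sqrt ln_mult_pos)
    have "ln (hausdorff_young_const p CARD('m)) = (ln (sqrt (2 * pi * p) ^ CARD('m)) + ln (sqrt (2 * pi) ^ CARD('m)))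
       - (1/p * ln (sqrt (2 * pi) ^ CARD('m)) + 1/p * ln (sqrt (2 * pi) ^ CARD('m)))"
      unfolding hausdorff_young_const_def using p by (simp only: ln_div ln_mult_pos ln_powr) (simp add: ln_div ln_mult_pos ln_powr)
    then show ?thesis unfolding s1 s2 b_def[symmetric] by simp
  qed
  have H0: "0 < hausdorff_young_const p CARD('m)" using p by (simp add: hausdorff_young_const_def)
  have "ln (T_factor Q B t * \<bar>det (freq_map Q B t ?\<kappa>)\<bar> powr (- r) * hausdorff_young_const p CARD('m))
     = ln (T_factor Q B t) + - r * ln \<bar>det (freq_map Q B t ?\<kappa>)\<bar> + ln (hausdorff_young_const p CARD('m))"
  proof -
    have "0 < \<bar>det (freq_map Q B t ?\<kappa>)\<bar> powr (- r)" using abs_det_freq_map(2)[OF \<kappa>] by simp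
    then show ?thesis using T_factor_pos H0 by (simp add: ln_mult_pos ln_powr)
  qed
  also have "\<dots> = (- (m/2) + m * r) * (2 * ln 2 + ln pi) + m/2 * ((1-r) * ln p - r * ln q) + - (trace B * r * t) - (1/2 - r) * ln D"
    unfolding l1 l2 l3 lnk lnq rp by (simp add: field_simps)
  also have "\<dots> = ln (sharp_const p q)"
  proof -
    have pw: "0 < (4 * pi) powr (- (m/2) + m * r)" "0 < p powr (1 - r)" "0 < q powr r" "0 < D powr (1/2 - r)"
      using p c(1) D_pos by auto
    have "ln (sharp_const p q) = ln ((4 * pi) powr (- (m/2) + m * r)) + ln ((p powr (1 - r) / q powr r) powr (m/2))
      + ln (exp (- (trace B * r * t)) / D powr (1/2 - r))"
      unfolding sharp_const_def Let_def m_def[symmetric] rp r_def[symmetric]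
      by (rule ln3) (use pw in auto)
    also have "ln ((4 * pi) powr (- (m/2) + m * r)) = (- (m/2) + m * r) * (2 * ln 2 + ln pi)"
      by (simp add: ln_powr ln_mult_pos ln4)
    also have "ln ((p powr (1 - r) / q powr r) powr (m/2)) = m/2 * ((1-r) * ln p - r * ln q)"
      using pw p c(1) by (simp add: ln_powr ln_div)
    also have "ln (exp (- (trace B * r * t)) / D powr (1/2 - r)) = - (trace B * r * t) - (1/2 - r) * ln D"
      using pw D_pos by (simp add: ln_powr ln_div)
    finally show ?thesis by simp
  qed
  finally have "ln (T_factor Q B t * \<bar>det (freq_map Q B t ?\<kappa>)\<bar> powr (- r) * hausdorff_young_const p CARD('m)) = ln (sharp_const p q)" .
  moreover have "0 < T_factor Q B t * \<bar>det (freq_map Q B t ?\<kappa>)\<bar> powr (- r) * hausdorff_young_const p CARD('m)"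
    using T_factor_pos H0 abs_det_freq_map(2)[OF \<kappa>] by simp
  moreover have "0 < sharp_const p q"
    using p c(1) D_pos by (simp add: sharp_const_def Let_def)
  ultimately show ?thesis by (simp add: r_def)
qed

text \<open>The sharp Hausdorff--Young inequality for the chirped function, followed by the
  linear change of variables \<open>x \<mapsto> Mx\<close>.\<close>

theorem T_op_sharp_bound:
  assumes p: "1 < p" "p \<le> 2" and pq: "1/p + 1/q = 1" and u: "bounded_supported \<phi>"
  shows "(\<integral>\<^sup>+x. ennreal (cmod (T \<phi> x) powr q) \<partial>lebesgue) \<le> ennreal ((sharp_const p q * Np p \<phi>) powr q)"
proof -
  note c = conjugate_exponents_real[OF p(1) pq]
  let ?\<kappa> = "sqrt (p - 1) / p"
  let ?M = "freq_map Q B t ?\<kappa>"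
  have \<kappa>: "0 < ?\<kappa>" and \<kappa>0: "?\<kappa> \<noteq> 0" using p by simp_all
  define v where "v = (\<lambda>y. chirp R y * \<phi> y)"
  have v: "bounded_supported v"
    using u unfolding bounded_supported_def v_def
    by (auto simp: norm_mult intro!: borel_measurable_times chirp_measurable)
  have Nv: "Np p v = Np p \<phi>" by (simp add: Np_def v_def norm_mult)
  have vi: "integrable lebesgue v" by (rule bounded_supported_bilinear(1)[OF p v v])
  let ?F = "\<lambda>y. ennreal (cmod (fourier ?\<kappa> v y) powr q)"
  have Fm: "?F \<in> borel_measurable borel"
    by (intro measurable_compose[OF _ measurable_ennreal] powr_real_measurable
        borel_measurable_continuous_onI continuous_on_norm fourier_continuous vi) auto
  have mvm: "(\<lambda>x. ?M *v x) \<in> borel_measurable lborel"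
    by (simp add: borel_measurable_continuous_onI matrix_vector_mult_continuous)
  let ?d = "\<bar>det ?M\<bar>" and ?K = "T_factor Q B t"
  have d: "0 < ?d" by (rule abs_det_freq_map(2)[OF \<kappa>])
  have K: "0 < ?K" by (rule T_factor_pos)
  have H: "0 \<le> hausdorff_young_const p CARD('m) * Np p v" using hausdorff_young_const_nonneg[OF p(1)] by (simp add: Np_def)
  have "(\<integral>\<^sup>+x. ?F (?M *v x) \<partial>lborel) = ennreal (1 / ?d) * (ennreal ?d * (\<integral>\<^sup>+x. ?F (?M *v x) \<partial>lborel))"
    using d by (simp add: mult.assoc[symmetric] ennreal_mult[symmetric])
  also have "ennreal ?d * (\<integral>\<^sup>+x. ?F (?M *v x) \<partial>lborel) = (\<integral>\<^sup>+x. ?F x \<partial>lborel)"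
    using d by (intro nn_integral_linear_image Fm) auto
  also have "\<dots> \<le> ennreal ((hausdorff_young_const p CARD('m) * Np p v) powr q)"
    using sharp_hausdorff_young[OF p pq v] by (simp add: nn_integral_completion)
  finally have le: "(\<integral>\<^sup>+x. ?F (?M *v x) \<partial>lborel) \<le> ennreal (1 / ?d) * ennreal ((hausdorff_young_const p CARD('m) * Np p v) powr q)"
    by (simp add: mult_left_mono)
  have "(\<integral>\<^sup>+x. ennreal (cmod (T \<phi> x) powr q) \<partial>lebesgue) = (\<integral>\<^sup>+x. ennreal (?K powr q) * ?F (?M *v x) \<partial>lborel)"
    unfolding nn_integral_completion cmod_T_op[OF \<kappa>0] v_def using K
    by (intro nn_integral_cong) (simp add: powr_mult ennreal_mult)
  also have "\<dots> = ennreal (?K powr q) * (\<integral>\<^sup>+x. ?F (?M *v x) \<partial>lborel)"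
    by (intro nn_integral_cmult measurable_compose[OF mvm Fm])
  also have "\<dots> \<le> ennreal (?K powr q) * (ennreal (1 / ?d) * ennreal ((hausdorff_young_const p CARD('m) * Np p v) powr q))"
    by (intro mult_left_mono le) auto
  also have "\<dots> = ennreal (?K powr q * (1 / ?d) * (hausdorff_young_const p CARD('m) * Np p v) powr q)"
    using K d H by (simp add: ennreal_mult[symmetric] mult.assoc)
  also have "?K powr q * (1 / ?d) * (hausdorff_young_const p CARD('m) * Np p v) powr q
     = (?K * ?d powr (- (1/q)) * (hausdorff_young_const p CARD('m) * Np p v)) powr q"
  proof -
    have "(?d powr (- (1/q))) powr q = 1 / ?d"
      unfolding powr_powr using powr_neg_one[OF d] c(1) by simp
    then show ?thesis using K H by (simp add: powr_mult)
  qed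
  also have "?K * ?d powr (- (1/q)) * (hausdorff_young_const p CARD('m) * Np p v) = sharp_const p q * Np p \<phi>"
    unfolding constant_identity[OF p pq, symmetric] Nv by (simp add: mult.assoc)
  finally show ?thesis .
qed

end

section \<open>Convergence and completeness in \<open>L\<^sup>p\<close>\<close>

definition Ip :: "real \<Rightarrow> (real^'m \<Rightarrow> complex) \<Rightarrow> ennreal" where
  "Ip p f = (\<integral>\<^sup>+x. ennreal (cmod (f x) powr p) \<partial>lebesgue)"

lemma powr_sum_le:
  fixes a b r :: real
  assumes "0 \<le> a" "0 \<le> b" "0 \<le> r" shows "(a + b) powr r \<le> 2 powr r * (a powr r + b powr r)"
proof -
  have "(a + b) powr r \<le> (2 * max a b) powr r" using assms by (intro powr_mono2) auto
  also have "\<dots> = 2 powr r * max a b powr r" using assms by (simp add: powr_mult)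
  also have "\<dots> \<le> 2 powr r * (a powr r + b powr r)" by (intro mult_left_mono) (auto simp: max_def)
  finally show ?thesis .
qed

lemma cmod_measurable: "f \<in> borel_measurable M \<Longrightarrow> (\<lambda>x. cmod (f x)) \<in> borel_measurable M"
  by (rule measurable_compose[OF _ borel_measurable_norm])

lemma cmod_powr_measurable:
  "f \<in> borel_measurable lebesgue \<Longrightarrow> (\<lambda>x. ennreal (cmod (f x) powr p)) \<in> borel_measurable lebesgue"
  by (intro measurable_compose[OF _ measurable_ennreal] powr_real_measurable cmod_measurable) auto

lemma Ip_add_le:
  assumes "f \<in> borel_measurable lebesgue" "g \<in> borel_measurable lebesgue" "0 \<le> p"
  shows "Ip p (\<lambda>x. f x + g x) \<le> ennreal (2 powr p) * (Ip p f + Ip p g)"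
proof -
  have "Ip p (\<lambda>x. f x + g x) \<le> (\<integral>\<^sup>+x. ennreal (2 powr p) * (ennreal (cmod (f x) powr p) + ennreal (cmod (g x) powr p)) \<partial>lebesgue)"
    unfolding Ip_def
  proof (rule nn_integral_mono)
    fix x
    have "cmod (f x + g x) powr p \<le> (cmod (f x) + cmod (g x)) powr p"
      using assms(3) by (intro powr_mono2 norm_triangle_ineq) auto
    also have "\<dots> \<le> 2 powr p * (cmod (f x) powr p + cmod (g x) powr p)"
      using assms(3) by (intro powr_sum_le) auto
    finally show "ennreal (cmod (f x + g x) powr p) \<le> ennreal (2 powr p) * (ennreal (cmod (f x) powr p) + ennreal (cmod (g x) powr p))"
      by (simp add: ennreal_mult[symmetric] ennreal_plus[symmetric] ennreal_leI del: ennreal_plus)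
  qed
  also have "\<dots> = ennreal (2 powr p) * (\<integral>\<^sup>+x. ennreal (cmod (f x) powr p) + ennreal (cmod (g x) powr p) \<partial>lebesgue)"
    by (intro nn_integral_cmult borel_measurable_add cmod_powr_measurable assms)
  also have "(\<integral>\<^sup>+x. ennreal (cmod (f x) powr p) + ennreal (cmod (g x) powr p) \<partial>lebesgue) = Ip p f + Ip p g"
    unfolding Ip_def by (intro nn_integral_add cmod_powr_measurable assms)
  finally show ?thesis .
qed

lemma Ip_mult:
  assumes "f \<in> borel_measurable lebesgue"
  shows "Ip p (\<lambda>x. a * f x) = ennreal (cmod a powr p) * Ip p f"
proof -
  have "Ip p (\<lambda>x. a * f x) = (\<integral>\<^sup>+x. ennreal (cmod a powr p) * ennreal (cmod (f x) powr p) \<partial>lebesgue)"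
    unfolding Ip_def by (intro nn_integral_cong) (simp add: norm_mult powr_mult ennreal_mult)
  also have "\<dots> = ennreal (cmod a powr p) * Ip p f"
    unfolding Ip_def by (intro nn_integral_cmult cmod_powr_measurable assms)
  finally show ?thesis .
qed

lemma Ip_cong_AE: "AE x in lebesgue. cmod (f x) = cmod (g x) \<Longrightarrow> Ip p f = Ip p g"
  unfolding Ip_def by (rule nn_integral_cong_AE) (auto elim: eventually_mono)

lemma Ip_mono: "(\<And>x. cmod (f x) \<le> cmod (g x)) \<Longrightarrow> 0 \<le> p \<Longrightarrow> Ip p f \<le> Ip p g"
  unfolding Ip_def by (intro nn_integral_mono ennreal_leI powr_mono2) auto

lemma Ip_eq_0:
  assumes "f \<in> borel_measurable lebesgue" "Ip p f = 0" shows "AE x in lebesgue. f x = 0"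
proof -
  have "AE x in lebesgue. ennreal (cmod (f x) powr p) = 0"
    using assms nn_integral_0_iff_AE[OF cmod_powr_measurable[OF assms(1), of p]] by (simp add: Ip_def)
  then show ?thesis by eventually_elim auto
qed

lemma tendsto_zero_sandwich_ennreal:
  fixes f g :: "nat \<Rightarrow> ennreal"
  assumes "g \<longlonglongrightarrow> 0" "\<And>n. f n \<le> g n" shows "f \<longlonglongrightarrow> 0"
  by (rule tendsto_sandwich[OF _ _ tendsto_const assms(1)]) (use assms(2) in auto)

lemma Ip_limit_unique:
  assumes m: "\<And>n. h n \<in> borel_measurable lebesgue" "g \<in> borel_measurable lebesgue" "g' \<in> borel_measurable lebesgue"
    and p: "0 \<le> p"
    and l: "(\<lambda>n. Ip p (\<lambda>x. h n x - g x)) \<longlonglongrightarrow> 0" "(\<lambda>n. Ip p (\<lambda>x. h n x - g' x)) \<longlonglongrightarrow> 0"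
  shows "AE x in lebesgue. g x = g' x"
proof -
  have "Ip p (\<lambda>x. g x - g' x) \<le> ennreal (2 powr p) * (Ip p (\<lambda>x. h n x - g x) + Ip p (\<lambda>x. h n x - g' x))" for n
  proof -
    have "Ip p (\<lambda>x. g x - g' x) = Ip p (\<lambda>x. (g x - h n x) + (h n x - g' x))" by simp
    also have "\<dots> \<le> ennreal (2 powr p) * (Ip p (\<lambda>x. g x - h n x) + Ip p (\<lambda>x. h n x - g' x))"
      by (intro Ip_add_le borel_measurable_diff m p)
    also have "Ip p (\<lambda>x. g x - h n x) = Ip p (\<lambda>x. h n x - g x)"
      by (intro Ip_cong_AE AE_I2) (simp add: norm_minus_commute)
    finally show ?thesis .
  qed
  moreover have "(\<lambda>n. ennreal (2 powr p) * (Ip p (\<lambda>x. h n x - g x) + Ip p (\<lambda>x. h n x - g' x))) \<longlonglongrightarrow> ennreal (2 powr p) * (0 + 0)"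
    by (intro ennreal_tendsto_cmult tendsto_add l) auto
  ultimately have "(\<lambda>n::nat. Ip p (\<lambda>x. g x - g' x)) \<longlonglongrightarrow> 0"
    using tendsto_zero_sandwich_ennreal[of "\<lambda>n. ennreal (2 powr p) * (Ip p (\<lambda>x. h n x - g x) + Ip p (\<lambda>x. h n x - g' x))"
        "\<lambda>n. Ip p (\<lambda>x. g x - g' x)"] by simp
  then have "Ip p (\<lambda>x. g x - g' x) = 0" by (rule LIMSEQ_unique[OF tendsto_const])
  from Ip_eq_0[OF borel_measurable_diff[OF m(2,3)] this] show ?thesis by eventually_elim simp
qed

lemma tendsto_zero_ennrealI:
  fixes f :: "nat \<Rightarrow> ennreal"
  assumes "\<And>e. 0 < e \<Longrightarrow> \<forall>\<^sub>F n in sequentially. f n \<le> ennreal e"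
  shows "f \<longlonglongrightarrow> 0"
proof (rule tendsto_0_if_Limsup_eq_0_ennreal)
  have "limsup f \<le> 0"
  proof (rule ennreal_le_epsilon)
    fix r :: real assume "0 < r"
    from Limsup_bounded[OF assms[OF this]] show "limsup f \<le> 0 + ennreal r" by simp
  qed
  then show "limsup f = 0" by simp
qed

text \<open>Riesz--Fischer. Along a subsequence with increments \<open>d\<^sub>k\<close> of
  geometrically small norm, \<open>\<Sum>\<^sub>k (2\<^sup>k |d\<^sub>k|)\<^sup>q\<close> is
  integrable, hence finite almost everywhere, and \<open>|d\<^sub>k| \<le> C
  2\<^bsup>-k\<^esup>\<close> there. The subsequence is part of the conclusion, since pointwise
  convergence identifies limits.\<close>

lemma Ip_complete:
  fixes h :: "nat \<Rightarrow> real^'m \<Rightarrow> complex"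
  assumes m: "\<And>n. h n \<in> borel_measurable lebesgue" and q: "1 \<le> q"
    and cauchy: "\<And>e. 0 < e \<Longrightarrow> \<exists>N. \<forall>n\<ge>N. \<forall>k\<ge>N. Ip q (\<lambda>x. h k x - h n x) \<le> ennreal e"
  obtains g s where "g \<in> borel_measurable lebesgue" "(\<lambda>n. Ip q (\<lambda>x. h n x - g x)) \<longlonglongrightarrow> 0"
    "strict_mono (s :: nat \<Rightarrow> nat)" "AE x in lebesgue. (\<lambda>k. h (s k) x) \<longlonglongrightarrow> g x"
proof -
  define e where "e = (\<lambda>k::nat. (1/2) ^ k * (1/2) powr (real k * q))"
  have e0: "0 < e k" for k by (simp add: e_def)
  have "\<exists>N. \<forall>k. \<forall>n\<ge>N k. \<forall>l\<ge>N k. Ip q (\<lambda>x. h l x - h n x) \<le> ennreal (e k)"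
    using cauchy[OF e0] by metis
  then obtain N where N: "\<And>k n l. N k \<le> n \<Longrightarrow> N k \<le> l \<Longrightarrow> Ip q (\<lambda>x. h l x - h n x) \<le> ennreal (e k)" by blast
  \<comment> \<open>increasing, with the increment \<open>d k\<close> of \<open>q\<close>-th
    power integral at most \<open>e k\<close>\<close>
  define s where "s = rec_nat (N 0) (\<lambda>k sk. Suc (max sk (N (Suc k))))"
  have s_Suc: "s (Suc k) = Suc (max (s k) (N (Suc k)))" for k by (simp add: s_def)
  have s_mono: "strict_mono s" by (rule strict_mono_Suc_iff[THEN iffD2]) (auto simp: s_Suc)
  have sN: "N k \<le> s k" for k by (cases k) (auto simp: s_def)
  define d where "d = (\<lambda>k x. h (s (Suc k)) x - h (s k) x)"
  have dm: "d k \<in> borel_measurable lebesgue" for k unfolding d_def by (intro borel_measurable_diff m)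
  have Id: "Ip q (d k) \<le> ennreal (e k)" for k
    unfolding d_def using sN[of k] strict_mono_less_eq[OF s_mono, of k "Suc k"] by (intro N) auto
  define w where "w = (\<lambda>k x. (2 ^ k * cmod (d k x)) powr q)"
  have wm: "(\<lambda>x. ennreal (w k x)) \<in> borel_measurable lebesgue" for k
    unfolding w_def
    by (intro measurable_compose[OF _ measurable_ennreal] powr_real_measurable borel_measurable_times cmod_measurable dm) auto
  have "(\<integral>\<^sup>+x. ennreal (w k x) \<partial>lebesgue) \<le> ennreal ((1/2) ^ k)" for k
  proof -
    have "(\<integral>\<^sup>+x. ennreal (w k x) \<partial>lebesgue) = (\<integral>\<^sup>+x. ennreal ((2 ^ k) powr q) * ennreal (cmod (d k x) powr q) \<partial>lebesgue)"
      by (intro nn_integral_cong) (simp add: w_def powr_mult ennreal_mult)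
    also have "\<dots> = ennreal ((2 ^ k) powr q) * Ip q (d k)"
      unfolding Ip_def by (intro nn_integral_cmult cmod_powr_measurable dm)
    also have "\<dots> \<le> ennreal ((2 ^ k) powr q) * ennreal (e k)" by (intro mult_left_mono Id) auto
    also have "\<dots> = ennreal ((1/2) ^ k)"
    proof -
      have "(2 ^ k) powr q * (1/2) powr (real k * q) = (1::real)"
        by (simp add: powr_realpow[symmetric] powr_powr powr_divide)
      then have "(2 ^ k) powr q * e k = (1/2) ^ k" by (simp add: e_def algebra_simps)
      then show ?thesis by (simp add: ennreal_mult[symmetric] less_imp_le[OF e0])
    qed
    finally show ?thesis .
  qed
  then have "(\<Sum>k. \<integral>\<^sup>+x. ennreal (w k x) \<partial>lebesgue) \<le> (\<Sum>k. ennreal ((1/2) ^ k))"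
    by (intro suminf_le) auto
  also have "\<dots> = ennreal (\<Sum>k. (1/2) ^ k)" by (intro suminf_ennreal2) (auto intro: summable_geometric)
  finally have "(\<integral>\<^sup>+x. (\<Sum>k. ennreal (w k x)) \<partial>lebesgue) < \<infinity>"
    by (subst nn_integral_suminf) (use wm in \<open>auto simp: less_top[symmetric] top_unique\<close>)
  then have "AE x in lebesgue. (\<Sum>k. ennreal (w k x)) \<noteq> \<infinity>"
    using wm by (intro nn_integral_PInf_AE) auto
  then have conv: "AE x in lebesgue. convergent (\<lambda>k. h (s k) x)"
  proof eventually_elim
    fix x assume fin: "(\<Sum>k. ennreal (w k x)) \<noteq> \<infinity>"
    define K where "K = enn2real (\<Sum>k. ennreal (w k x))"
    have wK: "w k x \<le> K" for k
    proof -
      have "ennreal (w k x) \<le> (\<Sum>k. ennreal (w k x))"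
        using sum_le_suminf[of "\<lambda>k. ennreal (w k x)" "{k}"] by simp
      also have "\<dots> = ennreal K" using fin by (simp add: K_def ennreal_enn2real_if)
      finally show ?thesis by (simp add: K_def w_def ennreal_le_iff enn2real_nonneg)
    qed
    have dk: "cmod (d k x) \<le> K powr (1/q) * (1/2) ^ k" for k
    proof -
      have "w k x powr (1/q) \<le> K powr (1/q)" using wK q by (intro powr_mono2) (auto simp: w_def)
      then have "2 ^ k * cmod (d k x) \<le> K powr (1/q)" using q by (simp add: w_def powr_powr)
      then show ?thesis by (simp add: field_simps power_divide)
    qed
    have "summable (\<lambda>k. d k x)"
      by (rule summable_comparison_test'[OF summable_mult[OF summable_geometric[of "1/2::real"]]]) (use dk in auto)
    then have "convergent (\<lambda>n. \<Sum>k<n. d k x)" by (simp add: summable_iff_convergent)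
    moreover have "(\<Sum>k<n. d k x) = h (s n) x - h (s 0) x" for n
      unfolding d_def by (induction n) auto
    ultimately have "convergent (\<lambda>n. h (s n) x - h (s 0) x)" by simp
    from convergent_add[OF this convergent_const[of "h (s 0) x"]]
    show "convergent (\<lambda>k. h (s k) x)" by simp
  qed
  define g where "g = (\<lambda>x. lim (\<lambda>k. h (s k) x))"
  have gm: "g \<in> borel_measurable lebesgue" unfolding g_def by (intro borel_measurable_lim_metric m)
  have gl: "AE x in lebesgue. (\<lambda>k. h (s k) x) \<longlonglongrightarrow> g x"
    using conv by eventually_elim (simp add: g_def convergent_LIMSEQ_iff)
  have "(\<lambda>n. Ip q (\<lambda>x. h n x - g x)) \<longlonglongrightarrow> 0"
  proof (rule tendsto_zero_ennrealI)
    fix r :: real assume r: "0 < r"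
    show "\<forall>\<^sub>F n in sequentially. Ip q (\<lambda>x. h n x - g x) \<le> ennreal r"
    proof -
      obtain N where N: "\<And>n k. N \<le> n \<Longrightarrow> N \<le> k \<Longrightarrow> Ip q (\<lambda>x. h k x - h n x) \<le> ennreal r" using cauchy[OF r] by blast
      have "Ip q (\<lambda>x. h n x - g x) \<le> ennreal r" if n: "N \<le> n" for n
      proof -
        have "Ip q (\<lambda>x. h n x - g x) = (\<integral>\<^sup>+x. liminf (\<lambda>k. ennreal (cmod (h n x - h (s k) x) powr q)) \<partial>lebesgue)"
          unfolding Ip_def
        proof (rule nn_integral_cong_AE)
          show "AE x in lebesgue. ennreal (cmod (h n x - g x) powr q) = liminf (\<lambda>k. ennreal (cmod (h n x - h (s k) x) powr q))"
            using gl
          proof eventually_elim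
            fix x assume l: "(\<lambda>k. h (s k) x) \<longlonglongrightarrow> g x"
            have "(\<lambda>k. ennreal (cmod (h n x - h (s k) x) powr q)) \<longlonglongrightarrow> ennreal (cmod (h n x - g x) powr q)"
              using q by (intro tendsto_ennrealI tendsto_powr' tendsto_norm tendsto_diff l tendsto_const) auto
            then show "ennreal (cmod (h n x - g x) powr q) = liminf (\<lambda>k. ennreal (cmod (h n x - h (s k) x) powr q))"
              by (intro lim_imp_Liminf[symmetric] trivial_limit_sequentially)
          qed
        qed
        also have "\<dots> \<le> liminf (\<lambda>k. \<integral>\<^sup>+x. ennreal (cmod (h n x - h (s k) x) powr q) \<partial>lebesgue)"
          by (intro nn_integral_liminf cmod_powr_measurable borel_measurable_diff m)
        also have "\<dots> \<le> ennreal r"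
        proof (rule Liminf_le)
          show "\<forall>\<^sub>F k in sequentially. (\<integral>\<^sup>+x. ennreal (cmod (h n x - h (s k) x) powr q) \<partial>lebesgue) \<le> ennreal r"
          proof (rule eventually_sequentiallyI[of N])
            fix k assume "N \<le> k"
            then have "N \<le> s k" using seq_suble[OF s_mono, of k] by simp
            then show "(\<integral>\<^sup>+x. ennreal (cmod (h n x - h (s k) x) powr q) \<partial>lebesgue) \<le> ennreal r"
              using N[of "s k" n] n by (simp add: Ip_def)
          qed
        qed simp
        finally show ?thesis .
      qed
      then show ?thesis by (intro eventually_sequentiallyI[of N])
    qed
  qed
  from that[OF gm this s_mono gl] show ?thesis .
qed

section \<open>Truncation\<close>

text \<open>Cut off in space and in value, so that truncations of any measurable function fall
  under \<open>T_op_sharp_bound\<close>.\<close>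

definition trunc :: "nat \<Rightarrow> (real^'m \<Rightarrow> complex) \<Rightarrow> real^'m \<Rightarrow> complex" where
  "trunc n f x = (if norm x \<le> real n \<and> cmod (f x) \<le> real n then f x else 0)"

lemma trunc_le: "cmod (trunc n f x) \<le> cmod (f x)"
  by (simp add: trunc_def)

lemma trunc_tendsto: "(\<lambda>n. trunc n f x) \<longlonglongrightarrow> f x"
proof -
  obtain n0 :: nat where n0: "max (norm x) (cmod (f x)) \<le> real n0" using real_arch_simple by blast
  have "\<forall>\<^sub>F n in sequentially. trunc n f x = f x"
    using n0 by (intro eventually_sequentiallyI[of n0]) (auto simp: trunc_def)
  then show ?thesis by (rule tendsto_eventually)
qed

lemma trunc_bounded_supported:
  fixes f :: "real^'m \<Rightarrow> complex"
  assumes "f \<in> borel_measurable lebesgue" shows "bounded_supported (trunc n f)"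
proof -
  have "{x. cmod (f x) \<le> real n} \<in> sets lebesgue"
    using borel_measurable_le[OF cmod_measurable[OF assms] borel_measurable_const[of "real n"]] by simp
  then have A: "cball 0 (real n) \<inter> {x. cmod (f x) \<le> real n} \<in> sets lebesgue" (is "?A \<in> _") by auto
  have t: "trunc n f = (\<lambda>x. if x \<in> ?A then f x else 0)"
    by (auto simp: trunc_def fun_eq_iff)
  have "trunc n f \<in> borel_measurable lebesgue"
    unfolding t by (intro measurable_If_set assms borel_measurable_const) (use A in simp)
  then show ?thesis
    unfolding bounded_supported_def
    by (intro conjI exI[of _ "real n"]) (auto simp: trunc_def)
qed

lemma bounded_supported_lincomb:
  assumes "bounded_supported f" "bounded_supported g"
  shows "bounded_supported (\<lambda>x. a * f x + b * g x)"
proof -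
  from assms obtain M N S T where f: "f \<in> borel_measurable lebesgue" "\<And>x. cmod (f x) \<le> M" "\<And>x. S < norm x \<Longrightarrow> f x = 0"
    and g: "g \<in> borel_measurable lebesgue" "\<And>x. cmod (g x) \<le> N" "\<And>x. T < norm x \<Longrightarrow> g x = 0"
    unfolding bounded_supported_def by blast
  show ?thesis unfolding bounded_supported_def
  proof (intro conjI exI allI impI)
    show "(\<lambda>x. a * f x + b * g x) \<in> borel_measurable lebesgue"
      by (intro borel_measurable_add borel_measurable_times f g borel_measurable_const)
    show "cmod (a * f x + b * g x) \<le> cmod a * M + cmod b * N" for x
      by (rule norm_triangle_le) (auto simp: norm_mult intro!: add_mono mult_left_mono f g)
    show "a * f x + b * g x = 0" if "max S T < norm x" for x using that f g by simp
  qed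
qed

lemma Ip_trunc_tendsto:
  fixes f :: "real^'m \<Rightarrow> complex"
  assumes f: "f \<in> borel_measurable lebesgue" and fin: "Ip p f < \<infinity>" and p: "0 < p"
  shows "(\<lambda>n. Ip p (\<lambda>x. f x - trunc n f x)) \<longlonglongrightarrow> 0"
proof -
  have tm: "trunc n f \<in> borel_measurable lebesgue" for n
    using trunc_bounded_supported[OF f, of n] by (simp add: bounded_supported_def)
  have "(\<lambda>n. Ip p (\<lambda>x. f x - trunc n f x)) \<longlonglongrightarrow> (\<integral>\<^sup>+(x::real^'m). 0 \<partial>lebesgue)"
    unfolding Ip_def
  proof (rule nn_integral_dominated_convergence[where w="\<lambda>x. ennreal (cmod (f x) powr p)"])
    show "AE x in lebesgue. (\<lambda>n. ennreal (cmod (f x - trunc n f x) powr p)) \<longlonglongrightarrow> 0"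
    proof (rule AE_I2)
      fix x
      have "(\<lambda>n. cmod (f x - trunc n f x) powr p) \<longlonglongrightarrow> cmod (f x - f x) powr p"
        using p by (intro tendsto_powr' tendsto_norm tendsto_diff trunc_tendsto tendsto_const) auto
      from tendsto_ennrealI[OF this] show "(\<lambda>n. ennreal (cmod (f x - trunc n f x) powr p)) \<longlonglongrightarrow> 0" by simp
    qed
    show "AE x in lebesgue. ennreal (cmod (f x - trunc n f x) powr p) \<le> ennreal (cmod (f x) powr p)" for n
      using p by (intro AE_I2 ennreal_leI powr_mono2) (auto simp: trunc_def)
    show "(\<integral>\<^sup>+x. ennreal (cmod (f x) powr p) \<partial>lebesgue) < \<infinity>" using fin by (simp add: Ip_def)
    show "(\<lambda>x. ennreal (cmod (f x - trunc n f x) powr p)) \<in> borel_measurable lebesgue" for n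
      by (intro cmod_powr_measurable borel_measurable_diff f tm)
    show "(\<lambda>x. ennreal (cmod (f x) powr p)) \<in> borel_measurable lebesgue"
      by (intro cmod_powr_measurable f)
  qed simp
  then show ?thesis by simp
qed

lemma Ip_bounded_supported_finite:
  fixes u :: "real^'m \<Rightarrow> complex"
  assumes u: "bounded_supported u" and p: "0 < p" shows "Ip p u < \<infinity>" "ennreal (Np p u powr p) = Ip p u"
proof -
  from u obtain M R where m: "u \<in> borel_measurable lebesgue" and M: "\<And>x. cmod (u x) \<le> M" and R: "\<And>x. R < norm x \<Longrightarrow> u x = 0"
    unfolding bounded_supported_def by blast
  have i: "integrable lebesgue (\<lambda>x. cmod (u x) powr p)"
  proof (rule Bochner_Integration.integrable_bound)
    show "integrable lebesgue (\<lambda>y::real^'m. M powr p * indicator (cball 0 R) y)"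
      by (intro integrable_mult_right integrable_real_indicator) (use emeasure_lborel_cball_finite[of "0::real^'m" R] in \<open>auto simp: top_unique less_top\<close>)
    show "AE y in lebesgue. norm (cmod (u y) powr p) \<le> norm (M powr p * indicator (cball 0 R) y)"
      using M R p by (intro AE_I2) (auto simp: indicator_def intro!: powr_mono2)
    show "(\<lambda>x. cmod (u x) powr p) \<in> borel_measurable lebesgue"
      by (intro powr_real_measurable cmod_measurable m) auto
  qed
  have e: "Ip p u = ennreal (\<integral>x. cmod (u x) powr p \<partial>lebesgue)"
    unfolding Ip_def by (rule nn_integral_eq_integral[OF i]) simp
  then show "Ip p u < \<infinity>" by simp
  have "Np p u powr p = (\<integral>x. cmod (u x) powr p \<partial>lebesgue)"
    unfolding Np_def using p by (simp add: powr_powr)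
  then show "ennreal (Np p u powr p) = Ip p u" by (simp add: e)
qed

section \<open>Density of Schwartz functions\<close>

lemma schwartz_measurable: "\<phi> \<in> schwartz \<Longrightarrow> \<phi> \<in> borel_measurable lebesgue"
proof -
  assume "\<phi> \<in> schwartz"
  then have "\<forall>x. iter_partial [] \<phi> differentiable (at x)" unfolding schwartz_def by blast
  then have "continuous_on UNIV \<phi>"
    by (simp add: iter_partial_def differentiable_imp_continuous_within continuous_on_eq_continuous_at)
  then show ?thesis by (rule continuous_imp_lebesgue_measurable)
qed

lemma schwartz_decay:
  assumes "\<phi> \<in> schwartz" obtains C where "\<And>x. norm x ^ k * cmod (\<phi> x) \<le> C"
proof -
  have "bounded (range (\<lambda>x. norm x ^ k *\<^sub>R iter_partial [] \<phi> x))"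
    using assms unfolding schwartz_def by blast
  then show ?thesis using that unfolding bounded_iff iter_partial_def by auto
qed

text \<open>The decay of order \<open>2m\<close> gives domination by the product of the
  integrable functions \<open>1 / (1 + x\<^sub>i\<^sup>2)\<close>.\<close>

lemma schwartz_integrable:
  fixes \<phi> :: "real^'m \<Rightarrow> complex"
  assumes \<phi>: "\<phi> \<in> schwartz" shows "integrable lebesgue \<phi>"
proof -
  let ?m = "CARD('m)"
  obtain C0 where C0: "\<And>x. norm x ^ 0 * cmod (\<phi> x) \<le> C0" using schwartz_decay[OF \<phi>] by blast
  obtain C1 where C1: "\<And>x. norm x ^ (2 * ?m) * cmod (\<phi> x) \<le> C1" using schwartz_decay[OF \<phi>] by blast
  define w where "w = (\<lambda>x::real^'m. \<Prod>e\<in>Basis. inverse (1 + (x \<bullet> e)\<^sup>2))"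
  have w0: "0 < w x" for x unfolding w_def by (intro prod_pos) (auto intro!: add_pos_nonneg)
  have wm: "w \<in> borel_measurable borel" unfolding w_def by measurable
  have le: "cmod (\<phi> x) \<le> (2 ^ ?m * (C0 + C1)) * w x" for x
  proof -
    have "inverse (w x) = (\<Prod>e\<in>Basis. 1 + (x \<bullet> e)\<^sup>2)"
      unfolding w_def by (simp add: prod_inversef[symmetric] o_def)
    also have "\<dots> \<le> (\<Prod>e\<in>(Basis :: (real^'m) set). 1 + (norm x)\<^sup>2)"
      using Basis_le_norm by (intro prod_mono) (auto simp: abs_le_square_iff[symmetric])
    also have "\<dots> = (1 + (norm x)\<^sup>2) ^ ?m" by simp
    also have "\<dots> \<le> 2 ^ ?m * (1 + norm x ^ (2 * ?m))"
    proof -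
      have "(1 + (norm x)\<^sup>2) ^ ?m \<le> (2 * max 1 ((norm x)\<^sup>2)) ^ ?m" by (intro power_mono) auto
      also have "\<dots> = 2 ^ ?m * max 1 ((norm x)\<^sup>2) ^ ?m" by (simp add: power_mult_distrib)
      also have "\<dots> \<le> 2 ^ ?m * (1 + norm x ^ (2 * ?m))"
        by (intro mult_left_mono) (auto simp: max_def power_mult)
      finally show ?thesis .
    qed
    finally have "inverse (w x) * cmod (\<phi> x) \<le> 2 ^ ?m * (1 + norm x ^ (2 * ?m)) * cmod (\<phi> x)"
      by (intro mult_right_mono) auto
    also have "\<dots> = 2 ^ ?m * (norm x ^ 0 * cmod (\<phi> x) + norm x ^ (2 * ?m) * cmod (\<phi> x))"
      by (simp add: algebra_simps)
    also have "\<dots> \<le> 2 ^ ?m * (C0 + C1)" by (intro mult_left_mono add_mono C0 C1) auto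
    finally show ?thesis using w0[of x] by (simp add: field_simps)
  qed
  have one: "(\<integral>\<^sup>+t. ennreal (inverse (1 + t\<^sup>2)) \<partial>(lborel :: real measure)) < \<infinity>"
  proof -
    have "integrable lborel (\<lambda>t::real. inverse (1 + t\<^sup>2))"
      using integrable_inverse_1_plus_square by (simp add: set_integrable_def)
    then have "(\<integral>\<^sup>+t. ennreal (norm (inverse (1 + t\<^sup>2))) \<partial>(lborel :: real measure)) < \<infinity>"
      unfolding integrable_iff_bounded by blast
    then show ?thesis by simp
  qed
  have "(\<integral>\<^sup>+x. ennreal (w x) \<partial>lborel) = (\<integral>\<^sup>+(x::real^'m). (\<Prod>e\<in>Basis. ennreal (inverse (1 + (x \<bullet> e)\<^sup>2))) \<partial>lborel)"
    unfolding w_def by (intro nn_integral_cong) (simp add: prod_ennreal)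
  also have "\<dots> = (\<Prod>e\<in>(Basis :: (real^'m) set). \<integral>\<^sup>+t. ennreal (inverse (1 + t\<^sup>2)) \<partial>lborel)"
    by (rule nn_integral_lborel_prod) auto
  also have "\<dots> < \<infinity>"
  proof -
    obtain k where k: "0 \<le> k" "(\<integral>\<^sup>+t. ennreal (inverse (1 + t\<^sup>2)) \<partial>(lborel :: real measure)) = ennreal k"
      using one by (cases "\<integral>\<^sup>+t. ennreal (inverse (1 + t\<^sup>2)) \<partial>(lborel :: real measure)") auto
    show ?thesis unfolding k(2) using k(1) by (simp add: ennreal_power)
  qed
  finally have "integrable lborel w" using wm w0 by (intro integrableI_nonneg) (auto intro: less_imp_le)
  then have wi: "integrable lebesgue w" using wm by (simp add: integrable_completion)
  show ?thesis
    by (rule Bochner_Integration.integrable_bound[OF integrable_mult_right[OF wi, of "2 ^ ?m * (C0 + C1)"] schwartz_measurable[OF \<phi>]])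
       (use order_trans[OF le abs_ge_self] in auto)
qed

lemma Ip_schwartz_finite:
  assumes \<phi>: "\<phi> \<in> schwartz" and p: "1 \<le> p" shows "Ip p \<phi> < \<infinity>"
proof -
  obtain M where M: "\<And>x. norm x ^ 0 * cmod (\<phi> x) \<le> M" using schwartz_decay[OF \<phi>] by blast
  have "Ip p \<phi> \<le> (\<integral>\<^sup>+x. ennreal (M powr (p - 1)) * ennreal (cmod (\<phi> x)) \<partial>lebesgue)"
    unfolding Ip_def
  proof (rule nn_integral_mono)
    fix x
    have "cmod (\<phi> x) powr p = cmod (\<phi> x) powr (p - 1) * cmod (\<phi> x)"
      using p by (cases "\<phi> x = 0") (simp_all add: powr_mult_base mult.commute[of _ "cmod _"])
    also have "\<dots> \<le> M powr (p - 1) * cmod (\<phi> x)"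
      using M[of x] p by (intro mult_right_mono powr_mono2) auto
    finally show "ennreal (cmod (\<phi> x) powr p) \<le> ennreal (M powr (p - 1)) * ennreal (cmod (\<phi> x))"
      by (simp add: ennreal_mult[symmetric] ennreal_leI)
  qed
  also have "\<dots> = ennreal (M powr (p - 1)) * (\<integral>\<^sup>+x. ennreal (cmod (\<phi> x)) \<partial>lebesgue)"
    by (intro nn_integral_cmult measurable_compose[OF _ measurable_ennreal] cmod_measurable schwartz_measurable \<phi>)
  also have "\<dots> < \<infinity>"
    using schwartz_integrable[OF \<phi>] by (auto simp: integrable_iff_bounded ennreal_mult_less_top)
  finally show ?thesis .
qed

lemma tendsto_zero_ennrealD:
  fixes f :: "nat \<Rightarrow> ennreal"
  assumes "f \<longlonglongrightarrow> 0" "0 < e" shows "\<forall>\<^sub>F n in sequentially. f n \<le> ennreal e"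
  using order_tendstoD(2)[OF assms(1), of "ennreal e"] assms(2) by (auto elim!: eventually_mono)

lemma Ip_tendsto_zero_add:
  assumes "\<And>n. u n \<in> borel_measurable lebesgue" "\<And>n. v n \<in> borel_measurable lebesgue" "0 \<le> p"
    and l: "(\<lambda>n. Ip p (u n)) \<longlonglongrightarrow> 0" "(\<lambda>n. Ip p (v n)) \<longlonglongrightarrow> 0"
  shows "(\<lambda>n. Ip p (\<lambda>x. u n x + v n x)) \<longlonglongrightarrow> 0"
proof (rule tendsto_zero_sandwich_ennreal)
  have "(\<lambda>n. ennreal (2 powr p) * (Ip p (u n) + Ip p (v n))) \<longlonglongrightarrow> ennreal (2 powr p) * (0 + 0)"
    by (intro ennreal_tendsto_cmult tendsto_add l) auto
  then show "(\<lambda>n. ennreal (2 powr p) * (Ip p (u n) + Ip p (v n))) \<longlonglongrightarrow> 0" by simp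
qed (intro Ip_add_le assms)

lemma Ip_tendsto_zero_mult:
  assumes "\<And>n. u n \<in> borel_measurable lebesgue" and l: "(\<lambda>n. Ip p (u n)) \<longlonglongrightarrow> 0"
  shows "(\<lambda>n. Ip p (\<lambda>x. a * u n x)) \<longlonglongrightarrow> 0"
proof -
  have "(\<lambda>n. ennreal (cmod a powr p) * Ip p (u n)) \<longlonglongrightarrow> ennreal (cmod a powr p) * 0"
    by (intro ennreal_tendsto_cmult l) auto
  then show ?thesis unfolding Ip_mult[OF assms(1)] by simp
qed

text \<open>\<open>dominated_density\<close> applies to the property of being approximable,
  since a trigonometric polynomial times a Gaussian is a Schwartz function; truncation then
  reaches all of \<open>L\<^sup>p\<close>.\<close>

theorem schwartz_dense:
  fixes f :: "real^'m \<Rightarrow> complex"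
  assumes f: "f \<in> borel_measurable lebesgue" "Ip p f < \<infinity>" and p: "1 \<le> p" and e: "0 < e"
  obtains \<psi> where "\<psi> \<in> schwartz" "Ip p (\<lambda>x. f x - \<psi> x) \<le> ennreal e"
proof -
  let ?P = "\<lambda>g. g \<in> borel_measurable lebesgue \<and> (\<forall>e>0. \<exists>\<psi>\<in>schwartz. Ip p (\<lambda>x. g x - \<psi> x) \<le> ennreal e)"
  have limP: "?P g" if gm: "g \<in> borel_measurable lebesgue" and gn: "\<And>n::nat. ?P (gn n)"
    and l: "(\<lambda>n. Ip p (\<lambda>x. g x - gn n x)) \<longlonglongrightarrow> 0" for g gn
  proof (intro conjI gm allI impI)
    fix e :: real assume e: "0 < e"
    \<comment> \<open>chosen so that \<open>2\<^sup>p (d + d) = e\<close>\<close>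
    define d where "d = e / (2 * 2 powr p)"
    have d: "0 < d" using e by (simp add: d_def)
    obtain n where n: "Ip p (\<lambda>x. g x - gn n x) \<le> ennreal d"
      using eventually_happens[OF tendsto_zero_ennrealD[OF l d]] by auto
    obtain \<psi> where \<psi>: "\<psi> \<in> schwartz" "Ip p (\<lambda>x. gn n x - \<psi> x) \<le> ennreal d" using gn[of n] d by blast
    have "Ip p (\<lambda>x. g x - \<psi> x) = Ip p (\<lambda>x. (g x - gn n x) + (gn n x - \<psi> x))" by simp
    also have "\<dots> \<le> ennreal (2 powr p) * (Ip p (\<lambda>x. g x - gn n x) + Ip p (\<lambda>x. gn n x - \<psi> x))"
      using p by (intro Ip_add_le borel_measurable_diff gm conjunct1[OF gn[of n]] schwartz_measurable[OF \<psi>(1)]) auto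
    also have "\<dots> \<le> ennreal (2 powr p) * (ennreal d + ennreal d)" by (intro mult_left_mono add_mono n \<psi>) auto
    also have "\<dots> = ennreal e" using d by (simp add: ennreal_mult[symmetric] ennreal_plus[symmetric] d_def del: ennreal_plus)
    finally show "\<exists>\<psi>\<in>schwartz. Ip p (\<lambda>x. g x - \<psi> x) \<le> ennreal e" using \<psi>(1) by blast
  qed
  have bs: "?P u" if u: "bounded_supported u" for u :: "real^'m \<Rightarrow> complex"
  proof -
    from u obtain M R where uu: "u \<in> borel_measurable lebesgue" "\<And>x. cmod (u x) \<le> M" "\<And>x. R < norm x \<Longrightarrow> u x = 0"
      unfolding bounded_supported_def by blast
    show ?thesis
    proof (rule dominated_density[of 1 ?P, OF _ _ _ uu])
      fix g :: "real^'m \<Rightarrow> complex" assume g: "trig_poly g"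
      have s: "gauss_times 1 g \<in> schwartz" by (rule gauss_times_schwartz[OF _ g]) simp
      then show "?P (gauss_times 1 g)"
        using p by (auto intro!: schwartz_measurable bexI[OF _ s] simp: Ip_def)
    next
      fix g :: "real^'m \<Rightarrow> complex" and gn C
      assume m: "\<And>n::nat. gn n \<in> borel_measurable lebesgue" and P: "\<And>n. ?P (gn n)"
        and gm: "g \<in> borel_measurable lebesgue" and b: "\<And>n x. cmod (gn n x) \<le> C * exp (- 1 * (norm x)\<^sup>2)"
        and l: "AE x in lebesgue. (\<lambda>n. gn n x) \<longlonglongrightarrow> g x"
      have C: "0 \<le> C" using order_trans[OF norm_ge_zero b[of 0 0]] by simp
      have gb: "AE x in lebesgue. cmod (g x) \<le> C * exp (- 1 * (norm x)\<^sup>2)"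
        using l
      proof eventually_elim
        fix x assume "(\<lambda>n. gn n x) \<longlonglongrightarrow> g x"
        from tendsto_norm[OF this] show "cmod (g x) \<le> C * exp (- 1 * (norm x)\<^sup>2)"
          by (rule LIMSEQ_le_const2) (use b in auto)
      qed
      define w where "w = (\<lambda>x::real^'m. (2 * C) powr p * exp (- p * (norm x)\<^sup>2))"
      have wi: "integrable lebesgue w" unfolding w_def
        using p by (intro integrable_mult_right gaussian_integrable_lebesgue) auto
      have "(\<lambda>n. Ip p (\<lambda>x. g x - gn n x)) \<longlonglongrightarrow> (\<integral>\<^sup>+(x::real^'m). 0 \<partial>lebesgue)"
        unfolding Ip_def
      proof (rule nn_integral_dominated_convergence[where w="\<lambda>x. ennreal (w x)"])
        show "AE x in lebesgue. (\<lambda>n. ennreal (cmod (g x - gn n x) powr p)) \<longlonglongrightarrow> 0"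
          using l
        proof eventually_elim
          fix x assume l: "(\<lambda>n. gn n x) \<longlonglongrightarrow> g x"
          have "(\<lambda>n. cmod (g x - gn n x) powr p) \<longlonglongrightarrow> cmod (g x - g x) powr p"
            using p by (intro tendsto_powr' tendsto_norm tendsto_diff l tendsto_const) auto
          from tendsto_ennrealI[OF this] show "(\<lambda>n. ennreal (cmod (g x - gn n x) powr p)) \<longlonglongrightarrow> 0" by simp
        qed
        show "AE x in lebesgue. ennreal (cmod (g x - gn n x) powr p) \<le> ennreal (w x)" for n
          using gb
        proof eventually_elim
          fix x assume g: "cmod (g x) \<le> C * exp (- 1 * (norm x)\<^sup>2)"
          have "cmod (g x - gn n x) \<le> 2 * C * exp (- 1 * (norm x)\<^sup>2)"
            using norm_triangle_ineq4[of "g x" "gn n x"] g b[of n x] by linarith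
          then have "cmod (g x - gn n x) powr p \<le> (2 * C * exp (- 1 * (norm x)\<^sup>2)) powr p"
            using p by (intro powr_mono2) auto
          also have "\<dots> = w x" using C by (simp add: w_def powr_mult exp_powr_real mult_ac)
          finally show "ennreal (cmod (g x - gn n x) powr p) \<le> ennreal (w x)" by (rule ennreal_leI)
        qed
        show "(\<integral>\<^sup>+x. ennreal (w x) \<partial>lebesgue) < \<infinity>"
        proof -
          have "(\<integral>\<^sup>+x. ennreal (norm (w x)) \<partial>lebesgue) < \<infinity>"
            using wi unfolding integrable_iff_bounded by blast
          then show ?thesis by (simp add: w_def)
        qed
        show "(\<lambda>x. ennreal (cmod (g x - gn n x) powr p)) \<in> borel_measurable lebesgue" for n
          by (intro cmod_powr_measurable borel_measurable_diff gm m)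
        show "(\<lambda>x. ennreal (w x)) \<in> borel_measurable lebesgue"
          using borel_measurable_integrable[OF wi] by (rule measurable_compose) simp
      qed simp
      then show "?P g" by (intro limP[OF gm P]) simp
    qed simp
  qed
  have "?P f"
  proof (rule limP[OF f(1), of "\<lambda>n. trunc n f"])
    show "?P (trunc n f)" for n by (rule bs[OF trunc_bounded_supported[OF f(1)]])
    show "(\<lambda>n. Ip p (\<lambda>x. f x - trunc n f x)) \<longlonglongrightarrow> 0" using p by (intro Ip_trunc_tendsto f) auto
  qed
  then show ?thesis using e that by blast
qed

section \<open>Norms and uniqueness of extensions\<close>

lemma Lp_norm_real:
  "0 < p \<Longrightarrow> Lp_norm (ennreal p) f = (if Ip p f = \<infinity> then \<infinity> else ennreal (enn2real (Ip p f) powr (1/p)))"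
  by (simp add: Lp_norm_def Ip_def Let_def)

lemma Lp_norm_finite_iff: "0 < p \<Longrightarrow> Lp_norm (ennreal p) f < \<infinity> \<longleftrightarrow> Ip p f < \<infinity>"
  by (simp add: Lp_norm_real less_top[symmetric])

lemma Lp_norm_le:
  assumes "0 < p" "0 \<le> a" "Ip p f \<le> ennreal (a powr p)" shows "Lp_norm (ennreal p) f \<le> ennreal a"
proof -
  have "Ip p f \<noteq> \<infinity>" using assms(3) by (auto simp: top_unique)
  moreover have "enn2real (Ip p f) powr (1/p) \<le> (a powr p) powr (1/p)"
    using assms enn2real_mono[OF assms(3)] by (intro powr_mono2) auto
  ultimately show ?thesis using assms by (simp add: Lp_norm_real powr_powr ennreal_leI)
qed

lemma Lp_norm_eq_0:
  assumes f: "f \<in> borel_measurable lebesgue" and p: "p = \<infinity> \<or> (\<exists>r>0. p = ennreal r)" and 0: "Lp_norm p f = 0"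
  shows "AE x in lebesgue. f x = 0"
proof (cases "p = \<infinity>")
  case True
  have "AE x in lebesgue. ennreal (cmod (f x)) \<le> 0"
    using esssup_AE[of "\<lambda>x. ennreal (cmod (f x))" lebesgue] 0 True by (simp add: Lp_norm_def)
  then show ?thesis by eventually_elim auto
next
  case False
  then obtain r where r: "0 < r" "p = ennreal r" using p by auto
  then have "Ip r f \<noteq> \<infinity>" "enn2real (Ip r f) powr (1/r) = 0"
    using 0 by (auto simp: Lp_norm_real ennreal_eq_0_iff split: if_splits)
  then have "Ip r f = 0" by (auto simp: enn2real_eq_0_iff)
  then show ?thesis by (rule Ip_eq_0[OF f])
qed

lemma Lp_norm_cong_AE:
  assumes "f \<in> borel_measurable lebesgue" "g \<in> borel_measurable lebesgue"
    and ae: "AE x in lebesgue. cmod (f x) = cmod (g x)"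
  shows "Lp_norm p f = Lp_norm p g"
proof -
  have "AE x in lebesgue. ennreal (cmod (f x)) = ennreal (cmod (g x))" using ae by eventually_elim simp
  then have "esssup lebesgue (\<lambda>x. ennreal (cmod (f x))) = esssup lebesgue (\<lambda>x. ennreal (cmod (g x)))"
    by (intro esssup_AE_cong measurable_compose[OF cmod_measurable measurable_ennreal] assms)
  moreover have "(\<integral>\<^sup>+x. ennreal (cmod (f x) powr enn2real p) \<partial>lebesgue) = (\<integral>\<^sup>+x. ennreal (cmod (g x) powr enn2real p) \<partial>lebesgue)"
    by (rule nn_integral_cong_AE) (use ae in eventually_elim, simp)
  ultimately show ?thesis by (simp add: Lp_norm_def)
qed

text \<open>A triangle inequality with constant \<open>4\<close>, from \<open>(a + b)\<^sup>r
  \<le> 2\<^sup>r (a\<^sup>r + b\<^sup>r)\<close>; it serves to let \<open>L\<^sup>q\<close>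
  distances tend to zero, where any constant does.\<close>

lemma Lp_norm_add_le:
  assumes f: "f \<in> borel_measurable lebesgue" "g \<in> borel_measurable lebesgue"
    and p: "p = \<infinity> \<or> (\<exists>r\<ge>1. p = ennreal r)"
  shows "Lp_norm p (\<lambda>x. f x + g x) \<le> 4 * (Lp_norm p f + Lp_norm p g)"
proof (cases "p = \<infinity>")
  case True
  let ?n = "\<lambda>f. esssup lebesgue (\<lambda>x. ennreal (cmod (f x)))"
  have "?n (\<lambda>x. f x + g x) \<le> ?n f + ?n g"
  proof (rule esssup_I)
    show "(\<lambda>x. ennreal (cmod (f x + g x))) \<in> borel_measurable lebesgue"
      by (intro measurable_compose[OF cmod_measurable measurable_ennreal] borel_measurable_add f)
    show "AE x in lebesgue. ennreal (cmod (f x + g x)) \<le> ?n f + ?n g"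
      using esssup_AE[of "\<lambda>x. ennreal (cmod (f x))" lebesgue] esssup_AE[of "\<lambda>x. ennreal (cmod (g x))" lebesgue]
    proof eventually_elim
      fix x assume 1: "ennreal (cmod (f x)) \<le> ?n f" "ennreal (cmod (g x)) \<le> ?n g"
      have "ennreal (cmod (f x + g x)) \<le> ennreal (cmod (f x)) + ennreal (cmod (g x))"
        by (simp add: ennreal_plus[symmetric] ennreal_leI norm_triangle_ineq del: ennreal_plus)
      also have "\<dots> \<le> ?n f + ?n g" by (intro add_mono 1)
      finally show "ennreal (cmod (f x + g x)) \<le> ?n f + ?n g" .
    qed
  qed
  also have "\<dots> \<le> 4 * (?n f + ?n g)"
    using mult_right_mono[of 1 4 "?n f + ?n g"] by simp
  finally show ?thesis using True by (simp add: Lp_norm_def)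
next
  case False
  then obtain r where r: "1 \<le> r" "p = ennreal r" using p by auto
  then have r0: "0 < r" by simp
  show ?thesis
  proof (cases "Ip r f = \<infinity> \<or> Ip r g = \<infinity>")
    case True
    then have e: "Lp_norm p f + Lp_norm p g = \<infinity>" using r0 r by (auto simp: Lp_norm_real)
    show ?thesis unfolding e by (simp add: ennreal_mult_top)
  next
    case False
    define a where "a = enn2real (Ip r f)" define b where "b = enn2real (Ip r g)"
    have ab: "Ip r f = ennreal a" "Ip r g = ennreal b" "0 \<le> a" "0 \<le> b"
      using False by (auto simp: a_def b_def less_top)
    define A where "A = a powr (1/r)" define B where "B = b powr (1/r)"
    have AB: "A powr r = a" "B powr r = b" "0 \<le> A" "0 \<le> B"
      using ab r0 by (auto simp: A_def B_def powr_powr)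
    have "Ip r (\<lambda>x. f x + g x) \<le> ennreal (2 powr r) * (ennreal a + ennreal b)"
      using Ip_add_le[OF f, of r] r0 ab by simp
    also have "\<dots> = ennreal (2 powr r * (A powr r + B powr r))"
      using ab AB by (simp add: ennreal_mult[symmetric] ennreal_plus[symmetric] del: ennreal_plus)
    also have "\<dots> \<le> ennreal ((4 * (A + B)) powr r)"
    proof (rule ennreal_leI)
      have "A powr r \<le> (A + B) powr r" "B powr r \<le> (A + B) powr r" using AB r0 by (auto intro!: powr_mono2)
      then have "A powr r + B powr r \<le> 2 * (A + B) powr r" by linarith
      also have "\<dots> \<le> 2 powr r * (A + B) powr r"
        using powr_mono[of 1 r 2] r by (intro mult_right_mono) auto
      finally have "2 powr r * (A powr r + B powr r) \<le> 2 powr r * (2 powr r * (A + B) powr r)"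
        by (intro mult_left_mono) auto
      also have "\<dots> = (4 * (A + B)) powr r"
      proof -
        have "(4 * (A + B)) powr r = 4 powr r * (A + B) powr r" by (rule powr_mult)
        moreover have "4 powr r = 2 powr r * 2 powr r" using powr_mult[of 2 2 r] by simp
        ultimately show ?thesis by simp
      qed
      finally show "2 powr r * (A powr r + B powr r) \<le> (4 * (A + B)) powr r" .
    qed
    finally have "Lp_norm p (\<lambda>x. f x + g x) \<le> ennreal (4 * (A + B))"
      unfolding r using AB by (intro Lp_norm_le r0) auto
    also have "\<dots> = ennreal 4 * (ennreal A + ennreal B)" using AB by (simp only: ennreal_mult ennreal_plus[symmetric])
    also have "\<dots> = 4 * (Lp_norm p f + Lp_norm p g)"
      using False r0 by (simp add: r Lp_norm_real A_def B_def a_def b_def)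
    finally show ?thesis .
  qed
qed

text \<open>Two bounded extensions agree on Schwartz functions, hence differ at \<open>f\<close>
  by at most a constant times the distance of \<open>f\<close> to a Schwartz function.\<close>

lemma extension_unique:
  fixes S1 S2 :: "(real^'m \<Rightarrow> complex) \<Rightarrow> real^'m \<Rightarrow> complex"
  assumes p: "1 \<le> p" and q: "q = \<infinity> \<or> (\<exists>r\<ge>1. q = ennreal r)"
    and S: "bounded_extension (ennreal p) q T S1" "bounded_extension (ennreal p) q T S2"
    and f: "f \<in> Lp (ennreal p)"
  shows "ae_eq (S1 f) (S2 f)"
proof -
  have p0: "0 < p" using p by simp
  obtain C1 where C1: "C1 < \<infinity>" "\<And>f. f \<in> Lp (ennreal p) \<Longrightarrow> Lp_norm q (S1 f) \<le> C1 * Lp_norm (ennreal p) f"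
    using S(1) unfolding bounded_extension_def bounded_linear_Lp_def by blast
  obtain C2 where C2: "C2 < \<infinity>" "\<And>f. f \<in> Lp (ennreal p) \<Longrightarrow> Lp_norm q (S2 f) \<le> C2 * Lp_norm (ennreal p) f"
    using S(2) unfolding bounded_extension_def bounded_linear_Lp_def by blast
  have fm: "f \<in> borel_measurable lebesgue" and fI: "Ip p f < \<infinity>"
    using f Lp_norm_finite_iff[OF p0, of f] by (simp_all add: Lp_def)
  have mS: "S1 g \<in> borel_measurable lebesgue" "S2 g \<in> borel_measurable lebesgue" if "g \<in> Lp (ennreal p)" for g
    using S that unfolding bounded_extension_def bounded_linear_Lp_def Lp_def by blast+
  have lin: "ae_eq (S1 (\<lambda>x. 1 * g x + 1 * h x)) (\<lambda>x. 1 * S1 g x + 1 * S1 h x)"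
     "ae_eq (S2 (\<lambda>x. 1 * g x + 1 * h x)) (\<lambda>x. 1 * S2 g x + 1 * S2 h x)"
    if "g \<in> Lp (ennreal p)" "h \<in> Lp (ennreal p)" for g h
    using S that unfolding bounded_extension_def bounded_linear_Lp_def by blast+
  have key: "Lp_norm q (\<lambda>x. S1 f x - S2 f x) \<le> (4 * (C1 + C2)) * ennreal d" if d: "0 < d" for d
  proof -
    obtain \<psi> where \<psi>: "\<psi> \<in> schwartz" "Ip p (\<lambda>x. f x - \<psi> x) \<le> ennreal (d powr p)"
      using schwartz_dense[OF fm fI p, of "d powr p"] d by auto
    define g where "g = (\<lambda>x. f x - \<psi> x)"
    have gm: "g \<in> borel_measurable lebesgue" unfolding g_def by (intro borel_measurable_diff fm schwartz_measurable \<psi>)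
    have gd: "Lp_norm (ennreal p) g \<le> ennreal d" unfolding g_def using d by (intro Lp_norm_le p0 \<psi>(2)) auto
    have gL: "g \<in> Lp (ennreal p)" using gm order_le_less_trans[OF gd] by (simp add: Lp_def)
    have \<psi>L: "\<psi> \<in> Lp (ennreal p)" using \<psi>(1) Ip_schwartz_finite[OF \<psi>(1) p] Lp_norm_finite_iff[OF p0, of \<psi>]
      by (simp add: Lp_def schwartz_measurable)
    have feq: "(\<lambda>x. 1 * g x + 1 * \<psi> x) = f" by (simp add: g_def)
    have "AE x in lebesgue. S1 f x = S1 g x + S1 \<psi> x" "AE x in lebesgue. S2 f x = S2 g x + S2 \<psi> x"
      using lin[OF gL \<psi>L] unfolding feq ae_eq_def by simp_all
    moreover have "AE x in lebesgue. S1 \<psi> x = T \<psi> x" "AE x in lebesgue. S2 \<psi> x = T \<psi> x"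
      using S \<psi>(1) unfolding bounded_extension_def ae_eq_def by blast+
    ultimately have ae: "AE x in lebesgue. cmod (S1 f x - S2 f x) = cmod (S1 g x + - S2 g x)"
      by eventually_elim simp
    have "Lp_norm q (\<lambda>x. S1 f x - S2 f x) = Lp_norm q (\<lambda>x. S1 g x + - S2 g x)"
      by (rule Lp_norm_cong_AE[OF _ _ ae]) (auto intro!: borel_measurable_diff borel_measurable_add borel_measurable_uminus mS f gL)
    also have "\<dots> \<le> 4 * (Lp_norm q (S1 g) + Lp_norm q (\<lambda>x. - S2 g x))"
      by (intro Lp_norm_add_le q borel_measurable_uminus mS gL)
    also have "Lp_norm q (\<lambda>x. - S2 g x) = Lp_norm q (S2 g)"
      by (intro Lp_norm_cong_AE borel_measurable_uminus mS gL) simp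
    also have "4 * (Lp_norm q (S1 g) + Lp_norm q (S2 g)) \<le> 4 * (C1 * ennreal d + C2 * ennreal d)"
      by (intro mult_left_mono add_mono order_trans[OF C1(2)[OF gL]] order_trans[OF C2(2)[OF gL]] mult_left_mono gd) auto
    finally show ?thesis by (simp add: distrib_right mult.assoc)
  qed
  have fin: "4 * (C1 + C2) < \<infinity>" using C1 C2 by (simp add: ennreal_mult_less_top)
  have "(\<lambda>n::nat. (4 * (C1 + C2)) * ennreal (1 / real (Suc n))) \<longlonglongrightarrow> (4 * (C1 + C2)) * ennreal 0"
    using fin LIMSEQ_inverse_real_of_nat by (intro ennreal_tendsto_cmult tendsto_ennrealI) (simp_all add: inverse_eq_divide)
  then have "(\<lambda>n::nat. Lp_norm q (\<lambda>x. S1 f x - S2 f x)) \<longlonglongrightarrow> 0"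
    by (intro tendsto_zero_sandwich_ennreal[OF _ key]) auto
  then have "Lp_norm q (\<lambda>x. S1 f x - S2 f x) = 0" by (rule LIMSEQ_unique[OF tendsto_const])
  moreover have "q = \<infinity> \<or> (\<exists>r>0. q = ennreal r)" using q by (metis less_le_trans zero_less_one)
  ultimately have "AE x in lebesgue. S1 f x - S2 f x = 0"
    by (intro Lp_norm_eq_0 borel_measurable_diff mS f)
  then show ?thesis unfolding ae_eq_def by eventually_elim simp
qed

section \<open>The bounded extension\<close>

lemma T_const_real:
  fixes Q B :: "real^'m^'m"
  assumes "1 < p" "1 < q"
  shows "T_const Q B t (ennreal p) (ennreal q) =
    (4 * pi) powr (- (real CARD('m) / 2) + real CARD('m) * (1 / q)) * (p powr (1/p) / q powr (1/q)) powr (real CARD('m) / 2)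
     * (exp (- (trace B * (1/q) * t)) / det (Qt Q B t) powr (1 / 2 - 1/q))"
proof -
  have "enn2real (inverse (ennreal q)) = 1/q"
    using assms by (simp add: inverse_ennreal inverse_eq_divide)
  moreover have "self_root (ennreal p) = p powr (1/p)" "self_root (ennreal q) = q powr (1/q)"
    using assms by (simp_all add: self_root_def)
  ultimately show ?thesis by (simp add: T_const_def Let_def)
qed

text \<open>The range \<open>1 \<le> p \<le> 2\<close> splits into the endpoint \<open>p =
  1\<close>, \<open>p' = \<infinity>\<close> and real exponents.\<close>

lemma conj_exponents_cases:
  assumes "conj_exponents p p'" "p \<le> 2"
  obtains "p = 1" "p' = \<infinity>"
    | P Q where "p = ennreal P" "p' = ennreal Q" "1 < P" "P \<le> 2" "1/P + 1/Q = 1"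
proof -
  have 1: "1 \<le> p" "1 \<le> p'" "inverse p + inverse p' = 1" using assms by (auto simp: conj_exponents_def)
  have "p \<noteq> \<infinity>" using assms(2) by (auto simp: top_unique)
  then obtain P where P: "p = ennreal P" "0 \<le> P" by (cases p) auto
  have P1: "1 \<le> P" "P \<le> 2"
    using 1(1) assms(2) P by (simp_all add: ennreal_1[symmetric] ennreal_le_iff ennreal_numeral[symmetric] del: ennreal_1 ennreal_numeral)
  have ip: "inverse p = ennreal (1/P)" using P P1 by (simp add: inverse_ennreal inverse_eq_divide)
  show ?thesis
  proof (cases "P = 1")
    case True
    then have "1 + inverse p' = 1 + 0" using 1(3) ip by simp
    then have "inverse p' = 0" by (subst (asm) ennreal_add_left_cancel) auto
    then have "p' = \<infinity>" by simp
    then show ?thesis using that(1) True P by simp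
  next
    case False
    then have P2: "1 < P" using P1 by simp
    have "p' \<noteq> \<infinity>"
    proof
      assume "p' = \<infinity>"
      then have "ennreal (1/P) = ennreal 1" using 1(3) ip by simp
      then show False using P2 by (subst (asm) ennreal_inj) auto
    qed
    then obtain Q where Q: "p' = ennreal Q" "0 \<le> Q" by (cases p') auto
    have Q1: "1 \<le> Q" using 1(2) Q by (simp add: ennreal_1[symmetric] ennreal_le_iff del: ennreal_1)
    have "inverse p' = ennreal (1/Q)" using Q Q1 by (simp add: inverse_ennreal inverse_eq_divide)
    then have "ennreal (1/P + 1/Q) = ennreal 1" using 1(3) ip P2 Q1 by (simp add: ennreal_plus[symmetric] del: ennreal_plus)
    then have "1/P + 1/Q = 1" using P2 Q1 by (subst (asm) ennreal_inj) auto
    then show ?thesis using that(2) P Q P2 P1 by blast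
  qed
qed

context schroedinger
begin

lemma sharp_const_pos: "1 < p \<Longrightarrow> 1 < q \<Longrightarrow> 0 < sharp_const p q"
  using D_pos by (simp add: sharp_const_def Let_def)

lemma bounded_supported_integrable: "bounded_supported u \<Longrightarrow> integrable lebesgue (u :: real^'m \<Rightarrow> complex)"
  using bounded_supported_bilinear(1)[of 2 u u] by simp

lemma T_op_Ip_le:
  assumes p: "1 < p" "p \<le> 2" and pq: "1/p + 1/q = 1" and u: "bounded_supported u"
    and d: "0 \<le> d" "Ip p u \<le> ennreal (d powr p)"
  shows "Ip q (T u) \<le> ennreal ((sharp_const p q * d) powr q)"
proof -
  note c = conjugate_exponents_real[OF p(1) pq]
  have N0: "0 \<le> Np p u" by (simp add: Np_def)
  have "ennreal (Np p u powr p) \<le> ennreal (d powr p)"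
    using Ip_bounded_supported_finite(2)[OF u, of p] p d by simp
  then have "Np p u powr p \<le> d powr p" using d by (simp add: ennreal_le_iff)
  then have "(Np p u powr p) powr (1/p) \<le> (d powr p) powr (1/p)" using p by (intro powr_mono2[of "1/p"]) (simp_all only: powr_ge_zero, simp_all)
  then have "Np p u \<le> d" using p N0 d by (simp add: powr_powr)
  then have "(sharp_const p q * Np p u) powr q \<le> (sharp_const p q * d) powr q"
    using c(1) sharp_const_pos[OF p(1) c(1)] N0 by (intro powr_mono2 mult_left_mono mult_nonneg_nonneg) auto
  then show ?thesis
    using T_op_sharp_bound[OF p pq u] unfolding Ip_def by (meson ennreal_leI order_trans)
qed

lemma T_op_tendsto_zero:
  assumes p: "1 < p" "p \<le> 2" and pq: "1/p + 1/q = 1" and u: "\<And>n. bounded_supported (u n)"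
    and l: "(\<lambda>n. Ip p (u n)) \<longlonglongrightarrow> 0"
  shows "(\<lambda>n. Ip q (T (u n))) \<longlonglongrightarrow> 0"
proof (rule tendsto_zero_ennrealI)
  fix e :: real assume e: "0 < e"
  note c = conjugate_exponents_real[OF p(1) pq]
  define d where "d = e powr (1/q) / sharp_const p q"
  have C: "0 < sharp_const p q" by (rule sharp_const_pos[OF p(1) c(1)])
  have d: "0 < d" "(sharp_const p q * d) powr q = e"
    using e C c(1) by (auto simp: d_def powr_powr)
  have "0 < d powr p" using d by simp
  from tendsto_zero_ennrealD[OF l this]
  show "\<forall>\<^sub>F n in sequentially. Ip q (T (u n)) \<le> ennreal e"
    by eventually_elim (use T_op_Ip_le[OF p pq u, of d] d in simp)
qed

text \<open>A relation and not a function, because the limit of \<open>\<T>(t)\<close> along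
  truncations is determined only almost everywhere. Norm convergence serves linearity; pointwise
  convergence of a subsequence serves the bound, through Fatou's lemma, and the comparison with
  the integral formula.\<close>

definition trunc_limit :: "real \<Rightarrow> (real^'m \<Rightarrow> complex) \<Rightarrow> (real^'m \<Rightarrow> complex) \<Rightarrow> bool" where
  "trunc_limit q f g \<longleftrightarrow> g \<in> borel_measurable lebesgue
     \<and> (\<lambda>n. Ip q (\<lambda>x. T (trunc n f) x - g x)) \<longlonglongrightarrow> 0
     \<and> (\<exists>s::nat \<Rightarrow> nat. strict_mono s \<and> (AE x in lebesgue. (\<lambda>k. T (trunc (s k) f) x) \<longlonglongrightarrow> g x))"

lemma T_op_trunc_measurable:
  "f \<in> borel_measurable lebesgue \<Longrightarrow> T (trunc n f) \<in> borel_measurable lebesgue"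
  by (intro T_op_measurable bounded_supported_integrable trunc_bounded_supported)

lemma ex_trunc_limit:
  assumes p: "1 < p" "p \<le> 2" and pq: "1/p + 1/q = 1"
    and f: "f \<in> borel_measurable lebesgue" "Ip p f < \<infinity>"
  shows "\<exists>g. trunc_limit q f g"
proof -
  note c = conjugate_exponents_real[OF p(1) pq]
  have bs: "bounded_supported (trunc n f)" for n by (rule trunc_bounded_supported[OF f(1)])
  have tm: "trunc n f \<in> borel_measurable lebesgue" for n using bs by (simp add: bounded_supported_def)
  have cauchy: "\<exists>N. \<forall>n\<ge>N. \<forall>k\<ge>N. Ip q (\<lambda>x. T (trunc k f) x - T (trunc n f) x) \<le> ennreal e"
    if e: "0 < e" for e
  proof -
    define d where "d = e powr (1/q) / sharp_const p q"
    have C: "0 < sharp_const p q" by (rule sharp_const_pos[OF p(1) c(1)])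
    have d: "0 < d" "(sharp_const p q * d) powr q = e"
      using e C c(1) by (auto simp: d_def powr_powr)
    \<comment> \<open>chosen so that \<open>2\<^sup>p (b + b) = d\<^sup>p\<close>\<close>
    define b where "b = d powr p / (2 * 2 powr p)"
    have b: "0 < b" using d by (simp add: b_def)
    have "(\<lambda>n. Ip p (\<lambda>x. f x - trunc n f x)) \<longlonglongrightarrow> 0" using p by (intro Ip_trunc_tendsto f) auto
    from tendsto_zero_ennrealD[OF this b] obtain N
      where N: "\<And>n. N \<le> n \<Longrightarrow> Ip p (\<lambda>x. f x - trunc n f x) \<le> ennreal b"
      unfolding eventually_sequentially by blast
    have "Ip q (\<lambda>x. T (trunc k f) x - T (trunc n f) x) \<le> ennreal e"
      if nk: "N \<le> n" "N \<le> k" for n k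
    proof -
      let ?u = "\<lambda>x. 1 * trunc k f x + (- 1) * trunc n f x"
      have u: "bounded_supported ?u" by (intro bounded_supported_lincomb bs)
      have "Ip p ?u = Ip p (\<lambda>x. (f x - trunc n f x) + (- 1) * (f x - trunc k f x))" by (simp add: algebra_simps)
      also have "\<dots> \<le> ennreal (2 powr p) * (Ip p (\<lambda>x. f x - trunc n f x) + Ip p (\<lambda>x. (- 1) * (f x - trunc k f x)))"
        using p by (intro Ip_add_le borel_measurable_diff borel_measurable_times borel_measurable_const f tm) auto
      also have "Ip p (\<lambda>x. (- 1) * (f x - trunc k f x)) = Ip p (\<lambda>x. f x - trunc k f x)"
        by (intro Ip_cong_AE) (simp add: norm_minus_commute)
      also have "ennreal (2 powr p) * (Ip p (\<lambda>x. f x - trunc n f x) + Ip p (\<lambda>x. f x - trunc k f x))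
          \<le> ennreal (2 powr p) * (ennreal b + ennreal b)"
        by (intro mult_left_mono add_mono N nk) auto
      also have "\<dots> = ennreal (d powr p)"
        using b by (simp add: ennreal_mult[symmetric] ennreal_plus[symmetric] b_def del: ennreal_plus)
      finally have "Ip q (T ?u) \<le> ennreal ((sharp_const p q * d) powr q)"
        using d by (intro T_op_Ip_le p pq u) auto
      moreover have "T ?u = (\<lambda>x. 1 * T (trunc k f) x + (- 1) * T (trunc n f) x)"
        by (intro ext T_op_linear bounded_supported_integrable bs)
      ultimately show ?thesis using d(2) by simp
    qed
    then show ?thesis by blast
  qed
  obtain g s where "g \<in> borel_measurable lebesgue" "(\<lambda>n. Ip q (\<lambda>x. T (trunc n f) x - g x)) \<longlonglongrightarrow> 0"
    "strict_mono (s :: nat \<Rightarrow> nat)" "AE x in lebesgue. (\<lambda>k. T (trunc (s k) f) x) \<longlonglongrightarrow> g x"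
    by (rule Ip_complete[of "\<lambda>n. T (trunc n f)" q])
       (use c(1) cauchy T_op_trunc_measurable[OF f(1)] in auto)
  then show ?thesis unfolding trunc_limit_def by blast
qed

lemma trunc_limit_bound:
  assumes p: "1 < p" "p \<le> 2" and pq: "1/p + 1/q = 1"
    and f: "f \<in> borel_measurable lebesgue" "Ip p f < \<infinity>" and g: "trunc_limit q f g"
  shows "Lp_norm (ennreal q) g \<le> ennreal (sharp_const p q) * Lp_norm (ennreal p) f"
proof -
  note c = conjugate_exponents_real[OF p(1) pq]
  define d where "d = enn2real (Ip p f) powr (1/p)"
  have d: "0 \<le> d" "d powr p = enn2real (Ip p f)" using p by (auto simp: d_def powr_powr)
  have fd: "Ip p f = ennreal (d powr p)" unfolding d using f(2) by (simp add: less_top)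
  obtain s where s: "strict_mono (s :: nat \<Rightarrow> nat)" "AE x in lebesgue. (\<lambda>k. T (trunc (s k) f) x) \<longlonglongrightarrow> g x"
    using g unfolding trunc_limit_def by blast
  have Tk: "Ip q (T (trunc n f)) \<le> ennreal ((sharp_const p q * d) powr q)" for n
  proof (rule T_op_Ip_le[OF p pq trunc_bounded_supported[OF f(1)] d(1)])
    show "Ip p (trunc n f) \<le> ennreal (d powr p)"
      unfolding fd[symmetric] using p by (intro Ip_mono trunc_le) auto
  qed
  have "Ip q g = (\<integral>\<^sup>+x. liminf (\<lambda>k. ennreal (cmod (T (trunc (s k) f) x) powr q)) \<partial>lebesgue)"
    unfolding Ip_def
  proof (rule nn_integral_cong_AE)
    show "AE x in lebesgue. ennreal (cmod (g x) powr q) = liminf (\<lambda>k. ennreal (cmod (T (trunc (s k) f) x) powr q))"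
      using s(2)
    proof eventually_elim
      fix x assume l: "(\<lambda>k. T (trunc (s k) f) x) \<longlonglongrightarrow> g x"
      have "(\<lambda>k. ennreal (cmod (T (trunc (s k) f) x) powr q)) \<longlonglongrightarrow> ennreal (cmod (g x) powr q)"
        using c(1) by (intro tendsto_ennrealI tendsto_powr' tendsto_norm l tendsto_const) auto
      then show "ennreal (cmod (g x) powr q) = liminf (\<lambda>k. ennreal (cmod (T (trunc (s k) f) x) powr q))"
        by (intro lim_imp_Liminf[symmetric] trivial_limit_sequentially)
    qed
  qed
  also have "\<dots> \<le> liminf (\<lambda>k. Ip q (T (trunc (s k) f)))"
    unfolding Ip_def by (intro nn_integral_liminf cmod_powr_measurable T_op_trunc_measurable f)
  also have "\<dots> \<le> ennreal ((sharp_const p q * d) powr q)"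
    by (rule Liminf_le) (use Tk in auto)
  finally have "Lp_norm (ennreal q) g \<le> ennreal (sharp_const p q * d)"
    using c(1) d sharp_const_pos[OF p(1) c(1)] by (intro Lp_norm_le) auto
  also have "\<dots> = ennreal (sharp_const p q) * Lp_norm (ennreal p) f"
    using p f(2) d sharp_const_pos[OF p(1) c(1)] by (simp add: Lp_norm_real d_def ennreal_mult)
  finally show ?thesis .
qed

lemma T_op_trunc_tendsto:
  assumes \<phi>: "integrable lebesgue \<phi>"
  shows "(\<lambda>n. T (trunc n \<phi>) x) \<longlonglongrightarrow> T \<phi> x"
proof -
  have "(\<lambda>n. fourier 1 (\<lambda>y. chirp R y * trunc n \<phi> y) w) \<longlonglongrightarrow> fourier 1 (\<lambda>y. chirp R y * \<phi> y) w" for w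
    unfolding fourier_def
  proof (rule integral_dominated_convergence[where w="\<lambda>y. cmod (\<phi> y)"])
    show "AE y in lebesgue. (\<lambda>n. cis (1 * (y \<bullet> w)) * (chirp R y * trunc n \<phi> y)) \<longlonglongrightarrow> cis (1 * (y \<bullet> w)) * (chirp R y * \<phi> y)"
      by (intro AE_I2 tendsto_mult tendsto_const trunc_tendsto)
    show "AE y in lebesgue. norm (cis (1 * (y \<bullet> w)) * (chirp R y * trunc n \<phi> y)) \<le> cmod (\<phi> y)" for n
      by (simp add: norm_mult trunc_le)
    have m: "\<phi> \<in> borel_measurable lebesgue" using \<phi> by simp
    show "(\<lambda>y. cis (1 * (y \<bullet> w)) * (chirp R y * \<phi> y)) \<in> borel_measurable lebesgue"
      by (intro borel_measurable_times cis_kernel_measurable chirp_measurable m)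
    show "(\<lambda>y. cis (1 * (y \<bullet> w)) * (chirp R y * trunc n \<phi> y)) \<in> borel_measurable lebesgue" for n
      using trunc_bounded_supported[OF m, of n]
      by (intro borel_measurable_times cis_kernel_measurable chirp_measurable) (simp add: bounded_supported_def)
  qed (use \<phi> in simp)
  then show ?thesis unfolding T_op_fourier[OF one_neq_zero] by (intro tendsto_mult tendsto_const)
qed

lemma trunc_limit_eq_T_op:
  assumes \<phi>: "integrable lebesgue \<phi>" and g: "trunc_limit q \<phi> g"
  shows "AE x in lebesgue. g x = T \<phi> x"
proof -
  obtain s where s: "strict_mono (s :: nat \<Rightarrow> nat)" "AE x in lebesgue. (\<lambda>k. T (trunc (s k) \<phi>) x) \<longlonglongrightarrow> g x"
    using g unfolding trunc_limit_def by blast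
  from s(2) show ?thesis
  proof eventually_elim
    fix x assume "(\<lambda>k. T (trunc (s k) \<phi>) x) \<longlonglongrightarrow> g x"
    moreover have "(\<lambda>k. T (trunc (s k) \<phi>) x) \<longlonglongrightarrow> T \<phi> x"
      using LIMSEQ_subseq_LIMSEQ[OF T_op_trunc_tendsto[OF \<phi>] s(1)] by (simp add: o_def)
    ultimately show "g x = T \<phi> x" by (rule LIMSEQ_unique)
  qed
qed

text \<open>Truncation is not linear, but \<open>trunc n (a f + b g)\<close> and \<open>a trunc
  n f + b trunc n g\<close> both tend to \<open>a f + b g\<close> in \<open>L\<^sup>p\<close>,
  so \<open>\<T>(t)\<close> of their difference \<open>w n\<close> tends to \<open>0\<close> in
  \<open>L\<^sup>q\<close>.\<close>

lemma trunc_limit_linear: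
  assumes p: "1 < p" "p \<le> 2" and pq: "1/p + 1/q = 1"
    and f: "f \<in> borel_measurable lebesgue" "Ip p f < \<infinity>" and g: "g \<in> borel_measurable lebesgue" "Ip p g < \<infinity>"
    and h: "h = (\<lambda>x. a * f x + b * g x)"
    and F: "trunc_limit q f F" and G: "trunc_limit q g G" and H: "trunc_limit q h H"
  shows "AE x in lebesgue. H x = a * F x + b * G x"
proof -
  note c = conjugate_exponents_real[OF p(1) pq]
  have p0: "0 < p" "0 \<le> p" "0 \<le> q" using p c by auto
  have hm: "h \<in> borel_measurable lebesgue"
    unfolding h by (intro borel_measurable_add borel_measurable_times f g borel_measurable_const)
  have af: "(\<lambda>x. a * f x) \<in> borel_measurable lebesgue" and bg: "(\<lambda>x. b * g x) \<in> borel_measurable lebesgue"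
    by (intro borel_measurable_times f g borel_measurable_const)+
  have hI: "Ip p h < \<infinity>"
  proof -
    have "Ip p h \<le> ennreal (2 powr p) * (ennreal (cmod a powr p) * Ip p f + ennreal (cmod b powr p) * Ip p g)"
      using Ip_add_le[OF af bg p0(2)] unfolding Ip_mult[OF f(1)] Ip_mult[OF g(1)] h .
    also have "\<dots> < \<infinity>" using f(2) g(2) by (simp add: ennreal_mult_less_top)
    finally show ?thesis .
  qed
  have bs: "bounded_supported (trunc n f)" "bounded_supported (trunc n g)" "bounded_supported (trunc n h)" for n
    by (intro trunc_bounded_supported f g hm)+
  have tm: "trunc n f \<in> borel_measurable lebesgue" "trunc n g \<in> borel_measurable lebesgue" "trunc n h \<in> borel_measurable lebesgue" for n
    using bs[of n] by (auto simp: bounded_supported_def)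
  have Tm: "T (trunc n f) \<in> borel_measurable lebesgue" "T (trunc n g) \<in> borel_measurable lebesgue"
    "T (trunc n h) \<in> borel_measurable lebesgue" for n
    by (intro T_op_trunc_measurable f g hm)+
  have FGHm: "F \<in> borel_measurable lebesgue" "G \<in> borel_measurable lebesgue" "H \<in> borel_measurable lebesgue"
    using F G H by (auto simp: trunc_limit_def)
  have lF: "(\<lambda>n. Ip q (\<lambda>x. T (trunc n f) x - F x)) \<longlonglongrightarrow> 0"
    and lG: "(\<lambda>n. Ip q (\<lambda>x. T (trunc n g) x - G x)) \<longlonglongrightarrow> 0"
    and lH: "(\<lambda>n. Ip q (\<lambda>x. T (trunc n h) x - H x)) \<longlonglongrightarrow> 0"
    using F G H by (auto simp: trunc_limit_def)
  define v where "v = (\<lambda>n x. a * trunc n f x + b * trunc n g x)"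
  define w where "w = (\<lambda>n x. 1 * trunc n h x + (- 1) * v n x)"
  have vb: "bounded_supported (v n)" for n unfolding v_def by (intro bounded_supported_lincomb bs)
  have wb: "bounded_supported (w n)" for n unfolding w_def by (intro bounded_supported_lincomb bs vb)
  have "(\<lambda>n. Ip p (\<lambda>x. (- 1) * (h x - trunc n h x) + (a * (f x - trunc n f x) + b * (g x - trunc n g x)))) \<longlonglongrightarrow> 0"
    by (intro Ip_tendsto_zero_add Ip_tendsto_zero_mult Ip_trunc_tendsto borel_measurable_add borel_measurable_times
        borel_measurable_diff borel_measurable_const f g hm hI tm p0)
  moreover have "(\<lambda>x. (- 1) * (h x - trunc n h x) + (a * (f x - trunc n f x) + b * (g x - trunc n g x))) = w n" for n
    by (simp add: fun_eq_iff w_def v_def h algebra_simps)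
  ultimately have "(\<lambda>n. Ip p (w n)) \<longlonglongrightarrow> 0" by simp
  then have lw: "(\<lambda>n. Ip q (T (w n))) \<longlonglongrightarrow> 0" by (rule T_op_tendsto_zero[OF p pq wb])
  have Tw: "T (w n) x = T (trunc n h) x - (a * T (trunc n f) x + b * T (trunc n g) x)" for n x
  proof -
    have "T (w n) x = 1 * T (trunc n h) x + (- 1) * T (v n) x"
      unfolding w_def by (intro T_op_linear bounded_supported_integrable bs vb)
    moreover have "T (v n) x = a * T (trunc n f) x + b * T (trunc n g) x"
      unfolding v_def by (intro T_op_linear bounded_supported_integrable bs)
    ultimately show ?thesis by simp
  qed
  have "(\<lambda>n. Ip q (\<lambda>x. T (w n) x + (a * (T (trunc n f) x - F x) + b * (T (trunc n g) x - G x)))) \<longlonglongrightarrow> 0"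
    by (intro Ip_tendsto_zero_add Ip_tendsto_zero_mult lw lF lG borel_measurable_add borel_measurable_times
        borel_measurable_diff borel_measurable_const Tm FGHm p0 T_op_measurable bounded_supported_integrable wb)
  moreover have "(\<lambda>x. T (w n) x + (a * (T (trunc n f) x - F x) + b * (T (trunc n g) x - G x)))
     = (\<lambda>x. T (trunc n h) x - (a * F x + b * G x))" for n
    by (simp add: fun_eq_iff Tw algebra_simps)
  ultimately have "(\<lambda>n. Ip q (\<lambda>x. T (trunc n h) x - (a * F x + b * G x))) \<longlonglongrightarrow> 0" by simp
  from Ip_limit_unique[OF Tm(3) FGHm(3) _ p0(3) lH this] FGHm show ?thesis
    by (simp add: borel_measurable_add borel_measurable_times)
qed

theorem extension_exists:
  assumes p: "1 < p" "p \<le> 2" and pq: "1/p + 1/q = 1"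
  shows "\<exists>S. bounded_extension (ennreal p) (ennreal q) T S \<and>
     (\<forall>f\<in>Lp (ennreal p). Lp_norm (ennreal q) (S f) \<le> ennreal (sharp_const p q) * Lp_norm (ennreal p) f)"
proof -
  note c = conjugate_exponents_real[OF p(1) pq]
  have p0: "0 < p" using p by simp
  define S where "S = (\<lambda>f. SOME g. trunc_limit q f g)"
  have L: "f \<in> borel_measurable lebesgue" "Ip p f < \<infinity>" if "f \<in> Lp (ennreal p)" for f :: "real^'m \<Rightarrow> complex"
    using that Lp_norm_finite_iff[OF p0, of f] by (auto simp: Lp_def)
  have S: "trunc_limit q f (S f)" if "f \<in> Lp (ennreal p)" for f
    unfolding S_def by (rule someI_ex[OF ex_trunc_limit[OF p pq L[OF that]]])
  have bound: "Lp_norm (ennreal q) (S f) \<le> ennreal (sharp_const p q) * Lp_norm (ennreal p) f" if "f \<in> Lp (ennreal p)" for f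
    by (rule trunc_limit_bound[OF p pq L[OF that] S[OF that]])
  have "bounded_linear_Lp (ennreal p) (ennreal q) S"
    unfolding bounded_linear_Lp_def
  proof (intro conjI ballI allI impI)
    fix f :: "real^'m \<Rightarrow> complex" assume f: "f \<in> Lp (ennreal p)"
    have "ennreal (sharp_const p q) * Lp_norm (ennreal p) f < \<infinity>"
      using f by (simp add: Lp_def ennreal_mult_less_top)
    then have "Lp_norm (ennreal q) (S f) < \<infinity>" using bound[OF f] by (rule le_less_trans[rotated])
    then show "S f \<in> Lp (ennreal q)" using S[OF f] by (simp add: Lp_def trunc_limit_def)
    fix g :: "real^'m \<Rightarrow> complex" assume g: "g \<in> Lp (ennreal p)"
    show "ae_eq (S f) (S g)" if fg: "ae_eq f g"
    proof -
      \<comment> \<open>almost everywhere equal functions have the same set of limits, hence the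
        same chosen one\<close>
      have "T (trunc n f) = T (trunc n g)" for n
        by (rule T_op_cong_AE) (use fg in \<open>auto simp: ae_eq_def trunc_def elim!: eventually_mono\<close>)
      then have "trunc_limit q f = trunc_limit q g" by (simp add: fun_eq_iff trunc_limit_def)
      then have "S f = S g" by (simp add: S_def)
      then show ?thesis by (simp add: ae_eq_def)
    qed
    fix a b :: complex
    let ?h = "\<lambda>x. a * f x + b * g x"
    have hL: "?h \<in> Lp (ennreal p)"
    proof -
      have m: "(\<lambda>x. a * f x) \<in> borel_measurable lebesgue" "(\<lambda>x. b * g x) \<in> borel_measurable lebesgue"
        by (intro borel_measurable_times borel_measurable_const L(1) f g)+
      have "Ip p ?h \<le> ennreal (2 powr p) * (ennreal (cmod a powr p) * Ip p f + ennreal (cmod b powr p) * Ip p g)"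
        using Ip_add_le[OF m, of p] p0 unfolding Ip_mult[OF L(1)[OF f]] Ip_mult[OF L(1)[OF g]] by simp
      also have "\<dots> < \<infinity>" using L(2)[OF f] L(2)[OF g] by (simp add: ennreal_mult_less_top)
      finally show ?thesis using Lp_norm_finite_iff[OF p0, of ?h] m by (simp add: Lp_def borel_measurable_add)
    qed
    show "ae_eq (S ?h) (\<lambda>x. a * S f x + b * S g x)"
      unfolding ae_eq_def
      by (rule trunc_limit_linear[OF p pq L[OF f] L[OF g] refl S[OF f] S[OF g] S[OF hL]])
  next
    show "\<exists>C<\<infinity>. \<forall>f\<in>Lp (ennreal p). Lp_norm (ennreal q) (S f) \<le> C * Lp_norm (ennreal p) f"
      using bound by (intro exI[of _ "ennreal (sharp_const p q)"]) auto
  qed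
  moreover have "ae_eq (S \<phi>) (T \<phi>)" if "\<phi> \<in> schwartz" for \<phi>
  proof -
    have "\<phi> \<in> Lp (ennreal p)"
      using that Ip_schwartz_finite[OF that, of p] Lp_norm_finite_iff[OF p0, of \<phi>] p
      by (simp add: Lp_def schwartz_measurable)
    then show ?thesis unfolding ae_eq_def by (intro trunc_limit_eq_T_op[OF schwartz_integrable[OF that] S])
  qed
  ultimately show ?thesis using bound unfolding bounded_extension_def by blast
qed

lemma Lp_1: "f \<in> Lp 1 \<longleftrightarrow> integrable lebesgue f" "f \<in> Lp 1 \<Longrightarrow> Lp_norm 1 f = ennreal (\<integral>x. cmod (f x) \<partial>lebesgue)"
  for f :: "real^'m \<Rightarrow> complex"
proof -
  have I: "Ip 1 f = (\<integral>\<^sup>+x. ennreal (cmod (f x)) \<partial>lebesgue)" by (simp add: Ip_def)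
  show 1: "f \<in> Lp 1 \<longleftrightarrow> integrable lebesgue f"
    using Lp_norm_finite_iff[of 1 f] by (auto simp: Lp_def integrable_iff_bounded I)
  assume f: "f \<in> Lp 1"
  then have i: "integrable lebesgue f" using 1 by simp
  then have "Ip 1 f = ennreal (\<integral>x. cmod (f x) \<partial>lebesgue)"
    unfolding I by (intro nn_integral_eq_integral) auto
  then show "Lp_norm 1 f = ennreal (\<integral>x. cmod (f x) \<partial>lebesgue)"
    using Lp_norm_real[of 1 f] by simp
qed

text \<open>At the endpoint \<open>p = 1\<close> the integral converges for every \<open>f \<in>
  L\<^sup>1\<close> and is bounded by the prefactor times the \<open>L\<^sup>1\<close> norm.\<close>

theorem T_op_extends_L1:
  "bounded_extension 1 \<infinity> T T"
  "f \<in> Lp 1 \<Longrightarrow> Lp_norm \<infinity> (T f) \<le> ennreal (T_factor Q B t) * Lp_norm 1 f"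
proof -
  have bound: "Lp_norm \<infinity> (T f) \<le> ennreal (T_factor Q B t) * Lp_norm 1 f" if f: "f \<in> Lp 1" for f
  proof -
    have i: "integrable lebesgue f" using f Lp_1 by blast
    have "esssup lebesgue (\<lambda>x. ennreal (cmod (T f x))) \<le> ennreal (T_factor Q B t * (\<integral>x. cmod (f x) \<partial>lebesgue))"
      by (intro esssup_I measurable_compose[OF cmod_measurable measurable_ennreal] T_op_measurable i AE_I2 ennreal_leI T_op_bound)
    then show ?thesis using Lp_1(2)[OF f] T_factor_pos by (simp add: Lp_norm_def ennreal_mult)
  qed
  then show "f \<in> Lp 1 \<Longrightarrow> Lp_norm \<infinity> (T f) \<le> ennreal (T_factor Q B t) * Lp_norm 1 f" .
  have "bounded_linear_Lp 1 \<infinity> T"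
    unfolding bounded_linear_Lp_def
  proof (intro conjI ballI allI impI)
    fix f :: "real^'m \<Rightarrow> complex" assume f: "f \<in> Lp 1"
    have "ennreal (T_factor Q B t) * Lp_norm 1 f < \<infinity>"
      using f by (simp add: Lp_def ennreal_mult_less_top)
    then have "Lp_norm \<infinity> (T f) < \<infinity>" using bound[OF f] by (rule le_less_trans[rotated])
    then show "T f \<in> Lp \<infinity>" using T_op_measurable[of f] Lp_1(1)[of f] f
      unfolding Lp_def[of \<infinity>] by blast
    fix g :: "real^'m \<Rightarrow> complex" assume g: "g \<in> Lp 1"
    show "ae_eq (T f) (T g)" if "ae_eq f g"
      using T_op_cong_AE[of f g] that by (simp add: ae_eq_def)
    show "ae_eq (T (\<lambda>x. a * f x + b * g x)) (\<lambda>x. a * T f x + b * T g x)" for a b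
      using T_op_linear[of f g a b] f g Lp_1(1) by (simp add: ae_eq_def)
  next
    show "\<exists>C<\<infinity>. \<forall>f\<in>Lp 1. Lp_norm \<infinity> (T f) \<le> C * Lp_norm 1 f"
      using bound by (intro exI[of _ "ennreal (T_factor Q B t)"]) auto
  qed
  then show "bounded_extension 1 \<infinity> T T"
    unfolding bounded_extension_def by (auto simp: ae_eq_def)
qed

lemma T_const_1: "T_const Q B t 1 \<infinity> = T_factor Q B t"
  using D_pos by (simp add: T_const_def T_factor_def self_root_def powr_half_sqrt)

theorem sharp_bounded_extension:
  assumes conj: "conj_exponents p p'" and p2: "p \<le> 2"
  shows "\<exists>S. bounded_extension p p' T S
     \<and> (\<forall>S'. bounded_extension p p' T S' \<longrightarrow> (\<forall>\<phi>\<in>Lp p. ae_eq (S' \<phi>) (S \<phi>)))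
     \<and> (\<forall>\<phi>\<in>Lp p. Lp_norm p' (S \<phi>) \<le> ennreal (T_const Q B t p p') * Lp_norm p \<phi>)"
  using conj p2
proof (cases rule: conj_exponents_cases)
  case 1
  show ?thesis unfolding 1
  proof (intro exI[of _ "T"] conjI allI impI ballI T_op_extends_L1(1))
    fix S' and \<phi> :: "real^'m \<Rightarrow> complex"
    assume "bounded_extension 1 \<infinity> T S'" "\<phi> \<in> Lp 1"
    then show "ae_eq (S' \<phi>) (T \<phi>)"
      using extension_unique[of 1 \<infinity> "T" S' "T" \<phi>] T_op_extends_L1(1) by simp
  next
    fix \<phi> :: "real^'m \<Rightarrow> complex" assume "\<phi> \<in> Lp 1"
    then show "Lp_norm \<infinity> (T \<phi>) \<le> ennreal (T_const Q B t 1 \<infinity>) * Lp_norm 1 \<phi>"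
      unfolding T_const_1 by (rule T_op_extends_L1(2))
  qed
next
  case (2 P P')
  note c = conjugate_exponents_real[OF 2(3,5)]
  obtain S where S: "bounded_extension (ennreal P) (ennreal P') T S"
    "\<And>f. f\<in>Lp (ennreal P) \<Longrightarrow> Lp_norm (ennreal P') (S f) \<le> ennreal (sharp_const P P') * Lp_norm (ennreal P) f"
    using extension_exists[OF 2(3,4,5)] by blast
  have T: "T_const Q B t (ennreal P) (ennreal P') = sharp_const P P'"
    unfolding T_const_real[OF 2(3) c(1)] sharp_const_def Let_def ..
  show ?thesis unfolding 2 T
  proof (intro exI[of _ S] conjI allI impI ballI S)
    fix S' and \<phi> :: "real^'m \<Rightarrow> complex"
    assume "bounded_extension (ennreal P) (ennreal P') T S'" "\<phi> \<in> Lp (ennreal P)"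
    then show "ae_eq (S' \<phi>) (S \<phi>)"
      using c(1) 2(3) by (intro extension_unique[OF _ _ _ S(1)]) (auto intro: exI[of _ P'])
  qed
qed

end

section \<open>Necessity of the exponents\<close>

text \<open>A nonempty open set has positive measure.\<close>

lemma ennreal_le_of_continuous_AE:
  fixes f :: "'a::euclidean_space \<Rightarrow> real"
  assumes f: "continuous_on UNIV f" and ae: "AE x in lebesgue. ennreal (f x) \<le> E" and pos: "0 \<le> f x0"
  shows "ennreal (f x0) \<le> E"
proof (cases E)
  case (real e)
  let ?U = "{x. e < f x}"
  have U: "open ?U" by (intro open_Collect_less continuous_intros f)
  have "AE x in lebesgue. x \<notin> ?U"
    using ae
  proof eventually_elim
    fix x assume "ennreal (f x) \<le> E"
    then show "x \<notin> ?U" using real by (cases "0 \<le> f x") (auto simp: ennreal_le_iff)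
  qed
  then have "?U \<in> null_sets lebesgue"
    using AE_iff_null_sets[of ?U lebesgue] sets_completionI_sets[of ?U lborel] borel_open[OF U] by simp
  then have "?U = {}" using open_not_negligible[OF U] by (auto simp: negligible_iff_null_sets)
  then have "f x0 \<le> e" by (auto simp: not_less[symmetric])
  then show ?thesis using real by (simp add: ennreal_leI)
qed simp

lemma gaussian_nn_integral_linear:
  fixes A :: "real^'m^'m"
  assumes A: "det A \<noteq> 0" and a: "0 < a"
  shows "(\<integral>\<^sup>+x. ennreal (exp (- a * (norm (A *v x))\<^sup>2)) \<partial>lebesgue) = ennreal (sqrt (pi / a) ^ CARD('m) / \<bar>det A\<bar>)"
proof -
  let ?f = "\<lambda>x::real^'m. ennreal (exp (- a * (norm x)\<^sup>2))"
  have I: "(\<integral>\<^sup>+x. ?f x \<partial>lborel) = ennreal (sqrt (pi / a) ^ CARD('m))"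
  proof -
    have "complex_of_real (\<integral>(x::real^'m). exp (- a * (norm x)\<^sup>2) \<partial>lborel) = complex_of_real (sqrt (pi / a) ^ CARD('m))"
      using gaussian_fourier_real(2)[OF a, of "0 :: real^'m"] by (simp add: scaleR_conv_of_real)
    then have "(\<integral>(x::real^'m). exp (- a * (norm x)\<^sup>2) \<partial>lborel) = sqrt (pi / a) ^ CARD('m)"
      by (simp only: of_real_eq_iff)
    then show ?thesis by (subst nn_integral_eq_integral[OF gaussian_integrable[OF a]]) auto
  qed
  have "ennreal \<bar>det A\<bar> * (\<integral>\<^sup>+x. ?f (A *v x) \<partial>lborel) = ennreal (sqrt (pi / a) ^ CARD('m))"
    unfolding I[symmetric] by (rule nn_integral_linear_image[OF A]) measurable
  then have "ennreal (1 / \<bar>det A\<bar>) * (ennreal \<bar>det A\<bar> * (\<integral>\<^sup>+x. ?f (A *v x) \<partial>lborel)) = ennreal (1 / \<bar>det A\<bar>) * ennreal (sqrt (pi / a) ^ CARD('m))"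
    by simp
  moreover have "ennreal (1 / \<bar>det A\<bar>) * ennreal \<bar>det A\<bar> = 1" using A by (simp add: ennreal_mult[symmetric])
  ultimately have "(\<integral>\<^sup>+x. ?f (A *v x) \<partial>lborel) = ennreal (1 / \<bar>det A\<bar>) * ennreal (sqrt (pi / a) ^ CARD('m))"
    by (simp add: mult.assoc[symmetric])
  then show ?thesis using a by (simp add: nn_integral_completion ennreal_mult[symmetric])
qed

text \<open>The constant \<open>k\<close> depends neither on the amplitude \<open>c\<close> nor
  on the width \<open>s\<close>. For \<open>r = \<infinity>\<close> the exponent of
  \<open>s\<close> vanishes, since \<open>inverse \<infinity> = 0\<close>.\<close>

lemma gauss_Lp_norm:
  fixes A :: "real^'m^'m"
  assumes A: "det A \<noteq> 0" and r: "1 \<le> r"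
  obtains k where "0 < k" "\<And>c s f. 0 \<le> c \<Longrightarrow> 0 < s \<Longrightarrow> (\<And>x. cmod (f x) = c * exp (- s * (norm (A *v x))\<^sup>2)) \<Longrightarrow>
     f \<in> borel_measurable lebesgue \<Longrightarrow> Lp_norm r f = ennreal (c * k * s powr (- (real CARD('m) / 2) * enn2real (inverse r)))"
proof (cases r)
  case top
  show ?thesis
  proof (rule that[of 1])
    fix c s :: real and f :: "real^'m \<Rightarrow> complex"
    assume c: "0 \<le> c" and s: "0 < s" and f: "\<And>x. cmod (f x) = c * exp (- s * (norm (A *v x))\<^sup>2)"
      and m: "f \<in> borel_measurable lebesgue"
    have "esssup lebesgue (\<lambda>x. ennreal (cmod (f x))) = ennreal c"
    proof (rule antisym)
      show "esssup lebesgue (\<lambda>x. ennreal (cmod (f x))) \<le> ennreal c"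
        using c s by (intro esssup_I measurable_compose[OF cmod_measurable measurable_ennreal] m AE_I2 ennreal_leI)
          (auto simp: f intro!: mult_left_le)
      have ct: "continuous_on UNIV (\<lambda>x. cmod (f x))" unfolding f
        by (intro continuous_intros matrix_vector_mult_continuous)
      have "ennreal (cmod (f 0)) \<le> esssup lebesgue (\<lambda>x. ennreal (cmod (f x)))"
        by (rule ennreal_le_of_continuous_AE[OF ct esssup_AE]) simp
      then show "ennreal c \<le> esssup lebesgue (\<lambda>x. ennreal (cmod (f x)))" by (simp add: f)
    qed
    then show "Lp_norm r f = ennreal (c * 1 * s powr (- (real CARD('m) / 2) * enn2real (inverse r)))"
      using top s by (simp add: Lp_norm_def)
  qed simp
next
  case (real R)
  have R: "1 \<le> R" using r real by (simp add: ennreal_1[symmetric] ennreal_le_iff del: ennreal_1)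
  have ir: "enn2real (inverse r) = 1/R" using real R by (simp add: inverse_ennreal inverse_eq_divide)
  define k where "k = (sqrt (pi / R) ^ CARD('m) / \<bar>det A\<bar>) powr (1/R)"
  show ?thesis
  proof (rule that[of k])
    show "0 < k" using A R by (simp add: k_def)
    fix c s :: real and f :: "real^'m \<Rightarrow> complex"
    assume c: "0 \<le> c" and s: "0 < s" and f: "\<And>x. cmod (f x) = c * exp (- s * (norm (A *v x))\<^sup>2)"
      and m: "f \<in> borel_measurable lebesgue"
    have "Ip R f = (\<integral>\<^sup>+x. ennreal (c powr R) * ennreal (exp (- (R * s) * (norm (A *v x))\<^sup>2)) \<partial>lebesgue)"
      unfolding Ip_def f using c by (intro nn_integral_cong) (simp add: powr_mult exp_powr_real ennreal_mult mult_ac)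
    also have "\<dots> = ennreal (c powr R) * ennreal (sqrt (pi / (R * s)) ^ CARD('m) / \<bar>det A\<bar>)"
    proof -
      have "0 < R * s" using R s by simp
      show ?thesis
        unfolding gaussian_nn_integral_linear[OF A \<open>0 < R * s\<close>, symmetric]
        by (intro nn_integral_cmult measurable_compose[OF _ measurable_ennreal]
          continuous_imp_lebesgue_measurable continuous_intros matrix_vector_mult_continuous)
    qed
    also have "\<dots> = ennreal (c powr R * (sqrt (pi / (R * s)) ^ CARD('m) / \<bar>det A\<bar>))"
      using R s by (simp add: ennreal_mult[symmetric])
    finally have I: "Ip R f = ennreal (c powr R * (sqrt (pi / (R * s)) ^ CARD('m) / \<bar>det A\<bar>))" .
    have sq: "sqrt (pi / (R * s)) ^ CARD('m) = sqrt (pi / R) ^ CARD('m) * s powr (- (real CARD('m) / 2))"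
    proof -
      have "sqrt (pi / (R * s)) = sqrt (pi / R) * (1 / sqrt s)" by (simp add: real_sqrt_divide real_sqrt_mult)
      moreover have "1 / sqrt s = s powr (- (1/2))" using s by (simp add: powr_minus powr_half_sqrt inverse_eq_divide)
      moreover have "(s powr (- (1/2))) ^ CARD('m) = s powr (- (real CARD('m) / 2))"
        using s by (simp add: powr_realpow[symmetric] powr_powr)
      ultimately show ?thesis by (simp only: power_mult_distrib)
    qed
    have "Lp_norm r f = ennreal ((c powr R * (sqrt (pi / (R * s)) ^ CARD('m) / \<bar>det A\<bar>)) powr (1/R))"
    proof -
      have "Lp_norm (ennreal R) f = (if Ip R f = \<infinity> then \<infinity> else ennreal (enn2real (Ip R f) powr (1/R)))"
        using R by (intro Lp_norm_real) simp
      moreover have "r = ennreal R" using real by simp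
      ultimately show ?thesis using R s unfolding I by simp
    qed
    also have "(c powr R * (sqrt (pi / (R * s)) ^ CARD('m) / \<bar>det A\<bar>)) powr (1/R)
       = c * k * s powr (- (real CARD('m) / 2) * (1/R))"
    proof -
      have "c powr R * (sqrt (pi / (R * s)) ^ CARD('m) / \<bar>det A\<bar>)
         = c powr R * ((sqrt (pi / R) ^ CARD('m) / \<bar>det A\<bar>) * s powr (- (real CARD('m) / 2)))"
        unfolding sq by simp
      moreover have "(c powr R * ((sqrt (pi / R) ^ CARD('m) / \<bar>det A\<bar>) * s powr (- (real CARD('m) / 2)))) powr (1/R) = (c powr R) powr (1/R) * (k * (s powr (- (real CARD('m) / 2))) powr (1/R))"
        unfolding k_def by (simp only: powr_mult)
      moreover have "(c powr R) powr (1/R) = c" using R c by (simp add: powr_powr)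
      moreover have "(s powr (- (real CARD('m) / 2))) powr (1/R) = s powr (- (real CARD('m) / 2) * (1/R))"
        by (rule powr_powr)
      ultimately show ?thesis by (simp only: mult.assoc)
    qed
    finally show "Lp_norm r f = ennreal (c * k * s powr (- (real CARD('m) / 2) * enn2real (inverse r)))"
      unfolding ir .
  qed
qed

lemma powr_bounded_imp_zero:
  fixes e L :: real
  assumes "\<And>a. 0 < a \<Longrightarrow> a powr e \<le> L" shows "e = 0"
proof (rule ccontr)
  assume e: "e \<noteq> 0"
  have L: "1 \<le> L" using assms[of 1] by simp
  have "((L + 1) powr (1/e)) powr e \<le> L" using L by (intro assms) auto
  then show False using e L by (simp add: powr_powr)
qed

lemma powr_bounded_imp_nonpos:
  fixes e L :: real
  assumes "\<And>a. 1 \<le> a \<Longrightarrow> a powr e \<le> L" shows "e \<le> 0"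
proof (rule ccontr)
  assume e: "\<not> e \<le> 0"
  have L: "1 \<le> L" using assms[of 1] by simp
  have "((L + 1) powr (1/e)) powr e \<le> L" using L e by (intro assms) (auto intro: ge_one_powr_ge_zero)
  then show False using e L by (simp add: powr_powr)
qed

lemma powr_quotient:
  fixes a b r :: real
  shows "(b / a) powr r = b powr r * a powr (- r)"
  unfolding powr_divide powr_minus by (simp only: divide_inverse)

lemma powr_inverse_four:
  fixes a r :: real
  assumes "0 < a" shows "(1 / (4 * a)) powr (- r) = 4 powr r * a powr r"
proof -
  have "(1 / (4 * a)) powr (- r) = (4 * a) powr r"
    using powr_quotient[of 1 "4 * a" "- r"] assms by simp
  then show ?thesis by (simp only: powr_mult)
qed

context schroedinger
begin

text \<open>The conjugate chirp cancels the chirp that \<open>\<T>(t)\<close> applies to its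
  argument, so that \<open>\<T>(t)\<close> transforms the pure Gaussian \<open>exp
  (-z|y|\<^sup>2)\<close>.\<close>

definition chirped_gaussian :: "complex \<Rightarrow> real^'m \<Rightarrow> complex" where
  "chirped_gaussian z y = cnj (chirp R y) * exp (- z * of_real ((norm y)\<^sup>2))"

lemma chirped_gaussian_schwartz:
  assumes z: "0 < Re z" shows "chirped_gaussian z \<in> schwartz"
proof -
  have "gauss_class (\<lambda>y. 1 * exp ((- \<i> / 4) * of_real ((R *v y) \<bullet> y) + (- z) * of_real ((norm y)\<^sup>2)))"
    using z by (intro gauss_class_base[of _ _ "Re z" 0] cpoly_add cpoly_mult cpoly_const cpoly_norm_square cpoly_quadratic) auto
  moreover have "(\<lambda>y. 1 * exp ((- \<i> / 4) * of_real ((R *v y) \<bullet> y) + (- z) * of_real ((norm y)\<^sup>2))) = chirped_gaussian z"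
    unfolding exp_add chirped_gaussian_def[abs_def] chirp_def cis_cnj
    by (simp add: fun_eq_iff cis_conv_exp)
  ultimately show ?thesis using gauss_class_schwartz by simp
qed

lemma cmod_chirped_gaussian: "cmod (chirped_gaussian z y) = 1 * exp (- Re z * (norm (mat 1 *v y))\<^sup>2)"
  by (simp add: chirped_gaussian_def norm_mult)

lemma cmod_T_op_chirped_gaussian:
  assumes z: "0 < Re z"
  shows "cmod (T (chirped_gaussian z) x) = T_factor Q B t * (pi / cmod z) powr (real CARD('m) / 2)
     * exp (- (Re z / (4 * (cmod z)\<^sup>2)) * (norm (freq_map Q B t 1 *v x))\<^sup>2)"
proof -
  let ?w = "freq_map Q B t 1 *v x"
  have c1: "chirp R y * chirped_gaussian z y = exp (- z * of_real ((norm y)\<^sup>2))" for y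
  proof -
    have "chirp R y * cnj (chirp R y) = 1" by (simp add: chirp_def cis_cnj cis_mult)
    then show ?thesis by (simp add: chirped_gaussian_def mult.assoc[symmetric])
  qed
  have "fourier 1 (\<lambda>y. chirp R y * chirped_gaussian z y) ?w = (\<integral>y. exp (- z * of_real ((norm y)\<^sup>2)) * cis (?w \<bullet> y) \<partial>lebesgue)"
    unfolding fourier_def c1 by (simp add: mult.commute inner_commute)
  also have "\<dots> = (\<integral>y. exp (- z * of_real ((norm y)\<^sup>2)) * cis (?w \<bullet> y) \<partial>lborel)"
    using borel_measurable_integrable[OF gaussian_fourier(1)[OF z, of ?w]] by (rule integral_completion)
  also have "\<dots> = csqrt (pi / z) ^ CARD('m) * exp (- of_real ((norm ?w)\<^sup>2) / (4 * z))"
    using gaussian_fourier(2)[OF z, of ?w] by simp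
  finally have F: "fourier 1 (\<lambda>y. chirp R y * chirped_gaussian z y) ?w = csqrt (pi / z) ^ CARD('m) * exp (- of_real ((norm ?w)\<^sup>2) / (4 * z))" .
  have z0: "z \<noteq> 0" using z by auto
  have "cmod (csqrt (pi / z) ^ CARD('m)) = (pi / cmod z) powr (real CARD('m) / 2)"
  proof -
    have "cmod (csqrt (pi / z) ^ CARD('m)) = sqrt (pi / cmod z) ^ CARD('m)" by (simp add: norm_power norm_divide)
    also have "\<dots> = ((pi / cmod z) powr (1/2)) powr (real CARD('m))"
      using z0 by (subst powr_realpow) (simp_all add: powr_half_sqrt)
    finally show ?thesis by (simp add: powr_powr)
  qed
  moreover have "cmod (exp (- of_real ((norm ?w)\<^sup>2) / (4 * z))) = exp (- (Re z / (4 * (cmod z)\<^sup>2)) * (norm ?w)\<^sup>2)"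
  proof -
    have "Re (- of_real ((norm ?w)\<^sup>2) / (4 * z)) = - ((norm ?w)\<^sup>2 * Re (1 / (4 * z)))"
      by (simp add: Re_divide)
    also have "Re (1 / (4 * z)) = Re z / (4 * (cmod z)\<^sup>2)"
    proof -
      have "1 / (4 * z) = (1/4) *\<^sub>R (1 / z)" by (simp add: scaleR_conv_of_real)
      then have "Re (1 / (4 * z)) = Re (1 / z) / 4" by simp
      also have "Re (1 / z) = Re z / (cmod z)\<^sup>2" by (simp add: Re_divide cmod_power2)
      finally show ?thesis by simp
    qed
    finally show ?thesis by (simp add: norm_exp_eq_Re mult.commute)
  qed
  ultimately show ?thesis unfolding cmod_T_op[OF one_neq_zero] F norm_mult by simp
qed

text \<open>With \<open>\<rho> = 1/p\<close> and \<open>\<tau> = 1/q\<close>, continuity on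
  \<open>chirped_gaussian z\<close> reads \<open>|z|\<^bsup>-m/2\<^esup> (Re z /
  4|z|\<^sup>2)\<^bsup>-m\<tau>/2\<^esup> \<le> C (Re z)\<^bsup>-m\<rho>/2\<^esup>\<close>.\<close>

theorem Lp_Lq_continuity_imp_conjugate:
  assumes p: "1 \<le> p" and q: "1 \<le> q" and cont: "Lp_continuous_on_schwartz p q T"
  shows "p \<le> 2 \<and> conj_exponents p q"
proof -
  define m where "m = real CARD('m)"
  have m: "0 < m" by (simp add: m_def)
  define \<rho> where "\<rho> = enn2real (inverse p)"
  define \<tau> where "\<tau> = enn2real (inverse q)"
  let ?M = "freq_map Q B t 1" and ?K = "T_factor Q B t"
  have dM: "det ?M \<noteq> 0" using abs_det_freq_map(2)[of 1] by simp
  obtain k where k: "0 < k" "\<And>c s f. 0 \<le> c \<Longrightarrow> 0 < s \<Longrightarrow> (\<And>x. cmod (f x) = c * exp (- s * (norm ((mat 1 :: real^'m^'m) *v x))\<^sup>2)) \<Longrightarrow>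
     f \<in> borel_measurable lebesgue \<Longrightarrow> Lp_norm p f = ennreal (c * k * s powr (- (m / 2) * \<rho>))"
    using gauss_Lp_norm[of "mat 1 :: real^'m^'m" p] p unfolding m_def \<rho>_def by (metis det_I zero_neq_one)
  obtain l where l: "0 < l" "\<And>c s f. 0 \<le> c \<Longrightarrow> 0 < s \<Longrightarrow> (\<And>x. cmod (f x) = c * exp (- s * (norm (?M *v x))\<^sup>2)) \<Longrightarrow>
     f \<in> borel_measurable lebesgue \<Longrightarrow> Lp_norm q f = ennreal (c * l * s powr (- (m / 2) * \<tau>))"
    using gauss_Lp_norm[OF dM q] unfolding m_def \<tau>_def by metis
  obtain C where C: "C < \<infinity>" "\<And>\<phi>. \<phi> \<in> schwartz \<Longrightarrow> Lp_norm q (T \<phi>) \<le> C * Lp_norm p \<phi>"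
    using cont unfolding Lp_continuous_on_schwartz_def by blast
  then obtain c where c: "C = ennreal c" "0 \<le> c" by (cases C) auto
  have main: "?K * (pi / cmod z) powr (m/2) * l * (Re z / (4 * (cmod z)\<^sup>2)) powr (- (m/2) * \<tau>) \<le> c * (1 * k * Re z powr (- (m/2) * \<rho>))"
    if z: "0 < Re z" for z
  proof -
    have z0: "z \<noteq> 0" using z by auto
    have s: "chirped_gaussian z \<in> schwartz" by (rule chirped_gaussian_schwartz[OF z])
    have "Lp_norm p (chirped_gaussian z) = ennreal (1 * k * Re z powr (- (m/2) * \<rho>))"
      by (rule k(2)[OF _ z cmod_chirped_gaussian schwartz_measurable[OF s]]) simp
    moreover have "Lp_norm q (T (chirped_gaussian z)) = ennreal (?K * (pi / cmod z) powr (m/2) * l * (Re z / (4 * (cmod z)\<^sup>2)) powr (- (m/2) * \<tau>))"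
    proof (rule l(2))
      show "0 \<le> ?K * (pi / cmod z) powr (m/2)" using T_factor_pos by simp
      show "0 < Re z / (4 * (cmod z)\<^sup>2)" using z z0 by simp
      show "cmod (T (chirped_gaussian z) x) = ?K * (pi / cmod z) powr (m/2) * exp (- (Re z / (4 * (cmod z)\<^sup>2)) * (norm (?M *v x))\<^sup>2)" for x
        unfolding m_def by (rule cmod_T_op_chirped_gaussian[OF z])
      show "T (chirped_gaussian z) \<in> borel_measurable lebesgue"
        by (intro T_op_measurable schwartz_integrable s)
    qed
    ultimately have "ennreal (?K * (pi / cmod z) powr (m/2) * l * (Re z / (4 * (cmod z)\<^sup>2)) powr (- (m/2) * \<tau>))
       \<le> ennreal (c * (1 * k * Re z powr (- (m/2) * \<rho>)))"
      using C(2)[OF s] c k(1) by (simp add: ennreal_mult[symmetric])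
    then show ?thesis using c k(1) by (subst (asm) ennreal_le_iff) auto
  qed
  \<comment> \<open>the constants independent of \<open>z\<close> on the left side of
    \<open>main\<close>\<close>
  define h where "h = ?K * pi powr (m/2) * l * 4 powr ((m/2) * \<tau>)"
  have h: "0 < h" using T_factor_pos l(1) by (simp add: h_def)
  have "\<tau> + \<rho> - 1 = 0"
  proof -
    \<comment> \<open>scaling: \<open>z = a\<close> real\<close>
    have "a powr ((m/2) * (\<tau> + \<rho> - 1)) \<le> c * k / h" if a: "0 < a" for a :: real
    proof -
      have e1: "(pi / a) powr (m/2) = pi powr (m/2) * a powr (- (m/2))"
        by (rule powr_quotient)
      have "a / (4 * a\<^sup>2) = 1 / (4 * a)" using a by (simp add: power2_eq_square)
      then have e2: "(a / (4 * a\<^sup>2)) powr (- (m/2) * \<tau>) = 4 powr ((m/2) * \<tau>) * a powr ((m/2) * \<tau>)"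
        using powr_inverse_four[OF a, of "(m/2) * \<tau>"] by (simp only: minus_mult_left)
      have mz: "?K * (pi / a) powr (m/2) * l * (a / (4 * a\<^sup>2)) powr (- (m/2) * \<tau>) \<le> c * (1 * k * a powr (- (m/2) * \<rho>))"
        using main[of "complex_of_real a"] a by (simp only: Re_complex_of_real norm_of_real abs_of_pos)
      then have "h * (a powr (- (m/2)) * a powr ((m/2) * \<tau>)) \<le> c * k * a powr (- (m/2) * \<rho>)"
        unfolding h_def e1 e2 by (simp only: mult_1 mult_ac)
      then have "h * (a powr (- (m/2)) * a powr ((m/2) * \<tau>)) * a powr ((m/2) * \<rho>) \<le> c * k * a powr (- (m/2) * \<rho>) * a powr ((m/2) * \<rho>)"
        by (rule mult_right_mono) simp
      also have "c * k * a powr (- (m/2) * \<rho>) * a powr ((m/2) * \<rho>) = c * k"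
        using a by (simp add: powr_minus)
      also have "h * (a powr (- (m/2)) * a powr ((m/2) * \<tau>)) * a powr ((m/2) * \<rho>) = h * a powr (- (m/2) + (m/2) * \<tau> + (m/2) * \<rho>)"
        by (simp only: powr_add mult.assoc)
      also have "- (m/2) + (m/2) * \<tau> + (m/2) * \<rho> = (m/2) * (\<tau> + \<rho> - 1)" by (simp add: field_simps)
      finally show ?thesis using h by (simp add: pos_le_divide_eq mult.commute)
    qed
    from powr_bounded_imp_zero[OF this] m show ?thesis by simp
  qed
  then have sum1: "\<rho> + \<tau> = 1" by simp
  have "(m/2) * (\<tau> - 1/2) \<le> 0"
  proof (rule powr_bounded_imp_nonpos)
    fix a :: real assume a: "1 \<le> a"
    \<comment> \<open>\<open>Re z = 1\<close> keeps the input norm fixed, while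
      \<open>|z|\<^sup>2 = a\<close> is arbitrarily large\<close>
    define z where "z = Complex 1 (sqrt (a - 1))"
    have z: "Re z = 1" "(cmod z)\<^sup>2 = a" "cmod z = a powr (1/2)"
      using a by (simp_all add: z_def cmod_power2 cmod_def powr_half_sqrt)
    have "(pi / a powr (1/2)) powr (m/2) = pi powr (m/2) * (a powr (1/2)) powr (- (m/2))"
      by (rule powr_quotient)
    then have e1: "(pi / a powr (1/2)) powr (m/2) = pi powr (m/2) * a powr (- (m/4))"
      by (simp add: powr_powr)
    have e2: "(1 / (4 * a)) powr (- (m/2) * \<tau>) = 4 powr ((m/2) * \<tau>) * a powr ((m/2) * \<tau>)"
      using powr_inverse_four[of a "(m/2) * \<tau>"] a by simp
    have "?K * (pi / a powr (1/2)) powr (m/2) * l * (1 / (4 * a)) powr (- (m/2) * \<tau>) \<le> c * (1 * k * 1 powr (- (m/2) * \<rho>))"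
      using main[of z, unfolded z(2), unfolded z(1,3)] zero_less_one by blast
    then have "h * (a powr (- (m/4)) * a powr ((m/2) * \<tau>)) \<le> c * k"
      unfolding h_def e1 e2 powr_one_eq_one by (simp only: mult_1 mult_1_right mult_ac)
    also have "h * (a powr (- (m/4)) * a powr ((m/2) * \<tau>)) = h * a powr (- (m/4) + (m/2) * \<tau>)"
      by (simp only: powr_add)
    also have "- (m/4) + (m/2) * \<tau> = (m/2) * (\<tau> - 1/2)" by (simp add: field_simps)
    finally show "a powr ((m/2) * (\<tau> - 1/2)) \<le> c * k / h" using h by (simp add: pos_le_divide_eq mult.commute)
  qed
  then have \<tau>2: "\<tau> \<le> 1/2" using m by (simp add: mult_le_0_iff)
  have inv: "inverse p = ennreal \<rho>" "inverse q = ennreal \<tau>"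
  proof -
    have fin: "inverse r = ennreal (enn2real (inverse r))" if "1 \<le> r" for r :: ennreal
    proof -
      have "r \<noteq> 0" using that by auto
      then show ?thesis by (cases r) (auto simp: inverse_ennreal)
    qed
    show "inverse p = ennreal \<rho>" "inverse q = ennreal \<tau>"
      unfolding \<rho>_def \<tau>_def using fin p q by auto
  qed
  have nn: "0 \<le> \<rho>" "0 \<le> \<tau>" by (auto simp: \<rho>_def \<tau>_def)
  have "inverse p + inverse q = 1"
    unfolding inv using nn sum1 by (simp add: ennreal_plus[symmetric] del: ennreal_plus)
  then have conj: "conj_exponents p q" using p q by (simp add: conj_exponents_def)
  have \<rho>2: "1/2 \<le> \<rho>" using sum1 \<tau>2 by simp
  have "p \<le> 2"
  proof (cases p)
    case top
    then show ?thesis using \<rho>2 by (simp add: \<rho>_def)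
  next
    case (real P)
    have P: "1 \<le> P" using p real by (simp add: ennreal_1[symmetric] ennreal_le_iff del: ennreal_1)
    then have "\<rho> = 1/P" using real by (simp add: \<rho>_def inverse_ennreal inverse_eq_divide)
    then have "1/2 \<le> 1/P" using \<rho>2 by simp
    then have "P \<le> 2" using P by (simp add: pos_le_divide_eq)
    then show ?thesis using real by (simp add: ennreal_numeral[symmetric] ennreal_le_iff del: ennreal_numeral)
  qed
  with conj show ?thesis by blast
qed

end

theorem theorem4p1:
  fixes Q B :: "real^'m^'m"
  assumes "transpose Q = Q"
    and "pos_semidef Q"
    and "\<And>t. t > 0 \<Longrightarrow> pos_def (Qt Q B t)"
  shows "(\<forall>t>0. \<forall>p\<ge>1. \<forall>q\<ge>1.
            Lp_continuous_on_schwartz p q (T_op Q B t) \<longrightarrow> p \<le> 2 \<and> conj_exponents p q)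
       \<and> (\<forall>p p'. \<forall>t>0. 1 \<le> p \<and> p \<le> 2 \<and> conj_exponents p p' \<longrightarrow>
            (\<exists>S. bounded_extension p p' (T_op Q B t) S
               \<and> (\<forall>S'. bounded_extension p p' (T_op Q B t) S' \<longrightarrow> (\<forall>\<phi>\<in>Lp p. ae_eq (S' \<phi>) (S \<phi>)))
               \<and> (\<forall>\<phi>\<in>Lp p. Lp_norm p' (S \<phi>) \<le> ennreal (T_const Q B t p p') * Lp_norm p \<phi>)))"
proof (intro conjI allI impI)
  fix t :: real and p q
  assume "0 < t" "1 \<le> p" "1 \<le> q" and cont: "Lp_continuous_on_schwartz p q (T_op Q B t)"
  interpret schroedinger Q B t by unfold_locales (use assms \<open>0 < t\<close> in auto)
  show "p \<le> 2" "conj_exponents p q" using Lp_Lq_continuity_imp_conjugate[OF \<open>1 \<le> p\<close> \<open>1 \<le> q\<close> cont] by auto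
next
  fix p p' and t :: real
  assume "0 < t" and p: "1 \<le> p \<and> p \<le> 2 \<and> conj_exponents p p'"
  interpret schroedinger Q B t by unfold_locales (use assms \<open>0 < t\<close> in auto)
  show "\<exists>S. bounded_extension p p' (T_op Q B t) S
      \<and> (\<forall>S'. bounded_extension p p' (T_op Q B t) S' \<longrightarrow> (\<forall>\<phi>\<in>Lp p. ae_eq (S' \<phi>) (S \<phi>)))
      \<and> (\<forall>\<phi>\<in>Lp p. Lp_norm p' (S \<phi>) \<le> ennreal (T_const Q B t p p') * Lp_norm p \<phi>)"
    using p by (intro sharp_bounded_extension) auto
qed

end
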